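(* Let $n\ge2$. For every zero-dimensional subscheme $Z\subset\mathbb{P}^n$ there exists a perfect extended monad $P^\bullet$ of the form $$0\to V_{1-n}\otimes\mathcal{O}_{\mathbb{P}^n}(1-n)\xrightarrow{\alpha_{1-n}}V_{2-n}\otimes\mathcal{O}_{\mathbb{P}^n}(2-n)\to\cdots\xrightarrow{\alpha_{-1}}V_0\otimes\mathcal{O}_{\mathbb{P}^n}\xrightarrow{\alpha_0}V_1\otimes\mathcal{O}_{\mathbb{P}^n}(1)\to0,$$ where $V_1:=H^0(\mathcal{O}_Z)$, $V_0\cong V_1^{\oplus n}\oplus\mathbb{C}$ and $V_i\cong V_1^{\oplus\binom{n}{1-i}}$ for $i<0$, whose cohomology is the ideal sheaf $\mathcal{I}_Z$.
   Context: $\mathbb{P}^n$ is projective space over $\mathbb{C}$. A perfect extended monad on $\mathbb{P}^n$ is a complex with terms $\mathcal{O}_{\mathbb{P}^n}(i)^{\oplus a_i}$ in degree $i$, $1-n\le i\le1$ (for some integers $a_i$) and zero in other degrees, which is exact at all positions except possibly degree $0$. Its cohomology is the coherent sheaf $\mathcal{H}^0(P^\bullet)=\ker\alpha_0/\mathrm{Im}\,\alpha_{-1}$. *)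

theory Defs
  imports
    "HOL-Algebra.Module"
    "HOL-Algebra.QuotRing"
    "HOL-Analysis.Abstract_Topology"
    "HOL-Computational_Algebra.Fraction_Field"
    "HOL-Library.Poly_Mapping"
    "HOL-Library.Extended_Real"
begin

section \<open>Dimension of a topological space\<close>

definition irreducible_closed :: "'p topology \<Rightarrow> 'p set \<Rightarrow> bool" where
  "irreducible_closed X Z \<longleftrightarrow> closedin X Z \<and> Z \<noteq> {} \<and>
     (\<forall>A B. closedin X A \<longrightarrow> closedin X B \<longrightarrow> Z = A \<union> B \<longrightarrow> A = Z \<or> B = Z)"

text \<open>The supremum is taken in the extended reals, so the empty space has dimension
  \<open>-\<infinity>\<close>; a space of dimension \<open>0\<close> is in particular nonempty.\<close>

definition krull_dim :: "'p topology \<Rightarrow> ereal" where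
  "krull_dim X = Sup {ereal (real k) |k. \<exists>Z :: nat \<Rightarrow> 'p set.
     (\<forall>i\<le>k. irreducible_closed X (Z i)) \<and> (\<forall>i<k. Z i \<subset> Z (Suc i))}"


section \<open>Sheaves of modules on a ringed space\<close>

text \<open>A ringed space is given by a topology \<open>X\<close> and a sheaf of rings \<open>R\<close>. The values of the
  fields below matter only at open sets; \<open>restriction F U V\<close> is the restriction map from \<open>U\<close>
  to \<open>V\<close>, for \<open>V \<subseteq> U\<close>.\<close>

record ('p, 'r) ring_sheaf =
  ring_sections :: "'p set \<Rightarrow> 'r ring"
  ring_restriction :: "'p set \<Rightarrow> 'p set \<Rightarrow> 'r \<Rightarrow> 'r"

record ('p, 'r, 's) module_sheaf =
  sections :: "'p set \<Rightarrow> ('r, 's) module"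
  restriction :: "'p set \<Rightarrow> 'p set \<Rightarrow> 's \<Rightarrow> 's"

text \<open>Records of type \<open>module\<close> extend ring records; the multiplicative fields play no role for
  modules.\<close>

definition make_module ::
    "'s set \<Rightarrow> 's \<Rightarrow> ('s \<Rightarrow> 's \<Rightarrow> 's) \<Rightarrow> ('r \<Rightarrow> 's \<Rightarrow> 's) \<Rightarrow> ('r, 's) module" where
  "make_module C z pl sm =
     \<lparr>carrier = C, mult = undefined, one = undefined, zero = z, add = pl, smult = sm\<rparr>"

definition sheaf_hom ::
    "'p topology \<Rightarrow> ('p, 'r) ring_sheaf \<Rightarrow> ('p, 'r, 's) module_sheaf \<Rightarrow> ('p, 'r, 't) module_sheaf
      \<Rightarrow> ('p set \<Rightarrow> 's \<Rightarrow> 't) \<Rightarrow> bool" where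
  "sheaf_hom X R F G \<phi> \<longleftrightarrow>
     (\<forall>U. openin X U \<longrightarrow>
        \<phi> U \<in> carrier (sections F U) \<rightarrow> carrier (sections G U) \<and>
        (\<forall>s\<in>carrier (sections F U). \<forall>t\<in>carrier (sections F U).
           \<phi> U (s \<oplus>\<^bsub>sections F U\<^esub> t) = \<phi> U s \<oplus>\<^bsub>sections G U\<^esub> \<phi> U t) \<and>
        (\<forall>a\<in>carrier (ring_sections R U). \<forall>s\<in>carrier (sections F U).
           \<phi> U (a \<odot>\<^bsub>sections F U\<^esub> s) = a \<odot>\<^bsub>sections G U\<^esub> \<phi> U s) \<and>
        (\<forall>V s. openin X V \<longrightarrow> V \<subseteq> U \<longrightarrow> s \<in> carrier (sections F U) \<longrightarrow>
           \<phi> V (restriction F U V s) = restriction G U V (\<phi> U s)))"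

definition sheaf_iso ::
    "'p topology \<Rightarrow> ('p, 'r) ring_sheaf \<Rightarrow> ('p, 'r, 's) module_sheaf \<Rightarrow> ('p, 'r, 't) module_sheaf
      \<Rightarrow> bool" where
  "sheaf_iso X R F G \<longleftrightarrow> (\<exists>\<phi>. sheaf_hom X R F G \<phi> \<and>
     (\<forall>U. openin X U \<longrightarrow> bij_betw (\<phi> U) (carrier (sections F U)) (carrier (sections G U))))"

definition subsheaf ::
    "'p topology \<Rightarrow> ('p, 'r) ring_sheaf \<Rightarrow> ('p, 'r, 's) module_sheaf \<Rightarrow> ('p set \<Rightarrow> 's set) \<Rightarrow> bool"
  where
  "subsheaf X R F N \<longleftrightarrow> (\<forall>U. openin X U \<longrightarrow>
     submodule (N U) (ring_sections R U) (sections F U) \<and>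
     (\<forall>V. openin X V \<longrightarrow> V \<subseteq> U \<longrightarrow> restriction F U V ` N U \<subseteq> N V) \<and>
     (\<forall>s\<in>carrier (sections F U).
        (\<forall>x\<in>U. \<exists>V. openin X V \<and> x \<in> V \<and> V \<subseteq> U \<and> restriction F U V s \<in> N V) \<longrightarrow> s \<in> N U))"

definition restrict_to :: "('p, 'r, 's) module_sheaf \<Rightarrow> ('p set \<Rightarrow> 's set) \<Rightarrow> ('p, 'r, 's) module_sheaf"
  where
  "restrict_to F N =
     \<lparr>sections = (\<lambda>U. (sections F U)\<lparr>carrier := N U\<rparr>), restriction = restriction F\<rparr>"

definition power_sheaf :: "('p, 'r, 's) module_sheaf \<Rightarrow> nat \<Rightarrow> ('p, 'r, nat \<Rightarrow> 's) module_sheaf"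
  where
  "power_sheaf F a =
     \<lparr>sections = (\<lambda>U. make_module
        ({..<a} \<rightarrow>\<^sub>E carrier (sections F U))
        (\<lambda>j\<in>{..<a}. \<zero>\<^bsub>sections F U\<^esub>)
        (\<lambda>s t. \<lambda>j\<in>{..<a}. s j \<oplus>\<^bsub>sections F U\<^esub> t j)
        (\<lambda>r s. \<lambda>j\<in>{..<a}. r \<odot>\<^bsub>sections F U\<^esub> s j)),
      restriction = (\<lambda>U V s. \<lambda>j\<in>{..<a}. restriction F U V (s j))\<rparr>"

definition structure_module :: "('p, 'r) ring_sheaf \<Rightarrow> ('p, 'r, 'r) module_sheaf" where
  "structure_module R =
     \<lparr>sections = (\<lambda>U. make_module (carrier (ring_sections R U)) \<zero>\<^bsub>ring_sections R U\<^esub>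
        (\<lambda>s t. s \<oplus>\<^bsub>ring_sections R U\<^esub> t) (\<lambda>r s. r \<otimes>\<^bsub>ring_sections R U\<^esub> s)),
      restriction = ring_restriction R\<rparr>"

definition kernel_sections ::
    "('p, 'r, 's) module_sheaf \<Rightarrow> ('p, 'r, 't) module_sheaf \<Rightarrow> ('p set \<Rightarrow> 's \<Rightarrow> 't)
      \<Rightarrow> 'p set \<Rightarrow> 's set" where
  "kernel_sections F G \<phi> U = {s \<in> carrier (sections F U). \<phi> U s = \<zero>\<^bsub>sections G U\<^esub>}"

text \<open>The image sheaf consists of the sections that lift locally.\<close>

definition image_sections ::
    "'p topology \<Rightarrow> ('p, 'r, 's) module_sheaf \<Rightarrow> ('p, 'r, 't) module_sheaf
      \<Rightarrow> ('p set \<Rightarrow> 's \<Rightarrow> 't) \<Rightarrow> 'p set \<Rightarrow> 't set" where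
  "image_sections X F G \<phi> U = {t \<in> carrier (sections G U).
     \<forall>x\<in>U. \<exists>V. openin X V \<and> x \<in> V \<and> V \<subseteq> U \<and>
       (\<exists>s\<in>carrier (sections F V). \<phi> V s = restriction G U V t)}"


subsection \<open>Stalks, sheafification, quotients\<close>

definition germ ::
    "'p topology \<Rightarrow> ('p, 'r, 's) module_sheaf \<Rightarrow> 'p \<Rightarrow> 'p set \<Rightarrow> 's \<Rightarrow> ('p set \<times> 's) set" where
  "germ X F x U s = {(V, t). openin X V \<and> x \<in> V \<and> t \<in> carrier (sections F V) \<and>
     (\<exists>W. openin X W \<and> x \<in> W \<and> W \<subseteq> U \<inter> V \<and> restriction F U W s = restriction F V W t)}"

definition stalk ::
    "'p topology \<Rightarrow> ('p, 'r, 's) module_sheaf \<Rightarrow> 'p \<Rightarrow> ('p set \<times> 's) set set" where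
  "stalk X F x = {germ X F x U s |U s. openin X U \<and> x \<in> U \<and> s \<in> carrier (sections F U)}"

text \<open>The operations on germs are defined on all representatives at once; the unions below run
  over equal sets.\<close>

definition germ_add ::
    "'p topology \<Rightarrow> ('p, 'r, 's) module_sheaf \<Rightarrow> 'p
      \<Rightarrow> ('p set \<times> 's) set \<Rightarrow> ('p set \<times> 's) set \<Rightarrow> ('p set \<times> 's) set" where
  "germ_add X F x g h = (\<Union>(U, s)\<in>g. \<Union>(V, t)\<in>h. germ X F x (U \<inter> V)
     (restriction F U (U \<inter> V) s \<oplus>\<^bsub>sections F (U \<inter> V)\<^esub> restriction F V (U \<inter> V) t))"

definition germ_smult ::
    "'p topology \<Rightarrow> ('p, 'r) ring_sheaf \<Rightarrow> ('p, 'r, 's) module_sheaf \<Rightarrow> 'p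
      \<Rightarrow> 'p set \<Rightarrow> 'r \<Rightarrow> ('p set \<times> 's) set \<Rightarrow> ('p set \<times> 's) set" where
  "germ_smult X R F x U r g = (\<Union>(V, t)\<in>g. germ X F x (U \<inter> V)
     (ring_restriction R U (U \<inter> V) r \<odot>\<^bsub>sections F (U \<inter> V)\<^esub> restriction F V (U \<inter> V) t))"

definition sheafify ::
    "'p topology \<Rightarrow> ('p, 'r) ring_sheaf \<Rightarrow> ('p, 'r, 's) module_sheaf
      \<Rightarrow> ('p, 'r, 'p \<Rightarrow> ('p set \<times> 's) set) module_sheaf" where
  "sheafify X R F =
     \<lparr>sections = (\<lambda>U. make_module
        {\<sigma> \<in> (\<Pi>\<^sub>E x\<in>U. stalk X F x). \<forall>x\<in>U. \<exists>V s. openin X V \<and> x \<in> V \<and> V \<subseteq> U \<and>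
            s \<in> carrier (sections F V) \<and> (\<forall>y\<in>V. \<sigma> y = germ X F y V s)}
        (\<lambda>x\<in>U. germ X F x U \<zero>\<^bsub>sections F U\<^esub>)
        (\<lambda>\<sigma> \<tau>. \<lambda>x\<in>U. germ_add X F x (\<sigma> x) (\<tau> x))
        (\<lambda>r \<sigma>. \<lambda>x\<in>U. germ_smult X R F x U r (\<sigma> x))),
      restriction = (\<lambda>U V \<sigma>. restrict \<sigma> V)\<rparr>"

definition quotient_presheaf ::
    "('p, 'r, 's) module_sheaf \<Rightarrow> ('p set \<Rightarrow> 's set) \<Rightarrow> ('p, 'r, 's set) module_sheaf" where
  "quotient_presheaf F N =
     \<lparr>sections = (\<lambda>U. make_module
        (a_rcosets\<^bsub>sections F U\<^esub> (N U))
        (N U)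
        (\<lambda>C D. C <+>\<^bsub>sections F U\<^esub> D)
        (\<lambda>r C. \<Union>s\<in>C. N U +>\<^bsub>sections F U\<^esub> (r \<odot>\<^bsub>sections F U\<^esub> s))),
      restriction = (\<lambda>U V C. \<Union>s\<in>C. N V +>\<^bsub>sections F V\<^esub> (restriction F U V s))\<rparr>"

definition quotient_sheaf ::
    "'p topology \<Rightarrow> ('p, 'r) ring_sheaf \<Rightarrow> ('p, 'r, 's) module_sheaf \<Rightarrow> ('p set \<Rightarrow> 's set)
      \<Rightarrow> ('p, 'r, 'p \<Rightarrow> ('p set \<times> 's set) set) module_sheaf" where
  "quotient_sheaf X R F N = sheafify X R (quotient_presheaf F N)"

definition support :: "'p topology \<Rightarrow> ('p, 'r, 's) module_sheaf \<Rightarrow> 'p set" where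
  "support X F = {x \<in> topspace X. stalk X F x \<noteq> {germ X F x (topspace X) \<zero>\<^bsub>sections F (topspace X)\<^esub>}}"


subsection \<open>Coherent sheaves\<close>

definition linear_combination ::
    "('p, 'r, 's) module_sheaf \<Rightarrow> 'p set \<Rightarrow> nat \<Rightarrow> (nat \<Rightarrow> 's) \<Rightarrow> 'p set \<Rightarrow> (nat \<Rightarrow> 'r) \<Rightarrow> 's" where
  "linear_combination F U k s V c =
     (\<Oplus>\<^bsub>sections F V\<^esub>j\<in>{..<k}. c j \<odot>\<^bsub>sections F V\<^esub> restriction F U V (s j))"

definition finite_type ::
    "'p topology \<Rightarrow> ('p, 'r) ring_sheaf \<Rightarrow> ('p, 'r, 's) module_sheaf \<Rightarrow> bool" where
  "finite_type X R F \<longleftrightarrow> (\<forall>x\<in>topspace X. \<exists>U k s. openin X U \<and> x \<in> U \<and>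
     s \<in> {..<k} \<rightarrow> carrier (sections F U) \<and>
     (\<forall>V t. openin X V \<longrightarrow> V \<subseteq> U \<longrightarrow> t \<in> carrier (sections F V) \<longrightarrow>
        (\<forall>y\<in>V. \<exists>W. openin X W \<and> y \<in> W \<and> W \<subseteq> V \<and>
           (\<exists>c\<in>{..<k} \<rightarrow> carrier (ring_sections R W).
              restriction F V W t = linear_combination F U k s W c))))"

definition relation_sheaf ::
    "('p, 'r) ring_sheaf \<Rightarrow> ('p, 'r, 's) module_sheaf \<Rightarrow> 'p set \<Rightarrow> nat \<Rightarrow> (nat \<Rightarrow> 's)
      \<Rightarrow> ('p, 'r, nat \<Rightarrow> 'r) module_sheaf" where
  "relation_sheaf R F U k s = restrict_to (power_sheaf (structure_module R) k)
     (\<lambda>V. {c \<in> {..<k} \<rightarrow>\<^sub>E carrier (ring_sections R V).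
            linear_combination F U k s V c = \<zero>\<^bsub>sections F V\<^esub>})"

text \<open>Serre's definition: \<open>F\<close> is of finite type, and so is the sheaf of relations between any
  finitely many sections of \<open>F\<close> over any open set.\<close>

definition coherent ::
    "'p topology \<Rightarrow> ('p, 'r) ring_sheaf \<Rightarrow> ('p, 'r, 's) module_sheaf \<Rightarrow> bool" where
  "coherent X R F \<longleftrightarrow> finite_type X R F \<and>
     (\<forall>U k s. openin X U \<longrightarrow> s \<in> {..<k} \<rightarrow> carrier (sections F U) \<longrightarrow>
        finite_type (subtopology X U) R (relation_sheaf R F U k s))"


section \<open>Projective space\<close>

text \<open>The homogeneous coordinate ring \<open>S = \<complex>[x\<^sub>0, \<dots>, x\<^sub>n]\<close>: polynomials are finitely
  supported functions from monomials to coefficients, and monomials are finitely supported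
  functions from variable indices to exponents.\<close>

type_synonym mpoly = "(nat \<Rightarrow>\<^sub>0 nat) \<Rightarrow>\<^sub>0 complex"
type_synonym point = "mpoly set"
type_synonym func = "point \<Rightarrow> mpoly fract"

definition coord_ring :: "nat \<Rightarrow> mpoly ring" where
  "coord_ring n =
     \<lparr>carrier = {f. \<forall>m\<in>Poly_Mapping.keys f. Poly_Mapping.keys m \<subseteq> {..n}},
      mult = (*), one = 1, zero = 0, add = (+)\<rparr>"

definition monom_degree :: "(nat \<Rightarrow>\<^sub>0 nat) \<Rightarrow> nat" where
  "monom_degree m = (\<Sum>i\<in>Poly_Mapping.keys m. Poly_Mapping.lookup m i)"

definition homogeneous :: "nat \<Rightarrow> nat \<Rightarrow> mpoly \<Rightarrow> bool" where
  "homogeneous n k f \<longleftrightarrow>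
     f \<in> carrier (coord_ring n) \<and> (\<forall>m\<in>Poly_Mapping.keys f. monom_degree m = k)"

definition irrelevant_ideal :: "nat \<Rightarrow> mpoly set" where
  "irrelevant_ideal n = {f \<in> carrier (coord_ring n). Poly_Mapping.lookup f 0 = 0}"

text \<open>The points of \<open>Proj S\<close>.\<close>

definition proj_points :: "nat \<Rightarrow> point set" where
  "proj_points n = {P. primeideal P (coord_ring n) \<and>
     P = Idl\<^bsub>coord_ring n\<^esub> {f \<in> P. \<exists>k. homogeneous n k f} \<and> \<not> irrelevant_ideal n \<subseteq> P}"

definition zariski_open :: "nat \<Rightarrow> point set \<Rightarrow> bool" where
  "zariski_open n U \<longleftrightarrow> (\<exists>E. (\<forall>f\<in>E. \<exists>k. homogeneous n k f) \<and> U = proj_points n - {P. E \<subseteq> P})"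

definition proj_space :: "nat \<Rightarrow> point topology" where
  "proj_space n = topology (zariski_open n)"

text \<open>Sections of \<open>\<O>(d)\<close> are functions assigning to each point \<open>P\<close> an element of degree \<open>d\<close> of
  the homogeneous localisation \<open>S\<^sub>P\<close> that are locally given by a single fraction. As \<open>S\<close> is a
  domain, all these localisations are contained in its field of fractions, where the
  values are taken. (The field of fractions used here is that of the polynomial ring in
  countably many variables, which contains the one of \<open>S\<close>.)\<close>

definition twist_sections :: "nat \<Rightarrow> int \<Rightarrow> point set \<Rightarrow> func set" where
  "twist_sections n d U = {s \<in> extensional U. \<forall>P\<in>U. \<exists>V f g k l.
     openin (proj_space n) V \<and> P \<in> V \<and> V \<subseteq> U \<and>
     homogeneous n k f \<and> homogeneous n l g \<and> int k = int l + d \<and>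
     (\<forall>Q\<in>V. g \<notin> Q \<and> s Q = Fract f g)}"

definition proj_structure :: "nat \<Rightarrow> (point, func) ring_sheaf" where
  "proj_structure n =
     \<lparr>ring_sections = (\<lambda>U. \<lparr>carrier = twist_sections n 0 U,
        mult = (\<lambda>s t. \<lambda>P\<in>U. s P * t P), one = (\<lambda>P\<in>U. 1),
        zero = (\<lambda>P\<in>U. 0), add = (\<lambda>s t. \<lambda>P\<in>U. s P + t P)\<rparr>),
      ring_restriction = (\<lambda>U V s. restrict s V)\<rparr>"

definition twist ::
    "nat \<Rightarrow> int \<Rightarrow> (point, func, func) module_sheaf"
  where
  "twist n d =
     \<lparr>sections = (\<lambda>U. make_module (twist_sections n d U) (\<lambda>P\<in>U. 0)
        (\<lambda>s t. \<lambda>P\<in>U. s P + t P) (\<lambda>r s. \<lambda>P\<in>U. r P * s P)),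
      restriction = (\<lambda>U V s. restrict s V)\<rparr>"

lemma coord_ring_simps:
  "zero (coord_ring n) = 0" "one (coord_ring n) = 1"
  "x \<otimes>\<^bsub>coord_ring n\<^esub> y = x * y" "x \<oplus>\<^bsub>coord_ring n\<^esub> y = x + y"
  by (simp_all add: coord_ring_def)

lemma homogeneous_1: "homogeneous n 0 1"
  by (auto simp: homogeneous_def coord_ring_def monom_degree_def keys_one)

lemma monom_degree_add: "monom_degree (a + b) = monom_degree a + monom_degree b"
proof -
  have *: "monom_degree c = (\<Sum>i\<in>A. Poly_Mapping.lookup c i)"
    if "finite A" "Poly_Mapping.keys c \<subseteq> A" for c A
    unfolding monom_degree_def
    by (rule sum.mono_neutral_left) (use that in \<open>auto simp: in_keys_iff\<close>)
  let ?A = "Poly_Mapping.keys a \<union> Poly_Mapping.keys b"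
  have "Poly_Mapping.keys (a + b) \<subseteq> ?A"
    by (rule Poly_Mapping.keys_add)
  then show ?thesis
    using *[of ?A a] *[of ?A b] *[of ?A "a + b"] by (simp add: lookup_add sum.distrib)
qed

lemma homogeneous_mult:
  assumes "homogeneous n k f" "homogeneous n l g"
  shows "homogeneous n (k + l) (f * g)"
proof -
  have "Poly_Mapping.keys m \<subseteq> {..n} \<and> monom_degree m = k + l"
    if m: "m \<in> Poly_Mapping.keys (f * g)" for m
  proof -
    from m keys_mult[of f g] obtain a b where ab: "m = a + b"
      "a \<in> Poly_Mapping.keys f" "b \<in> Poly_Mapping.keys g"
      by blast
    have "Poly_Mapping.keys a \<subseteq> {..n}" "Poly_Mapping.keys b \<subseteq> {..n}"
      "monom_degree a = k" "monom_degree b = l"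
      using assms ab by (simp_all add: homogeneous_def coord_ring_def)
    then show ?thesis
      using Poly_Mapping.keys_add[of a b] unfolding ab(1) monom_degree_add by blast
  qed
  then show ?thesis
    by (auto simp: homogeneous_def coord_ring_def)
qed

lemma istopology_zariski_open: "istopology (zariski_open n)"
  unfolding istopology_def
proof (intro conjI allI impI)
  fix A B assume "zariski_open n A" "zariski_open n B"
  then obtain E F where
    E: "\<forall>f\<in>E. \<exists>k. homogeneous n k f" "A = proj_points n - {P. E \<subseteq> P}" and
    F: "\<forall>f\<in>F. \<exists>k. homogeneous n k f" "B = proj_points n - {P. F \<subseteq> P}"
    unfolding zariski_open_def by metis
  define G where "G = {e * f |e f. e \<in> E \<and> f \<in> F}"
  have "\<forall>f\<in>G. \<exists>k. homogeneous n k f"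
    using E(1) F(1) homogeneous_mult unfolding G_def by blast
  moreover have "G \<subseteq> P \<longleftrightarrow> E \<subseteq> P \<or> F \<subseteq> P" if "P \<in> proj_points n" for P
  proof -
    interpret primeideal P "coord_ring n"
      using that by (simp add: proj_points_def)
    have carr: "E \<subseteq> carrier (coord_ring n)" "F \<subseteq> carrier (coord_ring n)"
      using E(1) F(1) unfolding homogeneous_def by blast+
    show ?thesis
    proof
      assume G: "G \<subseteq> P"
      have "e \<in> P \<or> f \<in> P" if ef: "e \<in> E" "f \<in> F" for e f
      proof (rule I_prime)
        show "e \<in> carrier (coord_ring n)" "f \<in> carrier (coord_ring n)"
          using ef carr by blast+
        show "e \<otimes>\<^bsub>coord_ring n\<^esub> f \<in> P"
          using G ef unfolding G_def coord_ring_simps by blast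
      qed
      then show "E \<subseteq> P \<or> F \<subseteq> P" by blast
    next
      assume EF: "E \<subseteq> P \<or> F \<subseteq> P"
      have "e * f \<in> P" if ef: "e \<in> E" "f \<in> F" for e f
        using EF
      proof
        assume "E \<subseteq> P"
        with I_r_closed[of e f] ef carr show ?thesis
          unfolding coord_ring_simps by blast
      next
        assume "F \<subseteq> P"
        with I_l_closed[of f e] ef carr show ?thesis
          unfolding coord_ring_simps by blast
      qed
      then show "G \<subseteq> P"
        unfolding G_def by blast
    qed
  qed
  then have "A \<inter> B = proj_points n - {P. G \<subseteq> P}"
    using E(2) F(2) by blast
  ultimately show "zariski_open n (A \<inter> B)"
    unfolding zariski_open_def by blast
next
  fix K assume K: "\<forall>A\<in>K. zariski_open n A"
  define G where "G = \<Union>{E. (\<forall>f\<in>E. \<exists>k. homogeneous n k f) \<and> proj_points n - {P. E \<subseteq> P} \<in> K}"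
  have "\<Union>K = proj_points n - {P. G \<subseteq> P}"
  proof
    show "\<Union>K \<subseteq> proj_points n - {P. G \<subseteq> P}"
    proof
      fix P assume "P \<in> \<Union>K"
      then obtain A where A: "A \<in> K" "P \<in> A" by blast
      with K obtain E where "\<forall>f\<in>E. \<exists>k. homogeneous n k f" "A = proj_points n - {P. E \<subseteq> P}"
        unfolding zariski_open_def by metis
      with A show "P \<in> proj_points n - {P. G \<subseteq> P}"
        unfolding G_def by auto
    qed
    show "proj_points n - {P. G \<subseteq> P} \<subseteq> \<Union>K"
      unfolding G_def by blast
  qed
  moreover have "\<forall>f\<in>G. \<exists>k. homogeneous n k f"
    unfolding G_def by blast
  ultimately show "zariski_open n (\<Union>K)"
    unfolding zariski_open_def by blast
qed

lemma openin_proj_space: "openin (proj_space n) U \<longleftrightarrow> zariski_open n U"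
  unfolding proj_space_def by (simp add: topology_inverse' istopology_zariski_open)

lemma topspace_proj_space: "topspace (proj_space n) = proj_points n"
proof -
  have "1 \<notin> P" if "P \<in> proj_points n" for P
  proof -
    interpret primeideal P "coord_ring n"
      using that by (simp add: proj_points_def)
    show ?thesis
      using one_imp_carrier I_notcarr by (auto simp: coord_ring_simps)
  qed
  then have "zariski_open n (proj_points n)"
    unfolding zariski_open_def using homogeneous_1 by (intro exI[of _ "{1}"]) auto
  then have "proj_points n \<subseteq> topspace (proj_space n)"
    by (intro openin_subset) (simp add: openin_proj_space)
  moreover have "topspace (proj_space n) \<subseteq> proj_points n"
    unfolding topspace_def by (auto simp: openin_proj_space zariski_open_def)
  ultimately show ?thesis by blast
qed


subsection \<open>Closed subschemes\<close>

definition ideal_sheaf ::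
    "nat \<Rightarrow> (point set \<Rightarrow> func set) \<Rightarrow> (point, func, func) module_sheaf" where
  "ideal_sheaf n I = restrict_to (structure_module (proj_structure n)) I"

text \<open>A closed subscheme \<open>Z\<close> of \<open>\<P>\<^sup>n\<close> is given by its ideal sheaf \<open>\<I>\<close>, a coherent
  sheaf of ideals: its underlying space is the support of \<open>\<O> / \<I>\<close>, and its structure sheaf
  is \<open>\<O> / \<I>\<close>, regarded as a sheaf on \<open>\<P>\<^sup>n\<close>.\<close>

definition closed_subscheme :: "nat \<Rightarrow> (point set \<Rightarrow> func set) \<Rightarrow> bool" where
  "closed_subscheme n I \<longleftrightarrow>
     subsheaf (proj_space n) (proj_structure n) (structure_module (proj_structure n)) I \<and>
     coherent (proj_space n) (proj_structure n) (ideal_sheaf n I)"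

definition subscheme_structure ::
    "nat \<Rightarrow> (point set \<Rightarrow> func set)
      \<Rightarrow> (point, func, point \<Rightarrow> (point set \<times> func set) set) module_sheaf" where
  "subscheme_structure n I =
     quotient_sheaf (proj_space n) (proj_structure n) (structure_module (proj_structure n)) I"

definition subscheme_space ::
    "nat \<Rightarrow> (point set \<Rightarrow> func set) \<Rightarrow> point topology" where
  "subscheme_space n I =
     subtopology (proj_space n) (support (proj_space n) (subscheme_structure n I))"

definition zero_dimensional_subscheme ::
    "nat \<Rightarrow> (point set \<Rightarrow> func set) \<Rightarrow> bool" where
  "zero_dimensional_subscheme n I \<longleftrightarrow> closed_subscheme n I \<and> krull_dim (subscheme_space n I) = 0"


subsection \<open>Global sections as complex vector spaces\<close>

definition global_sections ::
    "nat \<Rightarrow> (point, func, 's) module_sheaf \<Rightarrow> (complex, 's) module" where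
  "global_sections n F = (let M = sections F (proj_points n) in
     make_module (carrier M) \<zero>\<^bsub>M\<^esub> (\<lambda>s t. s \<oplus>\<^bsub>M\<^esub> t)
       (\<lambda>c s. (\<lambda>P\<in>proj_points n. Fract (Poly_Mapping.single 0 c) 1) \<odot>\<^bsub>M\<^esub> s))"

definition has_dimension :: "(complex, 's) module \<Rightarrow> nat \<Rightarrow> bool" where
  "has_dimension V h \<longleftrightarrow> (\<exists>b\<in>{..<h} \<rightarrow> carrier V. \<forall>v\<in>carrier V.
     \<exists>!c. c \<in> {..<h} \<rightarrow>\<^sub>E UNIV \<and> v = (\<Oplus>\<^bsub>V\<^esub>j\<in>{..<h}. c j \<odot>\<^bsub>V\<^esub> b j))"


section \<open>Perfect extended monads\<close>

text \<open>\<open>\<alpha> i\<close> is the differential from degree \<open>i\<close> to degree \<open>i + 1\<close>. Exactness is required in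
  every degree other than \<open>0\<close>: in degree \<open>1 - n\<close> it says that the first map is injective, in
  degree \<open>1\<close> that the last map is surjective.\<close>

definition monad_term ::
    "nat \<Rightarrow> (int \<Rightarrow> nat) \<Rightarrow> int
      \<Rightarrow> (point, func, nat \<Rightarrow> func) module_sheaf" where
  "monad_term n a i = power_sheaf (twist n i) (if 1 - int n \<le> i \<and> i \<le> 1 then a i else 0)"

definition perfect_extended_monad ::
    "nat \<Rightarrow> (int \<Rightarrow> nat)
      \<Rightarrow> (int \<Rightarrow> point set \<Rightarrow> (nat \<Rightarrow> func) \<Rightarrow> nat \<Rightarrow> func)
      \<Rightarrow> bool" where
  "perfect_extended_monad n a \<alpha> \<longleftrightarrow>
     (\<forall>i. sheaf_hom (proj_space n) (proj_structure n)
            (monad_term n a i) (monad_term n a (i + 1)) (\<alpha> i)) \<and>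
     (\<forall>i U s. openin (proj_space n) U \<longrightarrow> s \<in> carrier (sections (monad_term n a i) U) \<longrightarrow>
        \<alpha> (i + 1) U (\<alpha> i U s) = \<zero>\<^bsub>sections (monad_term n a (i + 2)) U\<^esub>) \<and>
     (\<forall>i U. i \<noteq> 0 \<longrightarrow> openin (proj_space n) U \<longrightarrow>
        kernel_sections (monad_term n a i) (monad_term n a (i + 1)) (\<alpha> i) U =
        image_sections (proj_space n) (monad_term n a (i - 1)) (monad_term n a i) (\<alpha> (i - 1)) U)"

definition monad_cohomology ::
    "nat \<Rightarrow> (int \<Rightarrow> nat)
      \<Rightarrow> (int \<Rightarrow> point set \<Rightarrow> (nat \<Rightarrow> func) \<Rightarrow> nat \<Rightarrow> func)
      \<Rightarrow> (point, func, point \<Rightarrow> (point set \<times> (nat \<Rightarrow> func) set) set) module_sheaf" where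
  "monad_cohomology n a \<alpha> =
     quotient_sheaf (proj_space n) (proj_structure n)
       (restrict_to (monad_term n a 0)
          (kernel_sections (monad_term n a 0) (monad_term n a 1) (\<alpha> 0)))
       (image_sections (proj_space n) (monad_term n a (-1)) (monad_term n a 0) (\<alpha> (-1)))"

end

theory Submission
  imports Defs
    "HOL-Computational_Algebra.Fundamental_Theorem_Algebra"
    "HOL-Analysis.Continuum_Not_Denumerable"
    "HOL-Library.Function_Algebras"
begin

text \<open>Let \<open>K\<close> be the field of fractions of the polynomial ring. Every nonempty open set of \<open>\<P>\<^sup>n\<close>
  contains the generic point, so sections of \<open>\<O>(d)\<close>, of its submodules and of finite sums of such
  sheaves are constant families with values in \<open>K\<close> that satisfy a condition at each point
  (\<open>twist_sections_iff\<close>). All statements about sheaves, including the passage to quotient sheaves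
  (\<open>constant_quotient\<close>, \<open>quotient_iso_ideal_sheaf\<close>), are thereby reduced to statements about
  submodules of \<open>K\<close> or of powers of \<open>K\<close> at single points.

  Let \<open>Z\<close> be the subscheme with ideal sheaf \<open>I\<close>. As \<open>Z\<close> has dimension zero, no point of its support
  specialises to another one. Together with a Nullstellensatz over the uncountable field \<open>\<complex>\<close>
  (\<open>exists_specialisation\<close>) and the fact that \<open>I\<close> is generated, on a chart, by its sections there
  (\<open>extend_after_power\<close>), this makes every function on a chart a root of a monic polynomial modulo
  \<open>I\<close> (\<open>algebraic\<close>). So the support is finite and misses a hyperplane \<open>l = 0\<close>, and the
  coordinate ring of the chart \<open>l \<noteq> 0\<close> modulo the ideal \<open>J\<close> of \<open>Z\<close> is a finite-dimensional algebra
  \<open>V\<close>, which is \<open>H\<^sup>0(\<O>\<^sub>Z)\<close> (\<open>dimension_global_sections\<close>). The coordinates \<open>x\<^sub>j / l\<close> act on \<open>V\<close> by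
  commuting matrices \<open>B\<^sub>1, \<dots>, B\<^sub>n\<close>.

  The monad is built from the Koszul complex of the commuting operators \<open>X\<^sub>j = x\<^sub>j - l B\<^sub>j\<close>, with
  terms \<open>\<Lambda>\<^sup>k \<complex>\<^sup>n \<otimes> V \<otimes> \<O>(1 - k)\<close>; this is where the binomial coefficients come from. One more
  summand \<open>\<O>\<close> is added in degree \<open>0\<close> and is mapped to \<open>V \<otimes> \<O>(1)\<close> by \<open>f \<mapsto> l f \<cdot> 1\<close>, where the last
  factor is the unit element of \<open>V\<close>. The theorem then rests on two facts.

  \<^item> The Koszul complex is exact except at its end. Over the polynomial ring, after a change of
    coordinates with \<open>l = x\<^sub>0\<close>, substituting the matrix \<open>x\<^sub>0 B\<^sub>j\<close> for \<open>x\<^sub>j\<close> splits off the image of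
    \<open>X\<^sub>j\<close>, whence the \<open>X\<^sub>j\<close> form a regular sequence (\<open>Y_regular\<close>) and the complex is exact
    (\<open>koszul_exact\<close>). Taking homogeneous components and clearing denominators gives exactness on
    stalks (\<open>stalk_koszul_exact\<close>).

  \<^item> The cokernel of \<open>(X\<^sub>1, \<dots>, X\<^sub>n)\<close> is \<open>\<O>\<^sub>Z\<close>, generated by \<open>l \<cdot> 1\<close>. Where \<open>l \<noteq> 0\<close>, a function \<open>f\<close>
    acts on the cokernel as multiplication by its class in \<open>V\<close> (\<open>multiplication_mod_pencil\<close>); where
    \<open>l = 0\<close>, one of the \<open>X\<^sub>j\<close> is surjective (\<open>pencil_surjective_on_hyperplane\<close>).

  By the second fact the new summand makes the complex exact at its end
  (\<open>augmented_pencil_surjective\<close>), and the elements of \<open>\<O>\<close> that lift to cycles in degree \<open>0\<close> are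
  exactly those of \<open>I\<close> (\<open>augmented_kernel_iff\<close>). By the first fact, cycles whose component in \<open>\<O>\<close>
  vanishes are boundaries. Hence projection to \<open>\<O>\<close> identifies the cohomology with \<open>I\<close>.\<close>

section \<open>Polynomials\<close>

definition var :: "nat \<Rightarrow> mpoly" where
  "var i = Poly_Mapping.single (Poly_Mapping.single i 1) 1"

definition const :: "complex \<Rightarrow> mpoly" where
  "const c = Poly_Mapping.single 0 c"

lemma const_hom [simp]:
  "const 0 = 0" "const 1 = 1"
  "const (a + b) = const a + const b" "const (a * b) = const a * const b"
  "const (a - b) = const a - const b" "const (- a) = - const a"
  by (simp_all add: const_def single_add single_diff single_uminus mult_single)

lemma const_sum: "const (sum f A) = (\<Sum>x\<in>A. const (f x))"
  by (induction A rule: infinite_finite_induct) auto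

lemma const_eq_0_iff [simp]: "const c = 0 \<longleftrightarrow> c = 0"
  unfolding const_def by (metis lookup_single_eq lookup_zero single_zero)

lemma var_mult_single:
  "var i * Poly_Mapping.single m c = Poly_Mapping.single (Poly_Mapping.single i 1 + m) c"
  by (simp add: var_def mult_single)

lemma const_mult_single:
  "const a * Poly_Mapping.single m c = Poly_Mapping.single m (a * c)"
  by (simp add: const_def mult_single)

lemma poly_expansion: "p = (\<Sum>m\<in>Poly_Mapping.keys p. Poly_Mapping.single m (Poly_Mapping.lookup p m))"
proof (rule poly_mapping_eqI)
  fix k
  show "Poly_Mapping.lookup p k = Poly_Mapping.lookup
          (\<Sum>m\<in>Poly_Mapping.keys p. Poly_Mapping.single m (Poly_Mapping.lookup p m)) k"
    by (auto simp: lookup_sum lookup_single when_def in_keys_iff)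
qed

lemma monom_degree_single [simp]: "monom_degree (Poly_Mapping.single i k) = k"
  by (simp add: monom_degree_def)

lemma monom_degree_zero [simp]: "monom_degree 0 = 0"
  by (simp add: monom_degree_def)

lemma monom_induct [consumes 1, case_names zero step]:
  assumes "Poly_Mapping.keys (m :: nat \<Rightarrow>\<^sub>0 nat) \<subseteq> I"
    and "P 0"
    and "\<And>i m. i \<in> I \<Longrightarrow> Poly_Mapping.keys m \<subseteq> I \<Longrightarrow> P m \<Longrightarrow> P (Poly_Mapping.single i 1 + m)"
  shows "P m"
  using assms(1)
proof (induction "monom_degree m" arbitrary: m)
  case 0
  have "m = 0"
  proof (rule poly_mapping_eqI)
    fix k
    show "Poly_Mapping.lookup m k = Poly_Mapping.lookup 0 k"
      using 0(1) by (cases "k \<in> Poly_Mapping.keys m") (auto simp: monom_degree_def in_keys_iff)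
  qed
  then show ?case using assms(2) by simp
next
  case (Suc d)
  then obtain i where i: "i \<in> Poly_Mapping.keys m"
    by (metis monom_degree_zero keys_eq_empty ex_in_conv Zero_neq_Suc)
  define m' where "m' = m - Poly_Mapping.single i 1"
  have m: "m = Poly_Mapping.single i 1 + m'"
  proof (rule poly_mapping_eqI)
    fix k
    show "Poly_Mapping.lookup m k = Poly_Mapping.lookup (Poly_Mapping.single i 1 + m') k"
      using i by (auto simp: m'_def lookup_add lookup_minus lookup_single when_def in_keys_iff)
  qed
  have "Poly_Mapping.keys m' \<subseteq> Poly_Mapping.keys m"
    by (auto simp: m'_def in_keys_iff lookup_minus)
  with Suc.prems have k: "Poly_Mapping.keys m' \<subseteq> I" by blast
  have "d = monom_degree m'"
    using Suc.hyps(2) m monom_degree_add[of "Poly_Mapping.single i 1" m'] by simp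
  from Suc.hyps(1)[OF this k] have "P m'" .
  then show ?case
    unfolding m using i k Suc.prems by (intro assms(3)) auto
qed

lemma mpoly_induct [case_names add const var]:
  assumes add: "\<And>p q. P p \<Longrightarrow> P q \<Longrightarrow> P (p + q)"
    and const: "\<And>c. P (const c)"
    and var: "\<And>i p. P p \<Longrightarrow> P (var i * p)"
  shows "P (p :: mpoly)"
proof -
  have single: "P (Poly_Mapping.single m c)" for m c
  proof (induction m rule: monom_induct[OF subset_UNIV, case_names zero step])
    case zero
    show ?case using const[of c] by (simp add: const_def)
  next
    case (step i m)
    from var[OF step(3), of i] show ?case by (simp only: var_mult_single)
  qed
  have "P (\<Sum>m\<in>A. Poly_Mapping.single m (Poly_Mapping.lookup p m))" if "finite A" for A
    using that by induction (use const[of 0] in \<open>auto intro: add single\<close>)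
  from this[of "Poly_Mapping.keys p"] show ?thesis
    by (simp flip: poly_expansion)
qed


subsection \<open>Linear maps given on monomials\<close>

definition linear_extension :: "((nat \<Rightarrow>\<^sub>0 nat) \<Rightarrow> mpoly) \<Rightarrow> mpoly \<Rightarrow> mpoly" where
  "linear_extension g p = (\<Sum>m\<in>Poly_Mapping.keys p. const (Poly_Mapping.lookup p m) * g m)"

lemma linear_extension_superset:
  assumes "finite A" "Poly_Mapping.keys p \<subseteq> A"
  shows "linear_extension g p = (\<Sum>m\<in>A. const (Poly_Mapping.lookup p m) * g m)"
  unfolding linear_extension_def
  by (rule sum.mono_neutral_left) (use assms in \<open>auto simp: in_keys_iff\<close>)

lemma linear_extension_add:
  "linear_extension g (p + q) = linear_extension g p + linear_extension g q"
proof -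
  let ?A = "Poly_Mapping.keys p \<union> Poly_Mapping.keys q"
  have "Poly_Mapping.keys (p + q) \<subseteq> ?A" by (rule Poly_Mapping.keys_add)
  then show ?thesis
    using linear_extension_superset[of ?A p g] linear_extension_superset[of ?A q g]
      linear_extension_superset[of ?A "p + q" g]
    by (simp add: lookup_add sum.distrib ring_distribs)
qed

lemma linear_extension_single:
  "linear_extension g (Poly_Mapping.single m c) = const c * g m"
  by (subst linear_extension_superset[of "{m}"]) auto

lemma linear_extension_zero [simp]: "linear_extension g 0 = 0"
  by (simp add: linear_extension_def)

lemma linear_extension_const: "linear_extension g (const c) = const c * g 0"
  using linear_extension_single[of g 0 c] by (simp only: const_def)

lemma linear_extension_sum:
  "linear_extension g (sum f A) = (\<Sum>x\<in>A. linear_extension g (f x))"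
  by (induction A rule: infinite_finite_induct) (auto simp: linear_extension_add)

lemma linear_extension_via_monomials:
  assumes add: "\<And>p q. F (p + q) = F p + (F q :: mpoly)" and "F 0 = 0"
    and "\<And>m c. F (Poly_Mapping.single m c) = const c * g m"
  shows "F p = linear_extension g p"
proof -
  have "F (sum f A) = (\<Sum>x\<in>A. F (f x))" for f :: "(nat \<Rightarrow>\<^sub>0 nat) \<Rightarrow> mpoly" and A
    by (induction A rule: infinite_finite_induct) (auto simp: assms)
  from this[of "\<lambda>m. Poly_Mapping.single m (Poly_Mapping.lookup p m)" "Poly_Mapping.keys p"]
  show ?thesis
    unfolding linear_extension_def poly_expansion[symmetric] assms(3) .
qed

lemma linear_extension_var_mult:
  "linear_extension g (var i * p) = linear_extension (\<lambda>m. g (Poly_Mapping.single i 1 + m)) p"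
  by (rule linear_extension_via_monomials)
    (auto simp: ring_distribs linear_extension_add var_mult_single linear_extension_single)

lemma linear_extension_const_mult:
  "linear_extension g (const c * p) = const c * linear_extension g p"
proof -
  have "linear_extension g (const c * p) = linear_extension (\<lambda>m. const c * g m) p"
    by (rule linear_extension_via_monomials)
      (auto simp: ring_distribs linear_extension_add const_mult_single linear_extension_single)
  also have "\<dots> = const c * linear_extension g p"
    by (simp add: linear_extension_def sum_distrib_left mult.left_commute)
  finally show ?thesis .
qed

lemma linear_extension_scale: "linear_extension (\<lambda>m. q * g m) p = q * linear_extension g p"
  by (simp add: linear_extension_def sum_distrib_left mult.left_commute)

lemma linear_extension_fun_sum:
  "linear_extension (\<lambda>m. \<Sum>x\<in>A. g x m) p = (\<Sum>x\<in>A. linear_extension (g x) p)"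
  by (simp add: linear_extension_def sum_distrib_left sum.swap[of _ A])


subsection \<open>Substitution\<close>

definition subst :: "(nat \<Rightarrow> mpoly) \<Rightarrow> mpoly \<Rightarrow> mpoly" where
  "subst \<sigma> = linear_extension (\<lambda>m. \<Prod>i\<in>Poly_Mapping.keys m. \<sigma> i ^ Poly_Mapping.lookup m i)"

lemma subst_add: "subst \<sigma> (p + q) = subst \<sigma> p + subst \<sigma> q"
  by (simp add: subst_def linear_extension_add)

lemma subst_const [simp]: "subst \<sigma> (const c) = const c"
  by (simp add: subst_def linear_extension_const)

lemma subst_sum: "subst \<sigma> (sum f A) = (\<Sum>x\<in>A. subst \<sigma> (f x))"
  by (simp add: subst_def linear_extension_sum)

lemma subst_var_mult: "subst \<sigma> (var i * p) = \<sigma> i * subst \<sigma> p"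
proof -
  have eq: "(\<Prod>j\<in>Poly_Mapping.keys m. \<sigma> j ^ Poly_Mapping.lookup m j) =
        (\<Prod>j\<in>A. \<sigma> j ^ Poly_Mapping.lookup m j)"
    if "finite A" "Poly_Mapping.keys m \<subseteq> A" for m A
    by (rule prod.mono_neutral_left) (use that in \<open>auto simp: in_keys_iff\<close>)
  have "(\<Prod>j\<in>Poly_Mapping.keys (Poly_Mapping.single i 1 + m).
            \<sigma> j ^ Poly_Mapping.lookup (Poly_Mapping.single i 1 + m) j) =
        \<sigma> i * (\<Prod>j\<in>Poly_Mapping.keys m. \<sigma> j ^ Poly_Mapping.lookup m j)" for m
  proof -
    let ?A = "insert i (Poly_Mapping.keys m)"
    have "Poly_Mapping.keys (Poly_Mapping.single i 1 + m) \<subseteq> ?A"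
      using Poly_Mapping.keys_add[of "Poly_Mapping.single i 1" m] by auto
    then have "(\<Prod>j\<in>Poly_Mapping.keys (Poly_Mapping.single i 1 + m).
            \<sigma> j ^ Poly_Mapping.lookup (Poly_Mapping.single i 1 + m) j)
        = (\<Prod>j\<in>?A. \<sigma> j ^ Poly_Mapping.lookup (Poly_Mapping.single i 1 + m) j)"
      by (intro eq) auto
    also have "\<dots> = (\<Prod>j\<in>?A. (if j = i then \<sigma> j else 1) * \<sigma> j ^ Poly_Mapping.lookup m j)"
      by (intro prod.cong) (auto simp: lookup_add lookup_single when_def)
    also have "\<dots> = \<sigma> i * (\<Prod>j\<in>?A. \<sigma> j ^ Poly_Mapping.lookup m j)"
      by (simp add: prod.distrib prod.delta)
    also have "(\<Prod>j\<in>?A. \<sigma> j ^ Poly_Mapping.lookup m j) =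
        (\<Prod>j\<in>Poly_Mapping.keys m. \<sigma> j ^ Poly_Mapping.lookup m j)"
      by (intro eq[symmetric]) auto
    finally show ?thesis .
  qed
  then show ?thesis
    by (simp add: subst_def linear_extension_var_mult linear_extension_scale)
qed

lemma subst_const_mult: "subst \<sigma> (const c * p) = const c * subst \<sigma> p"
  by (simp add: subst_def linear_extension_const_mult)

lemma subst_mult: "subst \<sigma> (p * q) = subst \<sigma> p * subst \<sigma> q"
  by (induction p rule: mpoly_induct)
    (auto simp: ring_distribs subst_add subst_const_mult subst_var_mult mult.assoc)

lemma subst_0 [simp]: "subst \<sigma> 0 = 0"
  using subst_const[of \<sigma> 0] by simp

lemma subst_1 [simp]: "subst \<sigma> 1 = 1"
  using subst_const[of \<sigma> 1] by simp

lemma subst_var [simp]: "subst \<sigma> (var i) = \<sigma> i"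
  using subst_var_mult[of \<sigma> i 1] by simp

lemma subst_minus: "subst \<sigma> (- p) = - subst \<sigma> p"
  using subst_const_mult[of \<sigma> "-1" p] by simp

lemma subst_diff: "subst \<sigma> (p - q) = subst \<sigma> p - subst \<sigma> q"
  using subst_add[of \<sigma> p "- q"] by (simp add: subst_minus)

lemma subst_subst_inverse:
  assumes "\<And>i. subst \<tau> (\<sigma> i) = var i"
  shows "subst \<tau> (subst \<sigma> p) = p"
  by (induction p rule: mpoly_induct)
    (auto simp: subst_add subst_var_mult subst_mult assms)


subsection \<open>The homogeneous coordinate ring\<close>

abbreviation coords :: "nat \<Rightarrow> mpoly set" where
  "coords n \<equiv> carrier (coord_ring n)"

lemma coords_iff: "f \<in> coords n \<longleftrightarrow> (\<forall>m\<in>Poly_Mapping.keys f. Poly_Mapping.keys m \<subseteq> {..n})"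
  by (simp add: coord_ring_def)

lemma coords_0 [simp]: "0 \<in> coords n" and coords_1 [simp]: "1 \<in> coords n"
  and coords_const [simp]: "const c \<in> coords n"
  by (auto simp: coords_iff const_def)

lemma coords_var: "i \<le> n \<Longrightarrow> var i \<in> coords n"
  by (auto simp: coords_iff var_def)

lemma coords_add [intro]: "f \<in> coords n \<Longrightarrow> g \<in> coords n \<Longrightarrow> f + g \<in> coords n"
  unfolding coords_iff using Poly_Mapping.keys_add[of f g] by blast

lemma coords_uminus [intro]: "f \<in> coords n \<Longrightarrow> - f \<in> coords n"
  unfolding coords_iff by simp

lemma coords_mult [intro]: "f \<in> coords n \<Longrightarrow> g \<in> coords n \<Longrightarrow> f * g \<in> coords n"
  unfolding coords_iff
proof
  fix m assume f: "\<forall>m\<in>Poly_Mapping.keys f. Poly_Mapping.keys m \<subseteq> {..n}"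
    and g: "\<forall>m\<in>Poly_Mapping.keys g. Poly_Mapping.keys m \<subseteq> {..n}"
    and m: "m \<in> Poly_Mapping.keys (f * g)"
  from m keys_mult[of f g] obtain a b where "m = a + b"
      "a \<in> Poly_Mapping.keys f" "b \<in> Poly_Mapping.keys g"
    by blast
  with f g Poly_Mapping.keys_add[of a b] show "Poly_Mapping.keys m \<subseteq> {..n}" by blast
qed

lemma cring_coord_ring: "cring (coord_ring n)"
proof (rule cringI)
  show "abelian_group (coord_ring n)"
  proof (rule abelian_groupI)
    fix x assume "x \<in> coords n"
    then show "\<exists>y\<in>coords n. y \<oplus>\<^bsub>coord_ring n\<^esub> x = \<zero>\<^bsub>coord_ring n\<^esub>"
      by (intro bexI[of _ "- x"]) (auto simp: coord_ring_simps)
  qed (auto simp: coord_ring_simps add_ac)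
  show "comm_monoid (coord_ring n)"
    by (rule comm_monoidI) (auto simp: coord_ring_simps mult_ac)
qed (auto simp: coord_ring_simps ring_distribs)


subsection \<open>Homogeneous polynomials\<close>

lemma homogeneous_coords: "homogeneous n k f \<Longrightarrow> f \<in> coords n"
  by (simp add: homogeneous_def)

lemma homogeneous_0 [simp]: "homogeneous n k 0"
  by (simp add: homogeneous_def)

lemma homogeneous_const [simp]: "homogeneous n 0 (const c)"
  by (cases "c = 0") (simp_all add: homogeneous_def coords_iff const_def)

lemma homogeneous_var: "i \<le> n \<Longrightarrow> homogeneous n 1 (var i)"
  by (simp add: homogeneous_def coords_var) (simp add: var_def)

lemma homogeneous_add:
  "homogeneous n k f \<Longrightarrow> homogeneous n k g \<Longrightarrow> homogeneous n k (f + g)"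
  unfolding homogeneous_def using Poly_Mapping.keys_add[of f g] by blast

lemma homogeneous_uminus: "homogeneous n k f \<Longrightarrow> homogeneous n k (- f)"
  unfolding homogeneous_def by auto

lemma homogeneous_sum:
  "(\<And>x. x \<in> A \<Longrightarrow> homogeneous n k (f x)) \<Longrightarrow> homogeneous n k (sum f A)"
  by (induction A rule: infinite_finite_induct) (auto intro: homogeneous_add)

lemma homogeneous_const_mult: "homogeneous n k f \<Longrightarrow> homogeneous n k (const c * f)"
  using homogeneous_mult[of n 0 "const c" k f] by simp

lemma homogeneous_power: "homogeneous n k f \<Longrightarrow> homogeneous n (e * k) (f ^ e)"
  by (induction e) (auto intro: homogeneous_1 homogeneous_mult)

definition homogeneous_component :: "nat \<Rightarrow> mpoly \<Rightarrow> mpoly" where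
  "homogeneous_component k f = (\<Sum>m | m \<in> Poly_Mapping.keys f \<and> monom_degree m = k.
     Poly_Mapping.single m (Poly_Mapping.lookup f m))"

lemma lookup_homogeneous_component:
  "Poly_Mapping.lookup (homogeneous_component k f) m = (if monom_degree m = k then Poly_Mapping.lookup f m else 0)"
  by (auto simp: homogeneous_component_def lookup_sum lookup_single when_def in_keys_iff)

lemma homogeneous_component_add: "homogeneous_component k (f + g) = homogeneous_component k f + homogeneous_component k g"
  by (rule poly_mapping_eqI) (simp add: lookup_homogeneous_component lookup_add)

lemma homogeneous_component_0 [simp]: "homogeneous_component k 0 = 0"
  by (rule poly_mapping_eqI) (simp add: lookup_homogeneous_component)

lemma homogeneous_component_sum: "homogeneous_component k (sum f A) = (\<Sum>x\<in>A. homogeneous_component k (f x))"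
  by (induction A rule: infinite_finite_induct) (auto simp: homogeneous_component_add)

lemma homogeneous_homogeneous_component: "f \<in> coords n \<Longrightarrow> homogeneous n k (homogeneous_component k f)"
  unfolding homogeneous_def coords_iff
  by (auto simp: in_keys_iff lookup_homogeneous_component split: if_splits)

lemma homogeneous_component_homogeneous: "homogeneous n k f \<Longrightarrow> homogeneous_component j f = (if j = k then f else 0)"
  by (intro poly_mapping_eqI) (auto simp: lookup_homogeneous_component homogeneous_def in_keys_iff)

lemma homogeneous_component_expansion:
  obtains N where "\<And>N'. N \<le> N' \<Longrightarrow> f = (\<Sum>k\<le>N'. homogeneous_component k f)"
proof
  fix N' assume N': "Max (insert 0 (monom_degree ` Poly_Mapping.keys f)) \<le> N'"
  show "f = (\<Sum>k\<le>N'. homogeneous_component k f)"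
  proof (rule poly_mapping_eqI)
    fix m
    have "monom_degree m \<le> N'" if "Poly_Mapping.lookup f m \<noteq> 0"
    proof -
      have "monom_degree m \<le> Max (insert 0 (monom_degree ` Poly_Mapping.keys f))"
        using that by (intro Max_ge) (auto simp: in_keys_iff)
      also note N'
      finally show ?thesis .
    qed
    then show "Poly_Mapping.lookup f m = Poly_Mapping.lookup (\<Sum>k\<le>N'. homogeneous_component k f) m"
      by (auto simp: lookup_sum lookup_homogeneous_component)
  qed
qed

lemma homogeneous_component_mult:
  assumes "f \<in> coords n" "g \<in> coords n"
  shows "homogeneous_component k (f * g) = (\<Sum>i\<le>k. homogeneous_component i f * homogeneous_component (k - i) g)"
proof -
  obtain N1 where N1: "\<And>N'. N1 \<le> N' \<Longrightarrow> f = (\<Sum>k\<le>N'. homogeneous_component k f)"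
    using homogeneous_component_expansion[of f] by blast
  obtain N2 where N2: "\<And>N'. N2 \<le> N' \<Longrightarrow> g = (\<Sum>k\<le>N'. homogeneous_component k g)"
    using homogeneous_component_expansion[of g] by blast
  define N where "N = max k (max N1 N2)"
  have "f * g = (\<Sum>i\<le>N. homogeneous_component i f) * (\<Sum>j\<le>N. homogeneous_component j g)"
    by (rule arg_cong2[where f = "(*)", OF N1 N2]) (simp_all add: N_def)
  also have "\<dots> = (\<Sum>i\<le>N. \<Sum>j\<le>N. homogeneous_component i f * homogeneous_component j g)"
    by (rule sum_product)
  finally have "homogeneous_component k (f * g) = (\<Sum>i\<le>N. \<Sum>j\<le>N. homogeneous_component k (homogeneous_component i f * homogeneous_component j g))"
    by (simp add: homogeneous_component_sum)
  also have "\<dots> = (\<Sum>i\<le>N. \<Sum>j\<le>N. if k = i + j then homogeneous_component i f * homogeneous_component j g else 0)"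
    using assms
    by (intro sum.cong refl homogeneous_component_homogeneous homogeneous_mult homogeneous_homogeneous_component)
  also have "\<dots> = (\<Sum>i\<le>N. if i \<le> k then homogeneous_component i f * homogeneous_component (k - i) g else 0)"
  proof (intro sum.cong refl)
    fix i
    have "(\<Sum>j\<le>N. if k = i + j then homogeneous_component i f * homogeneous_component j g else 0) =
          (\<Sum>j\<le>N. if j = k - i \<and> i \<le> k then homogeneous_component i f * homogeneous_component j g else 0)"
      by (intro sum.cong) auto
    also have "\<dots> = (if i \<le> k then homogeneous_component i f * homogeneous_component (k - i) g else 0)"
      by (auto simp: N_def)
    finally show "(\<Sum>j\<le>N. if k = i + j then homogeneous_component i f * homogeneous_component j g else 0) =
      (if i \<le> k then homogeneous_component i f * homogeneous_component (k - i) g else 0)" .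
  qed
  also have "\<dots> = (\<Sum>i\<le>k. homogeneous_component i f * homogeneous_component (k - i) g)"
    by (intro sum.mono_neutral_cong_right) (auto simp: N_def)
  finally show ?thesis .
qed

lemma homogeneous_component_mult_homogeneous:
  assumes "homogeneous n l g" "f \<in> coords n"
  shows "homogeneous_component k (g * f) = (if l \<le> k then g * homogeneous_component (k - l) f else 0)"
proof -
  have "homogeneous_component k (g * f) = (\<Sum>i\<le>k. homogeneous_component i g * homogeneous_component (k - i) f)"
    using assms homogeneous_coords by (intro homogeneous_component_mult) auto
  also have "\<dots> = (\<Sum>i\<le>k. if i = l then g * homogeneous_component (k - i) f else 0)"
    using homogeneous_component_homogeneous[OF assms(1)] by (intro sum.cong) auto
  finally show ?thesis by simp
qed

section \<open>Points of projective space\<close>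

lemma
  assumes "P \<in> proj_points n"
  shows point_coords: "f \<in> P \<Longrightarrow> f \<in> coords n"
    and point_0: "0 \<in> P"
    and point_1: "1 \<notin> P"
    and point_add: "f \<in> P \<Longrightarrow> g \<in> P \<Longrightarrow> f + g \<in> P"
    and point_mult: "f \<in> P \<Longrightarrow> g \<in> coords n \<Longrightarrow> g * f \<in> P"
    and point_prime: "f \<in> coords n \<Longrightarrow> g \<in> coords n \<Longrightarrow> f * g \<in> P \<Longrightarrow> f \<in> P \<or> g \<in> P"
proof -
  interpret primeideal P "coord_ring n"
    using assms by (simp add: proj_points_def)
  show "f \<in> P \<Longrightarrow> f \<in> coords n" by (rule Icarr)
  show "0 \<in> P" using additive_subgroup.zero_closed[OF additive_subgroup_axioms] by (simp add: coord_ring_simps)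
  show "1 \<notin> P" using one_imp_carrier I_notcarr by (auto simp: coord_ring_simps)
  show "f \<in> P \<Longrightarrow> g \<in> P \<Longrightarrow> f + g \<in> P"
    using additive_subgroup.a_closed[OF additive_subgroup_axioms] by (simp add: coord_ring_simps)
  show "f \<in> P \<Longrightarrow> g \<in> coords n \<Longrightarrow> g * f \<in> P"
    using I_l_closed by (simp add: coord_ring_simps)
  show "f \<in> coords n \<Longrightarrow> g \<in> coords n \<Longrightarrow> f * g \<in> P \<Longrightarrow> f \<in> P \<or> g \<in> P"
    using I_prime by (simp add: coord_ring_simps)
qed

lemma point_sum:
  "P \<in> proj_points n \<Longrightarrow> (\<And>x. x \<in> A \<Longrightarrow> f x \<in> P) \<Longrightarrow> sum f A \<in> P"
  by (induction A rule: infinite_finite_induct) (auto simp: point_0 intro: point_add)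

lemma point_uminus_iff:
  assumes "P \<in> proj_points n" shows "- f \<in> P \<longleftrightarrow> f \<in> P"
  using point_mult[OF assms _ coords_const[of "-1"], of f]
    point_mult[OF assms _ coords_const[of "-1"], of "- f"] by auto

lemma point_diff:
  "P \<in> proj_points n \<Longrightarrow> f \<in> P \<Longrightarrow> g \<in> P \<Longrightarrow> f - g \<in> P"
  using point_add[of P n f "- g"] point_uminus_iff[of P n g] by simp

lemma point_mult_notin:
  "P \<in> proj_points n \<Longrightarrow> homogeneous n k f \<Longrightarrow> homogeneous n l g \<Longrightarrow> f \<notin> P \<Longrightarrow> g \<notin> P \<Longrightarrow> f * g \<notin> P"
  using point_prime[of P n f g] homogeneous_coords by blast

lemma point_power_notin:
  assumes "P \<in> proj_points n" "homogeneous n k f" "f \<notin> P"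
  shows "f ^ e \<notin> P"
proof (induction e)
  case (Suc e)
  show ?case
    using point_mult_notin[OF assms(1,2) homogeneous_power[OF assms(2)] assms(3) Suc] by simp
qed (use point_1[OF assms(1)] in simp)

lemma homogeneous_diff:
  "homogeneous n k f \<Longrightarrow> homogeneous n k g \<Longrightarrow> homogeneous n k (f - g)"
  using homogeneous_add[of n k f "- g"] homogeneous_uminus[of n k g] by simp

lemma point_const_notin: "P \<in> proj_points n \<Longrightarrow> c \<noteq> 0 \<Longrightarrow> const c \<notin> P"
  using point_mult[of P n "const c" "const (1 / c)"] point_1[of P n]
  by (auto simp flip: const_hom(4))

text \<open>A homogeneous prime that contains all variables contains the irrelevant ideal.\<close>

lemma point_var:
  assumes P: "P \<in> proj_points n"
  obtains i where "i \<le> n" "var i \<notin> P"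
proof -
  have "\<exists>i\<le>n. var i \<notin> P"
  proof (rule ccontr)
    assume "\<not> ?thesis"
    then have v: "var i \<in> P" if "i \<le> n" for i using that by blast
    have single: "m = 0 \<or> (\<forall>c. Poly_Mapping.single m c \<in> P)"
      if "Poly_Mapping.keys m \<subseteq> {..n}" for m
      using that
    proof (induction m rule: monom_induct)
      case (step i m)
      have "Poly_Mapping.single m c * var i \<in> P" for c
        using step(1,2) v[of i] by (intro point_mult[OF P]) (auto simp: coords_iff)
      then show ?case by (simp only: mult.commute var_mult_single) simp
    qed simp
    have "f \<in> P" if f: "f \<in> irrelevant_ideal n" for f
    proof -
      have "(\<Sum>m\<in>Poly_Mapping.keys f. Poly_Mapping.single m (Poly_Mapping.lookup f m)) \<in> P"
      proof (rule point_sum[OF P])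
        fix m assume m: "m \<in> Poly_Mapping.keys f"
        have "Poly_Mapping.keys m \<subseteq> {..n}" "m \<noteq> 0"
          using f m by (auto simp: irrelevant_ideal_def coords_iff in_keys_iff)
        with single show "Poly_Mapping.single m (Poly_Mapping.lookup f m) \<in> P" by blast
      qed
      then show ?thesis by (simp flip: poly_expansion)
    qed
    with P show False by (auto simp: proj_points_def)
  qed
  with that show ?thesis by blast
qed

lemma point_subsetI:
  assumes P: "P \<in> proj_points n" and Q: "Q \<in> proj_points n"
    and *: "\<And>f k. homogeneous n k f \<Longrightarrow> f \<in> P \<Longrightarrow> f \<in> Q"
  shows "P \<subseteq> Q"
proof -
  interpret cring "coord_ring n" by (rule cring_coord_ring)
  have "P = Idl\<^bsub>coord_ring n\<^esub> {f \<in> P. \<exists>k. homogeneous n k f}"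
    using P by (simp add: proj_points_def)
  also have "\<dots> \<subseteq> Q"
    using Q * by (intro genideal_minimal) (auto simp: proj_points_def primeideal_def)
  finally show ?thesis .
qed

lemma generic_point: "{0} \<in> proj_points n"
proof -
  interpret cring "coord_ring n" by (rule cring_coord_ring)
  have id: "ideal {0} (coord_ring n)"
    using zeroideal by (simp add: coord_ring_simps)
  have "primeideal {0} (coord_ring n)"
    using id cring_coord_ring by (rule primeidealI) (use coords_1[of n] in \<open>auto simp: coord_ring_simps simp del: coords_1\<close>)
  moreover have "Idl\<^bsub>coord_ring n\<^esub> {f \<in> {0}. \<exists>k. homogeneous n k f} = {0}"
  proof
    show "Idl\<^bsub>coord_ring n\<^esub> {f \<in> {0}. \<exists>k. homogeneous n k f} \<subseteq> {0}"
      by (intro genideal_minimal id) auto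
    have "{f \<in> {0}. \<exists>k. homogeneous n k f} \<subseteq> Idl\<^bsub>coord_ring n\<^esub> {f \<in> {0}. \<exists>k. homogeneous n k f}"
      by (intro genideal_self) auto
    then show "{0} \<subseteq> Idl\<^bsub>coord_ring n\<^esub> {f \<in> {0}. \<exists>k. homogeneous n k f}" by auto
  qed
  moreover have "monom_degree (Poly_Mapping.single 0 1) \<noteq> monom_degree 0" by simp
  then have "Poly_Mapping.single 0 1 \<noteq> (0 :: nat \<Rightarrow>\<^sub>0 nat)" by metis
  then have "var 0 \<in> irrelevant_ideal n"
    using coords_var[of 0 n] by (auto simp: irrelevant_ideal_def var_def lookup_single when_def)
  moreover have "var 0 \<noteq> 0"
    by (metis var_def lookup_single_eq lookup_zero zero_neq_one)
  ultimately show ?thesis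
    unfolding proj_points_def by blast
qed

subsection \<open>Open sets\<close>

lemma openin_iff_basic:
  "openin (proj_space n) U \<longleftrightarrow> U \<subseteq> proj_points n \<and>
     (\<forall>P\<in>U. \<exists>h k. homogeneous n k h \<and> h \<notin> P \<and> {Q \<in> proj_points n. h \<notin> Q} \<subseteq> U)"
    (is "?L \<longleftrightarrow> ?R")
proof
  assume ?L
  then obtain E where E: "\<forall>f\<in>E. \<exists>k. homogeneous n k f" "U = proj_points n - {P. E \<subseteq> P}"
    unfolding openin_proj_space zariski_open_def by blast
  then show ?R by blast
next
  assume R: ?R
  define E where "E = {h. (\<exists>k. homogeneous n k h) \<and> {Q \<in> proj_points n. h \<notin> Q} \<subseteq> U}"
  have "U = proj_points n - {P. E \<subseteq> P}"
    using R unfolding E_def by blast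
  moreover have "\<forall>f\<in>E. \<exists>k. homogeneous n k f" unfolding E_def by blast
  ultimately show ?L
    unfolding openin_proj_space zariski_open_def by blast
qed

lemma openin_basic: "homogeneous n k h \<Longrightarrow> openin (proj_space n) {Q \<in> proj_points n. h \<notin> Q}"
  by (auto simp: openin_iff_basic)

text \<open>The zero ideal is contained in every homogeneous prime, hence lies in every basic open set
  that has a point.\<close>

lemma generic_in_open: "openin (proj_space n) U \<Longrightarrow> P \<in> U \<Longrightarrow> {0} \<in> U"
  unfolding openin_iff_basic using point_0 generic_point by blast

lemma open_points: "openin (proj_space n) U \<Longrightarrow> P \<in> U \<Longrightarrow> P \<in> proj_points n"
  unfolding openin_iff_basic by blast

section \<open>Stalks of the twisting sheaves inside the field of fractions\<close>

type_synonym ratfun = "mpoly fract"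

definition fr :: "mpoly \<Rightarrow> ratfun" where
  "fr f = Fract f 1"

lemma fr_hom [simp]:
  "fr 0 = 0" "fr 1 = 1" "fr (f + g) = fr f + fr g" "fr (f * g) = fr f * fr g"
  "fr (f - g) = fr f - fr g" "fr (- f) = - fr f"
  by (simp_all add: fr_def Zero_fract_def One_fract_def)

lemma fr_power [simp]: "fr (f ^ k) = fr f ^ k"
  by (induction k) auto

lemma fr_sum: "fr (sum f A) = (\<Sum>x\<in>A. fr (f x))"
  by (induction A rule: infinite_finite_induct) auto

lemma fr_eq_iff [simp]: "fr f = fr g \<longleftrightarrow> f = g"
  by (simp add: fr_def eq_fract)

lemma fr_eq_0_iff [simp]: "fr f = 0 \<longleftrightarrow> f = 0"
  using fr_eq_iff[of f 0] by (simp del: fr_eq_iff)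

lemma Fract_eq_fr: "Fract f g = fr f / fr g"
  by (simp add: fr_def)

text \<open>All stalks are realised inside one field, so that germs at different points can be compared
  and an element of the field can lie in many stalks at once.\<close>

definition twist_stalk :: "nat \<Rightarrow> int \<Rightarrow> point \<Rightarrow> ratfun set" where
  "twist_stalk n d P = {fr f / fr g |f g k l.
     homogeneous n k f \<and> homogeneous n l g \<and> int k = int l + d \<and> g \<notin> P}"

abbreviation local_ring :: "nat \<Rightarrow> point \<Rightarrow> ratfun set" where
  "local_ring n P \<equiv> twist_stalk n 0 P"

definition max_ideal :: "nat \<Rightarrow> point \<Rightarrow> ratfun set" where
  "max_ideal n P = {fr f / fr g |f g k. homogeneous n k f \<and> homogeneous n k g \<and> f \<in> P \<and> g \<notin> P}"

lemma twist_stalkI: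
  "homogeneous n k f \<Longrightarrow> homogeneous n l g \<Longrightarrow> int k = int l + d \<Longrightarrow> g \<notin> P \<Longrightarrow> q = fr f / fr g
    \<Longrightarrow> q \<in> twist_stalk n d P"
  unfolding twist_stalk_def by blast

lemma twist_stalkE:
  assumes "q \<in> twist_stalk n d P"
  obtains f g k l where "homogeneous n k f" "homogeneous n l g" "int k = int l + d" "g \<notin> P"
    "q = fr f / fr g"
  using assms unfolding twist_stalk_def by blast

lemma notin_point_nonzero: "P \<in> proj_points n \<Longrightarrow> g \<notin> P \<Longrightarrow> g \<noteq> 0"
  using point_0 by blast

lemma stalk_0:
  assumes P: "P \<in> proj_points n" shows "0 \<in> twist_stalk n d P"
proof -
  obtain i where i: "i \<le> n" "var i \<notin> P" using point_var[OF P] .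
  show ?thesis
    by (rule twist_stalkI[of n "nat (int (nat \<bar>d\<bar>) + d)" 0 "nat \<bar>d\<bar>" "var i ^ nat \<bar>d\<bar>"])
      (use homogeneous_power[OF homogeneous_var[OF i(1)], of "nat \<bar>d\<bar>"]
           point_power_notin[OF P homogeneous_var[OF i(1)] i(2)] in auto)
qed

lemma stalk_add:
  assumes P: "P \<in> proj_points n" and "p \<in> twist_stalk n d P" "q \<in> twist_stalk n d P"
  shows "p + q \<in> twist_stalk n d P"
proof -
  obtain f g k l where p: "homogeneous n k f" "homogeneous n l g" "int k = int l + d" "g \<notin> P"
    "p = fr f / fr g" using assms(2) by (rule twist_stalkE)
  obtain f' g' k' l' where q: "homogeneous n k' f'" "homogeneous n l' g'" "int k' = int l' + d"
    "g' \<notin> P" "q = fr f' / fr g'" using assms(3) by (rule twist_stalkE)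
  have nz: "g \<noteq> 0" "g' \<noteq> 0" using p(4) q(4) notin_point_nonzero[OF P] by auto
  have "homogeneous n (k + l') (f * g' + f' * g)"
  proof (rule homogeneous_add)
    show "homogeneous n (k + l') (f * g')" using p q by (intro homogeneous_mult)
    have "k + l' = k' + l" using p(3) q(3) by linarith
    then show "homogeneous n (k + l') (f' * g)" using p q by (metis homogeneous_mult)
  qed
  moreover have "homogeneous n (l + l') (g * g')" using p q by (intro homogeneous_mult)
  moreover have "g * g' \<notin> P" using p q by (intro point_mult_notin[OF P])
  moreover have "p + q = fr (f * g' + f' * g) / fr (g * g')"
    using nz unfolding p(5) q(5) by (simp add: field_simps)
  ultimately show ?thesis using p(3) by (intro twist_stalkI[of n "k + l'" _ "l + l'"]) auto
qed

lemma stalk_mult: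
  assumes P: "P \<in> proj_points n" and "p \<in> twist_stalk n d P" "q \<in> twist_stalk n e P"
  shows "p * q \<in> twist_stalk n (d + e) P"
proof -
  obtain f g k l where p: "homogeneous n k f" "homogeneous n l g" "int k = int l + d" "g \<notin> P"
    "p = fr f / fr g" using assms(2) by (rule twist_stalkE)
  obtain f' g' k' l' where q: "homogeneous n k' f'" "homogeneous n l' g'" "int k' = int l' + e"
    "g' \<notin> P" "q = fr f' / fr g'" using assms(3) by (rule twist_stalkE)
  show ?thesis
    by (rule twist_stalkI[of n "k + k'" "f * f'" "l + l'" "g * g'"])
      (use p q point_mult_notin[OF P p(2) q(2)] in \<open>auto intro: homogeneous_mult\<close>)
qed

lemma stalk_homogeneous:
  "P \<in> proj_points n \<Longrightarrow> homogeneous n k f \<Longrightarrow> fr f \<in> twist_stalk n (int k) P"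
  by (rule twist_stalkI[of n k f 0 1]) (auto simp: homogeneous_1 point_1)

lemma stalk_inverse:
  "P \<in> proj_points n \<Longrightarrow> homogeneous n k f \<Longrightarrow> f \<notin> P \<Longrightarrow> 1 / fr f \<in> twist_stalk n (- int k) P"
  by (rule twist_stalkI[of n 0 1 k f]) (auto simp: homogeneous_1)

lemma stalk_const: "P \<in> proj_points n \<Longrightarrow> fr (const c) \<in> local_ring n P"
  using stalk_homogeneous[of P n 0 "const c"] by simp

lemma stalk_1: "P \<in> proj_points n \<Longrightarrow> 1 \<in> local_ring n P"
  using stalk_const[of P n 1] by simp

lemma stalk_smult:
  "P \<in> proj_points n \<Longrightarrow> r \<in> local_ring n P \<Longrightarrow> q \<in> twist_stalk n d P \<Longrightarrow> r * q \<in> twist_stalk n d P"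
  using stalk_mult[of P n r 0 q d] by simp

lemma stalk_uminus:
  "P \<in> proj_points n \<Longrightarrow> q \<in> twist_stalk n d P \<Longrightarrow> - q \<in> twist_stalk n d P"
  using stalk_smult[of P n "fr (const (-1))" q d] stalk_const[of P n "-1"] by simp

lemma stalk_diff:
  "P \<in> proj_points n \<Longrightarrow> p \<in> twist_stalk n d P \<Longrightarrow> q \<in> twist_stalk n d P \<Longrightarrow> p - q \<in> twist_stalk n d P"
  using stalk_add[of P n p d "- q"] stalk_uminus[of P n q d] by simp

lemma stalk_sum:
  "P \<in> proj_points n \<Longrightarrow> (\<And>x. x \<in> A \<Longrightarrow> f x \<in> twist_stalk n d P) \<Longrightarrow> sum f A \<in> twist_stalk n d P"
  by (induction A rule: infinite_finite_induct) (auto simp: stalk_0 intro: stalk_add)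

lemma stalk_power:
  "P \<in> proj_points n \<Longrightarrow> q \<in> local_ring n P \<Longrightarrow> q ^ k \<in> local_ring n P"
  by (induction k) (auto simp: stalk_1 intro: stalk_smult)

lemma stalk_open:
  assumes "P \<in> proj_points n" "q \<in> twist_stalk n d P"
  shows "\<exists>U. openin (proj_space n) U \<and> P \<in> U \<and> (\<forall>Q\<in>U. q \<in> twist_stalk n d Q)"
proof -
  obtain f g k l where q: "homogeneous n k f" "homogeneous n l g" "int k = int l + d" "g \<notin> P"
    "q = fr f / fr g" using assms(2) by (rule twist_stalkE)
  have "\<forall>Q\<in>{Q \<in> proj_points n. g \<notin> Q}. q \<in> twist_stalk n d Q"
    using q by (auto intro: twist_stalkI)
  then show ?thesis
    using openin_basic[OF q(2)] assms(1) q(4) by blast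
qed

lemma max_ideal_local_ring: "q \<in> max_ideal n P \<Longrightarrow> q \<in> local_ring n P"
  unfolding max_ideal_def twist_stalk_def by auto

lemma fraction_in_max_ideal_iff:
  assumes P: "P \<in> proj_points n" and "homogeneous n k f" "homogeneous n k g" "g \<notin> P"
  shows "fr f / fr g \<in> max_ideal n P \<longleftrightarrow> f \<in> P"
proof
  assume "fr f / fr g \<in> max_ideal n P"
  then obtain f' g' l where *: "homogeneous n l f'" "homogeneous n l g'" "f' \<in> P" "g' \<notin> P"
    "fr f / fr g = fr f' / fr g'" unfolding max_ideal_def by blast
  have nz: "g \<noteq> 0" "g' \<noteq> 0" using assms * notin_point_nonzero[OF P] by auto
  have "fr (f * g') = fr (g * f')" using *(5) nz by (simp add: field_simps)
  then have "f * g' = g * f'" by (simp only: fr_eq_iff)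
  moreover have "g * f' \<in> P"
    using point_mult[OF P *(3)] homogeneous_coords[OF assms(3)] by blast
  ultimately show "f \<in> P"
    using point_prime[OF P homogeneous_coords[OF assms(2)] homogeneous_coords[OF *(2)]] *(4) by metis
next
  assume "f \<in> P"
  then show "fr f / fr g \<in> max_ideal n P"
    using assms unfolding max_ideal_def by blast
qed

lemma local_ringE:
  assumes "q \<in> local_ring n P"
  obtains f g k where "homogeneous n k f" "homogeneous n k g" "g \<notin> P" "q = fr f / fr g"
proof -
  obtain f g k l where "homogeneous n k f" "homogeneous n l g" "int k = int l + 0" "g \<notin> P"
    "q = fr f / fr g" using assms by (rule twist_stalkE)
  then show ?thesis using that by simp
qed

lemma local_unit:
  assumes P: "P \<in> proj_points n" and "q \<in> local_ring n P" "q \<notin> max_ideal n P"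
  shows "1 / q \<in> local_ring n P" "q \<noteq> 0"
proof -
  obtain f g k where q: "homogeneous n k f" "homogeneous n k g" "g \<notin> P" "q = fr f / fr g"
    using assms(2) by (rule local_ringE)
  have "f \<notin> P" using assms(3) fraction_in_max_ideal_iff[OF P q(1-3)] q(4) by simp
  then show "1 / q \<in> local_ring n P"
    using q by (auto intro: twist_stalkI)
  show "q \<noteq> 0" using \<open>f \<notin> P\<close> q notin_point_nonzero[OF P] by simp
qed

lemma max_ideal_smult:
  assumes P: "P \<in> proj_points n" and "a \<in> local_ring n P" "q \<in> max_ideal n P"
  shows "a * q \<in> max_ideal n P"
proof -
  obtain f g k where a: "homogeneous n k f" "homogeneous n k g" "g \<notin> P" "a = fr f / fr g"
    using assms(2) by (rule local_ringE)
  obtain f' g' l where q: "homogeneous n l f'" "homogeneous n l g'" "f' \<in> P" "g' \<notin> P"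
    "q = fr f' / fr g'" using assms(3) unfolding max_ideal_def by blast
  have "f * f' \<in> P" using point_mult[OF P q(3)] homogeneous_coords[OF a(1)] by blast
  then have "fr (f * f') / fr (g * g') \<in> max_ideal n P"
    using a q point_mult_notin[OF P a(2) q(2)]
      fraction_in_max_ideal_iff[OF P homogeneous_mult[OF a(1) q(1)] homogeneous_mult[OF a(2) q(2)]]
    by blast
  then show ?thesis using a q by simp
qed

lemma max_ideal_prime:
  assumes P: "P \<in> proj_points n" and "a \<in> local_ring n P" "b \<in> local_ring n P" "a * b \<in> max_ideal n P"
  shows "a \<in> max_ideal n P \<or> b \<in> max_ideal n P"
proof (rule ccontr)
  assume *: "\<not> ?thesis"
  then have "(1 / a) * (a * b) \<in> max_ideal n P"
    using local_unit(1)[OF P assms(2)] assms(4) max_ideal_smult[OF P] by blast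
  then show False using * local_unit(2)[OF P assms(2)] by simp
qed

lemma max_ideal_add:
  assumes P: "P \<in> proj_points n" and "p \<in> max_ideal n P" "q \<in> max_ideal n P"
  shows "p + q \<in> max_ideal n P"
proof -
  obtain f g k where p: "homogeneous n k f" "homogeneous n k g" "f \<in> P" "g \<notin> P"
    "p = fr f / fr g" using assms(2) unfolding max_ideal_def by blast
  obtain f' g' l where q: "homogeneous n l f'" "homogeneous n l g'" "f' \<in> P" "g' \<notin> P"
    "q = fr f' / fr g'" using assms(3) unfolding max_ideal_def by blast
  have nz: "g \<noteq> 0" "g' \<noteq> 0" using p q notin_point_nonzero[OF P] by auto
  have "g' * f + g * f' \<in> P"
    using p q homogeneous_coords by (intro point_add[OF P] point_mult[OF P]) blast+
  moreover have "homogeneous n (l + k) (g' * f + g * f')"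
    using p q homogeneous_mult[of n k g l f'] homogeneous_mult[of n l g' k f]
    by (intro homogeneous_add) (auto simp: add.commute)
  moreover have "homogeneous n (l + k) (g' * g)" using p q by (intro homogeneous_mult)
  moreover have "g' * g \<notin> P" using p q by (intro point_mult_notin[OF P])
  moreover have "p + q = fr (g' * f + g * f') / fr (g' * g)"
    using nz unfolding p(5) q(5) by (simp add: field_simps)
  ultimately show ?thesis
    unfolding max_ideal_def by blast
qed

lemma max_ideal_0: "P \<in> proj_points n \<Longrightarrow> 0 \<in> max_ideal n P"
  using fraction_in_max_ideal_iff[of P n 0 0 1] by (simp add: homogeneous_1 point_1 point_0)

lemma max_ideal_1: "P \<in> proj_points n \<Longrightarrow> 1 \<notin> max_ideal n P"
  using fraction_in_max_ideal_iff[of P n 0 1 1] by (simp add: homogeneous_1 point_1)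

lemma max_ideal_diff:
  "P \<in> proj_points n \<Longrightarrow> p \<in> max_ideal n P \<Longrightarrow> q \<in> max_ideal n P \<Longrightarrow> p - q \<in> max_ideal n P"
  using max_ideal_add[of P n p "- q"] max_ideal_smult[of P n "fr (const (-1))" q]
    stalk_const[of P n "-1"] by simp

lemma max_ideal_const_iff: "P \<in> proj_points n \<Longrightarrow> fr (const c) \<in> max_ideal n P \<longleftrightarrow> c = 0"
  using fraction_in_max_ideal_iff[of P n 0 "const c" 1] point_const_notin[of P n c]
  by (auto simp: homogeneous_1 point_1 point_0)

subsection \<open>Sections\<close>

text \<open>Every nonempty open set contains the generic point, so a section of a twisting sheaf over
  it is a constant function.\<close>

definition constant_section :: "point set \<Rightarrow> ratfun \<Rightarrow> func" where
  "constant_section U q = (\<lambda>P\<in>U. q)"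

lemma twist_sections_iff:
  assumes U: "openin (proj_space n) U"
  shows "s \<in> twist_sections n d U \<longleftrightarrow>
    (\<exists>q. s = constant_section U q \<and> (\<forall>P\<in>U. q \<in> twist_stalk n d P))" (is "?L \<longleftrightarrow> ?R")
proof
  assume L: ?L
  have loc: "\<exists>V f g k l. openin (proj_space n) V \<and> P \<in> V \<and> V \<subseteq> U \<and>
     homogeneous n k f \<and> homogeneous n l g \<and> int k = int l + d \<and>
     (\<forall>Q\<in>V. g \<notin> Q \<and> s Q = Fract f g)" if "P \<in> U" for P
    using L that unfolding twist_sections_def by blast
  have "s P = s {0} \<and> s P \<in> twist_stalk n d P" if P: "P \<in> U" for P
  proof -
    obtain V f g k l where V: "openin (proj_space n) V" "P \<in> V" "V \<subseteq> U"
     "homogeneous n k f" "homogeneous n l g" "int k = int l + d"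
     "\<forall>Q\<in>V. g \<notin> Q \<and> s Q = Fract f g" using loc[OF P] by blast
    have "{0} \<in> V" using V generic_in_open by blast
    with V show ?thesis
      by (auto simp: Fract_eq_fr intro: twist_stalkI)
  qed
  moreover have "s \<in> extensional U" using L by (simp add: twist_sections_def)
  ultimately have "s = constant_section U (s {0}) \<and> (\<forall>P\<in>U. s {0} \<in> twist_stalk n d P)"
    unfolding constant_section_def by (auto simp: extensional_def fun_eq_iff) metis
  then show ?R by blast
next
  assume ?R
  then obtain q where s: "s = constant_section U q" and q: "\<And>P. P \<in> U \<Longrightarrow> q \<in> twist_stalk n d P"
    by blast
  have "\<exists>V f g k l. openin (proj_space n) V \<and> P \<in> V \<and> V \<subseteq> U \<and>
     homogeneous n k f \<and> homogeneous n l g \<and> int k = int l + d \<and>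
     (\<forall>Q\<in>V. g \<notin> Q \<and> s Q = Fract f g)" if P: "P \<in> U" for P
  proof -
    obtain f g k l where *: "homogeneous n k f" "homogeneous n l g" "int k = int l + d" "g \<notin> P"
      "q = fr f / fr g" using q[OF P] by (rule twist_stalkE)
    have "openin (proj_space n) (U \<inter> {Q \<in> proj_points n. g \<notin> Q})"
      using U openin_basic[OF *(2)] by blast
    with * show ?thesis
      using P open_points[OF U P] unfolding s constant_section_def
      by (intro exI[of _ "U \<inter> {Q \<in> proj_points n. g \<notin> Q}"] exI[of _ f] exI[of _ g]
          exI[of _ k] exI[of _ l]) (auto simp: Fract_eq_fr)
  qed
  then show ?L
    unfolding twist_sections_def by (auto simp: s constant_section_def)
qed

section \<open>Prime ideals and affine charts\<close>

text \<open>The rings that occur are subrings of one field and are given by their carriers.\<close>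

definition ideal_in :: "'a::comm_ring_1 set \<Rightarrow> 'a set \<Rightarrow> bool" where
  "ideal_in A J \<longleftrightarrow> J \<subseteq> A \<and> 0 \<in> J \<and> (\<forall>x\<in>J. \<forall>y\<in>J. x + y \<in> J) \<and> (\<forall>a\<in>A. \<forall>x\<in>J. a * x \<in> J)"

lemma ideal_inD:
  assumes "ideal_in A J"
  shows "x \<in> J \<Longrightarrow> x \<in> A" "0 \<in> J" "x \<in> J \<Longrightarrow> y \<in> J \<Longrightarrow> x + y \<in> J" "a \<in> A \<Longrightarrow> x \<in> J \<Longrightarrow> a * x \<in> J"
  using assms unfolding ideal_in_def by auto

lemma ideal_in_adjoin:
  assumes A: "\<And>x y. x \<in> A \<Longrightarrow> y \<in> A \<Longrightarrow> x + y \<in> A" "\<And>x y. x \<in> A \<Longrightarrow> y \<in> A \<Longrightarrow> x * y \<in> A" "0 \<in> A"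
    and R: "ideal_in A R" and a: "a \<in> A"
  shows "ideal_in A {r + a * s |r s. r \<in> R \<and> s \<in> A}"
  unfolding ideal_in_def
proof (intro conjI ballI subsetI)
  show "0 \<in> {r + a * s |r s. r \<in> R \<and> s \<in> A}"
    using A(3) ideal_inD(2)[OF R] by (intro CollectI exI[of _ 0]) auto
next
  fix x y assume "x \<in> {r + a * s |r s. r \<in> R \<and> s \<in> A}" "y \<in> {r + a * s |r s. r \<in> R \<and> s \<in> A}"
  then obtain r s r' s' where "x = r + a * s" "y = r' + a * s'" "r \<in> R" "r' \<in> R" "s \<in> A" "s' \<in> A"
    by blast
  then show "x + y \<in> {r + a * s |r s. r \<in> R \<and> s \<in> A}"
    using A(1) ideal_inD(3)[OF R]
    by (intro CollectI exI[of _ "r + r'"] exI[of _ "s + s'"]) (auto simp: algebra_simps)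
next
  fix b x assume b: "b \<in> A" and "x \<in> {r + a * s |r s. r \<in> R \<and> s \<in> A}"
  then obtain r s where "x = r + a * s" "r \<in> R" "s \<in> A"
    by blast
  then show "b * x \<in> {r + a * s |r s. r \<in> R \<and> s \<in> A}"
    using A(2) ideal_inD(4)[OF R] b
    by (intro CollectI exI[of _ "b * r"] exI[of _ "b * s"]) (auto simp: algebra_simps)
qed (use A ideal_inD(1)[OF R] a in auto)

text \<open>An ideal maximal among those disjoint from \<open>M\<close> is prime: for \<open>x\<close> and \<open>y\<close> outside it, the ideals
  enlarged by \<open>x\<close> and by \<open>y\<close> meet \<open>M\<close>, and so does their product, which would be contained in
  the ideal if \<open>x y\<close> were an element of it.\<close>

lemma exists_prime_avoiding:
  assumes A: "\<And>x y. x \<in> A \<Longrightarrow> y \<in> A \<Longrightarrow> x + y \<in> A" "\<And>x y. x \<in> A \<Longrightarrow> y \<in> A \<Longrightarrow> x * y \<in> A"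
      "0 \<in> A" "1 \<in> A"
    and J: "ideal_in A J"
    and M: "1 \<in> M" "\<And>x y. x \<in> M \<Longrightarrow> y \<in> M \<Longrightarrow> x * y \<in> M" "J \<inter> M = {}"
  obtains R where "ideal_in A R" "J \<subseteq> R" "R \<inter> M = {}"
    "\<And>x y. x \<in> A \<Longrightarrow> y \<in> A \<Longrightarrow> x * y \<in> R \<Longrightarrow> x \<in> R \<or> y \<in> R"
proof -
  define Z where "Z = {R. ideal_in A R \<and> J \<subseteq> R \<and> R \<inter> M = {}}"
  have "\<exists>R\<in>Z. \<forall>X\<in>Z. R \<subseteq> X \<longrightarrow> X = R"
  proof (rule subset_Zorn_nonempty)
    show "Z \<noteq> {}" using J M unfolding Z_def by blast
  next
    fix C assume C: "C \<noteq> {}" "subset.chain Z C"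
    have CZ: "C \<subseteq> Z" and ch: "\<And>x y. x \<in> C \<Longrightarrow> y \<in> C \<Longrightarrow> x \<subseteq> y \<or> y \<subseteq> x"
      using C(2) unfolding subset_chain_def by blast+
    have "ideal_in A (\<Union>C)"
      unfolding ideal_in_def
    proof (intro conjI ballI)
      fix x y assume "x \<in> \<Union>C" "y \<in> \<Union>C"
      then obtain X Y where "X \<in> C" "Y \<in> C" "x \<in> X" "y \<in> Y" by blast
      then obtain W where "W \<in> C" "x \<in> W" "y \<in> W" using ch[of X Y] by blast
      moreover have "ideal_in A W" using CZ calculation Z_def by blast
      ultimately show "x + y \<in> \<Union>C" using ideal_inD(3) by blast
    next
      show "0 \<in> \<Union>C" using CZ C(1) ideal_inD(2) unfolding Z_def by blast
      show "\<Union>C \<subseteq> A" using CZ ideal_inD(1) unfolding Z_def by blast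
      fix a x assume "a \<in> A" "x \<in> \<Union>C"
      then show "a * x \<in> \<Union>C" using CZ ideal_inD(4) unfolding Z_def by blast
    qed
    then show "\<Union>C \<in> Z" using CZ C(1) unfolding Z_def by blast
  qed
  then obtain R where R: "R \<in> Z" and max: "\<And>X. X \<in> Z \<Longrightarrow> R \<subseteq> X \<Longrightarrow> X = R" by blast
  have idR: "ideal_in A R" using R unfolding Z_def by blast
  have meet: "\<exists>r\<in>R. \<exists>s\<in>A. r + a * s \<in> M" if a: "a \<in> A" "a \<notin> R" for a
  proof -
    let ?X = "{r + a * s |r s. r \<in> R \<and> s \<in> A}"
    have id: "ideal_in A ?X" by (rule ideal_in_adjoin) (use A idR a in auto)
    have "R \<subseteq> ?X"
    proof
      fix r assume "r \<in> R"
      then show "r \<in> ?X" using A(3) by (intro CollectI exI[of _ r] exI[of _ 0]) auto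
    qed
    moreover have "a \<in> ?X" using A(4) ideal_inD(2)[OF idR] by (intro CollectI exI[of _ 0] exI[of _ 1]) auto
    ultimately have "?X \<notin> Z" using max[of ?X] a(2) by blast
    then have "?X \<inter> M \<noteq> {}" using id \<open>R \<subseteq> ?X\<close> R unfolding Z_def by blast
    then show ?thesis by blast
  qed
  have "x \<in> R \<or> y \<in> R" if xy: "x \<in> A" "y \<in> A" "x * y \<in> R" for x y
  proof (rule ccontr)
    assume "\<not> ?thesis"
    then obtain r s r' s' where *: "r \<in> R" "s \<in> A" "r + x * s \<in> M" "r' \<in> R" "s' \<in> A" "r' + y * s' \<in> M"
      using meet xy by metis
    have "(r + x * s) * (r' + y * s') = (r' + y * s') * r + ((x * s) * r' + (s * s') * (x * y))"
      by (simp add: algebra_simps)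
    also have "\<dots> \<in> R"
      using * xy A(1,2) ideal_inD(1)[OF idR]
      by (intro ideal_inD(3)[OF idR] ideal_inD(4)[OF idR _ *(1)] ideal_inD(4)[OF idR _ *(4)]
          ideal_inD(4)[OF idR _ xy(3)]) auto
    finally show False using M(2) * R unfolding Z_def by blast
  qed
  with that[of R] R idR show ?thesis unfolding Z_def by blast
qed

locale chart =
  fixes n :: nat and l :: mpoly
  assumes hom_l: "homogeneous n 1 l" and l_nonzero: "l \<noteq> 0"
begin

text \<open>The coordinate ring of the affine chart \<open>l \<noteq> 0\<close>.\<close>

definition A :: "ratfun set" where
  "A = {fr f / fr l ^ k |f k. homogeneous n k f}"

abbreviation scalar :: "complex \<Rightarrow> ratfun" where
  "scalar c \<equiv> fr (const c)"

abbreviation coordinate :: "nat \<Rightarrow> ratfun" where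
  "coordinate j \<equiv> fr (var j) / fr l"

lemma A_I: "homogeneous n k f \<Longrightarrow> fr f / fr l ^ k \<in> A"
  unfolding A_def by blast

lemma A_scalar [simp]: "scalar c \<in> A"
  using A_I[OF homogeneous_const, of c] by simp

lemma A_0 [simp]: "0 \<in> A" and A_1 [simp]: "1 \<in> A"
  using A_scalar[of 0] A_scalar[of 1] by simp_all

lemma A_coordinate: "j \<le> n \<Longrightarrow> coordinate j \<in> A"
  using A_I[OF homogeneous_var] by simp

lemma A_mult: assumes "a \<in> A" "b \<in> A" shows "a * b \<in> A"
proof -
  obtain f k g m where "homogeneous n k f" "a = fr f / fr l ^ k" "homogeneous n m g" "b = fr g / fr l ^ m"
    using assms unfolding A_def by blast
  then show ?thesis
    using A_I[OF homogeneous_mult[of n k f m g]] by (simp add: power_add)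
qed

lemma A_add: assumes "a \<in> A" "b \<in> A" shows "a + b \<in> A"
proof -
  obtain f k g m where *: "homogeneous n k f" "a = fr f / fr l ^ k" "homogeneous n m g" "b = fr g / fr l ^ m"
    using assms unfolding A_def by blast
  have "homogeneous n (k + m) (f * l ^ m + g * l ^ k)"
    using homogeneous_mult[OF *(1) homogeneous_power[OF hom_l, of m]]
      homogeneous_mult[OF *(3) homogeneous_power[OF hom_l, of k]]
    by (intro homogeneous_add) (auto simp: add.commute)
  from A_I[OF this] show ?thesis
    using l_nonzero unfolding *(2,4) by (simp add: power_add field_simps)
qed

lemma A_uminus: "a \<in> A \<Longrightarrow> - a \<in> A"
  using A_mult[OF A_scalar[of "-1"], of a] by simp

lemma A_diff: "a \<in> A \<Longrightarrow> b \<in> A \<Longrightarrow> a - b \<in> A"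
  using A_add[of a "- b"] A_uminus[of b] by simp

lemma A_sum: "(\<And>x. x \<in> X \<Longrightarrow> f x \<in> A) \<Longrightarrow> sum f X \<in> A"
  by (induction X rule: infinite_finite_induct) (auto intro: A_add)

lemma A_prod: "(\<And>x. x \<in> X \<Longrightarrow> f x \<in> A) \<Longrightarrow> prod f X \<in> A"
  by (induction X rule: infinite_finite_induct) (auto intro: A_mult)

lemma A_power: "a \<in> A \<Longrightarrow> a ^ k \<in> A"
  by (induction k) (auto intro: A_mult)

lemma A_local: assumes "a \<in> A" "P \<in> proj_points n" "l \<notin> P" shows "a \<in> local_ring n P"
proof -
  obtain f k where "homogeneous n k f" "a = fr f / fr l ^ k" using assms(1) unfolding A_def by blast
  then show ?thesis
    using homogeneous_power[OF hom_l, of k] point_power_notin[OF assms(2) hom_l assms(3)]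
    by (intro twist_stalkI[of n k f k "l ^ k"]) auto
qed

text \<open>The coordinates generate the chart ring as an algebra, since a form of degree \<open>k\<close> divided by
  \<open>l\<^sup>k\<close> is a polynomial in them.\<close>

lemma A_induct [consumes 1, case_names scalar add coordinate]:
  assumes "a \<in> A"
    and scalar: "\<And>c. Q (scalar c)"
    and add: "\<And>a b. a \<in> A \<Longrightarrow> b \<in> A \<Longrightarrow> Q a \<Longrightarrow> Q b \<Longrightarrow> Q (a + b)"
    and coordinate: "\<And>a j. j \<le> n \<Longrightarrow> a \<in> A \<Longrightarrow> Q a \<Longrightarrow> Q (coordinate j * a)"
  shows "Q a"
proof -
  obtain f k where f: "homogeneous n k f" "a = fr f / fr l ^ k" using assms(1) unfolding A_def by blast
  have single: "fr (Poly_Mapping.single m c) / fr l ^ monom_degree m \<in> A \<and>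
      Q (fr (Poly_Mapping.single m c) / fr l ^ monom_degree m)"
    if "Poly_Mapping.keys m \<subseteq> {..n}" for m c
    using that
  proof (induction m rule: monom_induct)
    case zero
    then show ?case using scalar[of c] A_scalar[of c] by (simp add: const_def)
  next
    case (step i m)
    have eq: "fr (Poly_Mapping.single (Poly_Mapping.single i 1 + m) c)
        / fr l ^ monom_degree (Poly_Mapping.single i 1 + m)
      = coordinate i * (fr (Poly_Mapping.single m c) / fr l ^ monom_degree m)"
      by (simp only: monom_degree_add monom_degree_single power_add fr_hom(4) flip: var_mult_single) simp
    have "i \<le> n" using step(1) by simp
    then show ?case
      unfolding eq using step(3) coordinate[of i] A_mult[OF A_coordinate] by blast
  qed
  have "sum g X \<in> A \<and> Q (sum g X)" if "\<And>x. x \<in> X \<Longrightarrow> g x \<in> A \<and> Q (g x)" for g and X :: "(nat \<Rightarrow>\<^sub>0 nat) set"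
    using that
    by (induction X rule: infinite_finite_induct)
      (use scalar[of 0] in \<open>auto intro: add A_add\<close>)
  from this[of "Poly_Mapping.keys f" "\<lambda>m. fr (Poly_Mapping.single m (Poly_Mapping.lookup f m)) / fr l ^ k"]
  have "Q (\<Sum>m\<in>Poly_Mapping.keys f. fr (Poly_Mapping.single m (Poly_Mapping.lookup f m)) / fr l ^ k)"
    using single f(1) unfolding homogeneous_def coords_iff by metis
  also have "(\<Sum>m\<in>Poly_Mapping.keys f. fr (Poly_Mapping.single m (Poly_Mapping.lookup f m)) / fr l ^ k) = a"
    unfolding f(2) by (simp add: sum_divide_distrib[symmetric] fr_sum[symmetric] poly_expansion[symmetric])
  finally show ?thesis .
qed

lemma A_fraction:
  assumes "q \<in> local_ring n P" "P \<in> proj_points n" "l \<notin> P"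
  obtains a b where "a \<in> A" "b \<in> A" "b \<notin> max_ideal n P" "q = a / b"
proof -
  obtain f g k where q: "homogeneous n k f" "homogeneous n k g" "g \<notin> P" "q = fr f / fr g"
    using assms(1) by (rule local_ringE)
  have "fr g / fr l ^ k \<notin> max_ideal n P"
    using fraction_in_max_ideal_iff[OF assms(2) q(2), of "l ^ k"] q(3)
      homogeneous_power[OF hom_l, of k] point_power_notin[OF assms(2) hom_l assms(3)] by simp
  then show ?thesis
    using that[of "fr f / fr l ^ k" "fr g / fr l ^ k"] A_I q l_nonzero by (simp add: field_simps)
qed

text \<open>Every local ring at a point of the chart is a localisation of the chart ring.\<close>

lemma A_common_denominator:
  assumes P: "P \<in> proj_points n" "l \<notin> P" and "finite X" "\<And>x. x \<in> X \<Longrightarrow> f x \<in> local_ring n P"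
  shows "\<exists>d\<in>A. d \<notin> max_ideal n P \<and> (\<forall>x\<in>X. d * f x \<in> A)"
  using assms(3,4)
proof (induction X)
  case empty
  then show ?case using max_ideal_1[OF P(1)] A_1 by blast
next
  case (insert x X)
  then obtain d where d: "d \<in> A" "d \<notin> max_ideal n P" "\<forall>x\<in>X. d * f x \<in> A" by auto
  have "f x \<in> local_ring n P" using insert by blast
  then obtain a b where ab: "a \<in> A" "b \<in> A" "b \<notin> max_ideal n P" "f x = a / b"
    using A_fraction P by metis
  have b0: "b \<noteq> 0" using ab(3) max_ideal_0[OF P(1)] by auto
  show ?case
  proof (intro bexI[of _ "b * d"] conjI ballI)
    show "b * d \<in> A" using ab d A_mult by blast
    show "b * d \<notin> max_ideal n P"
      using max_ideal_prime[OF P(1)] A_local P ab d by blast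
    fix z assume z: "z \<in> insert x X"
    show "b * d * f z \<in> A"
    proof (cases "z = x")
      case True
      then have "b * d * f z = d * a" using ab b0 by simp
      then show ?thesis using A_mult[OF d(1) ab(1)] by (simp only:)
    next
      case False
      then show ?thesis using A_mult[OF ab(2), of "d * f z"] d z by (simp add: mult.assoc)
    qed
  qed
qed

lemma in_max_ideal_numerator:
  assumes "P \<in> proj_points n" "l \<notin> P" "homogeneous n k f"
  shows "fr f / fr l ^ k \<in> max_ideal n P \<longleftrightarrow> f \<in> P"
  using fraction_in_max_ideal_iff[OF assms(1,3), of "l ^ k"] homogeneous_power[OF hom_l, of k]
    point_power_notin[OF assms(1) hom_l assms(2)] by simp

lemma power_notin_max_ideal:
  assumes P: "P \<in> proj_points n" "l \<notin> P" and y: "y \<in> A" "y \<notin> max_ideal n P"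
  shows "y ^ k \<notin> max_ideal n P"
proof (induction k)
  case (Suc k)
  then show ?case
    using max_ideal_prime[OF P(1) A_local[OF y(1) P] A_local[OF A_power[OF y(1)] P]] y(2) by auto
qed (use max_ideal_1[OF P(1)] in simp)

lemma ideal_max_ideal:
  assumes "P \<in> proj_points n" "l \<notin> P" shows "ideal_in A (A \<inter> max_ideal n P)"
  unfolding ideal_in_def using assms
  by (auto intro: A_add A_mult max_ideal_add max_ideal_smult A_local max_ideal_0)

text \<open>A prime ideal of the coordinate ring of the chart is a point of projective space: the
  homogeneous ideal is spanned by the forms whose dehomogenisation lies in the prime.\<close>

lemma point_of_prime:
  assumes R: "ideal_in A R" "1 \<notin> R"
    and prime: "\<And>x y. x \<in> A \<Longrightarrow> y \<in> A \<Longrightarrow> x * y \<in> R \<Longrightarrow> x \<in> R \<or> y \<in> R"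
  obtains P where "P \<in> proj_points n" "l \<notin> P" "A \<inter> max_ideal n P = R"
proof -
  interpret cring "coord_ring n" by (rule cring_coord_ring)
  let ?d = "\<lambda>k f. fr (homogeneous_component k f) / fr l ^ k"
  define P where "P = {f \<in> coords n. \<forall>k. ?d k f \<in> R}"
  have dA: "?d k f \<in> A" if "f \<in> coords n" for k f
    by (rule A_I) (rule homogeneous_homogeneous_component[OF that])
  have hom_iff: "f \<in> P \<longleftrightarrow> fr f / fr l ^ k \<in> R" if "homogeneous n k f" for f k
  proof -
    have "?d j f = (if j = k then fr f / fr l ^ k else 0)" for j
      using homogeneous_component_homogeneous[OF that, of j] by auto
    then show ?thesis
      using ideal_inD(2)[OF R(1)] homogeneous_coords[OF that] unfolding P_def by auto
  qed
  have sumR: "sum g X \<in> R" if "\<And>x. x \<in> X \<Longrightarrow> g x \<in> R" for g and X :: "nat set"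
    using that by (induction X rule: infinite_finite_induct) (auto intro: ideal_inD[OF R(1)])
  have d_mult: "?d k (f * g) = (\<Sum>i\<le>k. ?d i f * ?d (k - i) g)" if "f \<in> coords n" "g \<in> coords n" for k f g
  proof -
    have "(\<Sum>i\<le>k. ?d i f * ?d (k - i) g) = (\<Sum>i\<le>k. fr (homogeneous_component i f) * fr (homogeneous_component (k - i) g) / fr l ^ k)"
    proof (intro sum.cong refl)
      fix i assume "i \<in> {..k}"
      then have "fr l ^ k = fr l ^ i * fr l ^ (k - i)" by (simp flip: power_add)
      then show "?d i f * ?d (k - i) g = fr (homogeneous_component i f) * fr (homogeneous_component (k - i) g) / fr l ^ k" by simp
    qed
    then show ?thesis
      by (simp add: homogeneous_component_mult[OF that] fr_sum sum_divide_distrib)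
  qed
  have Padd: "f + g \<in> P" if "f \<in> P" "g \<in> P" for f g
    using that ideal_inD(3)[OF R(1)] by (auto simp: P_def homogeneous_component_add add_divide_distrib)
  have Pmult: "g * f \<in> P" if "f \<in> P" "g \<in> coords n" for f g
  proof -
    have "?d k (g * f) \<in> R" for k
      using that dA ideal_inD(4)[OF R(1)] unfolding P_def
      by (subst d_mult) (auto simp del: times_divide_eq_left times_divide_eq_right times_divide_times_eq intro!: sumR)
    then show ?thesis using that unfolding P_def by blast
  qed
  have P0: "0 \<in> P" using ideal_inD(2)[OF R(1)] by (simp add: P_def)
  have Psub: "P \<subseteq> coords n" unfolding P_def by blast
  have id: "ideal P (coord_ring n)"
  proof (rule idealI)
    show "ring (coord_ring n)" by (rule ring_axioms)
    show "subgroup P (add_monoid (coord_ring n))"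
    proof (rule group.subgroupI)
      show "group (add_monoid (coord_ring n))" by (rule a_group)
      fix a assume a: "a \<in> P"
      have "inv\<^bsub>add_monoid (coord_ring n)\<^esub> a = - a"
      proof -
        have "\<ominus>\<^bsub>coord_ring n\<^esub> a = - a"
          by (rule minus_equality) (use a Psub in \<open>auto simp: coord_ring_simps\<close>)
        then show ?thesis by (simp add: a_inv_def)
      qed
      moreover have "- a \<in> P" using Pmult[OF a coords_const[of "-1"]] by simp
      ultimately show "inv\<^bsub>add_monoid (coord_ring n)\<^esub> a \<in> P" by simp
    qed (use Psub P0 Padd in \<open>auto simp: coord_ring_simps\<close>)
    show "\<And>a x. a \<in> P \<Longrightarrow> x \<in> coords n \<Longrightarrow> x \<otimes>\<^bsub>coord_ring n\<^esub> a \<in> P"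
      using Pmult by (simp add: coord_ring_simps)
    show "\<And>a x. a \<in> P \<Longrightarrow> x \<in> coords n \<Longrightarrow> a \<otimes>\<^bsub>coord_ring n\<^esub> x \<in> P"
      using Pmult by (simp add: coord_ring_simps mult.commute)
  qed
  have "1 \<notin> P" using hom_iff[OF homogeneous_1] R(2) by simp
  have prim: "primeideal P (coord_ring n)"
  proof (rule primeidealI[OF id cring_coord_ring])
    show "coords n \<noteq> P" using \<open>1 \<notin> P\<close> coords_1 by blast
    fix f g assume f: "f \<in> coords n" and g: "g \<in> coords n" and "f \<otimes>\<^bsub>coord_ring n\<^esub> g \<in> P"
    then have fg: "f * g \<in> P" by (simp add: coord_ring_simps)
    show "f \<in> P \<or> g \<in> P"
    proof (rule ccontr)
      \<comment> \<open>The product of the lowest components outside the prime is outside the prime.\<close>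
      assume "\<not> ?thesis"
      then have ex: "\<exists>k. ?d k f \<notin> R" "\<exists>k. ?d k g \<notin> R" using f g unfolding P_def by auto
      obtain i j where i: "?d i f \<notin> R" "\<And>i'. i' < i \<Longrightarrow> ?d i' f \<in> R"
        and j: "?d j g \<notin> R" "\<And>j'. j' < j \<Longrightarrow> ?d j' g \<in> R"
        using exists_least_iff[THEN iffD1, OF ex(1)] exists_least_iff[THEN iffD1, OF ex(2)] by blast
      have "?d (i + j) (f * g) \<in> R" using fg unfolding P_def by blast
      also have "?d (i + j) (f * g) = (\<Sum>i'\<le>i+j. ?d i' f * ?d (i + j - i') g)"
        by (rule d_mult[OF f g])
      also have "\<dots> = ?d i f * ?d j g + (\<Sum>i'\<in>{..i+j} - {i}. ?d i' f * ?d (i + j - i') g)"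
        by (subst sum.remove[of _ i]) auto
      finally have sm: "?d i f * ?d j g + (\<Sum>i'\<in>{..i+j} - {i}. ?d i' f * ?d (i + j - i') g) \<in> R" .
      have "(\<Sum>i'\<in>{..i+j} - {i}. ?d i' f * ?d (i + j - i') g) \<in> R"
      proof (rule sumR)
        fix i' assume i': "i' \<in> {..i+j} - {i}"
        show "?d i' f * ?d (i + j - i') g \<in> R"
        proof (cases "i' < i")
          case True
          then show ?thesis
            using ideal_inD(4)[OF R(1) dA[OF g] i(2)] by (simp add: mult.commute)
        next
          case False
          then have "i + j - i' < j" using i' by auto
          then show ?thesis using ideal_inD(4)[OF R(1) dA[OF f] j(2)] by blast
        qed
      qed
      from ideal_inD(3)[OF R(1) sm ideal_inD(4)[OF R(1) A_scalar[of "-1"] this]]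
      have "?d i f * ?d j g \<in> R" by simp
      then show False using prime[OF dA[OF f] dA[OF g]] i j by blast
    qed
  qed
  have "l \<notin> P" using hom_iff[OF hom_l] l_nonzero R(2) by simp
  have gen: "P = Idl\<^bsub>coord_ring n\<^esub> {f \<in> P. \<exists>k. homogeneous n k f}" (is "P = ?I")
  proof
    have sub: "{f \<in> P. \<exists>k. homogeneous n k f} \<subseteq> ?I"
      using Psub by (intro genideal_self) blast
    interpret I: ideal ?I "coord_ring n"
      by (rule genideal_ideal) (use Psub in blast)
    show "P \<subseteq> ?I"
    proof
      fix f assume f: "f \<in> P"
      have comp: "homogeneous_component k f \<in> ?I" for k
      proof -
        have "homogeneous n k (homogeneous_component k f)" using f Psub homogeneous_homogeneous_component by blast
        moreover have "homogeneous_component k f \<in> P"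
          using hom_iff[OF calculation] f unfolding P_def by blast
        ultimately show ?thesis using sub by blast
      qed
      have "sum (\<lambda>k. homogeneous_component k f) X \<in> ?I" if "finite X" for X
        using that
        by (induction X rule: finite_induct) (use comp additive_subgroup.zero_closed[OF I.additive_subgroup_axioms]
            additive_subgroup.a_closed[OF I.additive_subgroup_axioms] in \<open>auto simp: coord_ring_simps\<close>)
      moreover obtain N where "\<And>N'. N \<le> N' \<Longrightarrow> f = (\<Sum>k\<le>N'. homogeneous_component k f)"
        using homogeneous_component_expansion[of f] by blast
      then have "f = (\<Sum>k\<le>N. homogeneous_component k f)" by blast
      ultimately show "f \<in> ?I" using finite_atMost[of N] by (metis (no_types))
    qed
    show "?I \<subseteq> P" by (rule genideal_minimal[OF id]) blast
  qed
  have "0 \<notin> Poly_Mapping.keys l"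
    using hom_l unfolding homogeneous_def by (metis monom_degree_zero zero_neq_one)
  then have "l \<in> irrelevant_ideal n"
    using homogeneous_coords[OF hom_l] by (simp add: irrelevant_ideal_def in_keys_iff)
  then have P: "P \<in> proj_points n"
    using prim gen \<open>l \<notin> P\<close> unfolding proj_points_def by blast
  have "A \<inter> max_ideal n P = R"
  proof -
    have "a \<in> max_ideal n P \<longleftrightarrow> a \<in> R" if a: "a \<in> A" for a
    proof -
      obtain f k where "homogeneous n k f" "a = fr f / fr l ^ k" using a unfolding A_def by blast
      then show ?thesis using in_max_ideal_numerator[OF P \<open>l \<notin> P\<close>] hom_iff by simp
    qed
    then show ?thesis using ideal_inD(1)[OF R(1)] by blast
  qed
  with P \<open>l \<notin> P\<close> that show ?thesis by blast
qed

text \<open>Primes of the chart ring found by Zorn's lemma are needed only in the form of points.\<close>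

lemma exists_point:
  assumes "ideal_in A J" "1 \<in> M" "\<And>x y. x \<in> M \<Longrightarrow> y \<in> M \<Longrightarrow> x * y \<in> M" "J \<inter> M = {}" "M \<subseteq> A"
  obtains P where "P \<in> proj_points n" "l \<notin> P" "J \<subseteq> max_ideal n P" "M \<inter> max_ideal n P = {}"
proof -
  obtain R where R: "ideal_in A R" "J \<subseteq> R" "R \<inter> M = {}"
    "\<And>x y. x \<in> A \<Longrightarrow> y \<in> A \<Longrightarrow> x * y \<in> R \<Longrightarrow> x \<in> R \<or> y \<in> R"
    by (rule exists_prime_avoiding[of A J M])
      (use assms(1-4) A_add A_mult A_0 A_1 in blast)+
  have "1 \<notin> R" using R(3) assms(2) by blast
  obtain P where "P \<in> proj_points n" "l \<notin> P" "A \<inter> max_ideal n P = R"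
    by (rule point_of_prime[OF R(1) \<open>1 \<notin> R\<close> R(4)])
  with that[of P] R assms(5) show ?thesis by blast
qed

lemma adjoin_proper_point:
  assumes "ideal_in A J" "a \<in> A" "1 \<notin> {r + a * s |r s. r \<in> J \<and> s \<in> A}"
  obtains P where "P \<in> proj_points n" "l \<notin> P" "J \<subseteq> max_ideal n P" "a \<in> max_ideal n P"
proof -
  have id: "ideal_in A {r + a * s |r s. r \<in> J \<and> s \<in> A}"
    by (rule ideal_in_adjoin) (use A_add A_mult A_0 assms in auto)
  obtain P where P: "P \<in> proj_points n" "l \<notin> P"
      "{r + a * s |r s. r \<in> J \<and> s \<in> A} \<subseteq> max_ideal n P"
    by (rule exists_point[OF id, of "{1}"]) (use assms(3) A_1 in auto)
  have "r \<in> max_ideal n P" if "r \<in> J" for r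
  proof -
    have "r + a * 0 \<in> {r + a * s |r s. r \<in> J \<and> s \<in> A}" using that A_0 by blast
    then show ?thesis using P(3) by auto
  qed
  moreover have "a \<in> max_ideal n P"
  proof -
    have "0 + a * 1 \<in> {r + a * s |r s. r \<in> J \<and> s \<in> A}"
      using ideal_inD(2)[OF assms(1)] A_1 by blast
    then show ?thesis using P(3) by auto
  qed
  ultimately show ?thesis using that P by blast
qed

text \<open>This takes the place of compactness of the chart: if the admissible denominators of a
  construction form an ideal, and near every point one of them is a unit, then \<open>1\<close> is admissible.\<close>

lemma one_in_ideal:
  assumes "ideal_in A J" "\<And>P. P \<in> proj_points n \<Longrightarrow> l \<notin> P \<Longrightarrow> \<exists>g\<in>J. g \<notin> max_ideal n P"
  shows "1 \<in> J"
proof (rule ccontr)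
  assume "1 \<notin> J"
  then obtain P where "P \<in> proj_points n" "l \<notin> P" "J \<subseteq> max_ideal n P"
    using exists_point[of J "{1}"] assms(1) A_1 by auto
  with assms(2) show False by blast
qed


end

lemma max_ideal_sum:
  "P \<in> proj_points n \<Longrightarrow> (\<And>x. x \<in> X \<Longrightarrow> f x \<in> max_ideal n P) \<Longrightarrow> sum f X \<in> max_ideal n P"
  by (induction X rule: infinite_finite_induct) (auto simp: max_ideal_0 intro: max_ideal_add)

context chart begin

subsection \<open>A point whose coordinate is not algebraic is not closed\<close>

definition eval_at :: "ratfun \<Rightarrow> complex poly \<Rightarrow> ratfun" where
  "eval_at y q = poly (map_poly (\<lambda>c. fr (const c)) q) y"

lemma eval_at_pCons: "eval_at y (pCons c q) = fr (const c) + y * eval_at y q"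
  by (simp add: eval_at_def map_poly_pCons)

lemma eval_at_0 [simp]: "eval_at y 0 = 0"
  by (simp add: eval_at_def)

lemma eval_at_add: "eval_at y (p + q) = eval_at y p + eval_at y q"
  by (induction p q rule: poly_induct2) (simp_all add: eval_at_pCons algebra_simps)

lemma eval_at_smult: "eval_at y (smult c q) = fr (const c) * eval_at y q"
  by (induction q) (simp_all add: eval_at_pCons algebra_simps)

lemma eval_at_mult: "eval_at y (p * q) = eval_at y p * eval_at y q"
  by (induction p) (simp_all add: eval_at_pCons eval_at_add eval_at_smult algebra_simps)

lemma eval_at_1 [simp]: "eval_at y 1 = 1"
  by (simp add: one_pCons eval_at_pCons)

lemma eval_at_sum: "eval_at y (sum f X) = (\<Sum>x\<in>X. eval_at y (f x))"
  by (induction X rule: infinite_finite_induct) (simp_all add: eval_at_add)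

lemma eval_at_prod: "eval_at y (prod f X) = (\<Prod>x\<in>X. eval_at y (f x))"
  by (induction X rule: infinite_finite_induct) (simp_all add: eval_at_mult)

lemma eval_at_in_A: "y \<in> A \<Longrightarrow> eval_at y q \<in> A"
  by (induction q) (simp_all add: eval_at_pCons A_add A_mult)

text \<open>The polynomial splits into linear factors over \<open>\<complex>\<close>, and the prime contains one of them.\<close>

lemma root_in_max_ideal:
  assumes P: "P \<in> proj_points n" "l \<notin> P" and y: "y \<in> A" and "q \<noteq> 0" "eval_at y q \<in> max_ideal n P"
  shows "\<exists>c. y - fr (const c) \<in> max_ideal n P"
  using assms(4,5)
proof (induction "degree q" arbitrary: q)
  case 0
  then obtain a where "q = [:a:]" by (metis degree_eq_zeroE)
  with 0 show ?case using max_ideal_const_iff[OF P(1)] by (auto simp: eval_at_pCons)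
next
  case (Suc d)
  have "\<exists>z. poly q z = 0"
    by (rule fundamental_theorem_of_algebra_alt) (use Suc.hyps(2) in auto)
  then obtain z r where q: "q = [:-z, 1:] * r"
    using poly_eq_0_iff_dvd by (metis dvdE)
  have r: "r \<noteq> 0" "d = degree r"
    using Suc.hyps(2) Suc.prems(1) unfolding q by (auto simp: degree_mult_eq simp del: mult_pCons_left)
  have "eval_at y q = (y - fr (const z)) * eval_at y r"
    unfolding q eval_at_mult by (simp add: eval_at_pCons)
  then have "y - fr (const z) \<in> max_ideal n P \<or> eval_at y r \<in> max_ideal n P"
    using Suc.prems(2) y P by (intro max_ideal_prime[OF P(1)] A_local A_diff eval_at_in_A A_scalar) auto
  then show ?case using Suc.hyps(1)[OF r(2) r(1)] by blast
qed

end

primrec monomials :: "nat \<Rightarrow> nat \<Rightarrow> (nat \<Rightarrow>\<^sub>0 nat) set" where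
  "monomials n 0 = {0}"
| "monomials n (Suc k) = (\<Union>i\<le>n. (\<lambda>m. Poly_Mapping.single i 1 + m) ` monomials n k)"

lemma finite_monomials: "finite (monomials n k)"
  by (induction k) auto

lemma in_monomials: "Poly_Mapping.keys m \<subseteq> {..n} \<Longrightarrow> m \<in> monomials n (monom_degree m)"
proof (induction m rule: monom_induct)
  case (step i m)
  then show ?case by (auto simp: monom_degree_add)
qed simp

global_interpretation ratfun: vector_space "\<lambda>c q. fr (const c) * q"
  by unfold_locales (simp_all add: algebra_simps)

context chart begin

text \<open>If no \<open>y - c\<close> became a non-unit on the locus of the prime, the uncountably many inverses
  would be linearly dependent modulo the prime, because \<open>A\<close> is a countable union of
  finite-dimensional spaces; clearing denominators gives a polynomial relation for \<open>y\<close>.\<close>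

lemma exists_specialisation:
  assumes P: "P \<in> proj_points n" "l \<notin> P" and y: "y \<in> A"
    and nr: "\<And>c. y - scalar c \<notin> max_ideal n P"
  obtains Q c where "Q \<in> proj_points n" "l \<notin> Q" "A \<inter> max_ideal n P \<subseteq> max_ideal n Q"
    "y - scalar c \<in> max_ideal n Q"
proof -
  let ?m = "max_ideal n P"
  have "\<exists>c. 1 \<notin> {r + (y - scalar c) * s |r s. r \<in> A \<inter> ?m \<and> s \<in> A}"
  proof (rule ccontr)
    assume "\<not> ?thesis"
    then have "\<forall>c. \<exists>r s. r \<in> ?m \<and> s \<in> A \<and> 1 = r + (y - scalar c) * s" by blast
    then obtain r z where r: "\<And>c. r c \<in> ?m" and z: "\<And>c. z c \<in> A" and
        rz: "\<And>c. 1 = r c + (y - scalar c) * z c" by metis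
    have inj: "c = d" if "z c = z d" for c d
    proof (rule ccontr)
      assume "c \<noteq> d"
      have "r c + (y - scalar c) * z c = r d + (y - scalar d) * z c"
        using rz[of c] rz[of d] that by metis
      then have eq: "scalar (d - c) * z c = r d - r c" by (simp add: algebra_simps)
      then have "scalar (1 / (d - c)) * (scalar (d - c) * z c) \<in> ?m"
        unfolding eq using r P stalk_const[OF P(1)] by (intro max_ideal_smult max_ideal_diff)
      moreover have "scalar (1 / (d - c)) * (scalar (d - c) * z c) = scalar (1 / (d - c) * (d - c)) * z c"
        unfolding const_hom(4) fr_hom(4) by (simp only: mult.assoc)
      moreover have "1 / (d - c) * (d - c) = 1" using \<open>c \<noteq> d\<close> by simp
      ultimately have "z c \<in> ?m" by (simp only: const_hom(2) fr_hom(2) mult_1)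
      then have "r c + (y - scalar c) * z c \<in> ?m"
        using r P A_local[OF A_diff[OF y A_scalar] P] by (intro max_ideal_add max_ideal_smult)
      with rz[of c] max_ideal_1[OF P(1)] show False by simp
    qed
    \<comment> \<open>Elements of the chart ring with a pole of order at most \<open>k\<close> along \<open>l = 0\<close>; for one \<open>k\<close>,
      infinitely many of the inverses lie in this finite-dimensional space.\<close>
    define Ak where "Ak k = {fr f / fr l ^ k |f. homogeneous n k f}" for k
    have "UNIV = (\<Union>k. {c. z c \<in> Ak k})"
      using z unfolding A_def Ak_def by blast
    then obtain k where k: "infinite {c. z c \<in> Ak k}"
      using uncountable_UNIV_complex countable_UN[of UNIV "\<lambda>k. {c. z c \<in> Ak k}"]
        countable_finite by (metis UNIV_I countableI_type)
    define B where "B = (\<lambda>m. fr (Poly_Mapping.single m 1) / fr l ^ k) ` monomials n k"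
    have AkB: "Ak k \<subseteq> ratfun.span B"
    proof
      fix a assume "a \<in> Ak k"
      then obtain f where f: "homogeneous n k f" "a = fr f / fr l ^ k" unfolding Ak_def by blast
      have "a = (\<Sum>m\<in>Poly_Mapping.keys f. fr (Poly_Mapping.single m (Poly_Mapping.lookup f m)) / fr l ^ k)"
        unfolding f(2) by (simp add: sum_divide_distrib[symmetric] fr_sum[symmetric] poly_expansion[symmetric])
      also have "\<dots> = (\<Sum>m\<in>Poly_Mapping.keys f. scalar (Poly_Mapping.lookup f m) *
          (fr (Poly_Mapping.single m 1) / fr l ^ k))"
        by (simp add: const_mult_single flip: fr_hom(4))
      also have "\<dots> \<in> ratfun.span B"
      proof (intro ratfun.span_sum ratfun.span_scale ratfun.span_base)
        fix m assume "m \<in> Poly_Mapping.keys f"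
        then have "m \<in> monomials n k"
          using f(1) in_monomials[of m n] unfolding homogeneous_def coords_iff by auto
        then show "fr (Poly_Mapping.single m 1) / fr l ^ k \<in> B" unfolding B_def by blast
      qed
      finally show "a \<in> ratfun.span B" .
    qed
    have "infinite (z ` {c. z c \<in> Ak k})"
      using k inj by (subst finite_image_iff) (auto simp: inj_on_def)
    moreover have "finite B" by (simp add: B_def finite_monomials)
    moreover have "z ` {c. z c \<in> Ak k} \<subseteq> ratfun.span B" using AkB by blast
    ultimately have "ratfun.dependent (z ` {c. z c \<in> Ak k})"
      using ratfun.independent_span_bound by blast
    then obtain t u where t: "finite t" "t \<subseteq> z ` {c. z c \<in> Ak k}"
        "(\<Sum>v\<in>t. scalar (u v) * v) = 0" "\<exists>v\<in>t. u v \<noteq> 0"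
      unfolding ratfun.dependent_explicit by blast
    define T where "T = {c. z c \<in> t}"
    have inj_on: "inj_on z T" using inj by (auto simp: inj_on_def)
    have tT: "t = z ` T" using t(2) unfolding T_def by blast
    have T: "finite T" using t(1) inj_on unfolding tT by (simp add: finite_image_iff)
    define lam where "lam c = u (z c)" for c
    have rel: "(\<Sum>c\<in>T. scalar (lam c) * z c) = 0"
      using t(3) unfolding tT lam_def by (subst (asm) sum.reindex[OF inj_on]) simp
    obtain c0 where c0: "c0 \<in> T" "lam c0 \<noteq> 0" using t(4) unfolding tT lam_def by blast
    \<comment> \<open>The linear relation between the inverses of \<open>y - c\<close>, multiplied by \<open>\<Prod>d\<in>T. y - d\<close>.\<close>
    define q where "q = (\<Sum>c\<in>T. smult (lam c) (\<Prod>d\<in>T - {c}. [:-d, 1:]))"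
    have "poly q c0 = (\<Sum>c\<in>T. lam c * (\<Prod>d\<in>T - {c}. c0 - d))"
      by (simp add: q_def poly_sum poly_prod)
    also have "\<dots> = (\<Sum>c\<in>{c0}. lam c * (\<Prod>d\<in>T - {c}. c0 - d))"
      using T c0 by (intro sum.mono_neutral_right) auto
    finally have "poly q c0 \<noteq> 0" using c0 T by auto
    then have "q \<noteq> 0" by auto
    define D where "D c = (\<Prod>d\<in>T - {c}. y - scalar d)" for c
    have DA: "D c \<in> A" for c unfolding D_def using y by (intro A_prod A_diff A_scalar)
    have ev: "eval_at y q = (\<Sum>c\<in>T. scalar (lam c) * D c)"
      by (simp add: q_def D_def eval_at_sum eval_at_smult eval_at_prod eval_at_pCons)
    have "(\<Sum>c\<in>T. scalar (lam c) * (D c * (1 - r c))) =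
        (\<Sum>c\<in>T. (\<Prod>d\<in>T. y - scalar d) * (scalar (lam c) * z c))"
    proof (intro sum.cong refl)
      fix c assume c: "c \<in> T"
      have "(\<Prod>d\<in>T. y - scalar d) = (y - scalar c) * D c"
        unfolding D_def using T c by (simp add: prod.remove)
      moreover have "1 - r c = (y - scalar c) * z c" using rz[of c] by (simp add: algebra_simps)
      ultimately show "scalar (lam c) * (D c * (1 - r c)) = (\<Prod>d\<in>T. y - scalar d) * (scalar (lam c) * z c)"
        by (simp only: mult_ac)
    qed
    also have "\<dots> = 0" using rel by (simp flip: sum_distrib_left)
    finally have "eval_at y q = (\<Sum>c\<in>T. (scalar (lam c) * D c) * r c)"
      unfolding ev by (simp add: algebra_simps sum_subtractf)
    also have "\<dots> \<in> ?m"
    proof -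
      have "(scalar (lam c) * D c) * r c \<in> ?m" for c
        using r DA P by (intro max_ideal_smult A_local A_mult A_scalar)
      then show ?thesis by (rule max_ideal_sum[OF P(1)])
    qed
    finally show False using root_in_max_ideal[OF P y \<open>q \<noteq> 0\<close>] nr by blast
  qed
  then obtain c where c: "1 \<notin> {r + (y - scalar c) * s |r s. r \<in> A \<inter> ?m \<and> s \<in> A}" by blast
  obtain Q where "Q \<in> proj_points n" "l \<notin> Q" "A \<inter> ?m \<subseteq> max_ideal n Q" "y - scalar c \<in> max_ideal n Q"
    by (rule adjoin_proper_point[OF ideal_max_ideal[OF P] A_diff[OF y A_scalar] c])
  then show ?thesis by (rule that)
qed

end

section \<open>Koszul complexes of commuting operators\<close>

definition ksign :: "nat \<Rightarrow> nat set \<Rightarrow> 'm \<Rightarrow> 'm::ab_group_add" where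
  "ksign j S x = (if even (card {i\<in>S. i < j}) then x else - x)"

text \<open>A family \<open>s\<close> assigns a coefficient to each exterior monomial, indexed by a finite set \<open>S\<close>. All
  degrees are treated at once: the differential lowers the cardinality by one, so its component
  at \<open>S\<close> comes from the components at \<open>S\<close> with one more index.\<close>

definition koszul :: "(nat \<Rightarrow> 'm \<Rightarrow> 'm::ab_group_add) \<Rightarrow> nat \<Rightarrow> (nat set \<Rightarrow> 'm) \<Rightarrow> nat set \<Rightarrow> 'm" where
  "koszul X m s S = (\<Sum>j\<in>{1..m} - S. ksign j S (X j (s (insert j S))))"

lemma ksign_0 [simp]: "ksign j S 0 = 0"
  by (simp add: ksign_def)

lemma ksign_add: "ksign j S (x + y) = ksign j S x + ksign j S y"
  by (simp add: ksign_def)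

lemma ksign_uminus: "ksign j S (- x) = - ksign j S x"
  by (simp add: ksign_def)

lemma ksign_sum: "ksign j S (sum f A) = (\<Sum>x\<in>A. ksign j S (f x))"
  by (simp add: ksign_def sum_negf)

lemma ksign_commute: "ksign i S (ksign j T x) = ksign j T (ksign i S x)"
  by (simp add: ksign_def)

lemma ksign_insert:
  assumes "finite S" "i \<notin> S"
  shows "ksign j (insert i S) x = (if i < j then - ksign j S x else ksign j S x)"
proof (cases "i < j")
  case True
  then have "{k \<in> insert i S. k < j} = insert i {k \<in> S. k < j}" by auto
  with assms True show ?thesis by (simp add: ksign_def)
next
  case False
  then have "{k \<in> insert i S. k < j} = {k \<in> S. k < j}" by auto
  with False show ?thesis by (simp add: ksign_def)
qed

locale commuting_operators =
  fixes X :: "nat \<Rightarrow> 'm \<Rightarrow> 'm::ab_group_add"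
  assumes X_add: "X j (x + y) = X j x + X j y"
    and X_commute: "X i (X j x) = X j (X i x)"
begin

lemma X_0 [simp]: "X j 0 = 0"
  using X_add[of j 0 0] by simp

lemma X_uminus: "X j (- x) = - X j x"
  using X_add[of j x "- x"] by (simp add: add_eq_0_iff)

lemma X_sum: "X j (sum f A) = (\<Sum>x\<in>A. X j (f x))"
  by (induction A rule: infinite_finite_induct) (auto simp: X_add)

lemma X_ksign: "X j (ksign i S x) = ksign i S (X j x)"
  by (simp add: ksign_def X_uminus)

lemma koszul_add: "koszul X m (\<lambda>S. s S + t S) S = koszul X m s S + koszul X m t S"
  by (simp add: koszul_def X_add ksign_add sum.distrib)

lemma koszul_cong:
  "(\<And>j. j \<in> {1..m} - S \<Longrightarrow> s (insert j S) = t (insert j S)) \<Longrightarrow> koszul X m s S = koszul X m t S"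
  by (simp add: koszul_def)

text \<open>The terms for the ordered pairs \<open>(i, j)\<close> and \<open>(j, i)\<close> agree up to sign because the operators
  commute, and the signs are opposite.\<close>

lemma koszul_koszul:
  assumes "finite S"
  shows "koszul X m (koszul X m s) S = 0"
proof -
  define J where "J = {1..m} - S"
  define F where "F j i = ksign j S (ksign i (insert j S) (X j (X i (s (insert i (insert j S))))))" for j i
  have anti: "F j i = - F i j" if "j \<in> J" "i \<in> J" "i < j" for i j
    using that assms unfolding F_def J_def
    by (simp add: ksign_insert ksign_uminus X_commute[of j i] insert_commute[of i j] ksign_commute[of j S i S])
  have "koszul X m (koszul X m s) S = (\<Sum>j\<in>J. \<Sum>i\<in>J - {j}. F j i)"
  proof -
    have "{1..m} - insert j S = J - {j}" for j unfolding J_def by auto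
    then show ?thesis
      unfolding koszul_def F_def by (simp add: X_sum ksign_sum X_ksign J_def)
  qed
  also have "\<dots> = (\<Sum>j\<in>J. \<Sum>i\<in>J. (if i < j then F j i else 0) + (if j < i then F j i else 0))"
  proof (rule sum.cong[OF refl])
    fix j assume "j \<in> J"
    then have "(\<Sum>i\<in>J. (if i < j then F j i else 0) + (if j < i then F j i else 0)) =
        (\<Sum>i\<in>J - {j}. (if i < j then F j i else 0) + (if j < i then F j i else 0))"
      by (intro sum.mono_neutral_right) (auto simp: J_def)
    also have "\<dots> = (\<Sum>i\<in>J - {j}. F j i)"
      by (intro sum.cong) auto
    finally show "(\<Sum>i\<in>J - {j}. F j i) =
        (\<Sum>i\<in>J. (if i < j then F j i else 0) + (if j < i then F j i else 0))" by simp
  qed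
  also have "\<dots> = (\<Sum>j\<in>J. \<Sum>i\<in>J. (if i < j then F j i else 0)) + (\<Sum>j\<in>J. \<Sum>i\<in>J. (if j < i then F j i else 0))"
    by (simp add: sum.distrib)
  also have "(\<Sum>j\<in>J. \<Sum>i\<in>J. (if j < i then F j i else 0)) = (\<Sum>i\<in>J. \<Sum>j\<in>J. (if j < i then F j i else 0))"
    by (rule sum.swap)
  also have "\<dots> = - (\<Sum>j\<in>J. \<Sum>i\<in>J. (if i < j then F j i else 0))"
    unfolding sum_negf[symmetric] by (intro sum.cong refl) (use anti in auto)
  finally show ?thesis by simp
qed

text \<open>The minus sign arises because inserting an index \<open>j \<le> m\<close> into \<open>S\<close> reverses \<open>ksign (Suc m) S\<close>.\<close>

lemma koszul_last_operator:
  assumes "S \<subseteq> {1..m}"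
  shows "koszul X m (\<lambda>S. ksign (Suc m) S (X (Suc m) (u S))) S = - ksign (Suc m) S (X (Suc m) (koszul X m u S))"
proof -
  have fin: "finite S" using assms by (rule finite_subset) simp
  have "koszul X m (\<lambda>S. ksign (Suc m) S (X (Suc m) (u S))) S =
      (\<Sum>j\<in>{1..m} - S. - ksign (Suc m) S (X (Suc m) (ksign j S (X j (u (insert j S))))))"
    unfolding koszul_def
  proof (intro sum.cong refl)
    fix j assume j: "j \<in> {1..m} - S"
    then have "ksign (Suc m) (insert j S) x = - ksign (Suc m) S x" for x :: 'm
      using fin by (simp add: ksign_insert)
    then show "ksign j S (X j (ksign (Suc m) (insert j S) (X (Suc m) (u (insert j S))))) =
        - ksign (Suc m) S (X (Suc m) (ksign j S (X j (u (insert j S)))))"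
      by (simp add: X_uminus ksign_uminus X_ksign X_commute[of j "Suc m"] ksign_commute[of j S "Suc m" S])
  qed
  then show ?thesis by (simp add: koszul_def X_sum ksign_sum sum_negf)
qed

text \<open>By this lemma and the next one, the complex of \<open>m + 1\<close> operators is the mapping cone of the
  last operator on the complex of the first \<open>m\<close>.\<close>

lemma koszul_Suc:
  assumes "S \<subseteq> {1..m}"
  shows "koszul X (Suc m) s S = ksign (Suc m) S (X (Suc m) (s (insert (Suc m) S))) + koszul X m s S"
proof -
  have "Suc m \<notin> S" using assms by auto
  then have "{1..Suc m} - S = insert (Suc m) ({1..m} - S)" by auto
  then show ?thesis by (simp add: koszul_def)
qed

lemma koszul_Suc_insert:
  assumes "S \<subseteq> {1..m}"
  shows "koszul X (Suc m) s (insert (Suc m) S) = koszul X m (\<lambda>S. s (insert (Suc m) S)) S"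
proof -
  have "finite S" using assms by (rule finite_subset) simp
  moreover have "Suc m \<notin> S" using assms by auto
  moreover have "{1..Suc m} - insert (Suc m) S = {1..m} - S" by auto
  ultimately show ?thesis
    by (auto simp: koszul_def ksign_insert insert_commute intro!: sum.cong)
qed

text \<open>By induction on the number of operators, along the mapping cone: each operator is injective
  modulo the images of its predecessors. The component of \<open>s\<close> at the empty set has to vanish
  because the homology in degree zero is the cokernel of all operators.\<close>

lemma koszul_exact:
  assumes M: "0 \<in> M" "\<And>x y. x \<in> M \<Longrightarrow> y \<in> M \<Longrightarrow> x + y \<in> M" "\<And>x. x \<in> M \<Longrightarrow> - x \<in> M"
      "\<And>j x. x \<in> M \<Longrightarrow> X j x \<in> M"
    and regular: "\<And>k x r. k < m \<Longrightarrow> x \<in> M \<Longrightarrow> \<forall>j. r j \<in> M \<Longrightarrow> X (Suc k) x = (\<Sum>j\<in>{1..k}. X j (r j)) \<Longrightarrow>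
      \<exists>r'. (\<forall>j. r' j \<in> M) \<and> x = (\<Sum>j\<in>{1..k}. X j (r' j))"
    and s: "\<forall>S. s S \<in> M" "s {} = 0" "\<forall>S\<subseteq>{1..m}. koszul X m s S = 0"
  shows "\<exists>t. (\<forall>S. t S \<in> M) \<and> (\<forall>S\<subseteq>{1..m}. koszul X m t S = s S)"
  using regular s
proof (induction m arbitrary: s)
  case 0
  then show ?case using M(1) by (intro exI[of _ "\<lambda>_. 0"]) (simp add: koszul_def)
next
  case (Suc m)
  have IH: "\<exists>t. (\<forall>S. t S \<in> M) \<and> (\<forall>S\<subseteq>{1..m}. koszul X m t S = u S)"
    if "\<forall>S. u S \<in> M" "u {} = 0" "\<forall>S\<subseteq>{1..m}. koszul X m u S = 0" for u
    using Suc.IH[OF Suc.prems(1)] that by auto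
  \<comment> \<open>In the mapping cone, \<open>u\<close> is the part of \<open>s\<close> that involves the last index. It is a cycle for the
    first \<open>m\<close> operators. Its component of degree zero is a boundary by regularity, the others by
    the induction hypothesis; \<open>t1\<close> combines both preimages.\<close>
  define u where "u S = s (insert (Suc m) S)" for S
  have uM: "\<forall>S. u S \<in> M" using Suc.prems(2) by (simp add: u_def)
  have ku: "koszul X m u S = 0" if S: "S \<subseteq> {1..m}" for S
  proof -
    have "insert (Suc m) S \<subseteq> {1..Suc m}" using S by auto
    then have "koszul X (Suc m) s (insert (Suc m) S) = 0"
      using Suc.prems(4) by blast
    then show ?thesis unfolding koszul_Suc_insert[OF S] u_def .
  qed
  have ks: "ksign (Suc m) S (X (Suc m) (u S)) + koszul X m s S = 0" if S: "S \<subseteq> {1..m}" for S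
  proof -
    have "S \<subseteq> {1..Suc m}" using S by auto
    then have "koszul X (Suc m) s S = 0" using Suc.prems(4) by blast
    then show ?thesis unfolding koszul_Suc[OF S] u_def .
  qed
  have "X (Suc m) (u {}) = (\<Sum>j\<in>{1..m}. X j (- s {j}))"
    using ks[of "{}"] by (simp add: koszul_def ksign_def X_uminus sum_negf eq_neg_iff_add_eq_0)
  then obtain r where r: "\<forall>j. r j \<in> M" "u {} = (\<Sum>j\<in>{1..m}. X j (r j))"
    using Suc.prems(1)[of m "u {}" "\<lambda>j. - s {j}"] uM Suc.prems(2) M(3) by auto
  have "\<exists>t. (\<forall>S. t S \<in> M) \<and> (\<forall>S\<subseteq>{1..m}. koszul X m t S = (if S = {} then 0 else u S))"
    using uM M(1) ku by (intro IH) (auto intro!: trans[OF koszul_cong[of m _ "\<lambda>S. if S = {} then 0 else u S" u]])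
  then obtain t0 where t0: "\<forall>S. t0 S \<in> M"
    "\<And>S. S \<subseteq> {1..m} \<Longrightarrow> koszul X m t0 S = (if S = {} then 0 else u S)" by blast
  define t1 where "t1 S = (if S = {} then 0 else t0 S + (if \<exists>j. S = {j} then r (the_elem S) else 0))" for S
  have t1M: "\<forall>S. t1 S \<in> M" unfolding t1_def using M(1,2) t0 r by auto
  have kt1: "koszul X m t1 S = u S" if S: "S \<subseteq> {1..m}" for S
  proof -
    have "koszul X m t1 S = koszul X m (\<lambda>S. t0 S + (if \<exists>j. S = {j} then r (the_elem S) else 0)) S"
      by (rule koszul_cong) (simp add: t1_def)
    also have "\<dots> = koszul X m t0 S + koszul X m (\<lambda>S. if \<exists>j. S = {j} then r (the_elem S) else 0) S"
      by (rule koszul_add)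
    also have "koszul X m (\<lambda>S. if \<exists>j. S = {j} then r (the_elem S) else 0) S = (if S = {} then u {} else 0)"
    proof (cases "S = {}")
      case True
      then show ?thesis by (simp add: r(2) koszul_def ksign_def)
    next
      case False
      have "koszul X m (\<lambda>S. if \<exists>j. S = {j} then r (the_elem S) else 0) S = koszul X m (\<lambda>_. 0) S"
        by (rule koszul_cong) (use False in auto)
      then show ?thesis using False by (simp add: koszul_def)
    qed
    finally show ?thesis using t0(2)[OF S] by simp
  qed
  \<comment> \<open>Subtracting the boundary of \<open>t1\<close> leaves a cycle \<open>w\<close> for the first \<open>m\<close> operators that
    vanishes at the empty set, to which the induction hypothesis applies.\<close>
  define w where "w S = s S - ksign (Suc m) S (X (Suc m) (t1 S))" for S
  have wM: "\<forall>S. w S \<in> M"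
    using Suc.prems(2) M t1M by (auto simp: w_def ksign_def diff_conv_add_uminus simp del: add_uminus_conv_diff)
  have "\<exists>t. (\<forall>S. t S \<in> M) \<and> (\<forall>S\<subseteq>{1..m}. koszul X m t S = w S)"
  proof (intro IH wM allI impI)
    show "w {} = 0" using Suc.prems(3) by (simp add: w_def t1_def)
    fix S :: "nat set" assume S: "S \<subseteq> {1..m}"
    have "koszul X m w S = koszul X m s S + koszul X m (\<lambda>S. ksign (Suc m) S (X (Suc m) (- t1 S))) S"
      unfolding koszul_add[symmetric] w_def by (simp add: X_uminus ksign_uminus)
    also have "\<dots> = koszul X m s S - ksign (Suc m) S (X (Suc m) (koszul X m (\<lambda>S. - t1 S) S))"
      unfolding koszul_last_operator[OF S] by simp
    also have "koszul X m (\<lambda>S. - t1 S) S = - u S"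
      using kt1[OF S] by (simp add: koszul_def X_uminus ksign_uminus sum_negf)
    finally show "koszul X m w S = 0"
      using ks[OF S] by (simp add: X_uminus ksign_uminus add.commute)
  qed
  then obtain t2 where t2: "\<forall>S. t2 S \<in> M" "\<And>S. S \<subseteq> {1..m} \<Longrightarrow> koszul X m t2 S = w S" by blast
  define t where "t S = (if Suc m \<in> S then t1 (S - {Suc m}) else t2 S)" for S
  have "koszul X (Suc m) t S = s S" if S: "S \<subseteq> {1..Suc m}" for S
  proof (cases "Suc m \<in> S")
    case True
    define S' where "S' = S - {Suc m}"
    have S': "S' \<subseteq> {1..m}" "S = insert (Suc m) S'" "Suc m \<notin> S'" using True S by (auto simp: S'_def)
    have "koszul X (Suc m) t S = koszul X m (\<lambda>S. t (insert (Suc m) S)) S'"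
      unfolding S'(2) by (rule koszul_Suc_insert[OF S'(1)])
    also have "\<dots> = koszul X m t1 S'"
      by (rule koszul_cong) (use S' in \<open>auto simp: t_def\<close>)
    also have "\<dots> = s S" using kt1[OF S'(1)] S'(2) by (simp add: u_def)
    finally show ?thesis .
  next
    case False
    then have S': "S \<subseteq> {1..m}" using S by (auto simp: le_Suc_eq)
    have "koszul X (Suc m) t S = ksign (Suc m) S (X (Suc m) (t1 S)) + koszul X m t S"
      unfolding koszul_Suc[OF S'] using False by (simp add: t_def)
    also have "koszul X m t S = koszul X m t2 S"
      by (rule koszul_cong) (use False in \<open>auto simp: t_def\<close>)
    finally show ?thesis using t2(2)[OF S'] by (simp add: w_def)
  qed
  moreover have "\<forall>S. t S \<in> M" using t1M t2(1) by (simp add: t_def)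
  ultimately show ?case by blast
qed

end

lemma lookup_single_mult_shift:
  "Poly_Mapping.lookup (Poly_Mapping.single a 1 * (p :: mpoly)) (a + m) = Poly_Mapping.lookup p m"
proof -
  have "Poly_Mapping.single a 1 * p =
      Poly_Mapping.single a 1 * (\<Sum>k\<in>Poly_Mapping.keys p. Poly_Mapping.single k (Poly_Mapping.lookup p k))"
    by (simp flip: poly_expansion)
  also have "\<dots> = (\<Sum>k\<in>Poly_Mapping.keys p. Poly_Mapping.single (a + k) (Poly_Mapping.lookup p k))"
    by (simp add: sum_distrib_left mult_single)
  also have "Poly_Mapping.lookup \<dots> (a + m) = (\<Sum>k\<in>Poly_Mapping.keys p. if k = m then Poly_Mapping.lookup p k else 0)"
    unfolding lookup_sum by (intro sum.cong refl) (auto simp: lookup_single when_def)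
  also have "\<dots> = Poly_Mapping.lookup p m"
    by (auto simp: in_keys_iff)
  finally show ?thesis .
qed

section \<open>The Koszul complex of a matrix pencil\<close>

definition act :: "(complex \<Rightarrow> 'a::comm_ring_1) \<Rightarrow> (nat \<Rightarrow> nat \<Rightarrow> nat \<Rightarrow> complex) \<Rightarrow> nat \<Rightarrow> nat
    \<Rightarrow> (nat \<Rightarrow> 'a) \<Rightarrow> nat \<Rightarrow> 'a" where
  "act e B c j s = (\<lambda>v. \<Sum>w<c. e (B j v w) * s w)"

text \<open>The operator \<open>x\<^sub>j - l B\<^sub>j\<close> on vectors of length \<open>c\<close>. The ring, the embedding \<open>e\<close> of the constants,
  the coordinates and \<open>l\<close> are parameters because the same operators occur over the polynomial
  ring, over its field of fractions, and divided by \<open>l\<close>.\<close>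

definition pencil :: "(complex \<Rightarrow> 'a::comm_ring_1) \<Rightarrow> (nat \<Rightarrow> 'a) \<Rightarrow> 'a
    \<Rightarrow> (nat \<Rightarrow> nat \<Rightarrow> nat \<Rightarrow> complex) \<Rightarrow> nat \<Rightarrow> nat \<Rightarrow> (nat \<Rightarrow> 'a) \<Rightarrow> nat \<Rightarrow> 'a" where
  "pencil e x l B c j s = (\<lambda>v. x j * s v - l * act e B c j s v)"

lemma act_add: "act e B c j (s + t) = act e B c j s + act e B c j t"
  by (simp add: act_def fun_eq_iff ring_distribs sum.distrib)

lemma act_scale: "act e B c j (\<lambda>v. q * s v) = (\<lambda>v. q * act e B c j s v)"
  by (simp add: act_def fun_eq_iff sum_distrib_left mult_ac)

lemma pencil_add: "pencil e x l B c j (s + t) = pencil e x l B c j s + pencil e x l B c j t"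
  by (simp add: pencil_def fun_eq_iff act_add algebra_simps)

lemma pencil_scale: "pencil e x l B c j (\<lambda>v. q * s v) = (\<lambda>v. q * pencil e x l B c j s v)"
  by (simp add: pencil_def fun_eq_iff act_scale algebra_simps)

locale commuting_matrices =
  fixes B :: "nat \<Rightarrow> nat \<Rightarrow> nat \<Rightarrow> complex" and c :: nat
  assumes B_zero: "\<not> v < c \<Longrightarrow> B j v w = 0"
    and B_commute: "(\<Sum>u<c. B i v u * B j u w) = (\<Sum>u<c. B j v u * B i u w)"
begin

text \<open>Vectors of length \<open>c\<close> are functions that vanish from \<open>c\<close> on; so they form a subgroup of a
  function type and need no restriction to an index set.\<close>

definition vectors :: "(nat \<Rightarrow> 'a::zero) set" where
  "vectors = {s. \<forall>v\<ge>c. s v = 0}"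

lemma vectors_closed:
  "(0 :: nat \<Rightarrow> 'a::ab_group_add) \<in> vectors"
  "x \<in> vectors \<Longrightarrow> y \<in> vectors \<Longrightarrow> x + y \<in> (vectors :: (nat \<Rightarrow> 'a) set)"
  "x \<in> vectors \<Longrightarrow> - x \<in> (vectors :: (nat \<Rightarrow> 'a) set)"
  by (auto simp: vectors_def)

context
  fixes e :: "complex \<Rightarrow> 'a::comm_ring_1"
  assumes e_hom: "e 0 = 0" "e (a + b) = e a + e b" "e (a * b) = e a * e b"
begin

lemma e_sum: "e (sum f A) = (\<Sum>x\<in>A. e (f x))"
  by (induction A rule: infinite_finite_induct) (auto simp: e_hom)

lemma act_act: "act e B c i (act e B c j s) = (\<lambda>v. \<Sum>w<c. e (\<Sum>u<c. B i v u * B j u w) * s w)"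
proof
  fix v
  have "act e B c i (act e B c j s) v = (\<Sum>u<c. \<Sum>w<c. e (B i v u) * e (B j u w) * s w)"
    by (simp add: act_def sum_distrib_left mult.assoc)
  also have "\<dots> = (\<Sum>w<c. \<Sum>u<c. e (B i v u) * e (B j u w) * s w)"
    by (rule sum.swap)
  also have "\<dots> = (\<Sum>w<c. e (\<Sum>u<c. B i v u * B j u w) * s w)"
    by (simp add: e_sum e_hom sum_distrib_right)
  finally show "act e B c i (act e B c j s) v = (\<Sum>w<c. e (\<Sum>u<c. B i v u * B j u w) * s w)" .
qed

lemma act_commute: "act e B c i (act e B c j s) = act e B c j (act e B c i s)"
  unfolding act_act by (simp only: B_commute[of i])

lemma act_vectors: "act e B c j s \<in> vectors"
  by (simp add: act_def vectors_def B_zero e_hom)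

lemma act_diff: "act e B c j (s - t) = act e B c j s - act e B c j t"
  by (simp add: act_def fun_eq_iff ring_distribs sum_subtractf)

lemma act_pencil: "act e B c i (pencil e x l B c j s) = pencil e x l B c j (act e B c i s)"
proof -
  have "pencil e x l B c j s = (\<lambda>v. x j * s v) - (\<lambda>v. l * act e B c j s v)" for s
    by (simp add: pencil_def fun_eq_iff)
  then show ?thesis by (simp add: act_diff act_scale act_commute[of i])
qed

lemma commuting_pencil: "commuting_operators (pencil e x l B c)"
proof
  fix i j and s t :: "nat \<Rightarrow> 'a"
  show "pencil e x l B c j (s + t) = pencil e x l B c j s + pencil e x l B c j t" by (rule pencil_add)
  have eq: "pencil e x l B c i (pencil e x l B c j s) v =
     x i * (x j * s v - l * act e B c j s v) - l * (x j * act e B c i s v - l * act e B c j (act e B c i s) v)"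
    for i j v
    by (subst pencil_def, subst act_pencil) (simp add: pencil_def)
  show "pencil e x l B c i (pencil e x l B c j s) = pencil e x l B c j (pencil e x l B c i s)"
    unfolding fun_eq_iff eq act_commute[of j i s] by (simp add: algebra_simps)
qed

lemma pencil_vectors: "s \<in> vectors \<Longrightarrow> pencil e x l B c j s \<in> vectors"
  using act_vectors[of j s] by (simp add: pencil_def vectors_def)

end

lemma const_e_hom: "const 0 = 0" "const (a + b) = const a + const b" "const (a * b) = const a * const b"
  by simp_all

subsection \<open>Substituting a matrix for a variable\<close>

text \<open>\<open>E j\<close> replaces the variable \<open>x\<^sub>j\<close> by the operator \<open>x\<^sub>0 B\<^sub>j\<close>. It is a projection whose
  kernel is the image of the pencil \<open>x\<^sub>j - x\<^sub>0 B\<^sub>j\<close>.\<close>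

primrec matrix_power :: "nat \<Rightarrow> nat \<Rightarrow> nat \<Rightarrow> nat \<Rightarrow> complex" where
  "matrix_power j 0 v w = (if v = w then 1 else 0)"
| "matrix_power j (Suc k) v w = (\<Sum>u<c. B j v u * matrix_power j k u w)"

lemma matrix_power_commute:
  assumes "v < c" "w < c"
  shows "(\<Sum>u<c. matrix_power j k v u * B i u w) = (\<Sum>u<c. B i v u * matrix_power j k u w)"
  using assms
proof (induction k arbitrary: v)
  case 0
  then show ?case by (simp add: if_distrib[of "\<lambda>x. x * _"] if_distrib[of "\<lambda>x. _ * x"] sum.delta cong: if_cong)
next
  case (Suc k)
  have "(\<Sum>u<c. matrix_power j (Suc k) v u * B i u w)
      = (\<Sum>u<c. \<Sum>t<c. B j v t * (matrix_power j k t u * B i u w))"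
    by (simp add: sum_distrib_right mult.assoc)
  also have "\<dots> = (\<Sum>t<c. B j v t * (\<Sum>u<c. matrix_power j k t u * B i u w))"
    by (subst sum.swap) (simp add: sum_distrib_left)
  also have "\<dots> = (\<Sum>t<c. B j v t * (\<Sum>u<c. B i t u * matrix_power j k u w))"
    using Suc by simp
  also have "\<dots> = (\<Sum>u<c. (\<Sum>t<c. B j v t * B i t u) * matrix_power j k u w)"
    by (simp add: sum_distrib_left sum_distrib_right mult.assoc) (rule sum.swap)
  also have "\<dots> = (\<Sum>u<c. (\<Sum>t<c. B i v t * B j t u) * matrix_power j k u w)"
    by (simp only: B_commute[of i])
  also have "\<dots> = (\<Sum>t<c. B i v t * (\<Sum>u<c. B j t u * matrix_power j k u w))"
    by (simp add: sum_distrib_left sum_distrib_right mult.assoc) (rule sum.swap)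
  finally show ?case by simp
qed

text \<open>The monomial in which \<open>x\<^sub>j\<close> has been replaced by \<open>x\<^sub>0\<close>.\<close>

definition shift :: "nat \<Rightarrow> (nat \<Rightarrow>\<^sub>0 nat) \<Rightarrow> (nat \<Rightarrow>\<^sub>0 nat)" where
  "shift j m = m - Poly_Mapping.single j (Poly_Mapping.lookup m j) + Poly_Mapping.single 0 (Poly_Mapping.lookup m j)"

lemma shift_same: "0 < j \<Longrightarrow> shift j (Poly_Mapping.single j 1 + m) = Poly_Mapping.single 0 1 + shift j m"
  by (rule poly_mapping_eqI) (auto simp: shift_def lookup_add lookup_minus lookup_single when_def)

lemma shift_other: "i \<noteq> j \<Longrightarrow> shift j (Poly_Mapping.single i 1 + m) = Poly_Mapping.single i 1 + shift j m"
  by (rule poly_mapping_eqI) (auto simp: shift_def lookup_add lookup_minus lookup_single when_def)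

text \<open>The entry at \<open>(v, w)\<close> of the matrix that results from the monomial \<open>m\<close> by substituting \<open>x\<^sub>0 B\<^sub>j\<close>
  for \<open>x\<^sub>j\<close>.\<close>

definition kernel_entry :: "nat \<Rightarrow> nat \<Rightarrow> nat \<Rightarrow> (nat \<Rightarrow>\<^sub>0 nat) \<Rightarrow> mpoly" where
  "kernel_entry j v w m = const (matrix_power j (Poly_Mapping.lookup m j) v w) * Poly_Mapping.single (shift j m) 1"

definition E :: "nat \<Rightarrow> (nat \<Rightarrow> mpoly) \<Rightarrow> nat \<Rightarrow> mpoly" where
  "E j s = (\<lambda>v. if v < c then \<Sum>w<c. linear_extension (kernel_entry j v w) (s w) else 0)"

lemma E_add: "E j (s + t) = E j s + E j t"
  by (simp add: E_def fun_eq_iff linear_extension_add sum.distrib)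

lemma E_0 [simp]: "E j 0 = 0"
  by (simp add: E_def fun_eq_iff)

lemma E_diff: "E j (s - t) = E j s - E j t"
  using E_add[of j "s - t" t] by simp

lemma kernel_entry_same:
  assumes "0 < j"
  shows "kernel_entry j v w (Poly_Mapping.single j 1 + m) =
    var 0 * (\<Sum>u<c. const (B j v u) * kernel_entry j u w m)"
proof -
  have "Poly_Mapping.lookup (Poly_Mapping.single j 1 + m) j = Suc (Poly_Mapping.lookup m j)"
    by (simp add: lookup_add)
  then have "kernel_entry j v w (Poly_Mapping.single j 1 + m) =
     (\<Sum>u<c. const (B j v u) * const (matrix_power j (Poly_Mapping.lookup m j) u w)) *
       (var 0 * Poly_Mapping.single (shift j m) 1)"
    unfolding kernel_entry_def shift_same[OF assms] var_mult_single by (simp add: const_sum)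
  then show ?thesis
    by (simp add: kernel_entry_def sum_distrib_left sum_distrib_right mult_ac)
qed

lemma kernel_entry_other:
  assumes "i \<noteq> j"
  shows "kernel_entry j v w (Poly_Mapping.single i 1 + m) = var i * kernel_entry j v w m"
proof -
  have "Poly_Mapping.lookup (Poly_Mapping.single i 1 + m) j = Poly_Mapping.lookup m j"
    using assms by (simp add: lookup_add lookup_single)
  then show ?thesis
    unfolding kernel_entry_def shift_other[OF assms] var_mult_single[symmetric]
    by (simp only: mult.left_commute)
qed

lemma E_var_other: "i \<noteq> j \<Longrightarrow> E j (\<lambda>v. var i * s v) = (\<lambda>v. var i * E j s v)"
  by (simp add: E_def fun_eq_iff linear_extension_var_mult kernel_entry_other[unfolded One_nat_def]
      linear_extension_scale sum_distrib_left)

lemma E_var_same: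
  assumes "0 < j"
  shows "E j (\<lambda>v. var j * s v) = (\<lambda>v. var 0 * act const B c j (E j s) v)"
proof
  fix v
  show "E j (\<lambda>v. var j * s v) v = var 0 * act const B c j (E j s) v"
  proof (cases "v < c")
    case True
    have "E j (\<lambda>v. var j * s v) v =
        (\<Sum>w<c. linear_extension (\<lambda>m. var 0 * (\<Sum>u<c. const (B j v u) * kernel_entry j u w m)) (s w))"
      using True by (simp add: E_def linear_extension_var_mult kernel_entry_same[unfolded One_nat_def, OF assms])
    also have "\<dots> = var 0 * (\<Sum>w<c. \<Sum>u<c. const (B j v u) * linear_extension (kernel_entry j u w) (s w))"
      by (simp add: linear_extension_scale linear_extension_fun_sum sum_distrib_left)
    also have "(\<Sum>w<c. \<Sum>u<c. const (B j v u) * linear_extension (kernel_entry j u w) (s w)) =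
        (\<Sum>u<c. \<Sum>w<c. const (B j v u) * linear_extension (kernel_entry j u w) (s w))"
      by (rule sum.swap)
    also have "\<dots> = act const B c j (E j s) v"
      by (simp add: act_def E_def sum_distrib_left)
    finally show ?thesis .
  next
    case False
    then show ?thesis by (simp add: E_def act_def B_zero)
  qed
qed

lemma E_act: "E j (act const B c i s) = act const B c i (E j s)"
proof
  fix v
  show "E j (act const B c i s) v = act const B c i (E j s) v"
  proof (cases "v < c")
    case True
    have "E j (act const B c i s) v =
        (\<Sum>w<c. \<Sum>u<c. linear_extension (\<lambda>m. const (B i w u) * kernel_entry j v w m) (s u))"
      using True
      by (simp add: E_def act_def linear_extension_sum linear_extension_const_mult linear_extension_scale
          cong: sum.cong)
    also have "\<dots> = (\<Sum>u<c. linear_extension (\<lambda>m. \<Sum>w<c. const (B i w u) * kernel_entry j v w m) (s u))"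
      by (subst sum.swap) (simp add: linear_extension_fun_sum)
    also have "\<dots> = (\<Sum>u<c. linear_extension (\<lambda>m. \<Sum>w<c. const (B i v w) * kernel_entry j w u m) (s u))"
    proof (rule sum.cong[OF refl], rule arg_cong2[where f = linear_extension, OF _ refl], rule ext)
      fix u m assume u: "u \<in> {..<c}"
      have "(\<Sum>w<c. const (B i w u) * kernel_entry j v w m) =
          const (\<Sum>w<c. matrix_power j (Poly_Mapping.lookup m j) v w * B i w u) * Poly_Mapping.single (shift j m) 1"
        by (simp add: kernel_entry_def const_sum sum_distrib_left sum_distrib_right mult_ac)
      also have "\<dots> = const (\<Sum>w<c. B i v w * matrix_power j (Poly_Mapping.lookup m j) w u) * Poly_Mapping.single (shift j m) 1"
        using True u by (simp only: matrix_power_commute lessThan_iff)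
      also have "\<dots> = (\<Sum>w<c. const (B i v w) * kernel_entry j w u m)"
        by (simp add: kernel_entry_def const_sum sum_distrib_left sum_distrib_right mult_ac)
      finally show "(\<Sum>w<c. const (B i w u) * kernel_entry j v w m) = (\<Sum>w<c. const (B i v w) * kernel_entry j w u m)" .
    qed
    also have "\<dots> = (\<Sum>w<c. \<Sum>u<c. const (B i v w) * linear_extension (kernel_entry j w u) (s u))"
      by (simp add: linear_extension_fun_sum linear_extension_scale) (rule sum.swap)
    also have "\<dots> = act const B c i (E j s) v"
      by (simp add: act_def E_def sum_distrib_left)
    finally show ?thesis .
  next
    case False
    then show ?thesis by (simp add: E_def act_def B_zero)
  qed
qed

abbreviation Y :: "nat \<Rightarrow> (nat \<Rightarrow> mpoly) \<Rightarrow> nat \<Rightarrow> mpoly" where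
  "Y \<equiv> pencil const var (var 0) B c"

lemma Y_eq: "Y j s = (\<lambda>v. var j * s v) - (\<lambda>v. var 0 * act const B c j s v)"
  by (simp add: pencil_def fun_eq_iff)

interpretation Y: commuting_operators Y
  by (rule commuting_pencil) simp_all

lemma E_Y_same: "0 < j \<Longrightarrow> E j (Y j s) = 0"
  by (simp add: Y_eq E_diff E_var_same E_var_other E_act)

lemma E_Y_other: "0 < j \<Longrightarrow> i \<noteq> j \<Longrightarrow> E j (Y i s) = Y i (E j s)"
  by (simp add: Y_eq E_diff E_var_other E_act)

lemma Y_scale: "Y j (\<lambda>v. q * s v) = (\<lambda>v. q * Y j s v)"
  by (rule pencil_scale)

text \<open>The substitution changes a vector only by an element of the image of \<open>Y\<^sub>j\<close>: constant vectors
  are fixed, and the property is inherited by products with a variable, since \<open>x\<^sub>j\<close> and \<open>x\<^sub>0 B\<^sub>j\<close> act in the same way modulo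
  that image.\<close>

lemma E_complement:
  assumes j: "0 < j" and s: "s \<in> vectors"
  shows "\<exists>r\<in>vectors. s - E j s = Y j r"
proof -
  define W where "W = {s. \<exists>r\<in>vectors. s - E j s = Y j r}"
  define unit where "unit v p = (\<lambda>w. if w = v then p else (0::mpoly))" for v :: nat and p
  have W_add: "s + t \<in> W" if st: "s \<in> W" "t \<in> W" for s t
  proof -
    obtain r r' where r: "r \<in> vectors" "s - E j s = Y j r" "r' \<in> vectors" "t - E j t = Y j r'"
      using st unfolding W_def by blast
    have "s + t - E j (s + t) = (s - E j s) + (t - E j t)" by (simp add: E_add)
    also have "\<dots> = Y j (r + r')" by (simp only: r(2,4) Y.X_add)
    finally show ?thesis using vectors_closed(2)[OF r(1,3)] unfolding W_def by blast
  qed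
  have W_var: "(\<lambda>v. var i * s v) \<in> W" if s: "s \<in> W" for s i
  proof -
    obtain r where r: "r \<in> vectors" "s - E j s = Y j r" using s unfolding W_def by blast
    have s_eq: "s = E j s + Y j r" using r(2) by (simp add: algebra_simps)
    show ?thesis
    proof (cases "i = j")
      case False
      have "(\<lambda>v. var i * s v) - E j (\<lambda>v. var i * s v) = (\<lambda>v. var i * (s - E j s) v)"
        using False by (simp add: E_var_other fun_eq_iff algebra_simps)
      also have "\<dots> = Y j (\<lambda>v. var i * r v)" unfolding r(2) Y_scale ..
      finally have "(\<lambda>v. var i * s v) - E j (\<lambda>v. var i * s v) = Y j (\<lambda>v. var i * r v)" .
      moreover have "(\<lambda>v. var i * r v) \<in> vectors" using r(1) by (simp add: vectors_def)
      ultimately show ?thesis unfolding W_def by blast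
    next
      case True
      have "act const B c j (E j s) = act const B c j s - Y j (act const B c j r)"
        by (subst (2) s_eq) (simp add: act_add act_pencil)
      then have "(\<lambda>v. var j * s v) - E j (\<lambda>v. var j * s v) =
          (\<lambda>v. var j * s v) - (\<lambda>v. var 0 * (act const B c j s - Y j (act const B c j r)) v)"
        using j by (simp add: E_var_same)
      also have "\<dots> = Y j s + (\<lambda>v. var 0 * Y j (act const B c j r) v)"
        by (simp add: fun_eq_iff Y_eq algebra_simps)
      also have "\<dots> = Y j (s + (\<lambda>v. var 0 * act const B c j r v))"
        by (simp add: Y.X_add Y_scale)
      finally have eq: "(\<lambda>v. var j * s v) - E j (\<lambda>v. var j * s v) = Y j (s + (\<lambda>v. var 0 * act const B c j r v))" .
      have "s \<in> vectors"
        using pencil_vectors[OF const_e_hom r(1)] s_eq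
        by (subst s_eq, intro vectors_closed(2)) (auto simp: E_def vectors_def)
      moreover have "(\<lambda>v. var 0 * act const B c j r v) \<in> vectors"
        using act_vectors[OF const_e_hom] by (simp add: vectors_def)
      ultimately have "s + (\<lambda>v. var 0 * act const B c j r v) \<in> vectors" by (rule vectors_closed(2))
      with eq show ?thesis unfolding W_def True by blast
    qed
  qed
  have W_0: "0 \<in> W"
    unfolding W_def by (auto intro!: bexI[of _ 0] simp: vectors_closed)
  have W_unit: "unit v p \<in> W" if "v < c" for v p
  proof (induction p rule: mpoly_induct)
    case (add p q)
    have eq: "unit v (p + q) = unit v p + unit v q" by (simp add: unit_def fun_eq_iff)
    show ?case unfolding eq by (rule W_add[OF add])
  next
    case (const a)
    have "E j (unit v (const a)) = unit v (const a)"
    proof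
      fix u
      have "E j (unit v (const a)) u = (if u < c then \<Sum>w<c. if w = v then linear_extension (kernel_entry j u w) (const a) else 0 else 0)"
        unfolding E_def unit_def
        by (intro if_cong sum.cong refl) (simp add: if_distrib[of "linear_extension _"])
      also have "\<dots> = (if u < c then linear_extension (kernel_entry j u v) (const a) else 0)"
        using that by simp
      also have "\<dots> = unit v (const a) u"
        using that by (auto simp: linear_extension_const kernel_entry_def shift_def unit_def)
      finally show "E j (unit v (const a)) u = unit v (const a) u" .
    qed
    then show ?case unfolding W_def by (auto intro!: bexI[of _ 0] simp: vectors_closed)
  next
    case (var i p)
    have eq: "unit v (var i * p) = (\<lambda>w. var i * unit v p w)" by (simp add: unit_def fun_eq_iff)
    show ?case unfolding eq by (rule W_var[OF var])
  qed
  have sum_W: "(\<Sum>v\<in>A. unit v (s v)) \<in> W" if "A \<subseteq> {..<c}" for A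
    using finite_subset[OF that finite_lessThan] that
  proof (induction A rule: finite_induct)
    case empty
    show ?case unfolding sum.empty by (rule W_0)
  next
    case (insert v A)
    then show ?case unfolding sum.insert[OF insert(1,2)] by (intro W_add W_unit) auto
  qed
  have sum_s: "(\<Sum>v<c. unit v (s v)) = s"
  proof
    fix u
    have ap: "(\<Sum>v\<in>A. unit v (s v)) u = (\<Sum>v\<in>A. unit v (s v) u)" for A
      by (induction A rule: infinite_finite_induct) auto
    show "(\<Sum>v<c. unit v (s v)) u = s u"
      using s unfolding ap by (auto simp: unit_def vectors_def)
  qed
  have "s \<in> W" using sum_W[OF subset_refl] unfolding sum_s .
  then show ?thesis unfolding W_def by blast
qed

text \<open>A monomial of \<open>s\<close> with the largest exponent of \<open>x\<^sub>j\<close> yields, after multiplication by \<open>x\<^sub>j\<close>, a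
  monomial that \<open>x\<^sub>0 B\<^sub>j s\<close> does not have.\<close>

lemma Y_injective:
  assumes j: "0 < j" and s: "s \<in> vectors" "Y j s = 0"
  shows "s = 0"
proof (rule ccontr)
  assume "s \<noteq> 0"
  define D where "D = (\<Union>v<c. Poly_Mapping.keys (s v))"
  have "D \<noteq> {}"
  proof
    assume "D = {}"
    then have "s v = 0" if "v < c" for v using that by (auto simp: D_def)
    then have "s = 0" using s(1) by (auto simp: vectors_def fun_eq_iff not_less[symmetric])
    with \<open>s \<noteq> 0\<close> show False ..
  qed
  moreover have "finite D" by (simp add: D_def)
  ultimately have "Max ((\<lambda>m. Poly_Mapping.lookup m j) ` D) \<in> (\<lambda>m. Poly_Mapping.lookup m j) ` D"
    by (intro Max_in) auto
  then obtain m where m: "m \<in> D" "Max ((\<lambda>m. Poly_Mapping.lookup m j) ` D) = Poly_Mapping.lookup m j" by blast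
  have max: "Poly_Mapping.lookup m' j \<le> Poly_Mapping.lookup m j" if "m' \<in> D" for m'
    unfolding m(2)[symmetric] using that \<open>finite D\<close> by (intro Max_ge) auto
  obtain v where v: "v < c" "m \<in> Poly_Mapping.keys (s v)" using m(1) unfolding D_def by blast
  have "var j * s v = var 0 * act const B c j s v"
    using fun_cong[OF s(2), of v] by (simp add: pencil_def)
  also have "\<dots> = (\<Sum>w<c. (var 0 * const (B j v w)) * s w)"
    by (simp add: act_def sum_distrib_left mult.assoc)
  also have "Poly_Mapping.lookup \<dots> (Poly_Mapping.single j 1 + m) = 0"
    unfolding lookup_sum
  proof (intro sum.neutral ballI)
    fix w assume w: "w \<in> {..<c}"
    have eq: "var 0 * const (B j v w) = Poly_Mapping.single (Poly_Mapping.single 0 1) (B j v w)"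
      by (simp add: var_def const_def mult_single)
    have "Poly_Mapping.single j 1 + m \<notin> Poly_Mapping.keys (var 0 * const (B j v w) * s w)"
    proof
      assume "Poly_Mapping.single j 1 + m \<in> Poly_Mapping.keys (var 0 * const (B j v w) * s w)"
      then obtain m' where m': "Poly_Mapping.single j 1 + m = Poly_Mapping.single 0 1 + m'"
          "m' \<in> Poly_Mapping.keys (s w)"
        unfolding eq using keys_mult[of "Poly_Mapping.single (Poly_Mapping.single 0 1) (B j v w)" "s w"]
        by (auto split: if_splits)
      have "Poly_Mapping.lookup (Poly_Mapping.single j 1 + m) j = Poly_Mapping.lookup m' j"
        unfolding m'(1) using j by (simp add: lookup_add lookup_single)
      then show False using max[of m'] m'(2) w unfolding D_def by (auto simp: lookup_add)
    qed
    then show "Poly_Mapping.lookup (var 0 * const (B j v w) * s w) (Poly_Mapping.single j 1 + m) = 0"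
      by (simp add: in_keys_iff)
  qed
  finally have "Poly_Mapping.lookup (var j * s v) (Poly_Mapping.single j 1 + m) = 0" .
  moreover have "Poly_Mapping.lookup (var j * s v) (Poly_Mapping.single j 1 + m) = Poly_Mapping.lookup (s v) m"
    unfolding var_def by (rule lookup_single_mult_shift)
  ultimately show False using v(2) by (simp add: in_keys_iff)
qed

text \<open>The substitutions for \<open>x\<^sub>1, \<dots>, x\<^sub>m\<close> one after another: a projection whose kernel
  is the sum of the images of \<open>Y\<^sub>1, \<dots>, Y\<^sub>m\<close> and that commutes with the later operators.\<close>

primrec eliminate :: "nat \<Rightarrow> (nat \<Rightarrow> mpoly) \<Rightarrow> nat \<Rightarrow> mpoly" where
  "eliminate 0 s = s"
| "eliminate (Suc m) s = E (Suc m) (eliminate m s)"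

lemma eliminate_Y_later: "m < i \<Longrightarrow> eliminate m (Y i s) = Y i (eliminate m s)"
  by (induction m) (auto simp: E_Y_other)

lemma eliminate_0: "eliminate m 0 = 0"
  by (induction m) (simp_all only: eliminate.simps E_0)

lemma eliminate_Y_earlier: "1 \<le> j \<Longrightarrow> j \<le> m \<Longrightarrow> eliminate m (Y j s) = 0"
proof (induction m)
  case (Suc m)
  show ?case
  proof (cases "j = Suc m")
    case True
    then show ?thesis by (simp only: eliminate.simps eliminate_Y_later[OF lessI] E_Y_same[OF zero_less_Suc])
  next
    case False
    then have "j \<le> m" using Suc.prems(2) by simp
    with Suc.prems(1) have "eliminate m (Y j s) = 0" by (rule Suc.IH)
    then show ?thesis by (simp only: eliminate.simps E_0)
  qed
qed simp

lemma eliminate_add: "eliminate m (s + t) = eliminate m s + eliminate m t"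
  by (induction m) (simp_all only: eliminate.simps E_add)

lemma eliminate_sum: "eliminate m (sum f A) = (\<Sum>x\<in>A. eliminate m (f x))"
  by (induction A rule: infinite_finite_induct)
    (simp_all only: sum.infinite sum.empty sum.insert eliminate_add eliminate_0 simp_thms not_False_eq_True)

lemma eliminate_vectors: "s \<in> vectors \<Longrightarrow> eliminate m s \<in> vectors"
  by (cases m) (auto simp: E_def vectors_def)

lemma eliminate_complement:
  "s \<in> vectors \<Longrightarrow> \<exists>r. (\<forall>j. r j \<in> vectors) \<and> s - eliminate m s = (\<Sum>j\<in>{1..m}. Y j (r j))"
proof (induction m)
  case 0
  then show ?case by (intro exI[of _ "\<lambda>_. 0"]) (simp add: vectors_def)
next
  case (Suc m)
  then obtain r where r: "\<forall>j. r j \<in> vectors" "s - eliminate m s = (\<Sum>j\<in>{1..m}. Y j (r j))" by blast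
  obtain r' where r': "r' \<in> vectors" "eliminate m s - E (Suc m) (eliminate m s) = Y (Suc m) r'"
    using E_complement[of "Suc m" "eliminate m s"] eliminate_vectors[OF Suc.prems] by auto
  have "s - eliminate (Suc m) s = (s - eliminate m s) + (eliminate m s - E (Suc m) (eliminate m s))"
    by simp
  also have "\<dots> = (\<Sum>j\<in>{1..Suc m}. Y j ((r(Suc m := r')) j))"
    unfolding r(2) r'(2) by (subst sum.nat_ivl_Suc') (auto simp: add.commute intro!: sum.cong)
  finally show ?case using r(1) r'(1) by (intro exI[of _ "r(Suc m := r')"]) auto
qed

text \<open>Elimination turns the equation into \<open>Y\<^sub>k\<^sub>+\<^sub>1 (eliminate k s) = 0\<close>, so \<open>s\<close> lies in the kernel of
  the elimination by injectivity of \<open>Y\<^sub>k\<^sub>+\<^sub>1\<close>.\<close>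

lemma Y_regular:
  assumes s: "s \<in> vectors" and eq: "Y (Suc k) s = (\<Sum>j\<in>{1..k}. Y j (r j))"
  shows "\<exists>r'. (\<forall>j. r' j \<in> vectors) \<and> s = (\<Sum>j\<in>{1..k}. Y j (r' j))"
proof -
  have "Y (Suc k) (eliminate k s) = eliminate k (\<Sum>j\<in>{1..k}. Y j (r j))"
    unfolding eq[symmetric] by (simp add: eliminate_Y_later)
  also have "\<dots> = 0"
    unfolding eliminate_sum by (rule sum.neutral) (use eliminate_Y_earlier in \<open>metis atLeastAtMost_iff\<close>)
  finally have z: "Y (Suc k) (eliminate k s) = 0" .
  have ez: "eliminate k s = 0"
    by (rule Y_injective[OF zero_less_Suc eliminate_vectors[OF s] z])
  show ?thesis using eliminate_complement[OF s, of k] unfolding ez diff_zero .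
qed

lemma Y_koszul_exact:
  assumes "\<forall>S. s S \<in> vectors" "s {} = 0" "\<forall>S\<subseteq>{1..m}. koszul Y m s S = 0"
  shows "\<exists>t. (\<forall>S. t S \<in> vectors) \<and> (\<forall>S\<subseteq>{1..m}. koszul Y m t S = s S)"
proof (rule Y.koszul_exact[OF _ _ _ _ _ assms])
  fix k x r
  assume "x \<in> vectors" "Y (Suc k) x = (\<Sum>j\<in>{1..k}. Y j (r j))"
  then show "\<exists>r'. (\<forall>j. r' j \<in> vectors) \<and> x = (\<Sum>j\<in>{1..k}. Y j (r' j))" by (rule Y_regular)
qed (fact vectors_closed pencil_vectors[OF const_e_hom])+

end

subsection \<open>Graded exactness\<close>

lemma sum_fun_apply: "sum f A v = (\<Sum>x\<in>A. f x v)"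
  by (induction A rule: infinite_finite_induct) auto

lemma koszul_apply:
  "koszul X m s S v = (\<Sum>j\<in>{1..m} - S. ksign j S (X j (s (insert j S)) v))"
  unfolding koszul_def sum_fun_apply by (intro sum.cong refl) (simp add: ksign_def)

text \<open>A map of coefficients that is compatible with coordinates and constants carries one Koszul
  complex to the other. Source and target may use different maps \<open>h\<close> and \<open>h'\<close>, because taking
  homogeneous components shifts the degree by one along each operator.\<close>

lemma koszul_pencil_transport:
  fixes h h' :: "'a::comm_ring_1 \<Rightarrow> 'b::comm_ring_1"
  assumes add: "\<And>p q. h' (p + q) = h' p + h' q"
    and x: "\<And>j p. j \<in> {1..m} \<Longrightarrow> p \<in> D \<Longrightarrow> h' (x j * p) = x' j * h p"
    and l: "\<And>a p. p \<in> D \<Longrightarrow> h' (l * (e a * p)) = l' * (e' a * h p)"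
    and s: "\<And>S v. s S v \<in> D"
  shows "h' (koszul (pencil e x l B c) m s S v) = koszul (pencil e' x' l' B c) m (\<lambda>S v. h (s S v)) S v"
proof -
  have h0: "h' 0 = 0" using add[of 0 0] by simp
  have hu: "h' (- p) = - h' p" for p using add[of p "- p"] h0 by (simp add: add_eq_0_iff)
  have hd: "h' (p - q) = h' p - h' q" for p q using add[of p "- q"] hu by simp
  have hs: "h' (sum f A) = (\<Sum>x\<in>A. h' (f x))" for f and A :: "nat set"
    by (induction A rule: infinite_finite_induct) (auto simp: add h0)
  have hk: "h' (ksign j S p) = ksign j S (h' p)" for j p by (simp add: ksign_def hu)
  show ?thesis
    unfolding koszul_apply hs hk pencil_def act_def hd sum_distrib_left
    by (intro sum.cong refl arg_cong[where f = "ksign _ _"] arg_cong2[where f = minus])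
      (use x l s in auto)
qed

lemma coords_subst_retract: "subst (\<lambda>i. if i \<le> n then var i else 0) p \<in> coords n"
  by (induction p rule: mpoly_induct) (auto simp: subst_add subst_var_mult coords_var)

lemma subst_retract_coords:
  assumes "p \<in> coords n"
  shows "subst (\<lambda>i. if i \<le> n then var i else 0) p = p"
proof -
  let ?r = "subst (\<lambda>i. if i \<le> n then var i else 0)"
  have single: "?r (Poly_Mapping.single m a) = Poly_Mapping.single m a"
    if "Poly_Mapping.keys m \<subseteq> {..n}" for m a
    using that
  proof (induction m rule: monom_induct)
    case zero
    then show ?case using subst_const[of _ a] by (simp add: const_def)
  next
    case (step i m)
    then have "?r (var i * Poly_Mapping.single m a) = var i * Poly_Mapping.single m a"
      by (simp add: subst_var_mult)
    then show ?case by (simp only: var_mult_single)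
  qed
  have "?r (\<Sum>m\<in>Poly_Mapping.keys p. Poly_Mapping.single m (Poly_Mapping.lookup p m)) =
      (\<Sum>m\<in>Poly_Mapping.keys p. Poly_Mapping.single m (Poly_Mapping.lookup p m))"
    unfolding subst_sum using assms single by (intro sum.cong refl) (simp add: coords_iff)
  then show ?thesis by (simp flip: poly_expansion)
qed

definition linear_form :: "nat \<Rightarrow> (nat \<Rightarrow> complex) \<Rightarrow> mpoly" where
  "linear_form n a = var 0 + (\<Sum>j\<in>{1..n}. const (a j) * var j)"

lemma homogeneous_linear_form: "homogeneous n 1 (linear_form n a)"
  unfolding linear_form_def
  by (intro homogeneous_add homogeneous_sum homogeneous_const_mult homogeneous_var) auto

context commuting_matrices begin

text \<open>A linear substitution takes \<open>l\<close> to \<open>x\<^sub>0\<close>, where exactness is known for the full polynomial ring;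
  removing the surplus variables and taking the component of degree \<open>d\<close> makes the preimage
  homogeneous.\<close>

lemma koszul_exact_graded:
  assumes s: "\<And>S v. homogeneous n (Suc d) (s S v)" "\<And>S. s S \<in> vectors" "s {} = 0"
    and ks: "\<And>S. S \<subseteq> {1..n} \<Longrightarrow> koszul (pencil const var (linear_form n a) B c) n s S = 0"
  obtains t where "\<And>S v. homogeneous n d (t S v)" "\<And>S. t S \<in> vectors"
    "\<And>S. S \<subseteq> {1..n} \<Longrightarrow> koszul (pencil const var (linear_form n a) B c) n t S = s S"
proof -
  define q where "q = (\<Sum>j\<in>{1..n}. const (a j) * var j)"
  define \<sigma> where "\<sigma> i = (if i = 0 then var 0 + q else var i)" for i
  define \<tau> where "\<tau> i = (if i = 0 then var 0 - q else var i)" for i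
  have l: "linear_form n a = var 0 + q" by (simp add: linear_form_def q_def)
  have q: "subst \<rho> q = q" if "\<And>j. 0 < j \<Longrightarrow> \<rho> j = var j" for \<rho>
    unfolding q_def using that by (auto simp: subst_sum subst_mult intro!: sum.cong)
  have \<sigma>\<tau>: "subst \<sigma> (subst \<tau> p) = p" for p
    by (rule subst_subst_inverse) (auto simp: \<tau>_def subst_diff q \<sigma>_def)
  define s0 where "s0 S v = subst \<tau> (s S v)" for S v
  have "koszul Y n s0 S = 0" if "S \<subseteq> {1..n}" for S
  proof
    fix v
    have "koszul Y n s0 S v = subst \<tau> (koszul (pencil const var (linear_form n a) B c) n s S v)"
      unfolding s0_def
      by (rule koszul_pencil_transport[where D = UNIV, symmetric])
        (auto simp: subst_add subst_mult subst_const_mult q l \<tau>_def)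
    then show "koszul Y n s0 S v = 0 v" using ks[OF that] by simp
  qed
  moreover have "s0 S \<in> vectors" for S using s(2)[of S] by (simp add: s0_def vectors_def)
  moreover have "s0 {} = 0" using s(3) by (simp add: s0_def fun_eq_iff)
  ultimately obtain t0 where t0: "\<And>S. t0 S \<in> vectors" "\<And>S. S \<subseteq> {1..n} \<Longrightarrow> koszul Y n t0 S = s0 S"
    using Y_koszul_exact[of s0 n] by blast
  define t1 where "t1 S v = subst \<sigma> (t0 S v)" for S v
  have t1: "koszul (pencil const var (linear_form n a) B c) n t1 S v = s S v" if "S \<subseteq> {1..n}" for S v
  proof -
    have "koszul (pencil const var (linear_form n a) B c) n t1 S v = subst \<sigma> (koszul Y n t0 S v)"
      unfolding t1_def
      by (rule koszul_pencil_transport[where D = UNIV, symmetric])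
        (auto simp: subst_add subst_mult subst_const_mult q l \<sigma>_def)
    then show ?thesis using t0(2)[OF that] by (simp add: s0_def \<sigma>\<tau>)
  qed
  define ret where "ret = subst (\<lambda>i. if i \<le> n then var i else 0)"
  have ret: "ret p \<in> coords n" for p unfolding ret_def by (rule coords_subst_retract)
  have ret_id: "ret p = p" if "p \<in> coords n" for p
    unfolding ret_def by (rule subst_retract_coords[OF that])
  define t where "t S v = homogeneous_component d (ret (t1 S v))" for S v
  have t_hom: "homogeneous n d (t S v)" for S v
    unfolding t_def by (rule homogeneous_homogeneous_component[OF ret])
  have t_vec: "t S \<in> vectors" for S
    using t0(1)[of S] by (auto simp: t_def t1_def vectors_def ret_def)
  have "koszul (pencil const var (linear_form n a) B c) n t S = s S" if S: "S \<subseteq> {1..n}" for S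
  proof
    fix v
    have hm: "homogeneous_component (Suc d) (ret (g * p)) = g * homogeneous_component d (ret p)" if "homogeneous n 1 g" for g p
    proof -
      have "ret (g * p) = g * ret p"
        using ret_id[OF homogeneous_coords[OF that]] by (simp add: ret_def subst_mult)
      then show ?thesis using homogeneous_component_mult_homogeneous[OF that ret, of "Suc d" p] by simp
    qed
    have hc: "homogeneous_component d (ret (const b * p)) = const b * homogeneous_component d (ret p)" for b p
      using homogeneous_component_mult_homogeneous[OF homogeneous_const ret, of d b p] by (simp add: ret_def subst_const_mult)
    have "homogeneous_component (Suc d) (ret (koszul (pencil const var (linear_form n a) B c) n t1 S v)) =
        koszul (pencil const var (linear_form n a) B c) n t S v"
      unfolding t_def
      by (rule koszul_pencil_transport[where D = UNIV])
        (auto simp: ret_def subst_add homogeneous_component_add hm[unfolded ret_def] hc[unfolded ret_def]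
          homogeneous_var[unfolded One_nat_def] homogeneous_linear_form[unfolded One_nat_def])
    also have "homogeneous_component (Suc d) (ret (koszul (pencil const var (linear_form n a) B c) n t1 S v)) = s S v"
      unfolding t1[OF S] using s(1)[of S v] by (simp add: ret_id homogeneous_coords homogeneous_component_homogeneous)
    finally show "koszul (pencil const var (linear_form n a) B c) n t S v = s S v" ..
  qed
  with t_hom t_vec that show ?thesis by blast
qed

end

section \<open>Coherent ideals with zero-dimensional support\<close>

text \<open>An ideal sheaf of finite type, given by its stalks in the field of fractions. The last
  assumption says that the subscheme has dimension zero: no point of its support specialises to
  another one.\<close>

locale ideal_stalks =
  fixes n :: nat and I :: "point \<Rightarrow> ratfun set"
  assumes ideal_I: "P \<in> proj_points n \<Longrightarrow> ideal_in (local_ring n P) (I P)"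
    and open_I: "P \<in> proj_points n \<Longrightarrow> q \<in> I P \<Longrightarrow>
      \<exists>U. openin (proj_space n) U \<and> P \<in> U \<and> (\<forall>Q\<in>U. q \<in> I Q)"
    and generated_I: "P \<in> proj_points n \<Longrightarrow>
      \<exists>U k s. openin (proj_space n) U \<and> P \<in> U \<and> (\<forall>Q\<in>U. (\<forall>j<k. s j \<in> I Q) \<and>
        (\<forall>q\<in>I Q. \<exists>c. (\<forall>j<k. c j \<in> local_ring n Q) \<and> q = (\<Sum>j<(k::nat). c j * s j)))"
    and zero_dim: "P \<in> proj_points n \<Longrightarrow> Q \<in> proj_points n \<Longrightarrow> P \<subset> Q \<Longrightarrow> 1 \<notin> I P \<Longrightarrow> 1 \<in> I Q"
begin

definition supp :: "point set" where
  "supp = {P \<in> proj_points n. 1 \<notin> I P}"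

lemma I_local: "P \<in> proj_points n \<Longrightarrow> q \<in> I P \<Longrightarrow> q \<in> local_ring n P"
  and I_0: "P \<in> proj_points n \<Longrightarrow> 0 \<in> I P"
  and I_add: "P \<in> proj_points n \<Longrightarrow> p \<in> I P \<Longrightarrow> q \<in> I P \<Longrightarrow> p + q \<in> I P"
  and I_mult: "P \<in> proj_points n \<Longrightarrow> a \<in> local_ring n P \<Longrightarrow> q \<in> I P \<Longrightarrow> a * q \<in> I P"
  using ideal_inD[OF ideal_I] by blast+

lemma I_sum: "P \<in> proj_points n \<Longrightarrow> (\<And>x. x \<in> X \<Longrightarrow> f x \<in> I P) \<Longrightarrow> sum f X \<in> I P"
  by (induction X rule: infinite_finite_induct) (auto simp: I_0 intro: I_add)

lemma I_uminus: "P \<in> proj_points n \<Longrightarrow> q \<in> I P \<Longrightarrow> - q \<in> I P"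
  using I_mult[of P "fr (const (-1))" q] stalk_const[of P n "-1"] by simp

lemma I_unit_cancel:
  assumes P: "P \<in> proj_points n" and "a \<in> local_ring n P" "a \<notin> max_ideal n P" "a * q \<in> I P"
  shows "q \<in> I P"
  using I_mult[OF P local_unit(1)[OF P assms(2,3)] assms(4)] local_unit(2)[OF P assms(2,3)] by simp

end

locale ideal_on_chart = ideal_stalks n I + chart n l for n I l
begin

text \<open>The sections of the ideal sheaf over the chart.\<close>

definition J :: "ratfun set" where
  "J = {a \<in> A. \<forall>Q\<in>proj_points n. l \<notin> Q \<longrightarrow> a \<in> I Q}"

lemma J_A: "a \<in> J \<Longrightarrow> a \<in> A" and J_stalk: "a \<in> J \<Longrightarrow> P \<in> proj_points n \<Longrightarrow> l \<notin> P \<Longrightarrow> a \<in> I P"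
  by (auto simp: J_def)

lemma ideal_J: "ideal_in A J"
  unfolding ideal_in_def J_def by (auto intro: A_add A_mult I_add I_mult A_local I_0)

lemma J_add: "a \<in> J \<Longrightarrow> b \<in> J \<Longrightarrow> a + b \<in> J" and J_mult: "a \<in> A \<Longrightarrow> b \<in> J \<Longrightarrow> a * b \<in> J" and J_0: "0 \<in> J"
  using ideal_inD[OF ideal_J] by blast+

lemma J_scalar: "b \<in> J \<Longrightarrow> scalar x * b \<in> J"
  by (rule J_mult) auto

lemma J_diff: "a \<in> J \<Longrightarrow> b \<in> J \<Longrightarrow> a - b \<in> J"
  using J_add[of a "- b"] J_scalar[of b "-1"] by simp

lemma J_sum: "(\<And>x. x \<in> X \<Longrightarrow> f x \<in> J) \<Longrightarrow> sum f X \<in> J"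
  by (induction X rule: infinite_finite_induct) (auto simp: J_0 intro: J_add)

text \<open>If no power of \<open>x\<close> were in \<open>C\<close>, some point would contain \<open>C\<close> and avoid all powers of \<open>x\<close>.\<close>

lemma radical_power:
  assumes "ideal_in A C" "x \<in> A"
    and "\<And>Q. Q \<in> proj_points n \<Longrightarrow> l \<notin> Q \<Longrightarrow> C \<subseteq> max_ideal n Q \<Longrightarrow> x \<in> max_ideal n Q"
  shows "\<exists>N. x ^ N \<in> C"
proof (rule ccontr)
  assume no: "\<not> ?thesis"
  let ?M = "{x ^ k |k. True}"
  obtain Q where "Q \<in> proj_points n" "l \<notin> Q" "C \<subseteq> max_ideal n Q" "?M \<inter> max_ideal n Q = {}"
  proof (rule exists_point[OF assms(1), of ?M])
    show "1 \<in> ?M" by (intro CollectI exI[of _ 0]) simp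
    show "y * z \<in> ?M" if yz: "y \<in> ?M" "z \<in> ?M" for y z
    proof -
      obtain j k where "y = x ^ j" "z = x ^ k" using yz by blast
      then show ?thesis by (intro CollectI exI[of _ "j + k"]) (simp add: power_add)
    qed
    show "C \<inter> ?M = {}" using no by blast
    show "?M \<subseteq> A" using A_power[OF assms(2)] by blast
  qed
  moreover have "x \<in> ?M" by (intro CollectI exI[of _ 1]) simp
  ultimately show False using assms(3) by blast
qed

lemma open_basic_chart:
  assumes P: "P \<in> proj_points n" "l \<notin> P" and U: "openin (proj_space n) U" "P \<in> U"
  obtains h where "h \<in> A" "h \<notin> max_ideal n P"
    "\<And>Q. Q \<in> proj_points n \<Longrightarrow> l \<notin> Q \<Longrightarrow> h \<notin> max_ideal n Q \<Longrightarrow> Q \<in> U"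
proof -
  obtain h k where h: "homogeneous n k h" "h \<notin> P" "{Q \<in> proj_points n. h \<notin> Q} \<subseteq> U"
    using U unfolding openin_iff_basic by blast
  show ?thesis
  proof (rule that[of "fr h / fr l ^ k"])
    show "fr h / fr l ^ k \<in> A" by (rule A_I[OF h(1)])
    show "fr h / fr l ^ k \<notin> max_ideal n P" using in_max_ideal_numerator[OF P h(1)] h(2) by simp
    fix Q assume Q: "Q \<in> proj_points n" "l \<notin> Q" "fr h / fr l ^ k \<notin> max_ideal n Q"
    then have "h \<notin> Q" using in_max_ideal_numerator[OF Q(1,2) h(1)] by simp
    then show "Q \<in> U" using Q h(3) by blast
  qed
qed

lemma numerator_generators:
  assumes P: "P \<in> proj_points n" "l \<notin> P"
  obtains g k a where "g \<in> A" "g \<notin> max_ideal n P" "\<And>j. j < (k::nat) \<Longrightarrow> a j \<in> A"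
    "\<And>Q j. Q \<in> proj_points n \<Longrightarrow> l \<notin> Q \<Longrightarrow> g \<notin> max_ideal n Q \<Longrightarrow> j < k \<Longrightarrow> a j \<in> I Q"
    "\<And>Q q. Q \<in> proj_points n \<Longrightarrow> l \<notin> Q \<Longrightarrow> g \<notin> max_ideal n Q \<Longrightarrow> q \<in> I Q \<Longrightarrow>
      \<exists>c. (\<forall>j<k. c j \<in> local_ring n Q) \<and> q = (\<Sum>j<k. c j * a j)"
proof -
  obtain U k s where U: "openin (proj_space n) U" "P \<in> U"
    and gen: "\<And>Q. Q \<in> U \<Longrightarrow> (\<forall>j<k. s j \<in> I Q) \<and>
        (\<forall>q\<in>I Q. \<exists>c. (\<forall>j<k. c j \<in> local_ring n Q) \<and> q = (\<Sum>j<(k::nat). c j * s j))"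
    using generated_I[OF P(1)] by blast
  have "s j \<in> local_ring n P" if "j \<in> {..<k}" for j
    using gen[OF U(2)] I_local[OF P(1)] that by blast
  then obtain d where d: "d \<in> A" "d \<notin> max_ideal n P" "\<forall>j\<in>{..<k}. d * s j \<in> A"
    using A_common_denominator[OF P, of "{..<k}" s] by blast
  obtain h where h: "h \<in> A" "h \<notin> max_ideal n P"
    "\<And>Q. Q \<in> proj_points n \<Longrightarrow> l \<notin> Q \<Longrightarrow> h \<notin> max_ideal n Q \<Longrightarrow> Q \<in> U"
    using open_basic_chart[OF P U] by blast
  have outside: "d \<notin> max_ideal n Q \<and> Q \<in> U"
    if "Q \<in> proj_points n" "l \<notin> Q" "d * h \<notin> max_ideal n Q" for Q
    using that max_ideal_smult[of Q n d h] max_ideal_smult[of Q n h d] A_local[OF d(1)] A_local[OF h(1)] h(3)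
    by (metis mult.commute)
  show ?thesis
  proof (rule that[of "d * h" k "\<lambda>j. d * s j"])
    show "d * h \<in> A" using d h A_mult by blast
    show "d * h \<notin> max_ideal n P"
      using max_ideal_prime[OF P(1) A_local[OF d(1) P] A_local[OF h(1) P]] d h by blast
    show "d * s j \<in> A" if "j < k" for j using d(3) that by blast
    fix Q assume Q: "Q \<in> proj_points n" "l \<notin> Q" "d * h \<notin> max_ideal n Q"
    note out = outside[OF Q]
    show "d * s j \<in> I Q" if "j < k" for j
      using gen[of Q] out that I_mult[OF Q(1) A_local[OF d(1) Q(1,2)]] by blast
    fix q assume q: "q \<in> I Q"
    then obtain c where c: "\<And>j. j < k \<Longrightarrow> c j \<in> local_ring n Q" "q = (\<Sum>j<k. c j * s j)"
      using gen[of Q] out by blast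
    have u: "1 / d \<in> local_ring n Q" "d \<noteq> 0"
      using local_unit[OF Q(1) A_local[OF d(1) Q(1,2)]] out by auto
    have "q = (\<Sum>j<k. (1 / d * c j) * (d * s j))"
      unfolding c(2) using u(2) by (intro sum.cong refl) simp
    then show "\<exists>c. (\<forall>j<k. c j \<in> local_ring n Q) \<and> q = (\<Sum>j<k. c j * (d * s j))"
      using stalk_smult[OF Q(1) u(1)] c(1) by (intro exI[of _ "\<lambda>j. 1 / d * c j"]) blast
  qed
qed

text \<open>Near each point the ideal has finitely many generators, and some power of \<open>h\<close> times \<open>a\<close> is
  a combination of them by \<open>radical_power\<close>. The elements \<open>g\<close> outside whose zero set some power
  works form an ideal, and this ideal lies in no prime, so one power works everywhere.\<close>

lemma extend_after_power:
  assumes a: "a \<in> A" and h: "h \<in> A"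
    and aI: "\<And>Q. Q \<in> proj_points n \<Longrightarrow> l \<notin> Q \<Longrightarrow> h \<notin> max_ideal n Q \<Longrightarrow> a \<in> I Q"
  shows "\<exists>N. h ^ N * a \<in> J"
proof -
  define C where "C = {g \<in> A. \<exists>N. \<forall>Q\<in>proj_points n. l \<notin> Q \<longrightarrow> g \<notin> max_ideal n Q \<longrightarrow> h ^ N * a \<in> I Q}"
  have more: "h ^ N' * a \<in> I Q" if "Q \<in> proj_points n" "l \<notin> Q" "h ^ N * a \<in> I Q" "N \<le> N'" for Q N N'
  proof -
    have eq: "h ^ N' * a = h ^ (N' - N) * (h ^ N * a)"
      unfolding mult.assoc[symmetric] power_add[symmetric] using that(4) by simp
    show ?thesis unfolding eq by (rule I_mult[OF that(1) A_local[OF A_power[OF h] that(1,2)] that(3)])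
  qed
  have "ideal_in A C"
    unfolding ideal_in_def
  proof (intro conjI ballI subsetI)
    show "0 \<in> C" unfolding C_def using max_ideal_0 by auto
  next
    fix x y assume x: "x \<in> C" and y: "y \<in> C"
    obtain N where N: "\<And>Q. Q \<in> proj_points n \<Longrightarrow> l \<notin> Q \<Longrightarrow> x \<notin> max_ideal n Q \<Longrightarrow> h ^ N * a \<in> I Q"
      using x unfolding C_def by blast
    obtain N' where N': "\<And>Q. Q \<in> proj_points n \<Longrightarrow> l \<notin> Q \<Longrightarrow> y \<notin> max_ideal n Q \<Longrightarrow> h ^ N' * a \<in> I Q"
      using y unfolding C_def by blast
    have "h ^ max N N' * a \<in> I Q" if Q: "Q \<in> proj_points n" "l \<notin> Q" "x + y \<notin> max_ideal n Q" for Q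
    proof -
      have "x \<notin> max_ideal n Q \<or> y \<notin> max_ideal n Q" using Q max_ideal_add by blast
      then show ?thesis using N[OF Q(1,2)] N'[OF Q(1,2)] more[OF Q(1,2)] by (metis max.cobounded1 max.cobounded2)
    qed
    then show "x + y \<in> C" using x y A_add unfolding C_def by blast
  next
    fix b x assume b: "b \<in> A" and x: "x \<in> C"
    have "x \<notin> max_ideal n Q" if "Q \<in> proj_points n" "l \<notin> Q" "b * x \<notin> max_ideal n Q" for Q
      using max_ideal_smult[OF that(1) A_local[OF b that(1,2)]] that(3) by blast
    then show "b * x \<in> C" using x b A_mult unfolding C_def by blast
  qed (auto simp: C_def)
  moreover have "\<exists>g\<in>C. g \<notin> max_ideal n P" if P: "P \<in> proj_points n" "l \<notin> P" for P
  proof -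
    obtain g k s where g: "g \<in> A" "g \<notin> max_ideal n P" and s: "\<And>j. j < (k::nat) \<Longrightarrow> s j \<in> A"
      and sI: "\<And>Q j. Q \<in> proj_points n \<Longrightarrow> l \<notin> Q \<Longrightarrow> g \<notin> max_ideal n Q \<Longrightarrow> j < k \<Longrightarrow> s j \<in> I Q"
      and gen: "\<And>Q q. Q \<in> proj_points n \<Longrightarrow> l \<notin> Q \<Longrightarrow> g \<notin> max_ideal n Q \<Longrightarrow> q \<in> I Q \<Longrightarrow>
        \<exists>c. (\<forall>j<k. c j \<in> local_ring n Q) \<and> q = (\<Sum>j<k. c j * s j)"
      using numerator_generators[OF P] by blast
    define D where "D = {x \<in> A. \<exists>c. (\<forall>j<k. c j \<in> A) \<and> x * a = (\<Sum>j<k. c j * s j)}"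
    have "ideal_in A D"
      unfolding ideal_in_def
    proof (intro conjI ballI subsetI)
      show "0 \<in> D" unfolding D_def by (auto intro!: exI[of _ "\<lambda>_. 0"])
    next
      fix x y assume "x \<in> D" "y \<in> D"
      then obtain c c' where "\<forall>j<k. c j \<in> A" "x * a = (\<Sum>j<k. c j * s j)"
        "\<forall>j<k. c' j \<in> A" "y * a = (\<Sum>j<k. c' j * s j)" "x \<in> A" "y \<in> A" unfolding D_def by blast
      then show "x + y \<in> D" unfolding D_def
        by (auto simp: A_add ring_distribs sum.distrib intro!: exI[of _ "\<lambda>j. c j + c' j"])
    next
      fix b x assume "b \<in> A" "x \<in> D"
      then obtain c where "\<forall>j<k. c j \<in> A" "x * a = (\<Sum>j<k. c j * s j)" "x \<in> A" "b \<in> A"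
        unfolding D_def by blast
      then show "b * x \<in> D" unfolding D_def
        by (auto simp: A_mult mult.assoc sum_distrib_left intro!: exI[of _ "\<lambda>j. b * c j"])
    qed (auto simp: D_def)
    then have "\<exists>N. (g * h) ^ N \<in> D"
    proof (rule radical_power)
      show "g * h \<in> A" using g h A_mult by blast
      fix Q assume Q: "Q \<in> proj_points n" "l \<notin> Q" and DQ: "D \<subseteq> max_ideal n Q"
      show "g * h \<in> max_ideal n Q"
      proof (rule ccontr)
        assume ngh: "g * h \<notin> max_ideal n Q"
        have ng: "g \<notin> max_ideal n Q"
          using ngh max_ideal_smult[OF Q(1) A_local[OF h Q], of g] by (auto simp: mult.commute)
        have nh: "h \<notin> max_ideal n Q"
          using ngh max_ideal_smult[OF Q(1) A_local[OF g(1) Q], of h] by auto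
        obtain c where c: "\<forall>j<k. c j \<in> local_ring n Q" "a = (\<Sum>j<k. c j * s j)"
          using gen[OF Q ng aI[OF Q nh]] by blast
        obtain d where d: "d \<in> A" "d \<notin> max_ideal n Q" "\<forall>j\<in>{..<k}. d * c j \<in> A"
          using A_common_denominator[OF Q, of "{..<k}" c] c(1) by auto
        have "d * a = (\<Sum>j<k. (d * c j) * s j)" by (simp add: c(2) sum_distrib_left mult.assoc)
        then have "d \<in> D" using d unfolding D_def by (auto intro!: exI[of _ "\<lambda>j. d * c j"])
        then show False using DQ d(2) by blast
      qed
    qed
    then obtain N c where c: "\<forall>j<k. c j \<in> A" "(g * h) ^ N * a = (\<Sum>j<k. c j * s j)"
      unfolding D_def by blast
    have "h ^ N * a \<in> I Q" if Q: "Q \<in> proj_points n" "l \<notin> Q" "g \<notin> max_ideal n Q" for Q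
    proof -
      have "(\<Sum>j<k. c j * s j) \<in> I Q"
        using c(1) sI[OF Q] by (intro I_sum I_mult Q A_local) auto
      then have "g ^ N * (h ^ N * a) \<in> I Q" unfolding c(2)[symmetric] by (simp add: power_mult_distrib mult.assoc)
      moreover have "g ^ N \<notin> max_ideal n Q" by (rule power_notin_max_ideal[OF Q(1,2) g(1) Q(3)])
      ultimately show ?thesis
        using I_unit_cancel[OF Q(1) A_local[OF A_power[OF g(1)] Q(1,2)]] by blast
    qed
    then have "g \<in> C" using g(1) unfolding C_def by blast
    with g(2) show ?thesis by blast
  qed
  ultimately have "1 \<in> C" by (rule one_in_ideal)
  then obtain N where N: "\<forall>Q\<in>proj_points n. l \<notin> Q \<longrightarrow> h ^ N * a \<in> I Q"
    unfolding C_def using max_ideal_1 by blast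
  then show ?thesis using A_mult[OF A_power[OF h] a] unfolding J_def by blast
qed

text \<open>Each stalk of the ideal is a localisation of \<open>J\<close>.\<close>

lemma stalk_from_J:
  assumes P: "P \<in> proj_points n" "l \<notin> P" and q: "q \<in> I P"
  obtains h where "h \<in> A" "h \<notin> max_ideal n P" "h * q \<in> J"
proof -
  obtain a b where ab: "a \<in> A" "b \<in> A" "b \<notin> max_ideal n P" "q = a / b"
    by (rule A_fraction[OF I_local[OF P(1) q] P])
  have "b \<noteq> 0" using ab(3) max_ideal_0[OF P(1)] by auto
  then have bq: "b * q = a" using ab by simp
  have "a \<in> I P" using I_mult[OF P(1) A_local[OF ab(2) P] q] bq by simp
  then obtain U where U: "openin (proj_space n) U" "P \<in> U" "\<forall>Q\<in>U. a \<in> I Q"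
    using open_I[OF P(1)] by blast
  obtain h where h: "h \<in> A" "h \<notin> max_ideal n P"
    "\<And>Q. Q \<in> proj_points n \<Longrightarrow> l \<notin> Q \<Longrightarrow> h \<notin> max_ideal n Q \<Longrightarrow> Q \<in> U"
    using open_basic_chart[OF P U(1,2)] by blast
  obtain N where N: "h ^ N * a \<in> J"
    using extend_after_power[OF ab(1) h(1)] h(3) U(3) by blast
  have hN: "h ^ N \<notin> max_ideal n P" by (rule power_notin_max_ideal[OF P h(1,2)])
  show ?thesis
  proof (rule that[of "h ^ N * b"])
    show "h ^ N * b \<in> A" using A_mult A_power h ab by blast
    show "h ^ N * b \<notin> max_ideal n P"
      using max_ideal_prime[OF P(1) A_local[OF A_power[OF h(1)] P] A_local[OF ab(2) P]] hN ab(3) by blast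
    show "h ^ N * b * q \<in> J" using N bq by (simp add: mult.assoc)
  qed
qed

lemma supp_iff:
  assumes P: "P \<in> proj_points n" "l \<notin> P"
  shows "P \<in> supp \<longleftrightarrow> J \<subseteq> max_ideal n P"
proof
  assume s: "P \<in> supp"
  show "J \<subseteq> max_ideal n P"
  proof
    fix a assume a: "a \<in> J"
    show "a \<in> max_ideal n P"
    proof (rule ccontr)
      assume "a \<notin> max_ideal n P"
      then have "1 \<in> I P"
        using I_unit_cancel[OF P(1) A_local[OF J_A[OF a] P], of 1] J_stalk[OF a P] by simp
      with s show False by (simp add: supp_def)
    qed
  qed
next
  assume J: "J \<subseteq> max_ideal n P"
  show "P \<in> supp"
  proof (rule ccontr)
    assume "P \<notin> supp"
    then have "1 \<in> I P" using P by (simp add: supp_def)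
    then obtain h where "h \<notin> max_ideal n P" "h * 1 \<in> J" using stalk_from_J[OF P] by blast
    with J show False by auto
  qed
qed

text \<open>Otherwise some prime contains \<open>J\<close> and avoids all \<open>y - c\<close>; this point of the support
  specialises to one that contains some \<open>y - c\<close>, and the support contains two comparable
  points.\<close>

lemma algebraic:
  assumes y: "y \<in> A"
  shows "\<exists>cs. prod_list (map (\<lambda>c. y - scalar c) cs) \<in> J"
proof (rule ccontr)
  assume no: "\<not> ?thesis"
  let ?M = "{prod_list (map (\<lambda>c. y - scalar c) cs) |cs. True}"
  have plA: "prod_list (map (\<lambda>c. y - scalar c) cs) \<in> A" for cs
    by (induction cs) (auto intro!: A_mult A_diff y)
  obtain P where P: "P \<in> proj_points n" "l \<notin> P" "J \<subseteq> max_ideal n P" "?M \<inter> max_ideal n P = {}"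
  proof (rule exists_point[OF ideal_J, of ?M])
    show "1 \<in> ?M" by (intro CollectI exI[of _ "[]"]) simp
    show "u * v \<in> ?M" if uv: "u \<in> ?M" "v \<in> ?M" for u v
    proof -
      obtain cs ds where "u = prod_list (map (\<lambda>c. y - scalar c) cs)" "v = prod_list (map (\<lambda>c. y - scalar c) ds)"
        using uv by blast
      then show ?thesis by (intro CollectI exI[of _ "cs @ ds"]) simp
    qed
    show "J \<inter> ?M = {}" using no by blast
    show "?M \<subseteq> A" using plA by blast
  qed
  have ny: "y - scalar c \<notin> max_ideal n P" for c
  proof -
    have "y - scalar c \<in> ?M" by (intro CollectI exI[of _ "[c]"]) simp
    then show ?thesis using P(4) by blast
  qed
  obtain Q c where Q: "Q \<in> proj_points n" "l \<notin> Q" "A \<inter> max_ideal n P \<subseteq> max_ideal n Q"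
    "y - scalar c \<in> max_ideal n Q"
    by (rule exists_specialisation[OF P(1,2) y ny])
  have "P \<subseteq> Q"
  proof (rule point_subsetI[OF P(1) Q(1)])
    fix f k assume f: "homogeneous n k f" "f \<in> P"
    then have "fr f / fr l ^ k \<in> A \<inter> max_ideal n P"
      using in_max_ideal_numerator[OF P(1,2) f(1)] A_I[OF f(1)] by blast
    then show "f \<in> Q" using Q(3) in_max_ideal_numerator[OF Q(1,2) f(1)] by blast
  qed
  moreover have "P \<noteq> Q" using ny Q(4) by blast
  moreover have "P \<in> supp" using supp_iff[OF P(1,2)] P(3) by blast
  moreover have "Q \<in> supp" using supp_iff[OF Q(1,2)] P(3) Q(3) J_A by blast
  ultimately show False using zero_dim[OF P(1) Q(1)] by (auto simp: supp_def)
qed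

lemma coordinate_roots:
  obtains cs where "\<And>j. j \<le> n \<Longrightarrow> cs j \<noteq> []"
    "\<And>j. j \<le> n \<Longrightarrow> prod_list (map (\<lambda>c. coordinate j - scalar c) (cs j)) \<in> J"
proof -
  have "\<exists>cs. j \<le> n \<longrightarrow> cs \<noteq> [] \<and> prod_list (map (\<lambda>c. coordinate j - scalar c) cs) \<in> J" for j
  proof (cases "j \<le> n")
    case True
    obtain cs where cs: "prod_list (map (\<lambda>c. coordinate j - scalar c) cs) \<in> J"
      using algebraic[OF A_coordinate[OF True]] by blast
    \<comment> \<open>The superfluous root \<open>0\<close> makes the list nonempty even if \<open>J\<close> contains \<open>1\<close>.\<close>
    have "coordinate j * prod_list (map (\<lambda>c. coordinate j - scalar c) cs) \<in> J"
      by (rule J_mult[OF A_coordinate[OF True] cs])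
    then have "prod_list (map (\<lambda>c. coordinate j - scalar c) (0 # cs)) \<in> J" by simp
    then show ?thesis by blast
  qed simp
  then obtain cs where "\<forall>j. j \<le> n \<longrightarrow> cs j \<noteq> [] \<and> prod_list (map (\<lambda>c. coordinate j - scalar c) (cs j)) \<in> J"
    by metis
  then show ?thesis using that by blast
qed

lemma root_at_point:
  assumes P: "P \<in> proj_points n" "l \<notin> P" and y: "y \<in> A"
    and "prod_list (map (\<lambda>c. y - scalar c) cs) \<in> max_ideal n P"
  shows "\<exists>c\<in>set cs. y - scalar c \<in> max_ideal n P"
  using assms(4)
proof (induction cs)
  case Nil
  then show ?case using max_ideal_1[OF P(1)] by simp
next
  case (Cons c cs)
  have "prod_list (map (\<lambda>c. y - scalar c) cs) \<in> A"
    by (induction cs) (auto intro!: A_mult A_diff y)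
  then show ?case
    using Cons max_ideal_prime[OF P(1) A_local[OF A_diff[OF y A_scalar] P] A_local[OF _ P]] by auto
qed

text \<open>Functions on the chart are polynomials in the coordinates, so their values are determined by
  those of the coordinates.\<close>

lemma values_at_points:
  assumes P: "P \<in> proj_points n" "l \<notin> P" and Q: "Q \<in> proj_points n" "l \<notin> Q"
    and "\<And>j. j \<le> n \<Longrightarrow> coordinate j - scalar (x j) \<in> max_ideal n P \<inter> max_ideal n Q" and "a \<in> A"
  shows "\<exists>c. a - scalar c \<in> max_ideal n P \<inter> max_ideal n Q"
  using assms(6)
proof (induction a rule: A_induct)
  case (scalar c)
  show ?case using max_ideal_0[OF P(1)] max_ideal_0[OF Q(1)] by (intro exI[of _ c]) simp
next
  case (add a b)
  then obtain c d where cd: "a - scalar c \<in> max_ideal n P \<inter> max_ideal n Q" "b - scalar d \<in> max_ideal n P \<inter> max_ideal n Q"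
    by blast
  have "a + b - scalar (c + d) = (a - scalar c) + (b - scalar d)" by simp
  then show ?case
    using max_ideal_add[OF P(1)] max_ideal_add[OF Q(1)] cd by (intro exI[of _ "c + d"]) (metis IntI IntD1 IntD2)
next
  case (coordinate a j)
  then obtain c where c: "a - scalar c \<in> max_ideal n P \<inter> max_ideal n Q" by blast
  have eq: "coordinate j * a - scalar (c * x j) = coordinate j * (a - scalar c) + scalar c * (coordinate j - scalar (x j))"
    unfolding right_diff_distrib const_hom(4) fr_hom(4) by simp
  have "coordinate j * a - scalar (c * x j) \<in> max_ideal n R" if R: "R = P \<or> R = Q" for R
    unfolding eq
  proof (intro max_ideal_add max_ideal_smult)
    show "R \<in> proj_points n" "R \<in> proj_points n" "R \<in> proj_points n" using R P Q by blast+
    show "coordinate j \<in> local_ring n R" "scalar c \<in> local_ring n R"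
      using R P Q A_coordinate[OF coordinate(1)] A_local stalk_const by blast+
    show "a - scalar c \<in> max_ideal n R" "coordinate j - scalar (x j) \<in> max_ideal n R"
      using R c assms(5)[OF coordinate(1)] by blast+
  qed
  then show ?case by blast
qed

lemma points_eqI:
  assumes P: "P \<in> proj_points n" "l \<notin> P" and Q: "Q \<in> proj_points n" "l \<notin> Q"
    and x: "\<And>j. j \<le> n \<Longrightarrow> coordinate j - scalar (x j) \<in> max_ideal n P \<inter> max_ideal n Q"
  shows "P = Q"
proof -
  have iff: "f \<in> P \<longleftrightarrow> f \<in> Q" if f: "homogeneous n k f" for f k
  proof -
    let ?a = "fr f / fr l ^ k"
    obtain z where z: "?a - scalar z \<in> max_ideal n P" "?a - scalar z \<in> max_ideal n Q"
      using values_at_points[OF P Q x A_I[OF f]] by blast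
    have "?a \<in> max_ideal n R \<longleftrightarrow> z = 0" if R: "R \<in> proj_points n" "?a - scalar z \<in> max_ideal n R" for R
    proof
      assume "?a \<in> max_ideal n R"
      from max_ideal_diff[OF R(1) this R(2)] have "scalar z \<in> max_ideal n R" by simp
      then show "z = 0" by (simp only: max_ideal_const_iff[OF R(1)])
    qed (use R(2) in simp)
    then show ?thesis using z P Q in_max_ideal_numerator[OF P f] in_max_ideal_numerator[OF Q f] by blast
  qed
  show ?thesis
    using point_subsetI[OF P(1) Q(1)] point_subsetI[OF Q(1) P(1)] iff by blast
qed

lemma finite_supp_chart: "finite {P \<in> supp. l \<notin> P}"
proof -
  obtain cs where cs: "\<And>j. j \<le> n \<Longrightarrow> cs j \<noteq> []"
    "\<And>j. j \<le> n \<Longrightarrow> prod_list (map (\<lambda>c. coordinate j - scalar c) (cs j)) \<in> J"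
    using coordinate_roots by blast
  have "\<exists>x\<in>PiE {..n} (\<lambda>j. set (cs j)). \<forall>j\<le>n. coordinate j - scalar (x j) \<in> max_ideal n P"
    if P: "P \<in> supp" "l \<notin> P" for P
  proof -
    have pP: "P \<in> proj_points n" using P by (simp add: supp_def)
    have "\<forall>j\<in>{..n}. \<exists>c. c \<in> set (cs j) \<and> coordinate j - scalar c \<in> max_ideal n P"
      using root_at_point[OF pP P(2) A_coordinate] cs(2) supp_iff[OF pP P(2)] P(1) by blast
    then obtain x where x: "\<forall>j\<in>{..n}. x j \<in> set (cs j) \<and> coordinate j - scalar (x j) \<in> max_ideal n P"
      by metis
    then show ?thesis by (intro bexI[of _ "restrict x {..n}"]) auto
  qed
  then obtain F where F: "\<And>P. P \<in> supp \<Longrightarrow> l \<notin> P \<Longrightarrow> F P \<in> PiE {..n} (\<lambda>j. set (cs j))"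
    "\<And>P j. P \<in> supp \<Longrightarrow> l \<notin> P \<Longrightarrow> j \<le> n \<Longrightarrow> coordinate j - scalar (F P j) \<in> max_ideal n P"
    by metis
  have "inj_on F {P \<in> supp. l \<notin> P}"
  proof (rule inj_onI)
    fix P Q assume *: "P \<in> {P \<in> supp. l \<notin> P}" "Q \<in> {P \<in> supp. l \<notin> P}" "F P = F Q"
    then have pts: "P \<in> proj_points n" "l \<notin> P" "Q \<in> proj_points n" "l \<notin> Q" by (auto simp: supp_def)
    show "P = Q"
    proof (rule points_eqI[OF pts])
      fix j assume "j \<le> n"
      then show "coordinate j - scalar (F P j) \<in> max_ideal n P \<inter> max_ideal n Q"
        using F(2)[of P j] F(2)[of Q j] * by auto
    qed
  qed
  moreover have "F ` {P \<in> supp. l \<notin> P} \<subseteq> PiE {..n} (\<lambda>j. set (cs j))" using F(1) by blast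
  moreover have "finite (PiE {..n} (\<lambda>j. set (cs j)))" by (intro finite_PiE) auto
  ultimately show ?thesis by (rule inj_on_finite)
qed

end

lemma var_nonzero: "var i \<noteq> 0"
  by (metis var_def lookup_single_eq lookup_zero zero_neq_one)

lemma linear_form_nonzero: "linear_form n a \<noteq> 0"
proof
  assume "linear_form n a = 0"
  then have "subst (\<lambda>i. if i = 0 then 1 else 0) (linear_form n a) = 0" by simp
  moreover have "subst (\<lambda>i. if i = 0 then 1 else 0) (linear_form n a) = 1"
    by (simp add: linear_form_def subst_add subst_sum subst_mult)
  ultimately show False by simp
qed

context ideal_stalks begin

lemma ideal_on_chart_var: "i \<le> n \<Longrightarrow> ideal_on_chart n I (var i)"
  by unfold_locales (use homogeneous_var var_nonzero in auto)

lemma finite_supp: "finite supp"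
proof -
  have "finite {P \<in> supp. var i \<notin> P}" if "i \<le> n" for i
    by (rule ideal_on_chart.finite_supp_chart[OF ideal_on_chart_var[OF that]])
  then have "finite (\<Union>i\<le>n. {P \<in> supp. var i \<notin> P})" by blast
  moreover have "supp \<subseteq> (\<Union>i\<le>n. {P \<in> supp. var i \<notin> P})"
    using point_var unfolding supp_def by blast
  ultimately show ?thesis by (rule finite_subset[rotated])
qed

text \<open>At a point of the support with coordinates \<open>x\<^sub>0, \<dots>, x\<^sub>n\<close>, the form with coefficients
  \<open>1, t, \<dots>, t\<^sup>n\<close> vanishes only for roots \<open>t\<close> of the nonzero polynomial \<open>\<Sum>j\<le>n. x\<^sub>j t\<^sup>j\<close>.\<close>

lemma finite_bad_forms:
  assumes P: "P \<in> supp"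
  shows "finite {t. linear_form n (\<lambda>j. t ^ j) \<in> P}"
proof -
  have pP: "P \<in> proj_points n" using P by (simp add: supp_def)
  obtain i where i: "i \<le> n" "var i \<notin> P" using point_var[OF pP] .
  interpret chart_i: ideal_on_chart n I "var i" by (rule ideal_on_chart_var[OF i(1)])
  obtain cs where cs: "\<And>j. j \<le> n \<Longrightarrow> prod_list (map (\<lambda>c. chart_i.coordinate j - chart_i.scalar c) (cs j)) \<in> chart_i.J"
    using chart_i.coordinate_roots by blast
  have "\<exists>c. var j - const c * var i \<in> P" if j: "j \<le> n" for j
  proof -
    have "prod_list (map (\<lambda>c. chart_i.coordinate j - chart_i.scalar c) (cs j)) \<in> max_ideal n P"
      using cs[OF j] chart_i.supp_iff[OF pP i(2)] P by blast
    then obtain c where c: "chart_i.coordinate j - chart_i.scalar c \<in> max_ideal n P"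
      using chart_i.root_at_point[OF pP i(2) chart_i.A_coordinate[OF j]] by blast
    have "chart_i.coordinate j - chart_i.scalar c = fr (var j - const c * var i) / fr (var i) ^ 1"
      using var_nonzero[of i] by (simp add: field_simps)
    moreover have "homogeneous n 1 (var j - const c * var i)"
      by (intro homogeneous_diff homogeneous_const_mult homogeneous_var i j)
    ultimately show ?thesis
      using c chart_i.in_max_ideal_numerator[OF pP i(2), of 1 "var j - const c * var i"] by auto
  qed
  then obtain x where x: "\<And>j. j \<le> n \<Longrightarrow> var j - const (x j) * var i \<in> P" by metis
  have const_var: "c = 0" if c: "const c * var i \<in> P" for c
    using point_prime[OF pP coords_const coords_var[OF i(1)] c] i(2) point_const_notin[OF pP] by blast
  have xi: "x i = 1"
  proof -
    have "const (1 - x i) * var i \<in> P" using x[OF i(1)] by (simp add: algebra_simps)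
    then show ?thesis using const_var by fastforce
  qed
  define p where "p = (\<Sum>j\<le>n. monom (x j) j)"
  have "coeff p i = (\<Sum>j\<le>n. if j = i then x j else 0)" by (simp add: p_def coeff_sum)
  also have "\<dots> = 1" using i(1) xi by simp
  finally have "p \<noteq> 0" by auto
  have "{t. linear_form n (\<lambda>j. t ^ j) \<in> P} \<subseteq> {t. poly p t = 0}"
  proof
    fix t assume "t \<in> {t. linear_form n (\<lambda>j. t ^ j) \<in> P}"
    then have lP: "linear_form n (\<lambda>j. t ^ j) \<in> P" by simp
    have "{..n} = insert 0 {1..n}" by auto
    then have l: "linear_form n (\<lambda>j. t ^ j) = (\<Sum>j\<le>n. const (t ^ j) * var j)"
      by (simp add: linear_form_def)
    have "(\<Sum>j\<le>n. const (t ^ j) * (var j - const (x j) * var i)) \<in> P"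
      using x by (intro point_sum[OF pP] point_mult[OF pP] coords_const) auto
    from point_diff[OF pP lP this]
    have "linear_form n (\<lambda>j. t ^ j) - (\<Sum>j\<le>n. const (t ^ j) * (var j - const (x j) * var i)) \<in> P" .
    also have "linear_form n (\<lambda>j. t ^ j) - (\<Sum>j\<le>n. const (t ^ j) * (var j - const (x j) * var i)) =
        const (poly p t) * var i"
      unfolding l by (simp add: p_def poly_sum poly_monom const_sum sum_distrib_left sum_distrib_right
          algebra_simps sum_subtractf[symmetric])
    finally show "t \<in> {t. poly p t = 0}" using const_var by blast
  qed
  then show ?thesis using poly_roots_finite[OF \<open>p \<noteq> 0\<close>] finite_subset by blast
qed

lemma exists_form_missing_supp: "\<exists>a. \<forall>P\<in>supp. linear_form n a \<notin> P"
proof -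
  have "finite (\<Union>P\<in>supp. {t. linear_form n (\<lambda>j. t ^ j) \<in> P})"
    using finite_supp finite_bad_forms by blast
  then obtain t :: complex where "t \<notin> (\<Union>P\<in>supp. {t. linear_form n (\<lambda>j. t ^ j) \<in> P})"
    using infinite_UNIV_char_0 by (metis ex_new_if_finite)
  then show ?thesis by blast
qed

end

section \<open>The coordinate algebra of the subscheme\<close>

context ideal_on_chart begin

definition spanning :: "ratfun set \<Rightarrow> bool" where
  "spanning G \<longleftrightarrow> finite G \<and> G \<subseteq> A \<and> (\<forall>x\<in>A. \<exists>\<gamma>. x - (\<Sum>g\<in>G. scalar (\<gamma> g) * g) \<in> J)"

text \<open>For each coordinate some list of linear factors has its product in \<open>J\<close>. The products of initial
  segments of these lists span, because multiplication by a coordinate lengthens one of the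
  segments or completes it.\<close>

lemma exists_spanning: "\<exists>G. spanning G"
proof -
  obtain cs where cs: "\<And>j. j \<le> n \<Longrightarrow> cs j \<noteq> []"
    "\<And>j. j \<le> n \<Longrightarrow> prod_list (map (\<lambda>c. coordinate j - scalar c) (cs j)) \<in> J"
    using coordinate_roots by blast
  define u where "u j e = (\<Prod>k<e. coordinate j - scalar (cs j ! k))" for j e
  define g where "g \<epsilon> = (\<Prod>j\<le>n. u j (\<epsilon> j))" for \<epsilon> :: "nat \<Rightarrow> nat"
  define Ex where "Ex = PiE {..n} (\<lambda>j. {..<length (cs j)})"
  define G where "G = g ` Ex"
  have uA: "u j e \<in> A" if "j \<le> n" for j e
    unfolding u_def using A_coordinate[OF that] by (intro A_prod A_diff A_scalar)
  have gA: "g \<epsilon> \<in> A" for \<epsilon> unfolding g_def using uA by (intro A_prod) auto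
  have finE: "finite Ex" unfolding Ex_def by (intro finite_PiE) auto
  define W where "W = {x \<in> A. \<exists>\<gamma>. x - (\<Sum>g\<in>G. scalar (\<gamma> g) * g) \<in> J}"
  have finG: "finite G" using finE by (simp add: G_def)
  have W_add: "x + y \<in> W" if xy: "x \<in> W" "y \<in> W" for x y
  proof -
    obtain \<gamma> \<delta> where *: "x - (\<Sum>g\<in>G. scalar (\<gamma> g) * g) \<in> J" "y - (\<Sum>g\<in>G. scalar (\<delta> g) * g) \<in> J"
      using xy unfolding W_def by blast
    have "x + y - (\<Sum>g\<in>G. scalar (\<gamma> g + \<delta> g) * g) =
        (x - (\<Sum>g\<in>G. scalar (\<gamma> g) * g)) + (y - (\<Sum>g\<in>G. scalar (\<delta> g) * g))"
      by (simp only: const_hom(3) fr_hom(3) distrib_right sum.distrib add_diff_add)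
    also have "\<dots> \<in> J" using * by (rule J_add)
    finally show ?thesis using xy A_add unfolding W_def by (auto intro!: exI[of _ "\<lambda>g. \<gamma> g + \<delta> g"])
  qed
  have W_scalar: "scalar z * x \<in> W" if x: "x \<in> W" for x z
  proof -
    obtain \<gamma> where *: "x - (\<Sum>g\<in>G. scalar (\<gamma> g) * g) \<in> J" using x unfolding W_def by blast
    have "scalar z * x - (\<Sum>g\<in>G. scalar (z * \<gamma> g) * g) = scalar z * (x - (\<Sum>g\<in>G. scalar (\<gamma> g) * g))"
      by (simp only: right_diff_distrib sum_distrib_left const_hom(4) fr_hom(4) mult.assoc)
    also have "\<dots> \<in> J" using * by (rule J_scalar)
    finally show ?thesis using x A_mult[OF A_scalar] unfolding W_def by (auto intro!: exI[of _ "\<lambda>g. z * \<gamma> g"])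
  qed
  have W_J: "x \<in> W" if "x \<in> J" for x
    using that J_A unfolding W_def by (auto intro!: exI[of _ "\<lambda>_. 0"])
  have W_G: "x \<in> W" if x: "x \<in> G" for x
  proof -
    have "(\<Sum>g\<in>G. scalar (if g = x then 1 else 0) * g) = (\<Sum>g\<in>G. if g = x then x else 0)"
      by (intro sum.cong) auto
    also have "\<dots> = x" using x finG by simp
    finally show ?thesis using x gA J_0 unfolding W_def G_def by (auto intro!: exI[of _ "\<lambda>g. if g = x then 1 else 0"])
  qed
  have W_sum: "sum f X \<in> W" if "\<And>x. x \<in> X \<Longrightarrow> f x \<in> W" for f and X :: "ratfun set"
    using that by (induction X rule: infinite_finite_induct) (auto intro: W_add W_J J_0)
  \<comment> \<open>Multiplication by \<open>x\<^sub>j / l = (x\<^sub>j / l - z) + z\<close> either raises the exponent \<open>\<epsilon> j\<close> or completes the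
    product of all linear factors, which lies in \<open>J\<close>.\<close>
  have step: "coordinate j * g \<epsilon> \<in> W" if j: "j \<le> n" and \<epsilon>: "\<epsilon> \<in> Ex" for j \<epsilon>
  proof -
    define z where "z = cs j ! (\<epsilon> j)"
    define \<epsilon>' where "\<epsilon>' = \<epsilon>(j := Suc (\<epsilon> j))"
    have lt: "\<epsilon> j < length (cs j)" using \<epsilon> j unfolding Ex_def by auto
    have rest: "(\<Prod>i\<in>{..n} - {j}. u i (\<epsilon>' i)) = (\<Prod>i\<in>{..n} - {j}. u i (\<epsilon> i))"
      by (intro prod.cong) (auto simp: \<epsilon>'_def)
    have g\<epsilon>: "g \<epsilon> = u j (\<epsilon> j) * (\<Prod>i\<in>{..n} - {j}. u i (\<epsilon> i))"
      unfolding g_def using j by (subst prod.remove[of _ j]) auto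
    have g\<epsilon>': "g \<epsilon>' = u j (Suc (\<epsilon> j)) * (\<Prod>i\<in>{..n} - {j}. u i (\<epsilon> i))"
      unfolding g_def rest[symmetric] using j by (subst prod.remove[of _ j]) (auto simp: \<epsilon>'_def)
    have eq: "coordinate j * g \<epsilon> = g \<epsilon>' + scalar z * g \<epsilon>"
    proof -
      have "u j (Suc (\<epsilon> j)) = u j (\<epsilon> j) * (coordinate j - scalar z)"
        by (simp add: u_def z_def)
      then have "g \<epsilon>' = (coordinate j - scalar z) * g \<epsilon>" unfolding g\<epsilon> g\<epsilon>' by (simp only: mult_ac)
      then show ?thesis by (simp only: left_diff_distrib diff_add_cancel)
    qed
    have "g \<epsilon>' \<in> W"
    proof (cases "Suc (\<epsilon> j) < length (cs j)")
      case True
      then have "\<epsilon>' \<in> Ex" using \<epsilon> j unfolding Ex_def \<epsilon>'_def by (auto simp: PiE_iff extensional_def)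
      then show ?thesis using W_G unfolding G_def by blast
    next
      case False
      then have "Suc (\<epsilon> j) = length (cs j)" using lt by simp
      then have "u j (Suc (\<epsilon> j)) = prod_list (map (\<lambda>c. coordinate j - scalar c) (cs j))"
        by (simp add: u_def prod.list_conv_set_nth atLeast0LessThan)
      then have "u j (Suc (\<epsilon> j)) \<in> J" using cs(2)[OF j] by simp
      moreover have "(\<Prod>i\<in>{..n} - {j}. u i (\<epsilon> i)) \<in> A" using uA by (intro A_prod) auto
      ultimately have "(\<Prod>i\<in>{..n} - {j}. u i (\<epsilon> i)) * u j (Suc (\<epsilon> j)) \<in> J" by (intro J_mult)
      then have "g \<epsilon>' \<in> J" unfolding g\<epsilon>' by (simp only: mult.commute)
      then show ?thesis by (rule W_J)
    qed
    moreover have "g \<epsilon> \<in> W" using \<epsilon> W_G unfolding G_def by blast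
    ultimately show ?thesis unfolding eq by (intro W_add W_scalar)
  qed
  have W_coordinate: "coordinate j * x \<in> W" if j: "j \<le> n" and x: "x \<in> W" for j x
  proof -
    obtain \<gamma> where \<gamma>: "x - (\<Sum>g\<in>G. scalar (\<gamma> g) * g) \<in> J" using x unfolding W_def by blast
    have eq: "coordinate j * x = coordinate j * (x - (\<Sum>g\<in>G. scalar (\<gamma> g) * g)) +
        (\<Sum>g\<in>G. scalar (\<gamma> g) * (coordinate j * g))"
      by (simp only: right_diff_distrib sum_distrib_left mult.left_commute diff_add_cancel)
    show ?thesis unfolding eq
    proof (intro W_add W_sum W_scalar)
      show "coordinate j * (x - (\<Sum>g\<in>G. scalar (\<gamma> g) * g)) \<in> W"
        by (rule W_J[OF J_mult[OF A_coordinate[OF j] \<gamma>]])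
      show "coordinate j * h \<in> W" if "h \<in> G" for h using that step[OF j] unfolding G_def by blast
    qed
  qed
  have "restrict (\<lambda>_. 0) {..n} \<in> Ex" using cs(1) unfolding Ex_def by auto
  then have "g (restrict (\<lambda>_. 0) {..n}) \<in> G" unfolding G_def by blast
  then have one: "1 \<in> W" using W_G by (simp add: g_def u_def)
  have "x \<in> W" if "x \<in> A" for x
    using that
  proof (induction x rule: A_induct)
    case (scalar c)
    then show ?case using W_scalar[OF one, of c] by simp
  qed (use W_add W_coordinate in auto)
  then show ?thesis using finG gA unfolding spanning_def W_def G_def by blast
qed

lemma exists_basis:
  obtains c b where "\<And>w. w < (c::nat) \<Longrightarrow> b w \<in> A"
    "\<And>x. x \<in> A \<Longrightarrow> \<exists>\<gamma>. x - (\<Sum>w<c. scalar (\<gamma> w) * b w) \<in> J"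
    "\<And>\<gamma> w. (\<Sum>w<c. scalar (\<gamma> w) * b w) \<in> J \<Longrightarrow> w < c \<Longrightarrow> \<gamma> w = 0"
proof -
  \<comment> \<open>A spanning set of minimal cardinality is independent modulo \<open>J\<close>.\<close>
  obtain G where G: "spanning G" and min: "\<And>G'. spanning G' \<Longrightarrow> card G \<le> card G'"
    using exists_spanning ex_has_least_nat[of spanning _ card] by blast
  have finG: "finite G" and GA: "G \<subseteq> A" and span: "\<forall>x\<in>A. \<exists>\<gamma>. x - (\<Sum>g\<in>G. scalar (\<gamma> g) * g) \<in> J"
    using G unfolding spanning_def by auto
  have indep: "\<delta> h = 0" if \<delta>: "(\<Sum>g\<in>G. scalar (\<delta> g) * g) \<in> J" and h: "h \<in> G" for \<delta> h
  proof (rule ccontr)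
    assume nz: "\<delta> h \<noteq> 0"
    have "spanning (G - {h})"
      unfolding spanning_def
    proof (intro conjI ballI)
      fix x assume "x \<in> A"
      then obtain \<gamma> where \<gamma>: "x - (\<Sum>g\<in>G. scalar (\<gamma> g) * g) \<in> J" using span by blast
      define \<gamma>' where "\<gamma>' g = \<gamma> g - \<gamma> h / \<delta> h * \<delta> g" for g
      have "(\<Sum>g\<in>G. scalar (\<gamma>' g) * g) = (\<Sum>g\<in>G - {h}. scalar (\<gamma>' g) * g)"
        using nz finG by (intro sum.mono_neutral_right) (auto simp: \<gamma>'_def)
      moreover have "(\<Sum>g\<in>G. scalar (\<gamma>' g) * g) =
          (\<Sum>g\<in>G. scalar (\<gamma> g) * g) - scalar (\<gamma> h / \<delta> h) * (\<Sum>g\<in>G. scalar (\<delta> g) * g)"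
        unfolding \<gamma>'_def by (simp only: const_hom(4,5) fr_hom(4,5) left_diff_distrib sum_subtractf sum_distrib_left mult.assoc)
      ultimately have red: "(\<Sum>g\<in>G - {h}. scalar (\<gamma>' g) * g) =
          (\<Sum>g\<in>G. scalar (\<gamma> g) * g) - scalar (\<gamma> h / \<delta> h) * (\<Sum>g\<in>G. scalar (\<delta> g) * g)"
        by (simp only:)
      have "x - (\<Sum>g\<in>G - {h}. scalar (\<gamma>' g) * g) =
          (x - (\<Sum>g\<in>G. scalar (\<gamma> g) * g)) + scalar (\<gamma> h / \<delta> h) * (\<Sum>g\<in>G. scalar (\<delta> g) * g)"
        unfolding red by (simp only: diff_diff_eq2 diff_add_eq)
      also have "\<dots> \<in> J" by (intro J_add \<gamma> J_scalar \<delta>)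
      finally show "\<exists>\<gamma>. x - (\<Sum>g\<in>G - {h}. scalar (\<gamma> g) * g) \<in> J" by blast
    qed (use finG GA in auto)
    then have "card G \<le> card (G - {h})" by (rule min)
    then show False using h finG by (metis card_Diff1_less not_le)
  qed
  obtain b where b: "bij_betw b {..<card G} G"
    using ex_bij_betw_nat_finite[OF finG] by (auto simp: atLeast0LessThan)
  have reindex: "(\<Sum>g\<in>G. scalar (\<gamma> g) * g) = (\<Sum>w<card G. scalar (\<gamma> (b w)) * b w)" for \<gamma>
    using sum.reindex_bij_betw[OF b, of "\<lambda>g. scalar (\<gamma> g) * g"] by simp
  show ?thesis
  proof (rule that[of "card G" b])
    show "b w \<in> A" if "w < card G" for w using b GA that by (auto simp: bij_betw_def)
    show "\<exists>\<gamma>. x - (\<Sum>w<card G. scalar (\<gamma> w) * b w) \<in> J" if x: "x \<in> A" for x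
    proof -
      obtain \<gamma> where "x - (\<Sum>w<card G. scalar (\<gamma> (b w)) * b w) \<in> J"
        using span x unfolding reindex by blast
      then show ?thesis by (intro exI[of _ "\<lambda>w. \<gamma> (b w)"])
    qed
    fix \<gamma> w assume \<gamma>: "(\<Sum>w<card G. scalar (\<gamma> w) * b w) \<in> J" and w: "w < card G"
    define \<delta> where "\<delta> = \<gamma> \<circ> the_inv_into {..<card G} b"
    have inv: "the_inv_into {..<card G} b (b v) = v" if "v < card G" for v
      using b that by (intro the_inv_into_f_f) (auto simp: bij_betw_def)
    have "(\<Sum>g\<in>G. scalar (\<delta> g) * g) = (\<Sum>w<card G. scalar (\<gamma> w) * b w)"
      unfolding reindex \<delta>_def by (intro sum.cong) (auto simp: inv)
    then have "\<delta> (b w) = 0" using \<gamma> b w by (intro indep) (auto simp: bij_betw_def)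
    then show "\<gamma> w = 0" using inv[OF w] by (simp add: \<delta>_def)
  qed
qed

end

text \<open>A hyperplane \<open>l = x\<^sub>0 + a\<^sub>1 x\<^sub>1 + \<dots> + a\<^sub>n x\<^sub>n = 0\<close> that misses the support, and a basis \<open>b\<close> of the
  algebra \<open>A / J\<close> on the complementary chart.\<close>

locale ideal_basis = ideal_stalks n I for n I +
  fixes a :: "nat \<Rightarrow> complex" and c :: nat and b :: "nat \<Rightarrow> ratfun"
  assumes off_supp: "P \<in> supp \<Longrightarrow> linear_form n a \<notin> P"
    and b_A: "w < c \<Longrightarrow> b w \<in> chart.A n (linear_form n a)"
    and b_spans: "x \<in> chart.A n (linear_form n a) \<Longrightarrow>
      \<exists>\<gamma>. x - (\<Sum>w<c. fr (const (\<gamma> w)) * b w) \<in> ideal_on_chart.J n I (linear_form n a)"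
    and b_independent: "(\<Sum>w<c. fr (const (\<gamma> w)) * b w) \<in> ideal_on_chart.J n I (linear_form n a) \<Longrightarrow>
      w < c \<Longrightarrow> \<gamma> w = 0"

lemma (in ideal_stalks) exists_ideal_basis: "\<exists>a c b. ideal_basis n I a c b"
proof -
  obtain a where a: "\<forall>P\<in>supp. linear_form n a \<notin> P" using exists_form_missing_supp by blast
  interpret ideal_on_chart n I "linear_form n a"
    by unfold_locales (use homogeneous_linear_form linear_form_nonzero in auto)
  obtain c b where "\<And>w. w < (c::nat) \<Longrightarrow> b w \<in> A"
    "\<And>x. x \<in> A \<Longrightarrow> \<exists>\<gamma>. x - (\<Sum>w<c. scalar (\<gamma> w) * b w) \<in> J"
    "\<And>\<gamma> w. (\<Sum>w<c. scalar (\<gamma> w) * b w) \<in> J \<Longrightarrow> w < c \<Longrightarrow> \<gamma> w = 0"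
    using exists_basis by blast
  then have "ideal_basis n I a c b"
    using a by unfold_locales auto
  then show ?thesis by blast
qed

context ideal_basis begin

abbreviation l :: mpoly where "l \<equiv> linear_form n a"

sublocale ideal_on_chart n I "linear_form n a"
  by unfold_locales (use homogeneous_linear_form linear_form_nonzero in auto)

definition coord :: "ratfun \<Rightarrow> nat \<Rightarrow> complex" where
  "coord x = (\<lambda>w. if w < c then (SOME \<gamma>. x - (\<Sum>w<c. scalar (\<gamma> w) * b w) \<in> J) w else 0)"

lemma coord_spec:
  assumes "x \<in> A" shows "x - (\<Sum>w<c. scalar (coord x w) * b w) \<in> J"
proof -
  have "x - (\<Sum>w<c. scalar ((SOME \<gamma>. x - (\<Sum>w<c. scalar (\<gamma> w) * b w) \<in> J) w) * b w) \<in> J"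
    by (rule someI_ex[OF b_spans[OF assms]])
  also have "(\<Sum>w<c. scalar ((SOME \<gamma>. x - (\<Sum>w<c. scalar (\<gamma> w) * b w) \<in> J) w) * b w) =
      (\<Sum>w<c. scalar (coord x w) * b w)"
    by (intro sum.cong) (auto simp: coord_def)
  finally show ?thesis .
qed

lemma coord_outside: "\<not> w < c \<Longrightarrow> coord x w = 0"
  by (simp add: coord_def)

lemma coord_unique:
  assumes x: "x \<in> A" and \<gamma>: "x - (\<Sum>w<c. scalar (\<gamma> w) * b w) \<in> J" and "w < c"
  shows "coord x w = \<gamma> w"
proof -
  have "(\<Sum>w<c. scalar (coord x w - \<gamma> w) * b w) =
      (x - (\<Sum>w<c. scalar (\<gamma> w) * b w)) - (x - (\<Sum>w<c. scalar (coord x w) * b w))"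
    by (simp add: left_diff_distrib sum_subtractf)
  also have "\<dots> \<in> J" by (rule J_diff[OF \<gamma> coord_spec[OF x]])
  finally have "coord x w - \<gamma> w = 0" by (rule b_independent) fact
  then show ?thesis by simp
qed

lemma coord_J: assumes "x \<in> J" shows "coord x w = 0"
proof (cases "w < c")
  case True
  show ?thesis by (rule coord_unique[OF J_A[OF assms] _ True]) (use assms in simp)
qed (simp add: coord_outside)

lemma coord_add:
  assumes "x \<in> A" "y \<in> A" shows "coord (x + y) w = coord x w + coord y w"
proof (cases "w < c")
  case True
  have "x + y - (\<Sum>w<c. scalar (coord x w + coord y w) * b w) =
      (x - (\<Sum>w<c. scalar (coord x w) * b w)) + (y - (\<Sum>w<c. scalar (coord y w) * b w))"
    by (simp only: const_hom(3) fr_hom(3) distrib_right sum.distrib add_diff_add)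
  also have "\<dots> \<in> J" by (intro J_add coord_spec assms)
  finally show ?thesis by (rule coord_unique[OF A_add[OF assms] _ True])
qed (simp add: coord_outside)

lemma coord_scalar:
  assumes "x \<in> A" shows "coord (scalar z * x) w = z * coord x w"
proof (cases "w < c")
  case True
  have "scalar z * x - (\<Sum>w<c. scalar (z * coord x w) * b w) =
      scalar z * (x - (\<Sum>w<c. scalar (coord x w) * b w))"
    by (simp only: right_diff_distrib sum_distrib_left const_hom(4) fr_hom(4) mult.assoc)
  also have "\<dots> \<in> J" by (intro J_scalar coord_spec assms)
  finally show ?thesis by (rule coord_unique[OF A_mult[OF A_scalar assms] _ True])
qed (simp add: coord_outside)

lemma coord_basis:
  assumes "v < c" shows "coord (b v) w = (if w = v then 1 else 0)"
proof (cases "w < c")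
  case True
  have "(\<Sum>w<c. scalar (if w = v then 1 else 0) * b w) = (\<Sum>w<c. if w = v then b v else 0)"
    by (intro sum.cong) auto
  then have "b v - (\<Sum>w<c. scalar (if w = v then 1 else 0) * b w) \<in> J"
    using assms J_0 by simp
  then show ?thesis by (rule coord_unique[OF b_A[OF assms] _ True, of "\<lambda>w. if w = v then 1 else 0"])
qed (use assms in \<open>auto simp: coord_outside\<close>)

text \<open>The matrix of multiplication by \<open>x\<^sub>j / l\<close> on \<open>A / J\<close>. It is zero for \<open>j > n\<close>, so that the
  matrices commute without restriction on the index.\<close>

definition B :: "nat \<Rightarrow> nat \<Rightarrow> nat \<Rightarrow> complex" where
  "B j v w = (if j \<le> n \<and> w < c then coord (coordinate j * b w) v else 0)"

lemma coord_coordinate: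
  assumes j: "j \<le> n" and x: "x \<in> A"
  shows "coord (coordinate j * x) v = (\<Sum>w<c. B j v w * coord x w)"
proof (cases "v < c")
  case True
  define U where "U w = (\<Sum>v<c. scalar (coord (coordinate j * b w) v) * b v)" for w
  have S: "(\<Sum>v<c. scalar (\<Sum>w<c. B j v w * coord x w) * b v) = (\<Sum>w<c. scalar (coord x w) * U w)"
  proof -
    have "(\<Sum>v<c. scalar (\<Sum>w<c. B j v w * coord x w) * b v) = (\<Sum>v<c. \<Sum>w<c. scalar (coord x w) * (scalar (B j v w) * b v))"
      by (simp add: const_sum fr_sum sum_distrib_right sum_distrib_left mult_ac)
    also have "\<dots> = (\<Sum>w<c. \<Sum>v<c. scalar (coord x w) * (scalar (B j v w) * b v))"
      by (rule sum.swap)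
    also have "\<dots> = (\<Sum>w<c. scalar (coord x w) * U w)"
      unfolding U_def sum_distrib_left by (intro sum.cong refl) (use j in \<open>simp add: B_def\<close>)
    finally show ?thesis .
  qed
  have X: "coordinate j * (x - (\<Sum>w<c. scalar (coord x w) * b w)) =
      coordinate j * x - (\<Sum>w<c. scalar (coord x w) * (coordinate j * b w))"
    by (simp only: right_diff_distrib sum_distrib_left mult.left_commute)
  have Z: "(\<Sum>w<c. scalar (coord x w) * (coordinate j * b w - U w)) =
      (\<Sum>w<c. scalar (coord x w) * (coordinate j * b w)) - (\<Sum>w<c. scalar (coord x w) * U w)"
    by (simp only: right_diff_distrib sum_subtractf)
  have "coordinate j * x - (\<Sum>v<c. scalar (\<Sum>w<c. B j v w * coord x w) * b v) =
      coordinate j * (x - (\<Sum>w<c. scalar (coord x w) * b w)) +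
      (\<Sum>w<c. scalar (coord x w) * (coordinate j * b w - U w))"
    unfolding S X Z by simp
  also have "\<dots> \<in> J"
    unfolding U_def by (intro J_add J_mult J_sum J_scalar coord_spec x A_mult A_coordinate j b_A) auto
  finally show ?thesis by (rule coord_unique[OF A_mult[OF A_coordinate[OF j] x] _ True])
qed (auto simp: coord_outside B_def intro!: sum.neutral)

sublocale commuting_matrices B c
proof
  show "B j v w = 0" if "\<not> v < c" for j v w using that by (simp add: B_def coord_outside)
  fix i v j w
  have B_eq: "(\<Sum>u<c. B i v u * B j u w) = coord (coordinate i * (coordinate j * b w)) v"
    if "i \<le> n" "j \<le> n" "w < c" for i j
    using that coord_coordinate[OF that(1) A_mult[OF A_coordinate[OF that(2)] b_A[OF that(3)]], of v]
    by (simp add: B_def)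
  show "(\<Sum>u<c. B i v u * B j u w) = (\<Sum>u<c. B j v u * B i u w)"
  proof (cases "i \<le> n \<and> j \<le> n \<and> w < c")
    case True
    then show ?thesis using B_eq[of i j] B_eq[of j i] by (simp only: mult.left_commute)
  next
    case False
    then show ?thesis by (auto simp: B_def)
  qed
qed

end

section \<open>Exactness on stalks\<close>

text \<open>The degree of the denominator is made large enough that the numerators have positive degree,
  as the graded exactness requires.\<close>

lemma stalk_common_denominator:
  assumes P: "P \<in> proj_points n" and "finite X" "\<And>x. x \<in> X \<Longrightarrow> f x \<in> twist_stalk n d P"
  shows "\<exists>g m p. homogeneous n m g \<and> g \<notin> P \<and> int m + d \<ge> 1 \<and>
    (\<forall>x\<in>X. homogeneous n (nat (int m + d)) (p x) \<and> f x = fr (p x) / fr g)"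
  using assms(2,3)
proof (induction X)
  case empty
  obtain i where i: "i \<le> n" "var i \<notin> P" using point_var[OF P] .
  let ?N = "Suc (nat \<bar>d\<bar>)"
  have "homogeneous n ?N (var i ^ ?N)"
    using homogeneous_power[OF homogeneous_var[OF i(1)], of ?N] by simp
  moreover have "var i ^ ?N \<notin> P" by (rule point_power_notin[OF P homogeneous_var[OF i(1)] i(2)])
  ultimately show ?case by (intro exI[of _ "var i ^ ?N"] exI[of _ ?N]) auto
next
  case (insert x X)
  then obtain g m p where g: "homogeneous n m g" "g \<notin> P" "int m + d \<ge> 1"
    and p: "\<And>x. x \<in> X \<Longrightarrow> homogeneous n (nat (int m + d)) (p x)" "\<And>x. x \<in> X \<Longrightarrow> f x = fr (p x) / fr g"
    by (metis insertCI)
  have "f x \<in> twist_stalk n d P" using insert by blast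
  then obtain f' g' k k' where q: "homogeneous n k f'" "homogeneous n k' g'" "int k = int k' + d" "g' \<notin> P"
    "f x = fr f' / fr g'" by (rule twist_stalkE)
  have nz: "g \<noteq> 0" "g' \<noteq> 0" using notin_point_nonzero[OF P] g(2) q(4) by auto
  define p' where "p' y = (if y = x then g * f' else p y * g')" for y
  have "homogeneous n (nat (int (m + k') + d)) (p' y) \<and> f y = fr (p' y) / fr (g * g')" if y: "y \<in> insert x X" for y
  proof (cases "y = x")
    case True
    have "nat (int (m + k') + d) = m + k" using q(3) by simp
    then show ?thesis using True q nz g(1) by (simp add: p'_def homogeneous_mult)
  next
    case False
    have "nat (int (m + k') + d) = nat (int m + d) + k'" using g(3) by simp
    then show ?thesis using False y p q(2) nz by (simp add: p'_def homogeneous_mult)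
  qed
  moreover have "homogeneous n (m + k') (g * g')" using g q by (intro homogeneous_mult)
  moreover have "g * g' \<notin> P" using point_mult_notin[OF P g(1) q(2)] g q by blast
  moreover have "int (m + k') + d \<ge> 1" using g(3) by simp
  ultimately show ?case by blast
qed

context ideal_basis begin

abbreviation X :: "nat \<Rightarrow> (nat \<Rightarrow> ratfun) \<Rightarrow> nat \<Rightarrow> ratfun" where
  "X \<equiv> pencil (\<lambda>z. fr (const z)) (\<lambda>j. fr (var j)) (fr l) B c"

text \<open>The operators \<open>X\<close> divided by \<open>l\<close>, for use at points of the chart.\<close>

abbreviation X' :: "nat \<Rightarrow> (nat \<Rightarrow> ratfun) \<Rightarrow> nat \<Rightarrow> ratfun" where
  "X' \<equiv> pencil (\<lambda>z. fr (const z)) (\<lambda>j. fr (var j) / fr l) 1 B c"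

lemma X_eq: "X j s v = fr l * X' j s v"
  using l_nonzero by (simp add: pencil_def algebra_simps)

text \<open>Exactness of the localised Koszul complex follows from the graded exactness by clearing
  denominators.\<close>

lemma stalk_koszul_exact:
  assumes P: "P \<in> proj_points n"
    and s: "\<And>S v. s S v \<in> twist_stalk n d P" "\<And>S. s S \<in> vectors" "s {} = (\<lambda>_. 0)"
    and ks: "\<And>S v. S \<subseteq> {1..n} \<Longrightarrow> koszul X n s S v = 0"
  obtains t where "\<And>S v. t S v \<in> twist_stalk n (d - 1) P" "\<And>S. t S \<in> vectors"
    "\<And>S v. S \<subseteq> {1..n} \<Longrightarrow> koszul X n t S v = s S v"
proof -
  have "\<exists>g m p. homogeneous n m g \<and> g \<notin> P \<and> int m + d \<ge> 1 \<and> (\<forall>x\<in>Pow {1..n} \<times> {..<c}.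
      homogeneous n (nat (int m + d)) (p x) \<and> s (fst x) (snd x) = fr (p x) / fr g)"
    by (rule stalk_common_denominator[OF P]) (simp_all add: s(1))
  then obtain g m p where g: "homogeneous n m g" "g \<notin> P" "int m + d \<ge> 1"
    and p': "\<forall>x\<in>Pow {1..n} \<times> {..<c}. homogeneous n (nat (int m + d)) (p x) \<and> s (fst x) (snd x) = fr (p x) / fr g"
    by blast
  have p: "homogeneous n (nat (int m + d)) (p (S, v)) \<and> s S v = fr (p (S, v)) / fr g" if "S \<subseteq> {1..n}" "v < c" for S v
    using bspec[OF p', of "(S, v)"] that by simp
  have g0: "fr g \<noteq> 0" using notin_point_nonzero[OF P g(2)] by simp
  define f where "f S v = (if S \<subseteq> {1..n} \<and> v < c \<and> S \<noteq> {} then p (S, v) else 0)" for S v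
  have fs: "fr (f S v) = fr g * s S v" if "S \<subseteq> {1..n}" for S v
  proof (cases "v < c \<and> S \<noteq> {}")
    case True
    then show ?thesis using p[OF that, of v] that g0 by (simp add: f_def)
  next
    case False
    then have "s S v = 0" using s(2)[of S] s(3) by (auto simp: vectors_def)
    then show ?thesis using False by (auto simp: f_def)
  qed
  define k where "k = nat (int m + d) - 1"
  have k: "nat (int m + d) = Suc k" "int m + d = int k + 1" using g(3) by (simp_all add: k_def)
  have kf: "koszul (pencil const var l B c) n f S = 0" if S: "S \<subseteq> {1..n}" for S
  proof
    fix v
    have "fr (koszul (pencil const var l B c) n f S v) = koszul X n (\<lambda>S v. fr (f S v)) S v"
      by (rule koszul_pencil_transport[where D = UNIV]) auto
    also have "\<dots> = koszul X n (\<lambda>S v. fr g * s S v) S v"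
      unfolding koszul_apply
    proof (intro sum.cong refl arg_cong[where f = "ksign _ _"])
      fix j assume "j \<in> {1..n} - S"
      then have "insert j S \<subseteq> {1..n}" using S by auto
      then have "(\<lambda>v. fr (f (insert j S) v)) = (\<lambda>v. fr g * s (insert j S) v)" using fs by blast
      then show "X j (\<lambda>v. fr (f (insert j S) v)) v = X j (\<lambda>v. fr g * s (insert j S) v) v" by (simp only:)
    qed
    also have "\<dots> = fr g * koszul X n s S v"
      by (rule koszul_pencil_transport[where D = UNIV and h' = "\<lambda>q. fr g * q", symmetric])
        (auto simp: algebra_simps)
    also have "\<dots> = 0" using ks[OF S] by simp
    finally show "koszul (pencil const var l B c) n f S v = 0 v" by simp
  qed
  obtain t0 where t0: "\<And>S v. homogeneous n k (t0 S v)" "\<And>S. t0 S \<in> vectors"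
    "\<And>S. S \<subseteq> {1..n} \<Longrightarrow> koszul (pencil const var l B c) n t0 S = f S"
  proof (rule koszul_exact_graded[of n k f a])
    show "homogeneous n (Suc k) (f S v)" for S v
      using p[of S v] k by (auto simp: f_def)
    show "f S \<in> vectors" for S by (auto simp: f_def vectors_def)
    show "f {} = 0" by (simp add: f_def fun_eq_iff)
  qed (use kf in auto)
  show ?thesis
  proof (rule that[of "\<lambda>S v. 1 / fr g * fr (t0 S v)"])
    fix S v
    show "1 / fr g * fr (t0 S v) \<in> twist_stalk n (d - 1) P"
      by (rule twist_stalkI[OF t0(1) g(1) _ g(2)]) (use k(2) in auto)
    show "(\<lambda>v. 1 / fr g * fr (t0 S v)) \<in> vectors"
      using t0(2)[of S] by (simp add: vectors_def)
    assume S: "S \<subseteq> {1..n}"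
    have "koszul X n (\<lambda>S v. 1 / fr g * fr (t0 S v)) S v = 1 / fr g * fr (koszul (pencil const var l B c) n t0 S v)"
      by (rule koszul_pencil_transport[where D = UNIV and h' = "\<lambda>q. 1 / fr g * fr q", symmetric])
        (auto simp: algebra_simps add_divide_distrib)
    also have "\<dots> = s S v" using t0(3)[OF S] fs[OF S, of v] g0 by simp
    finally show "koszul X n (\<lambda>S v. 1 / fr g * fr (t0 S v)) S v = s S v" .
  qed
qed

definition pencil_image :: "(nat \<Rightarrow> (nat \<Rightarrow> ratfun) \<Rightarrow> nat \<Rightarrow> ratfun) \<Rightarrow> ratfun set \<Rightarrow> (nat \<Rightarrow> ratfun) set" where
  "pencil_image T D = {s. \<exists>r. (\<forall>j. r j \<in> vectors) \<and> (\<forall>j v. r j v \<in> D) \<and>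
     (\<forall>v. s v = (\<Sum>j\<in>{1..n}. T j (r j) v))}"

lemma pencil_imageI:
  "(\<And>j. r j \<in> vectors) \<Longrightarrow> (\<And>j v. r j v \<in> D) \<Longrightarrow> (\<And>v. s v = (\<Sum>j\<in>{1..n}. T j (r j) v)) \<Longrightarrow> s \<in> pencil_image T D"
  unfolding pencil_image_def by blast

lemma pencil_imageE:
  assumes "s \<in> pencil_image T D"
  obtains r where "\<And>j. r j \<in> vectors" "\<And>j v. r j v \<in> D" "\<And>v. s v = (\<Sum>j\<in>{1..n}. T j (r j) v)"
  using assms unfolding pencil_image_def by blast

lemma pencil_sum_apply: "pencil e x m B c j (\<lambda>v. r v + t v) v = pencil e x m B c j r v + pencil e x m B c j t v"
  using pencil_add[of e x m B c j r t] by (simp add: fun_eq_iff plus_fun_def)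

lemma pencil_scale_apply: "pencil e x m B c j (\<lambda>v. q * r v) v = q * pencil e x m B c j r v"
  by (simp add: pencil_scale)

lemma pencil_zero_apply: "pencil e x m B c j (\<lambda>v. 0) v = 0"
  by (simp add: pencil_def act_def)

lemma pencil_image_add:
  assumes D: "\<And>x y. x \<in> D \<Longrightarrow> y \<in> D \<Longrightarrow> x + y \<in> D"
    and "s \<in> pencil_image (pencil e x m B c) D" "t \<in> pencil_image (pencil e x m B c) D"
  shows "(\<lambda>v. s v + t v) \<in> pencil_image (pencil e x m B c) D"
proof -
  obtain r where r: "\<And>j. r j \<in> vectors" "\<And>j v. r j v \<in> D" "\<And>v. s v = (\<Sum>j\<in>{1..n}. pencil e x m B c j (r j) v)"
    using assms(2) by (rule pencil_imageE) blast
  obtain r' where r': "\<And>j. r' j \<in> vectors" "\<And>j v. r' j v \<in> D" "\<And>v. t v = (\<Sum>j\<in>{1..n}. pencil e x m B c j (r' j) v)"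
    using assms(3) by (rule pencil_imageE) blast
  show ?thesis
  proof (rule pencil_imageI[of "\<lambda>j v. r j v + r' j v"])
    show "(\<lambda>v. r j v + r' j v) \<in> vectors" for j using r(1)[of j] r'(1)[of j] by (simp add: vectors_def)
    show "r j v + r' j v \<in> D" for j v using D r r' by blast
    show "s v + t v = (\<Sum>j\<in>{1..n}. pencil e x m B c j (\<lambda>v. r j v + r' j v) v)" for v
      unfolding pencil_sum_apply sum.distrib r(3) r'(3) ..
  qed
qed

lemma pencil_image_scale:
  assumes D: "\<And>x. x \<in> D \<Longrightarrow> q * x \<in> D'" and s: "s \<in> pencil_image (pencil e x m B c) D"
  shows "(\<lambda>v. q * s v) \<in> pencil_image (pencil e x m B c) D'"
proof -
  obtain r where r: "\<And>j. r j \<in> vectors" "\<And>j v. r j v \<in> D" "\<And>v. s v = (\<Sum>j\<in>{1..n}. pencil e x m B c j (r j) v)"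
    using s by (rule pencil_imageE) blast
  show ?thesis
  proof (rule pencil_imageI[of "\<lambda>j v. q * r j v"])
    show "(\<lambda>v. q * r j v) \<in> vectors" for j using r(1)[of j] by (simp add: vectors_def)
    show "q * r j v \<in> D'" for j v using D r by blast
    show "q * s v = (\<Sum>j\<in>{1..n}. pencil e x m B c j (\<lambda>v. q * r j v) v)" for v
      unfolding pencil_scale_apply r(3) sum_distrib_left ..
  qed
qed

lemma pencil_image_single:
  assumes "j \<in> {1..n}" "r \<in> vectors" "\<And>v. r v \<in> D" "0 \<in> D"
  shows "pencil e x m B c j r \<in> pencil_image (pencil e x m B c) D"
proof (rule pencil_imageI[of "\<lambda>i. if i = j then r else (\<lambda>_. 0)"])
  fix v
  have "(\<Sum>i\<in>{1..n}. pencil e x m B c i (if i = j then r else (\<lambda>_. 0)) v) =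
      (\<Sum>i\<in>{1..n}. if i = j then pencil e x m B c j r v else 0)"
    by (intro sum.cong) (auto simp: pencil_zero_apply)
  then show "pencil e x m B c j r v = (\<Sum>i\<in>{1..n}. pencil e x m B c i (if i = j then r else (\<lambda>_. 0)) v)"
    using assms(1) by simp
qed (use assms in \<open>auto simp: vectors_def\<close>)

lemma pencil_image_zero: "0 \<in> D \<Longrightarrow> (\<lambda>_. 0) \<in> pencil_image (pencil e x m B c) D"
  by (rule pencil_imageI[of "\<lambda>_ _. 0"]) (auto simp: vectors_def pencil_zero_apply)

lemma pencil_image_sum:
  assumes "\<And>x y. x \<in> D \<Longrightarrow> y \<in> D \<Longrightarrow> x + y \<in> D" "0 \<in> D"
    and "\<And>i. i \<in> K \<Longrightarrow> s i \<in> pencil_image (pencil e x m B c) D"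
  shows "(\<lambda>v. \<Sum>i\<in>K. s i v) \<in> pencil_image (pencil e x m B c) D"
  using assms(3)
proof (induction K rule: infinite_finite_induct)
  case (insert i K)
  then show ?case using pencil_image_add[OF assms(1), of "s i" e x m "\<lambda>v. \<Sum>i\<in>K. s i v"] by simp
qed (simp_all add: pencil_image_zero[OF assms(2)])

lemma pencil_image_X:
  assumes "s \<in> pencil_image X' D" shows "(\<lambda>v. fr l * s v) \<in> pencil_image X D"
proof -
  obtain r where r: "\<And>j. r j \<in> vectors" "\<And>j v. r j v \<in> D" "\<And>v. s v = (\<Sum>j\<in>{1..n}. X' j (r j) v)"
    using assms by (rule pencil_imageE) blast
  show ?thesis
    by (rule pencil_imageI[of r]) (use r in \<open>auto simp: X_eq sum_distrib_left\<close>)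
qed

text \<open>The class of \<open>x\<close> in \<open>A / J\<close> as a vector of constant functions.\<close>

definition coord_vector :: "ratfun \<Rightarrow> nat \<Rightarrow> ratfun" where
  "coord_vector x = (\<lambda>v. scalar (coord x v))"

lemma coord_vector_vectors: "coord_vector x \<in> vectors"
  by (simp add: coord_vector_def vectors_def coord_outside)

lemma coord_vector_A: "coord_vector x v \<in> A"
  by (simp add: coord_vector_def)

lemma coord_vector_add: "x \<in> A \<Longrightarrow> y \<in> A \<Longrightarrow> coord_vector (x + y) v = coord_vector x v + coord_vector y v"
  by (simp add: coord_vector_def coord_add)

lemma coord_vector_scalar: "x \<in> A \<Longrightarrow> coord_vector (scalar z * x) v = scalar z * coord_vector x v"
  by (simp add: coord_vector_def coord_scalar)

lemma coord_vector_J: "x \<in> J \<Longrightarrow> coord_vector x v = 0"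
  by (simp add: coord_vector_def coord_J)

lemma coord_vector_coordinate:
  "j \<le> n \<Longrightarrow> x \<in> A \<Longrightarrow> coord_vector (coordinate j * x) v = act (\<lambda>z. fr (const z)) B c j (coord_vector x) v"
  by (simp only: coord_vector_def act_def coord_coordinate const_sum fr_sum const_hom(4) fr_hom(4))

lemma vector_as_combination:
  assumes "s \<in> vectors" shows "s v = (\<Sum>w<c. s w * coord_vector (b w) v)"
proof (cases "v < c")
  case True
  have "(\<Sum>w<c. s w * coord_vector (b w) v) = (\<Sum>w<c. if w = v then s v else 0)"
    by (intro sum.cong) (auto simp: coord_vector_def coord_basis)
  then show ?thesis using True by simp
next
  case False
  then show ?thesis using assms by (simp add: vectors_def coord_vector_def coord_outside)
qed

text \<open>For a coordinate \<open>x\<^sub>j / l\<close> this is the definition of the pencil, since \<open>B\<^sub>j\<close> represents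
  multiplication by that coordinate; the coordinates generate the chart ring.\<close>

lemma multiplication_mod_pencil:
  assumes "f \<in> A" "x \<in> A"
  shows "(\<lambda>v. f * coord_vector x v - coord_vector (f * x) v) \<in> pencil_image X' A"
proof -
  define W where "W = {f \<in> A. \<forall>x\<in>A. (\<lambda>v. f * coord_vector x v - coord_vector (f * x) v) \<in> pencil_image X' A}"
  have W_add: "f + g \<in> W" if f: "f \<in> W" and g: "g \<in> W" for f g
  proof -
    have fg: "f \<in> A" "g \<in> A" using f g by (auto simp: W_def)
    have "(\<lambda>v. (f + g) * coord_vector x v - coord_vector ((f + g) * x) v) \<in> pencil_image X' A" if x: "x \<in> A" for x
    proof -
      have "(\<lambda>v. (f * coord_vector x v - coord_vector (f * x) v) + (g * coord_vector x v - coord_vector (g * x) v)) \<in> pencil_image X' A"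
        using f g x by (intro pencil_image_add A_add) (auto simp: W_def)
      moreover have "(f * coord_vector x v - coord_vector (f * x) v) + (g * coord_vector x v - coord_vector (g * x) v) =
          (f + g) * coord_vector x v - coord_vector ((f + g) * x) v" for v
        using coord_vector_add[OF A_mult[OF fg(1) x] A_mult[OF fg(2) x]] by (simp add: algebra_simps)
      ultimately show ?thesis by (simp only:)
    qed
    then show ?thesis using fg A_add by (simp add: W_def)
  qed
  have W_scalar: "scalar z * f \<in> W" if f: "f \<in> W" for z f
  proof -
    have fA: "f \<in> A" using f by (simp add: W_def)
    have "(\<lambda>v. scalar z * f * coord_vector x v - coord_vector (scalar z * f * x) v) \<in> pencil_image X' A" if x: "x \<in> A" for x
    proof -
      have "(\<lambda>v. scalar z * (f * coord_vector x v - coord_vector (f * x) v)) \<in> pencil_image X' A"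
        using f x A_mult[OF A_scalar] by (intro pencil_image_scale[where D = A]) (auto simp: W_def)
      moreover have "scalar z * (f * coord_vector x v - coord_vector (f * x) v) = scalar z * f * coord_vector x v - coord_vector (scalar z * f * x) v" for v
        using coord_vector_scalar[OF A_mult[OF fA x]] by (simp add: right_diff_distrib mult.assoc)
      ultimately show ?thesis by (simp only:)
    qed
    then show ?thesis using fA A_mult[OF A_scalar] by (simp add: W_def)
  qed
  have W_1: "1 \<in> W" by (simp add: W_def pencil_image_zero)
  have W_coordinate: "coordinate j * f \<in> W" if f: "f \<in> W" and j: "j \<in> {1..n}" for j f
  proof -
    have fA: "f \<in> A" and jn: "j \<le> n" using f j by (auto simp: W_def)
    have "(\<lambda>v. coordinate j * f * coord_vector x v - coord_vector (coordinate j * f * x) v) \<in> pencil_image X' A" if x: "x \<in> A" for x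
    proof -
      have "(\<lambda>v. coordinate j * (f * coord_vector x v - coord_vector (f * x) v)) \<in> pencil_image X' A"
        using f x A_mult[OF A_coordinate[OF jn]] by (intro pencil_image_scale[where D = A]) (auto simp: W_def)
      then have "(\<lambda>v. coordinate j * (f * coord_vector x v - coord_vector (f * x) v) + X' j (coord_vector (f * x)) v) \<in> pencil_image X' A"
        by (intro pencil_image_add A_add pencil_image_single j coord_vector_vectors coord_vector_A) auto
      moreover have "coordinate j * (f * coord_vector x v - coord_vector (f * x) v) + X' j (coord_vector (f * x)) v =
          coordinate j * f * coord_vector x v - coord_vector (coordinate j * f * x) v" for v
        using coord_vector_coordinate[OF jn A_mult[OF fA x], of v]
        by (simp only: pencil_def mult_1 right_diff_distrib mult.assoc) simp
      ultimately show ?thesis by (simp only:)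
    qed
    then show ?thesis using fA A_mult[OF A_coordinate[OF jn]] by (simp add: W_def)
  qed
  have W_sum: "sum g K \<in> W" if "\<And>i. i \<in> K \<Longrightarrow> g i \<in> W" for g and K :: "nat set"
    using that
  proof (induction K rule: infinite_finite_induct)
    case (insert i K)
    then show ?case by (simp add: W_add)
  qed (use W_scalar[OF W_1, of 0] in simp_all)
  \<comment> \<open>The operators do not involve \<open>x\<^sub>0\<close>, which is a combination of \<open>l\<close> and the other coordinates.\<close>
  have W_coordinate_0: "coordinate 0 * f \<in> W" if f: "f \<in> W" for f
  proof -
    have "fr (var 0) = fr l - (\<Sum>j\<in>{1..n}. scalar (a j) * fr (var j))"
      by (simp add: linear_form_def fr_sum)
    then have "coordinate 0 = 1 - (\<Sum>j\<in>{1..n}. scalar (a j) * coordinate j)"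
      using l_nonzero by (simp add: diff_divide_distrib sum_divide_distrib)
    then have eq: "coordinate 0 * f = f + scalar (- 1) * (\<Sum>j\<in>{1..n}. scalar (a j) * (coordinate j * f))"
      by (simp add: left_diff_distrib sum_distrib_right mult.assoc)
    show ?thesis unfolding eq by (intro W_add f W_scalar W_sum W_coordinate)
  qed
  have "f \<in> W" using assms(1)
  proof (induction f rule: A_induct)
    case (scalar z)
    then show ?case using W_scalar[OF W_1, of z] by simp
  next
    case (coordinate f j)
    then show ?case using W_coordinate[of f j] W_coordinate_0[of f] by (cases "j = 0") auto
  qed (rule W_add)
  then show ?thesis using assms(2) by (simp add: W_def)
qed

text \<open>For \<open>f \<in> J\<close> the class of \<open>f\<close> vanishes, so \<open>f\<close> times the unit vector lies in the image.\<close>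

lemma unit_vector_multiple_of_ideal:
  assumes P: "P \<in> proj_points n" "l \<notin> P" and r: "r \<in> I P"
  shows "(\<lambda>v. r * coord_vector 1 v) \<in> pencil_image X' (local_ring n P)"
proof -
  obtain h where h: "h \<in> A" "h \<notin> max_ideal n P" "h * r \<in> J" by (rule stalk_from_J[OF P r])
  have im: "(\<lambda>v. h * r * coord_vector 1 v) \<in> pencil_image X' A"
    using multiplication_mod_pencil[OF J_A[OF h(3)] A_1] by (simp add: coord_vector_J[OF h(3)])
  have "(\<lambda>v. 1 / h * (h * r * coord_vector 1 v)) \<in> pencil_image X' (local_ring n P)"
  proof (rule pencil_image_scale[OF _ im])
    show "1 / h * x \<in> local_ring n P" if "x \<in> A" for x
      by (rule stalk_smult[OF P(1) local_unit(1)[OF P(1) A_local[OF h(1) P] h(2)] A_local[OF that P]])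
  qed
  moreover have "h \<noteq> 0" using local_unit(2)[OF P(1) A_local[OF h(1) P] h(2)] .
  ultimately show ?thesis by simp
qed

text \<open>The evaluation \<open>s \<mapsto> \<Sum>v. s v * b v\<close> inverts the formation of coordinate vectors modulo the
  ideal. It annihilates the image of the pencil because \<open>B\<^sub>j\<close> represents multiplication by the
  coordinate.\<close>

lemma pencil_evaluation:
  assumes P: "P \<in> proj_points n" "l \<notin> P" and s: "s \<in> vectors" "\<And>v. s v \<in> local_ring n P" and j: "j \<le> n"
  shows "(\<Sum>v<c. X' j s v * b v) \<in> I P"
proof -
  have "(\<Sum>v<c. X' j s v * b v) =
      (\<Sum>w<c. s w * (coordinate j * b w)) - (\<Sum>v<c. \<Sum>w<c. s w * (scalar (B j v w) * b v))"
    by (simp only: pencil_def act_def mult_1 left_diff_distrib sum_subtractf sum_distrib_right)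
      (simp only: mult_ac)
  also have "(\<Sum>v<c. \<Sum>w<c. s w * (scalar (B j v w) * b v)) = (\<Sum>w<c. s w * (\<Sum>v<c. scalar (B j v w) * b v))"
    by (subst sum.swap) (simp add: sum_distrib_left)
  also have "(\<Sum>w<c. s w * (coordinate j * b w)) - \<dots> =
      (\<Sum>w<c. s w * (coordinate j * b w - (\<Sum>v<c. scalar (B j v w) * b v)))"
    by (simp only: right_diff_distrib sum_subtractf)
  also have "\<dots> \<in> I P"
  proof (intro I_sum[OF P(1)] I_mult[OF P(1)] s(2))
    fix w assume "w \<in> {..<c}"
    then have w: "w < c" by simp
    have "coordinate j * b w - (\<Sum>v<c. scalar (coord (coordinate j * b w) v) * b v) \<in> J"
      by (rule coord_spec[OF A_mult[OF A_coordinate[OF j] b_A[OF w]]])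
    then show "coordinate j * b w - (\<Sum>v<c. scalar (B j v w) * b v) \<in> I P"
      using J_stalk[OF _ P] w j by (simp add: B_def)
  qed
  finally show ?thesis .
qed

lemma ideal_from_unit_vector:
  assumes P: "P \<in> proj_points n" "l \<notin> P" and r: "r \<in> local_ring n P"
    and im: "(\<lambda>v. r * coord_vector 1 v) \<in> pencil_image X' (local_ring n P)"
  shows "r \<in> I P"
proof -
  obtain t where t: "\<And>j. t j \<in> vectors" "\<And>j v. t j v \<in> local_ring n P"
    "\<And>v. r * coord_vector 1 v = (\<Sum>j\<in>{1..n}. X' j (t j) v)"
    using im by (rule pencil_imageE) blast
  have "r * (\<Sum>v<c. scalar (coord 1 v) * b v) = (\<Sum>v<c. (r * coord_vector 1 v) * b v)"
    by (simp add: coord_vector_def sum_distrib_left mult.assoc)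
  also have "\<dots> = (\<Sum>j\<in>{1..n}. \<Sum>v<c. X' j (t j) v * b v)"
    unfolding t(3) sum_distrib_right by (rule sum.swap)
  also have "\<dots> \<in> I P"
    using t by (intro I_sum[OF P(1)] pencil_evaluation[OF P]) auto
  finally have 1: "r * (\<Sum>v<c. scalar (coord 1 v) * b v) \<in> I P" .
  have 2: "r * (1 - (\<Sum>v<c. scalar (coord 1 v) * b v)) \<in> I P"
    by (intro I_mult[OF P(1) r] J_stalk[OF _ P] coord_spec) simp
  from I_add[OF P(1) 1 2] show ?thesis by (simp add: right_diff_distrib)
qed

text \<open>Modulo the image, the coordinate vector of \<open>b w\<close> is \<open>b w\<close> times the unit vector, so every
  vector is congruent to its evaluation times the unit vector.\<close>

lemma vector_multiple_of_unit_vector: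
  assumes P: "P \<in> proj_points n" "l \<notin> P" and s: "s \<in> vectors" "\<And>v. s v \<in> local_ring n P"
  shows "\<exists>q\<in>local_ring n P. (\<lambda>v. s v - q * coord_vector 1 v) \<in> pencil_image X' (local_ring n P)"
proof (intro bexI)
  let ?q = "\<Sum>w<c. s w * b w"
  show "?q \<in> local_ring n P"
    using s(2) A_local[OF b_A P] by (intro stalk_sum[OF P(1)] stalk_smult[OF P(1)]) auto
  have "(\<lambda>v. - s w * (b w * coord_vector 1 v - coord_vector (b w * 1) v)) \<in> pencil_image X' (local_ring n P)"
    if "w \<in> {..<c}" for w
  proof (rule pencil_image_scale[OF _ multiplication_mod_pencil])
    show "b w \<in> A" "1 \<in> A" using that b_A by auto
    show "- s w * x \<in> local_ring n P" if "x \<in> A" for x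
      using stalk_smult[OF P(1) stalk_uminus[OF P(1) s(2)] A_local[OF that P]] .
  qed
  then have "(\<lambda>v. \<Sum>w<c. - s w * (b w * coord_vector 1 v - coord_vector (b w * 1) v)) \<in> pencil_image X' (local_ring n P)"
    by (intro pencil_image_sum stalk_add[OF P(1)] stalk_0[OF P(1)])
  moreover have "(\<Sum>w<c. - s w * (b w * coord_vector 1 v - coord_vector (b w * 1) v)) = s v - ?q * coord_vector 1 v" for v
    using vector_as_combination[OF s(1), of v]
    by (simp add: right_diff_distrib sum_subtractf sum_distrib_right mult.assoc sum_negf)
  ultimately show "(\<lambda>v. s v - ?q * coord_vector 1 v) \<in> pencil_image X' (local_ring n P)" by (simp only:)
qed

text \<open>On the hyperplane \<open>l = 0\<close> some coordinate \<open>x\<^sub>j\<close> is a unit; the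
  polynomial relation for \<open>B\<^sub>j\<close> then shows that \<open>x\<^sub>j - l B\<^sub>j\<close> is already surjective.\<close>

lemma pencil_surjective_on_hyperplane:
  assumes P: "P \<in> proj_points n" and lP: "l \<in> P" and s: "s \<in> vectors" "\<And>v. s v \<in> twist_stalk n 1 P"
  shows "s \<in> pencil_image X (local_ring n P)"
proof -
  have "\<exists>j\<in>{1..n}. var j \<notin> P"
  proof (rule ccontr)
    assume "\<not> ?thesis"
    then have v: "var j \<in> P" if "j \<in> {1..n}" for j using that by blast
    have "l - (\<Sum>j\<in>{1..n}. const (a j) * var j) \<in> P"
      using v by (intro point_diff[OF P lP] point_sum[OF P] point_mult[OF P] coords_const)
    then have "var 0 \<in> P" by (simp add: linear_form_def)
    moreover obtain i where "i \<le> n" "var i \<notin> P" by (rule point_var[OF P])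
    ultimately show False using v[of i] by (cases "i = 0") auto
  qed
  then obtain j where j: "j \<in> {1..n}" "var j \<notin> P" by blast
  have jn: "j \<le> n" using j by simp
  let ?R = "local_ring n P"
  define u where "u = fr (var j)"
  define \<epsilon> where "\<epsilon> = fr l / u"
  have u0: "u \<noteq> 0" using notin_point_nonzero[OF P j(2)] by (simp add: u_def)
  have \<epsilon>m: "\<epsilon> \<in> max_ideal n P"
    using fraction_in_max_ideal_iff[OF P hom_l homogeneous_var[OF jn] j(2)] lP by (simp add: \<epsilon>_def u_def)
  have \<epsilon>R: "\<epsilon> \<in> ?R" by (rule max_ideal_local_ring[OF \<epsilon>m])
  let ?T = "pencil (\<lambda>z. fr (const z)) (\<lambda>_. 1) \<epsilon> B c j"
  have X_T: "X j r v = u * ?T r v" for r v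
    using u0 by (simp add: pencil_def \<epsilon>_def u_def right_diff_distrib)
  have unit: "1 - \<epsilon> * scalar z \<in> ?R" "1 - \<epsilon> * scalar z \<notin> max_ideal n P" for z
  proof -
    have e: "\<epsilon> * scalar z \<in> max_ideal n P"
      using max_ideal_smult[OF P stalk_const[OF P] \<epsilon>m, of z] by (simp only: mult.commute)
    show "1 - \<epsilon> * scalar z \<in> ?R" by (rule stalk_diff[OF P stalk_1[OF P] max_ideal_local_ring[OF e]])
    show "1 - \<epsilon> * scalar z \<notin> max_ideal n P"
      using max_ideal_add[OF P _ e, of "1 - \<epsilon> * scalar z"] max_ideal_1[OF P] by auto
  qed
  \<comment> \<open>Each factor satisfies \<open>1 - \<epsilon> z = (1 - \<epsilon> B\<^sub>j) + \<epsilon> (B\<^sub>j - z)\<close>. Hence \<open>\<Prod>z. 1 - \<epsilon> z\<close>, a unit because \<open>\<epsilon>\<close>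
    lies in the maximal ideal, is congruent to \<open>\<epsilon>\<^sup>k \<Prod>z. B\<^sub>j - z\<close> modulo the image of \<open>1 - \<epsilon> B\<^sub>j\<close>,
    and the latter product vanishes for the roots \<open>z\<close> of the relation.\<close>
  have claim: "\<exists>t\<in>vectors. (\<forall>v. t v \<in> ?R) \<and> (\<forall>v. prod_list (map (\<lambda>z. 1 - \<epsilon> * scalar z) zs) * coord_vector x v =
      ?T t v + \<epsilon> ^ length zs * coord_vector (prod_list (map (\<lambda>z. coordinate j - scalar z) zs) * x) v)"
    if x: "x \<in> A" for zs x
  proof (induction zs)
    case Nil
    show ?case using stalk_0[OF P]
      by (intro bexI[of _ "\<lambda>_. 0"]) (auto simp: vectors_def pencil_zero_apply)
  next
    case (Cons z zs)
    obtain t where t: "t \<in> vectors" "\<And>v. t v \<in> ?R"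
      "\<And>v. prod_list (map (\<lambda>z. 1 - \<epsilon> * scalar z) zs) * coord_vector x v =
        ?T t v + \<epsilon> ^ length zs * coord_vector (prod_list (map (\<lambda>z. coordinate j - scalar z) zs) * x) v"
      using Cons by blast
    define y where "y = prod_list (map (\<lambda>z. coordinate j - scalar z) zs) * x"
    have "prod_list (map (\<lambda>z. coordinate j - scalar z) zs) \<in> A"
      by (induction zs) (auto intro!: A_mult A_diff A_coordinate jn)
    then have yA: "y \<in> A" unfolding y_def using x by (intro A_mult)
    have cy: "coord_vector ((coordinate j - scalar z) * y) v = act (\<lambda>z. fr (const z)) B c j (coord_vector y) v - scalar z * coord_vector y v" for v
    proof -
      have "(coordinate j - scalar z) * y = coordinate j * y + scalar (- z) * y" by (simp add: left_diff_distrib)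
      then have "coord_vector ((coordinate j - scalar z) * y) v = coord_vector (coordinate j * y) v + scalar (- z) * coord_vector y v"
        using coord_vector_add[OF A_mult[OF A_coordinate[OF jn] yA] A_mult[OF A_scalar yA]] coord_vector_scalar[OF yA] by (simp only:)
      then show ?thesis using coord_vector_coordinate[OF jn yA] by simp
    qed
    define t' where "t' v = (1 - \<epsilon> * scalar z) * t v + \<epsilon> ^ length zs * coord_vector y v" for v
    have "t' \<in> vectors" using t(1) coord_vector_vectors[of y] by (simp add: vectors_def t'_def)
    moreover have "t' v \<in> ?R" for v
      unfolding t'_def coord_vector_def
      by (intro stalk_add[OF P] stalk_smult[OF P] unit(1) t(2) stalk_power[OF P] \<epsilon>R stalk_const[OF P])
    moreover have "prod_list (map (\<lambda>z. 1 - \<epsilon> * scalar z) (z # zs)) * coord_vector x v =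
        ?T t' v + \<epsilon> ^ length (z # zs) * coord_vector (prod_list (map (\<lambda>z. coordinate j - scalar z) (z # zs)) * x) v" for v
    proof -
      have 1: "?T t' v = (1 - \<epsilon> * scalar z) * ?T t v + \<epsilon> ^ length zs * ?T (coord_vector y) v"
        unfolding t'_def pencil_sum_apply pencil_scale_apply ..
      have 2: "?T (coord_vector y) v = coord_vector y v - \<epsilon> * act (\<lambda>z. fr (const z)) B c j (coord_vector y) v"
        by (simp only: pencil_def mult_1)
      have 3: "prod_list (map (\<lambda>z. coordinate j - scalar z) (z # zs)) * x = (coordinate j - scalar z) * y"
        by (simp add: y_def mult.assoc)
      have 4: "prod_list (map (\<lambda>z. 1 - \<epsilon> * scalar z) (z # zs)) * coord_vector x v =
          (1 - \<epsilon> * scalar z) * (?T t v + \<epsilon> ^ length zs * coord_vector y v)"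
        using t(3)[of v] by (simp add: y_def mult.assoc)
      show ?thesis
        unfolding 4 3 cy 1 2 by (simp only: length_Cons power_Suc) (simp only: algebra_simps mult_1)
    qed
    ultimately show ?case by blast
  qed
  obtain zs where zs: "prod_list (map (\<lambda>z. coordinate j - scalar z) zs) \<in> J"
    using algebraic[OF A_coordinate[OF jn]] by blast
  define U where "U = prod_list (map (\<lambda>z. 1 - \<epsilon> * scalar z) zs)"
  have U: "U \<in> ?R \<and> U \<notin> max_ideal n P"
    unfolding U_def
  proof (induction zs)
    case (Cons z zs)
    then show ?case using stalk_smult[OF P unit(1)] max_ideal_prime[OF P unit(1)] unit(2) by auto
  qed (use stalk_1[OF P] max_ideal_1[OF P] in auto)
  have U1: "1 / U \<in> ?R" "U \<noteq> 0" using local_unit[OF P] U by auto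
  have "\<exists>t. t \<in> vectors \<and> (\<forall>v. t v \<in> ?R) \<and> (\<forall>v. coord_vector (b w) v = ?T t v)" if w: "w < c" for w
  proof -
    obtain t where t: "t \<in> vectors" "\<And>v. t v \<in> ?R"
      "\<And>v. U * coord_vector (b w) v = ?T t v + \<epsilon> ^ length zs * coord_vector (prod_list (map (\<lambda>z. coordinate j - scalar z) zs) * b w) v"
      using claim[OF b_A[OF w], of zs] unfolding U_def by blast
    have "b w * prod_list (map (\<lambda>z. coordinate j - scalar z) zs) \<in> J" by (rule J_mult[OF b_A[OF w] zs])
    then have "prod_list (map (\<lambda>z. coordinate j - scalar z) zs) * b w \<in> J" by (simp only: mult.commute)
    then have "U * coord_vector (b w) v = ?T t v" for v using t(3)[of v] coord_vector_J by simp
    then have "coord_vector (b w) v = ?T (\<lambda>v. 1 / U * t v) v" for v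
      unfolding pencil_scale_apply using U1(2) by (metis nonzero_mult_div_cancel_left times_divide_eq_left mult_1)
    moreover have "(\<lambda>v. 1 / U * t v) \<in> vectors" using t(1) by (simp add: vectors_def)
    moreover have "1 / U * t v \<in> ?R" for v using stalk_smult[OF P U1(1) t(2)] .
    ultimately show ?thesis by blast
  qed
  then obtain t where t: "\<And>w. w < c \<Longrightarrow> t w \<in> vectors" "\<And>w v. w < c \<Longrightarrow> t w v \<in> ?R"
    "\<And>w v. w < c \<Longrightarrow> coord_vector (b w) v = ?T (t w) v" by metis
  define s' where "s' v = 1 / u * s v" for v
  have s'R: "s' v \<in> ?R" for v
    using stalk_mult[OF P stalk_inverse[OF P homogeneous_var[OF jn] j(2)] s(2)[of v]] by (simp add: s'_def u_def)
  have "(\<lambda>v. \<Sum>w<c. s' w * X j (t w) v) \<in> pencil_image X ?R"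
    using t s'R stalk_0[OF P]
    by (intro pencil_image_sum pencil_image_scale[where D = ?R] pencil_image_single j(1) stalk_add[OF P] stalk_smult[OF P])
      auto
  moreover have "(\<Sum>w<c. s' w * X j (t w) v) = s v" for v
  proof -
    have "(\<Sum>w<c. s' w * X j (t w) v) = (\<Sum>w<c. s w * coord_vector (b w) v)"
      unfolding X_T using t(3) u0 by (intro sum.cong) (auto simp: s'_def)
    then show ?thesis using vector_as_combination[OF s(1), of v] by simp
  qed
  ultimately show ?thesis by (simp only: eta_contract_eq)
qed

text \<open>The summand \<open>\<O>\<close> covers the cokernel of the pencil.\<close>

lemma augmented_pencil_surjective:
  assumes P: "P \<in> proj_points n" and s: "s \<in> vectors" "\<And>v. s v \<in> twist_stalk n 1 P"
  shows "\<exists>q\<in>local_ring n P. (\<lambda>v. s v - fr l * (q * coord_vector 1 v)) \<in> pencil_image X (local_ring n P)"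
proof (cases "l \<in> P")
  case True
  then show ?thesis
    using pencil_surjective_on_hyperplane[OF P True s] stalk_0[OF P] by (intro bexI[of _ 0]) simp_all
next
  case False
  define s' where "s' v = 1 / fr l * s v" for v
  have "s' v \<in> local_ring n P" for v
    using stalk_mult[OF P stalk_inverse[OF P hom_l False] s(2)[of v]] by (simp add: s'_def)
  moreover have "s' \<in> vectors" using s(1) by (simp add: vectors_def s'_def)
  ultimately obtain q where q: "q \<in> local_ring n P" "(\<lambda>v. s' v - q * coord_vector 1 v) \<in> pencil_image X' (local_ring n P)"
    using vector_multiple_of_unit_vector[OF P False, of s'] by blast
  have "(\<lambda>v. fr l * (s' v - q * coord_vector 1 v)) \<in> pencil_image X (local_ring n P)"
    by (rule pencil_image_X[OF q(2)])
  moreover have "fr l * (s' v - q * coord_vector 1 v) = s v - fr l * (q * coord_vector 1 v)" for v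
    using l_nonzero by (simp add: s'_def right_diff_distrib)
  ultimately show ?thesis using q(1) by (intro bexI[of _ q]) (simp_all only:)
qed

lemma augmented_kernel_iff:
  assumes P: "P \<in> proj_points n" and q: "q \<in> local_ring n P"
  shows "(\<lambda>v. fr l * (q * coord_vector 1 v)) \<in> pencil_image X (local_ring n P) \<longleftrightarrow> q \<in> I P"
proof (cases "l \<in> P")
  case True
  then have "P \<notin> supp" using off_supp by blast
  then have "1 \<in> I P" using P by (simp add: supp_def)
  then have "q \<in> I P" using I_mult[OF P q] by fastforce
  moreover have "(\<lambda>v. fr l * (q * coord_vector 1 v)) \<in> pencil_image X (local_ring n P)"
  proof (rule pencil_surjective_on_hyperplane[OF P True])
    show "(\<lambda>v. fr l * (q * coord_vector 1 v)) \<in> vectors" using coord_vector_vectors[of 1] by (simp add: vectors_def)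
    show "fr l * (q * coord_vector 1 v) \<in> twist_stalk n 1 P" for v
      using stalk_mult[OF P stalk_homogeneous[OF P hom_l] stalk_smult[OF P q stalk_const[OF P]]]
      by (simp add: coord_vector_def)
  qed
  ultimately show ?thesis by blast
next
  case False
  show ?thesis
  proof
    assume "(\<lambda>v. fr l * (q * coord_vector 1 v)) \<in> pencil_image X (local_ring n P)"
    then obtain r where r: "\<And>j. r j \<in> vectors" "\<And>j v. r j v \<in> local_ring n P"
      "\<And>v. fr l * (q * coord_vector 1 v) = (\<Sum>j\<in>{1..n}. X j (r j) v)"
      by (rule pencil_imageE) blast
    have "q * coord_vector 1 v = (\<Sum>j\<in>{1..n}. X' j (r j) v)" for v
    proof -
      have "fr l * (q * coord_vector 1 v) = fr l * (\<Sum>j\<in>{1..n}. X' j (r j) v)"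
        unfolding r(3) X_eq sum_distrib_left ..
      then show ?thesis using l_nonzero by simp
    qed
    then show "q \<in> I P"
      by (intro ideal_from_unit_vector[OF P False q] pencil_imageI[of r] r)
  next
    assume "q \<in> I P"
    then show "(\<lambda>v. fr l * (q * coord_vector 1 v)) \<in> pencil_image X (local_ring n P)"
      by (intro pencil_image_X unit_vector_multiple_of_ideal[OF P False])
  qed
qed

end

section \<open>Quotients of sheaves with constant sections\<close>

text \<open>A quotient \<open>F / N\<close> of sheaves whose sections over a nonempty open set are single elements of a
  group \<open>'q\<close>, encoded by \<open>\<kappa>\<close>, that lie in \<open>Fst P\<close> (respectively \<open>Nst P\<close>) for every point \<open>P\<close>. It is
  applied to the structure sheaf modulo an ideal and to cycles modulo boundaries of the monad.\<close>

locale constant_quotient =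
  fixes n :: nat
    and F :: "(point, func, 's) module_sheaf" and N :: "point set \<Rightarrow> 's set"
    and \<kappa> :: "point set \<Rightarrow> 'q::ab_group_add \<Rightarrow> 's"
    and Fst Nst :: "point \<Rightarrow> 'q set"
    and sm :: "ratfun \<Rightarrow> 'q \<Rightarrow> 'q"
  assumes carrier_F: "openin (proj_space n) U \<Longrightarrow> carrier (sections F U) = \<kappa> U ` {q. \<forall>P\<in>U. q \<in> Fst P}"
    and zero_F: "openin (proj_space n) U \<Longrightarrow> \<zero>\<^bsub>sections F U\<^esub> = \<kappa> U 0"
    and add_F: "openin (proj_space n) U \<Longrightarrow> \<forall>P\<in>U. q \<in> Fst P \<Longrightarrow> \<forall>P\<in>U. q' \<in> Fst P \<Longrightarrow>
      \<kappa> U q \<oplus>\<^bsub>sections F U\<^esub> \<kappa> U q' = \<kappa> U (q + q')"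
    and smult_F: "openin (proj_space n) U \<Longrightarrow> \<forall>P\<in>U. q \<in> Fst P \<Longrightarrow> \<forall>P\<in>U. r \<in> local_ring n P \<Longrightarrow>
      constant_section U r \<odot>\<^bsub>sections F U\<^esub> \<kappa> U q = \<kappa> U (sm r q)"
    and restriction_F: "openin (proj_space n) U \<Longrightarrow> openin (proj_space n) V \<Longrightarrow> V \<subseteq> U \<Longrightarrow>
      \<forall>P\<in>U. q \<in> Fst P \<Longrightarrow> restriction F U V (\<kappa> U q) = \<kappa> V q"
    and N_eq: "openin (proj_space n) U \<Longrightarrow> N U = \<kappa> U ` {q. \<forall>P\<in>U. q \<in> Nst P}"
    and \<kappa>_inj: "openin (proj_space n) U \<Longrightarrow> U \<noteq> {} \<Longrightarrow> \<forall>P\<in>U. q \<in> Fst P \<Longrightarrow> \<forall>P\<in>U. q' \<in> Fst P \<Longrightarrow>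
      \<kappa> U q = \<kappa> U q' \<Longrightarrow> q = q'"
    and Fst_open: "P \<in> proj_points n \<Longrightarrow> q \<in> Fst P \<Longrightarrow> \<exists>U. openin (proj_space n) U \<and> P \<in> U \<and> (\<forall>Q\<in>U. q \<in> Fst Q)"
    and Nst_open: "P \<in> proj_points n \<Longrightarrow> q \<in> Nst P \<Longrightarrow> \<exists>U. openin (proj_space n) U \<and> P \<in> U \<and> (\<forall>Q\<in>U. q \<in> Nst Q)"
    and Nst_Fst: "P \<in> proj_points n \<Longrightarrow> q \<in> Nst P \<Longrightarrow> q \<in> Fst P"
    and Fst_add: "P \<in> proj_points n \<Longrightarrow> q \<in> Fst P \<Longrightarrow> q' \<in> Fst P \<Longrightarrow> q + q' \<in> Fst P"
    and Fst_uminus: "P \<in> proj_points n \<Longrightarrow> q \<in> Fst P \<Longrightarrow> - q \<in> Fst P"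
    and Fst_sm: "P \<in> proj_points n \<Longrightarrow> r \<in> local_ring n P \<Longrightarrow> q \<in> Fst P \<Longrightarrow> sm r q \<in> Fst P"
    and Nst_0: "P \<in> proj_points n \<Longrightarrow> 0 \<in> Nst P"
    and Nst_add: "P \<in> proj_points n \<Longrightarrow> q \<in> Nst P \<Longrightarrow> q' \<in> Nst P \<Longrightarrow> q + q' \<in> Nst P"
    and Nst_uminus: "P \<in> proj_points n \<Longrightarrow> q \<in> Nst P \<Longrightarrow> - q \<in> Nst P"
    and Nst_sm: "P \<in> proj_points n \<Longrightarrow> r \<in> local_ring n P \<Longrightarrow> q \<in> Nst P \<Longrightarrow> sm r q \<in> Nst P"
    and sm_diff: "sm r (q - q') = sm r q - sm r q'"
begin

abbreviation X :: "point topology" where "X \<equiv> proj_space n"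

definition Fsec :: "point set \<Rightarrow> 'q set" where "Fsec U = {q. \<forall>P\<in>U. q \<in> Fst P}"

definition Nsec :: "point set \<Rightarrow> 'q set" where "Nsec U = {q. \<forall>P\<in>U. q \<in> Nst P}"

lemma Fst_0: "P \<in> proj_points n \<Longrightarrow> 0 \<in> Fst P"
  using Nst_0 Nst_Fst by blast

lemma Fst_diff: "P \<in> proj_points n \<Longrightarrow> q \<in> Fst P \<Longrightarrow> q' \<in> Fst P \<Longrightarrow> q - q' \<in> Fst P"
  using Fst_add[of P q "- q'"] Fst_uminus[of P q'] by simp

lemma Nst_diff_sym: "P \<in> proj_points n \<Longrightarrow> q - q' \<in> Nst P \<Longrightarrow> q' - q \<in> Nst P"
  using Nst_uminus[of P "q - q'"] by simp

lemma Nst_diff_trans: "P \<in> proj_points n \<Longrightarrow> q - q' \<in> Nst P \<Longrightarrow> q' - q'' \<in> Nst P \<Longrightarrow> q - q'' \<in> Nst P"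
  using Nst_add[of P "q - q'" "q' - q''"] by simp

definition coset :: "point set \<Rightarrow> 'q \<Rightarrow> 's set" where
  "coset U q = \<kappa> U ` {q'. q' - q \<in> Nsec U}"

lemma Fsec_near:
  assumes U: "openin X U" and q: "q \<in> Fsec U" and "q' - q \<in> Nsec U" shows "q' \<in> Fsec U"
proof -
  have "q' \<in> Fst P" if P: "P \<in> U" for P
    using Fst_add[OF open_points[OF U P], of "q' - q" q] Nst_Fst[OF open_points[OF U P]] assms P
    by (auto simp: Fsec_def Nsec_def)
  then show ?thesis by (simp add: Fsec_def)
qed

lemma a_r_coset_eq:
  assumes U: "openin X U" and q: "q \<in> Fsec U"
  shows "N U +>\<^bsub>sections F U\<^esub> \<kappa> U q = coset U q"
proof -
  have "N U +>\<^bsub>sections F U\<^esub> \<kappa> U q = (\<lambda>m. \<kappa> U m \<oplus>\<^bsub>sections F U\<^esub> \<kappa> U q) ` Nsec U"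
    unfolding a_r_coset_def r_coset_def N_eq[OF U] Nsec_def by auto
  also have "\<dots> = (\<lambda>m. \<kappa> U (m + q)) ` Nsec U"
  proof (rule image_cong[OF refl])
    fix m assume "m \<in> Nsec U"
    then show "\<kappa> U m \<oplus>\<^bsub>sections F U\<^esub> \<kappa> U q = \<kappa> U (m + q)"
      using q Nst_Fst open_points[OF U] by (intro add_F[OF U]) (auto simp: Nsec_def Fsec_def)
  qed
  also have "\<dots> = coset U q"
  proof -
    have "{q'. q' - q \<in> Nsec U} = (\<lambda>m. m + q) ` Nsec U"
    proof (intro Set.set_eqI iffI)
      fix x assume "x \<in> {q'. q' - q \<in> Nsec U}"
      then show "x \<in> (\<lambda>m. m + q) ` Nsec U" by (intro image_eqI[of _ _ "x - q"]) auto
    qed auto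
    then show ?thesis unfolding coset_def by (simp add: image_image)
  qed
  finally show ?thesis .
qed

abbreviation Q :: "(point, func, 's set) module_sheaf" where "Q \<equiv> quotient_presheaf F N"

lemma carrier_Q:
  assumes U: "openin X U" shows "carrier (sections Q U) = coset U ` Fsec U"
proof -
  have "carrier (sections Q U) = (\<lambda>s. N U +>\<^bsub>sections F U\<^esub> s) ` carrier (sections F U)"
    by (auto simp: quotient_presheaf_def make_module_def A_RCOSETS_def RCOSETS_def a_r_coset_def)
  also have "\<dots> = coset U ` Fsec U"
    unfolding carrier_F[OF U] image_image Fsec_def[symmetric]
    by (rule image_cong[OF refl]) (rule a_r_coset_eq[OF U])
  finally show ?thesis .
qed

lemma coset_eqI:
  assumes U: "openin X U" and "q - q' \<in> Nsec U" shows "coset U q = coset U q'"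
proof -
  have "r - q \<in> Nsec U \<longleftrightarrow> r - q' \<in> Nsec U" for r
    using assms(2) Nst_diff_trans[OF open_points[OF U]] Nst_diff_sym[OF open_points[OF U]]
    unfolding Nsec_def mem_Collect_eq by meson
  then show ?thesis by (simp add: coset_def)
qed

lemma zero_Nsec: "openin X U \<Longrightarrow> 0 \<in> Nsec U"
  using Nst_0 open_points unfolding Nsec_def by blast

lemma coset_eq_iff:
  assumes U: "openin X U" "U \<noteq> {}" and q: "q \<in> Fsec U" "q' \<in> Fsec U"
  shows "coset U q = coset U q' \<longleftrightarrow> q - q' \<in> Nsec U"
proof
  assume "coset U q = coset U q'"
  moreover have "\<kappa> U q \<in> coset U q" using zero_Nsec[OF U(1)] by (auto simp: coset_def)
  ultimately obtain r where r: "\<kappa> U q = \<kappa> U r" "r - q' \<in> Nsec U" unfolding coset_def by auto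
  have "r \<in> Fsec U" by (rule Fsec_near[OF U(1) q(2) r(2)])
  then have "q = r" using q r(1) by (intro \<kappa>_inj[OF U]) (auto simp: Fsec_def)
  then show "q - q' \<in> Nsec U" using r(2) by simp
qed (rule coset_eqI[OF U(1)])

lemma Fsec_mono: "V \<subseteq> U \<Longrightarrow> q \<in> Fsec U \<Longrightarrow> q \<in> Fsec V" and Nsec_mono: "V \<subseteq> U \<Longrightarrow> q \<in> Nsec U \<Longrightarrow> q \<in> Nsec V"
  by (auto simp: Fsec_def Nsec_def)

lemma union_const: "x \<in> A \<Longrightarrow> (\<And>y. y \<in> A \<Longrightarrow> f y = b) \<Longrightarrow> (\<Union>y\<in>A. f y) = b"
  by auto

lemma coset_self: "openin X U \<Longrightarrow> \<kappa> U q \<in> coset U q"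
  using zero_Nsec by (auto simp: coset_def)

lemma restriction_Q:
  assumes U: "openin X U" and V: "openin X V" "V \<subseteq> U" and q: "q \<in> Fsec U"
  shows "restriction Q U V (coset U q) = coset V q"
proof -
  have "(\<Union>s\<in>coset U q. N V +>\<^bsub>sections F V\<^esub> restriction F U V s) = coset V q"
  proof (rule union_const[OF coset_self[OF U]])
    fix s assume "s \<in> coset U q"
    then obtain r where r: "s = \<kappa> U r" "r - q \<in> Nsec U" unfolding coset_def by blast
    have rF: "r \<in> Fsec U" by (rule Fsec_near[OF U q r(2)])
    have "restriction F U V s = \<kappa> V r"
      unfolding r(1) using rF by (intro restriction_F[OF U V]) (auto simp: Fsec_def)
    then have "N V +>\<^bsub>sections F V\<^esub> restriction F U V s = coset V r"
      using a_r_coset_eq[OF V(1) Fsec_mono[OF V(2) rF]] by simp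
    also have "\<dots> = coset V q" by (rule coset_eqI[OF V(1) Nsec_mono[OF V(2) r(2)]])
    finally show "N V +>\<^bsub>sections F V\<^esub> restriction F U V s = coset V q" .
  qed
  then show ?thesis by (simp add: quotient_presheaf_def)
qed

lemma add_Q:
  assumes U: "openin X U" and q: "q \<in> Fsec U" "q' \<in> Fsec U"
  shows "coset U q \<oplus>\<^bsub>sections Q U\<^esub> coset U q' = coset U (q + q')"
proof -
  have mem: "coset U q \<oplus>\<^bsub>sections Q U\<^esub> coset U q' =
      {x \<oplus>\<^bsub>sections F U\<^esub> y |x y. x \<in> coset U q \<and> y \<in> coset U q'}"
    by (auto simp: quotient_presheaf_def make_module_def set_add_def set_mult_def)
  also have "\<dots> = {\<kappa> U r \<oplus>\<^bsub>sections F U\<^esub> \<kappa> U r' |r r'. r - q \<in> Nsec U \<and> r' - q' \<in> Nsec U}"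
    unfolding coset_def by blast
  also have "\<dots> = {\<kappa> U (r + r') |r r'. r - q \<in> Nsec U \<and> r' - q' \<in> Nsec U}"
  proof -
    have "\<kappa> U r \<oplus>\<^bsub>sections F U\<^esub> \<kappa> U r' = \<kappa> U (r + r')" if "r - q \<in> Nsec U" "r' - q' \<in> Nsec U" for r r'
      using Fsec_near[OF U q(1) that(1)] Fsec_near[OF U q(2) that(2)]
      by (intro add_F[OF U]) (auto simp: Fsec_def)
    then show ?thesis by (metis (no_types, opaque_lifting))
  qed
  also have "\<dots> = coset U (q + q')"
  proof
    show "{\<kappa> U (r + r') |r r'. r - q \<in> Nsec U \<and> r' - q' \<in> Nsec U} \<subseteq> coset U (q + q')"
    proof
      fix x assume "x \<in> {\<kappa> U (r + r') |r r'. r - q \<in> Nsec U \<and> r' - q' \<in> Nsec U}"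
      then obtain r r' where x: "x = \<kappa> U (r + r')" "r - q \<in> Nsec U" "r' - q' \<in> Nsec U" by blast
      have "(r - q) + (r' - q') \<in> Nsec U"
        using x(2,3) Nst_add[OF open_points[OF U]] unfolding Nsec_def by blast
      then show "x \<in> coset U (q + q')" unfolding x(1) coset_def by (auto simp: algebra_simps)
    qed
    show "coset U (q + q') \<subseteq> {\<kappa> U (r + r') |r r'. r - q \<in> Nsec U \<and> r' - q' \<in> Nsec U}"
    proof
      fix x assume "x \<in> coset U (q + q')"
      then obtain r where r: "x = \<kappa> U r" "r - (q + q') \<in> Nsec U" unfolding coset_def by blast
      have "x = \<kappa> U ((r - q') + q')" "(r - q') - q \<in> Nsec U" "q' - q' \<in> Nsec U"
        using r zero_Nsec[OF U] by (auto simp: algebra_simps)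
      then show "x \<in> {\<kappa> U (r + r') |r r'. r - q \<in> Nsec U \<and> r' - q' \<in> Nsec U}" by blast
    qed
  qed
  finally show ?thesis .
qed

lemma smult_Q:
  assumes U: "openin X U" and q: "q \<in> Fsec U" and r: "\<forall>P\<in>U. r \<in> local_ring n P"
  shows "constant_section U r \<odot>\<^bsub>sections Q U\<^esub> coset U q = coset U (sm r q)"
proof -
  have "(\<Union>s\<in>coset U q. N U +>\<^bsub>sections F U\<^esub> (constant_section U r \<odot>\<^bsub>sections F U\<^esub> s)) = coset U (sm r q)"
  proof (rule union_const[OF coset_self[OF U]])
    fix s assume "s \<in> coset U q"
    then obtain p where p: "s = \<kappa> U p" "p - q \<in> Nsec U" unfolding coset_def by blast
    have pF: "p \<in> Fsec U" by (rule Fsec_near[OF U q p(2)])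
    have "constant_section U r \<odot>\<^bsub>sections F U\<^esub> s = \<kappa> U (sm r p)"
      unfolding p(1) using pF r by (intro smult_F[OF U]) (auto simp: Fsec_def)
    moreover have "sm r p \<in> Fsec U"
      using pF r Fst_sm[OF open_points[OF U]] unfolding Fsec_def by blast
    ultimately have "N U +>\<^bsub>sections F U\<^esub> (constant_section U r \<odot>\<^bsub>sections F U\<^esub> s) = coset U (sm r p)"
      using a_r_coset_eq[OF U] by simp
    also have "\<dots> = coset U (sm r q)"
      using p(2) r Nst_sm[OF open_points[OF U]] unfolding Nsec_def
      by (intro coset_eqI[OF U]) (auto simp: Nsec_def simp flip: sm_diff)
    finally show "N U +>\<^bsub>sections F U\<^esub> (constant_section U r \<odot>\<^bsub>sections F U\<^esub> s) = coset U (sm r q)" .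
  qed
  then show ?thesis by (simp add: quotient_presheaf_def make_module_def)
qed

text \<open>The germ at \<open>P\<close> of the class of \<open>q\<close>, described by all its representatives. The description makes
  sense for any \<open>q\<close>, without choosing an open set on which \<open>q\<close> is a section.\<close>

definition germ_class :: "point \<Rightarrow> 'q \<Rightarrow> (point set \<times> 's set) set" where
  "germ_class P q = {(V, C). openin X V \<and> P \<in> V \<and> (\<exists>r\<in>Fsec V. C = coset V r \<and> q - r \<in> Nst P)}"

lemma germ_coset:
  assumes U: "openin X U" and P: "P \<in> U" and q: "q \<in> Fsec U"
  shows "germ X Q P U (coset U q) = germ_class P q"
proof -
  note pP = open_points[OF U P]
  have "(\<exists>W. openin X W \<and> P \<in> W \<and> W \<subseteq> U \<inter> V \<and> restriction Q U W (coset U q) = restriction Q V W (coset V r)) \<longleftrightarrow>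
      q - r \<in> Nst P" (is "?L \<longleftrightarrow> ?R") if V: "openin X V" "P \<in> V" and r: "r \<in> Fsec V" for V r
  proof
    assume ?L
    then obtain W where W: "openin X W" "P \<in> W" "W \<subseteq> U" "W \<subseteq> V"
      "restriction Q U W (coset U q) = restriction Q V W (coset V r)" by blast
    then have "coset W q = coset W r"
      using restriction_Q[OF U W(1,3) q] restriction_Q[OF V(1) W(1,4) r] by simp
    then have "q - r \<in> Nsec W"
      using coset_eq_iff[OF W(1) _ Fsec_mono[OF W(3) q] Fsec_mono[OF W(4) r]] W(2) by blast
    then show ?R using W(2) by (simp add: Nsec_def)
  next
    assume ?R
    then obtain W0 where W0: "openin X W0" "P \<in> W0" "\<forall>Q\<in>W0. q - r \<in> Nst Q" using Nst_open[OF pP] by blast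
    define W where "W = W0 \<inter> (U \<inter> V)"
    have W: "openin X W" "P \<in> W" "W \<subseteq> U" "W \<subseteq> V"
      using W0 U V P by (auto simp: W_def)
    have "coset W q = coset W r" using W0(3) by (intro coset_eqI[OF W(1)]) (auto simp: Nsec_def W_def)
    then have "restriction Q U W (coset U q) = restriction Q V W (coset V r)"
      using restriction_Q[OF U W(1,3) q] restriction_Q[OF V(1) W(1,4) r] by simp
    then show ?L using W by blast
  qed
  then show ?thesis
    unfolding germ_def germ_class_def using carrier_Q by fastforce
qed

lemma germ_class_eq_iff:
  assumes P: "P \<in> proj_points n" and q: "q \<in> Fst P" "q' \<in> Fst P"
  shows "germ_class P q = germ_class P q' \<longleftrightarrow> q - q' \<in> Nst P"
proof
  assume eq: "germ_class P q = germ_class P q'"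
  obtain U where U: "openin X U" "P \<in> U" "\<forall>Q\<in>U. q \<in> Fst Q" using Fst_open[OF P q(1)] by blast
  then have "(U, coset U q) \<in> germ_class P q" using Nst_0[OF P] by (auto simp: germ_class_def Fsec_def)
  then have "(U, coset U q) \<in> germ_class P q'" unfolding eq .
  then obtain r where r: "r \<in> Fsec U" "coset U q = coset U r" "q' - r \<in> Nst P" unfolding germ_class_def by blast
  have "q - r \<in> Nsec U"
    using coset_eq_iff[OF U(1) _ _ r(1), of q] r(2) U by (auto simp: Fsec_def)
  then have "q - r \<in> Nst P" using U(2) by (simp add: Nsec_def)
  then show "q - q' \<in> Nst P" using Nst_diff_trans[OF P _ Nst_diff_sym[OF P r(3)]] by blast
next
  assume d: "q - q' \<in> Nst P"
  have "q - r \<in> Nst P \<longleftrightarrow> q' - r \<in> Nst P" for r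
    using Nst_diff_trans[OF P d] Nst_diff_trans[OF P Nst_diff_sym[OF P d]] by blast
  then show "germ_class P q = germ_class P q'" by (simp add: germ_class_def)
qed

lemma stalk_Q:
  assumes P: "P \<in> proj_points n" shows "stalk X Q P = germ_class P ` Fst P"
proof
  show "stalk X Q P \<subseteq> germ_class P ` Fst P"
  proof
    fix g assume "g \<in> stalk X Q P"
    then obtain U s where U: "g = germ X Q P U s" "openin X U" "P \<in> U" "s \<in> carrier (sections Q U)"
      unfolding stalk_def by blast
    then obtain q where "q \<in> Fsec U" "s = coset U q" using carrier_Q by blast
    then show "g \<in> germ_class P ` Fst P" using U germ_coset by (auto simp: Fsec_def)
  qed
  show "germ_class P ` Fst P \<subseteq> stalk X Q P"
  proof
    fix g assume "g \<in> germ_class P ` Fst P"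
    then obtain q where q: "q \<in> Fst P" "g = germ_class P q" by blast
    obtain U where U: "openin X U" "P \<in> U" "\<forall>Q\<in>U. q \<in> Fst Q" using Fst_open[OF P q(1)] by blast
    then have "q \<in> Fsec U" by (simp add: Fsec_def)
    then show "g \<in> stalk X Q P"
      unfolding stalk_def q(2) using U carrier_Q[OF U(1)] germ_coset[OF U(1,2)] by blast
  qed
qed

lemma germ_class_member:
  assumes P: "P \<in> proj_points n" and q: "q \<in> Fst P"
  obtains U C where "(U, C) \<in> germ_class P q"
proof -
  obtain U where "openin X U" "P \<in> U" "\<forall>Q\<in>U. q \<in> Fst Q" using Fst_open[OF P q] by blast
  then have "(U, coset U q) \<in> germ_class P q" using Nst_0[OF P] by (auto simp: germ_class_def Fsec_def)
  then show ?thesis by (rule that)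
qed

lemma germ_add_germ_class:
  assumes P: "P \<in> proj_points n" and q: "q \<in> Fst P" "q' \<in> Fst P"
  shows "germ_add X Q P (germ_class P q) (germ_class P q') = germ_class P (q + q')"
proof -
  have val: "germ X Q P (U \<inter> V) (restriction Q U (U \<inter> V) C \<oplus>\<^bsub>sections Q (U \<inter> V)\<^esub> restriction Q V (U \<inter> V) D) = germ_class P (q + q')"
    if mem: "(U, C) \<in> germ_class P q" "(V, D) \<in> germ_class P q'" for U C V D
  proof -
    obtain r where U: "openin X U" "P \<in> U" "r \<in> Fsec U" "C = coset U r" "q - r \<in> Nst P"
      using mem(1) unfolding germ_class_def by blast
    obtain r' where V: "openin X V" "P \<in> V" "r' \<in> Fsec V" "D = coset V r'" "q' - r' \<in> Nst P"
      using mem(2) unfolding germ_class_def by blast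
    define W where "W = U \<inter> V"
    have W: "openin X W" "P \<in> W" "W \<subseteq> U" "W \<subseteq> V" using U V by (auto simp: W_def)
    have rW: "r \<in> Fsec W" "r' \<in> Fsec W" using Fsec_mono[OF W(3) U(3)] Fsec_mono[OF W(4) V(3)] .
    have sW: "r + r' \<in> Fsec W" using rW Fst_add[OF open_points[OF W(1)]] unfolding Fsec_def by blast
    have "germ X Q P W (restriction Q U W C \<oplus>\<^bsub>sections Q W\<^esub> restriction Q V W D) = germ_class P (r + r')"
      unfolding U(4) V(4) restriction_Q[OF U(1) W(1,3) U(3)] restriction_Q[OF V(1) W(1,4) V(3)] add_Q[OF W(1) rW]
      by (rule germ_coset[OF W(1,2) sW])
    also have "\<dots> = germ_class P (q + q')"
    proof -
      have "(r + r') - (q + q') = - ((q - r) + (q' - r'))" by simp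
      then have "(r + r') - (q + q') \<in> Nst P" using Nst_uminus[OF P Nst_add[OF P U(5) V(5)]] by (simp only:)
      then show ?thesis
        using germ_class_eq_iff[OF P _ Fst_add[OF P q]] sW W(2) by (auto simp: Fsec_def)
    qed
    finally show ?thesis unfolding W_def .
  qed
  obtain U C where UC: "(U, C) \<in> germ_class P q" by (rule germ_class_member[OF P q(1)])
  obtain V D where VD: "(V, D) \<in> germ_class P q'" by (rule germ_class_member[OF P q(2)])
  show ?thesis
    unfolding germ_add_def
  proof (rule union_const[OF UC])
    fix x assume "x \<in> germ_class P q"
    then obtain U C where x: "x = (U, C)" "(U, C) \<in> germ_class P q" by (cases x) auto
    have "(\<Union>y\<in>germ_class P q'. (case y of (V, t) \<Rightarrow> germ X Q P (U \<inter> V) (restriction Q U (U \<inter> V) C \<oplus>\<^bsub>sections Q (U \<inter> V)\<^esub> restriction Q V (U \<inter> V) t))) = germ_class P (q + q')"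
      by (rule union_const[OF VD]) (use val[OF x(2)] in auto)
    then show "(case x of (U, s) \<Rightarrow> \<Union>(V, t)\<in>germ_class P q'. germ X Q P (U \<inter> V) (restriction Q U (U \<inter> V) s \<oplus>\<^bsub>sections Q (U \<inter> V)\<^esub> restriction Q V (U \<inter> V) t)) = germ_class P (q + q')"
      unfolding x(1) by simp
  qed
qed

lemma germ_smult_germ_class:
  assumes U: "openin X U" "P \<in> U" and q: "q \<in> Fst P" and r: "\<forall>P\<in>U. r \<in> local_ring n P"
  shows "germ_smult X (proj_structure n) Q P U (constant_section U r) (germ_class P q) = germ_class P (sm r q)"
proof -
  note P = open_points[OF U]
  have rP: "r \<in> local_ring n P" using r U by blast
  obtain V D where VD: "(V, D) \<in> germ_class P q" by (rule germ_class_member[OF P q])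
  show ?thesis
    unfolding germ_smult_def
  proof (rule union_const[OF VD])
    fix x assume "x \<in> germ_class P q"
    then obtain V C where x: "x = (V, C)" "(V, C) \<in> germ_class P q" by (cases x) auto
    then obtain p where V: "openin X V" "P \<in> V" "p \<in> Fsec V" "C = coset V p" "q - p \<in> Nst P"
      unfolding germ_class_def by blast
    define W where "W = U \<inter> V"
    have W: "openin X W" "P \<in> W" "W \<subseteq> U" "W \<subseteq> V" using U V by (auto simp: W_def)
    have pW: "p \<in> Fsec W" using Fsec_mono[OF W(4) V(3)] .
    have rW: "\<forall>P\<in>W. r \<in> local_ring n P" using r W by blast
    have sW: "sm r p \<in> Fsec W" using pW rW Fst_sm[OF open_points[OF W(1)]] unfolding Fsec_def by blast
    have "ring_restriction (proj_structure n) U W (constant_section U r) = constant_section W r"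
      using W(3) by (auto simp: proj_structure_def constant_section_def restrict_def fun_eq_iff)
    then have "germ X Q P W (ring_restriction (proj_structure n) U W (constant_section U r) \<odot>\<^bsub>sections Q W\<^esub> restriction Q V W C) = germ_class P (sm r p)"
      unfolding V(4) restriction_Q[OF V(1) W(1,4) V(3)]
      using smult_Q[OF W(1) pW rW] germ_coset[OF W(1,2) sW] by simp
    also have "\<dots> = germ_class P (sm r q)"
    proof -
      have "sm r (p - q) \<in> Nst P" using Nst_sm[OF P rP Nst_diff_sym[OF P V(5)]] .
      then show ?thesis using germ_class_eq_iff[OF P _ Fst_sm[OF P rP q]] sW W(2) by (auto simp: Fsec_def sm_diff)
    qed
    finally show "(case x of (V, t) \<Rightarrow> germ X Q P (U \<inter> V) (ring_restriction (proj_structure n) U (U \<inter> V) (constant_section U r) \<odot>\<^bsub>sections Q (U \<inter> V)\<^esub> restriction Q V (U \<inter> V) t)) = germ_class P (sm r q)"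
      unfolding x(1) W_def by simp
  qed
qed

abbreviation QS :: "(point, func, point \<Rightarrow> (point set \<times> 's set) set) module_sheaf" where
  "QS \<equiv> quotient_sheaf (proj_space n) (proj_structure n) F N"

lemma carrier_QS:
  assumes U: "openin X U"
  shows "\<sigma> \<in> carrier (sections QS U) \<longleftrightarrow> \<sigma> \<in> extensional U \<and>
    (\<forall>P\<in>U. \<exists>V q. openin X V \<and> P \<in> V \<and> V \<subseteq> U \<and> q \<in> Fsec V \<and> (\<forall>y\<in>V. \<sigma> y = germ_class y q))"
    (is "_ \<longleftrightarrow> ?R")
proof -
  have loc: "(\<exists>V s. openin X V \<and> P \<in> V \<and> V \<subseteq> U \<and> s \<in> carrier (sections Q V) \<and> (\<forall>y\<in>V. \<sigma> y = germ X Q y V s)) \<longleftrightarrow>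
     (\<exists>V q. openin X V \<and> P \<in> V \<and> V \<subseteq> U \<and> q \<in> Fsec V \<and> (\<forall>y\<in>V. \<sigma> y = germ_class y q))" (is "?A P \<longleftrightarrow> ?B P") for P
  proof
    assume "?A P"
    then obtain V s where V: "openin X V" "P \<in> V" "V \<subseteq> U" "s \<in> carrier (sections Q V)"
      "\<forall>y\<in>V. \<sigma> y = germ X Q y V s" by blast
    then obtain q where q: "q \<in> Fsec V" "s = coset V q" using carrier_Q[OF V(1)] by blast
    have "\<forall>y\<in>V. \<sigma> y = germ_class y q" using V(5) germ_coset[OF V(1) _ q(1)] unfolding q(2) by simp
    then show "?B P" using V(1-3) q(1) by blast
  next
    assume "?B P"
    then obtain V q where V: "openin X V" "P \<in> V" "V \<subseteq> U" "q \<in> Fsec V" "\<forall>y\<in>V. \<sigma> y = germ_class y q" by blast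
    have "\<forall>y\<in>V. \<sigma> y = germ X Q y V (coset V q)" using V(5) germ_coset[OF V(1) _ V(4)] by simp
    moreover have "coset V q \<in> carrier (sections Q V)" using carrier_Q[OF V(1)] V(4) by blast
    ultimately show "?A P" using V(1-3) by blast
  qed
  have "\<sigma> \<in> carrier (sections QS U) \<longleftrightarrow> \<sigma> \<in> (\<Pi>\<^sub>E x\<in>U. stalk X Q x) \<and>
    (\<forall>P\<in>U. \<exists>V q. openin X V \<and> P \<in> V \<and> V \<subseteq> U \<and> q \<in> Fsec V \<and> (\<forall>y\<in>V. \<sigma> y = germ_class y q))"
  proof -
    have "carrier (sections QS U) = {\<sigma> \<in> (\<Pi>\<^sub>E x\<in>U. stalk X Q x). \<forall>P\<in>U. \<exists>V s. openin X V \<and> P \<in> V \<and> V \<subseteq> U \<and>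
        s \<in> carrier (sections Q V) \<and> (\<forall>y\<in>V. \<sigma> y = germ X Q y V s)}"
      by (simp add: quotient_sheaf_def sheafify_def make_module_def)
    then show ?thesis by (simp only: mem_Collect_eq loc)
  qed
  also have "\<dots> \<longleftrightarrow> ?R"
  proof -
    have "\<sigma> P \<in> stalk X Q P" if "?R" and P: "P \<in> U" for P
    proof -
      obtain V q where "P \<in> V" "q \<in> Fsec V" "\<forall>y\<in>V. \<sigma> y = germ_class y q" using \<open>?R\<close> P by blast
      then show ?thesis using stalk_Q[OF open_points[OF U P]] by (auto simp: Fsec_def)
    qed
    then show ?thesis by (auto simp: PiE_iff)
  qed
  finally show ?thesis .
qed

lemma sections_QS_value:
  assumes U: "openin X U" and "\<sigma> \<in> carrier (sections QS U)" "P \<in> U"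
  obtains q where "q \<in> Fst P" "\<sigma> P = germ_class P q"
proof -
  obtain V q where "P \<in> V" "q \<in> Fsec V" "\<forall>y\<in>V. \<sigma> y = germ_class y q"
    using iffD1[OF carrier_QS[OF U] assms(2)] assms(3) by blast
  then have "q \<in> Fst P" "\<sigma> P = germ_class P q" by (auto simp: Fsec_def)
  then show ?thesis by (rule that)
qed

lemma add_QS: "\<sigma> \<oplus>\<^bsub>sections QS U\<^esub> \<tau> = (\<lambda>P\<in>U. germ_add X Q P (\<sigma> P) (\<tau> P))"
  and smult_QS: "r \<odot>\<^bsub>sections QS U\<^esub> \<sigma> = (\<lambda>P\<in>U. germ_smult X (proj_structure n) Q P U r (\<sigma> P))"
  and restriction_QS: "restriction QS U V \<sigma> = restrict \<sigma> V"
  by (simp_all add: quotient_sheaf_def sheafify_def make_module_def)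

lemma zero_QS: 
  assumes U: "openin X U" shows "\<zero>\<^bsub>sections QS U\<^esub> = (\<lambda>P\<in>U. germ_class P 0)"
proof -
  have "0 \<in> Fsec U" using Fst_0[OF open_points[OF U]] by (simp add: Fsec_def)
  have "\<zero>\<^bsub>sections Q U\<^esub> = coset U 0"
    by (simp add: quotient_presheaf_def make_module_def N_eq[OF U] coset_def Nsec_def)
  moreover have "\<zero>\<^bsub>sections QS U\<^esub> = (\<lambda>x\<in>U. germ X Q x U \<zero>\<^bsub>sections Q U\<^esub>)"
    by (simp add: quotient_sheaf_def sheafify_def make_module_def)
  ultimately show ?thesis
    using germ_coset[OF U _ \<open>0 \<in> Fsec U\<close>] by (auto simp: fun_eq_iff restrict_def)
qed

end

lemma constant_section_add: "(\<lambda>P\<in>U. constant_section U p P + constant_section U q P) = constant_section U (p + q)"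
  by (auto simp: constant_section_def restrict_def fun_eq_iff)

lemma constant_section_mult: "(\<lambda>P\<in>U. constant_section U r P * constant_section U q P) = constant_section U (r * q)"
  by (auto simp: constant_section_def restrict_def fun_eq_iff)

lemma restrict_constant_section: "V \<subseteq> U \<Longrightarrow> restrict (constant_section U q) V = constant_section V q"
  by (auto simp: constant_section_def restrict_def fun_eq_iff)

lemma constant_section_inj: "U \<noteq> {} \<Longrightarrow> constant_section U q = constant_section U q' \<Longrightarrow> q = q'"
  unfolding constant_section_def restrict_def fun_eq_iff by (metis ex_in_conv)

lemma carrier_ring_sections:
  "openin (proj_space n) U \<Longrightarrow> carrier (ring_sections (proj_structure n) U) =
    constant_section U ` {q. \<forall>P\<in>U. q \<in> local_ring n P}"
  by (auto simp: proj_structure_def twist_sections_iff)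

context constant_quotient begin

text \<open>A section of a quotient with values in constants is determined by its value at the
  generic point; this turns a compatible family of isomorphisms on stalks into an isomorphism
  of sheaves.\<close>

lemma quotient_iso_ideal_sheaf:
  assumes proj_add: "\<And>q q'. proj (q + q') = proj q + proj q'"
    and proj_sm: "\<And>r q. proj (sm r q) = r * proj q"
    and target: "\<And>U. openin X U \<Longrightarrow> I U = constant_section U ` {q. \<forall>P\<in>U. q \<in> Ist P}"
    and proj_I: "\<And>P q. P \<in> proj_points n \<Longrightarrow> q \<in> Fst P \<Longrightarrow> proj q \<in> Ist P"
    and surj: "\<And>P r. P \<in> proj_points n \<Longrightarrow> r \<in> Ist P \<Longrightarrow> \<exists>q\<in>Fst P. proj q = r"
    and ker: "\<And>P q. P \<in> proj_points n \<Longrightarrow> q \<in> Fst P \<Longrightarrow> proj q = 0 \<longleftrightarrow> q \<in> Nst P"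
  shows "sheaf_iso X (proj_structure n) QS (ideal_sheaf n I)"
proof -
  define val where "val P g = (THE v. \<exists>q\<in>Fst P. g = germ_class P q \<and> v = proj q)" for P g
  have proj_diff: "proj (q - q') = proj q - proj q'" for q q'
    using proj_add[of "q - q'" q'] by simp
  have val: "val P (germ_class P q) = proj q" if P: "P \<in> proj_points n" and q: "q \<in> Fst P" for P q
    unfolding val_def
  proof (rule the_equality)
    show "\<exists>q'\<in>Fst P. germ_class P q = germ_class P q' \<and> proj q = proj q'" using q by blast
    fix v assume "\<exists>q'\<in>Fst P. germ_class P q = germ_class P q' \<and> v = proj q'"
    then obtain q' where q': "q' \<in> Fst P" "germ_class P q = germ_class P q'" "v = proj q'" by blast
    have "q - q' \<in> Nst P" using germ_class_eq_iff[OF P q q'(1)] q'(2) by simp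
    then have "proj (q - q') = 0" using ker[OF P Fst_diff[OF P q q'(1)]] by blast
    then show "v = proj q" using q'(3) proj_diff by simp
  qed
  define \<phi> where "\<phi> U \<sigma> = (\<lambda>P\<in>U. val P (\<sigma> P))" for U and \<sigma> :: "point \<Rightarrow> (point set \<times> 's set) set"
  have const: "\<phi> U \<sigma> = constant_section U (val {0} (\<sigma> {0})) \<and> (\<forall>P\<in>U. val {0} (\<sigma> {0}) \<in> Ist P)"
    if U: "openin X U" and \<sigma>: "\<sigma> \<in> carrier (sections QS U)" for U \<sigma>
  proof -
    have "val P (\<sigma> P) = val {0} (\<sigma> {0}) \<and> val {0} (\<sigma> {0}) \<in> Ist P" if P: "P \<in> U" for P
    proof -
      obtain V q where V: "openin X V" "P \<in> V" "q \<in> Fsec V" "\<forall>y\<in>V. \<sigma> y = germ_class y q"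
        using iffD1[OF carrier_QS[OF U] \<sigma>] P by blast
      have v: "val y (\<sigma> y) = proj q" if y: "y \<in> V" for y
        using V(3,4) y val[OF open_points[OF V(1) y], of q] by (simp add: Fsec_def)
      have "proj q \<in> Ist P" using proj_I[OF open_points[OF V(1,2)]] V(2,3) by (simp add: Fsec_def)
      then show ?thesis using v[OF V(2)] v[OF generic_in_open[OF V(1,2)]] by simp
    qed
    then show ?thesis by (auto simp: \<phi>_def constant_section_def restrict_def fun_eq_iff)
  qed
  have carrier_I: "carrier (sections (ideal_sheaf n I) U) = I U" for U
    by (simp add: ideal_sheaf_def restrict_to_def)
  have add_I: "s \<oplus>\<^bsub>sections (ideal_sheaf n I) U\<^esub> t = (\<lambda>P\<in>U. s P + t P)" for s t U
    by (simp add: ideal_sheaf_def restrict_to_def structure_module_def make_module_def proj_structure_def)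
  have smult_I: "r \<odot>\<^bsub>sections (ideal_sheaf n I) U\<^esub> t = (\<lambda>P\<in>U. r P * t P)" for r t U
    by (simp add: ideal_sheaf_def restrict_to_def structure_module_def make_module_def proj_structure_def)
  have restriction_I: "restriction (ideal_sheaf n I) U V t = restrict t V" for t U V
    by (simp add: ideal_sheaf_def restrict_to_def structure_module_def proj_structure_def)
  have hom: "sheaf_hom X (proj_structure n) QS (ideal_sheaf n I) \<phi>"
    unfolding sheaf_hom_def
  proof (intro allI impI conjI ballI)
    fix U assume U: "openin X U"
    show "\<phi> U \<in> carrier (sections QS U) \<rightarrow> carrier (sections (ideal_sheaf n I) U)"
      unfolding carrier_I target[OF U] using const[OF U] by blast
    fix \<sigma> assume \<sigma>: "\<sigma> \<in> carrier (sections QS U)"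
    {
      fix \<tau> assume \<tau>: "\<tau> \<in> carrier (sections QS U)"
      have "val P (germ_add X Q P (\<sigma> P) (\<tau> P)) = val P (\<sigma> P) + val P (\<tau> P)" if P: "P \<in> U" for P
      proof -
        note pP = open_points[OF U P]
        obtain q where q: "q \<in> Fst P" "\<sigma> P = germ_class P q" by (rule sections_QS_value[OF U \<sigma> P])
        obtain q' where q': "q' \<in> Fst P" "\<tau> P = germ_class P q'" by (rule sections_QS_value[OF U \<tau> P])
        show ?thesis
          unfolding q(2) q'(2) germ_add_germ_class[OF pP q(1) q'(1)]
            val[OF pP q(1)] val[OF pP q'(1)] val[OF pP Fst_add[OF pP q(1) q'(1)]] by (rule proj_add)
      qed
      then show "\<phi> U (\<sigma> \<oplus>\<^bsub>sections QS U\<^esub> \<tau>) = \<phi> U \<sigma> \<oplus>\<^bsub>sections (ideal_sheaf n I) U\<^esub> \<phi> U \<tau>"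
        unfolding add_QS add_I by (auto simp: \<phi>_def restrict_def fun_eq_iff)
    }
    {
      fix V \<tau> assume V: "openin X V" "V \<subseteq> U" and \<tau>: "\<tau> \<in> carrier (sections QS U)"
      show "\<phi> V (restriction QS U V \<tau>) = restriction (ideal_sheaf n I) U V (\<phi> U \<tau>)"
        unfolding restriction_QS restriction_I using V(2) by (auto simp: \<phi>_def restrict_def fun_eq_iff)
    }
  next
    fix U r \<sigma> assume U: "openin X U" and r: "r \<in> carrier (ring_sections (proj_structure n) U)"
      and \<sigma>: "\<sigma> \<in> carrier (sections QS U)"
    obtain q where q: "r = constant_section U q" "\<forall>P\<in>U. q \<in> local_ring n P"
      using r unfolding carrier_ring_sections[OF U] by blast
    have "val P (germ_smult X (proj_structure n) Q P U r (\<sigma> P)) = r P * val P (\<sigma> P)" if P: "P \<in> U" for P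
    proof -
      note pP = open_points[OF U P]
      obtain p where p: "p \<in> Fst P" "\<sigma> P = germ_class P p" by (rule sections_QS_value[OF U \<sigma> P])
      have "val P (germ_smult X (proj_structure n) Q P U r (\<sigma> P)) = proj (sm q p)"
        unfolding p(2) q(1) germ_smult_germ_class[OF U P p(1) q(2)]
        by (rule val[OF pP Fst_sm[OF pP _ p(1)]]) (use q(2) P in blast)
      then show ?thesis
        unfolding p(2) val[OF pP p(1)] proj_sm q(1) using P by (simp add: constant_section_def)
    qed
    then show "\<phi> U (r \<odot>\<^bsub>sections QS U\<^esub> \<sigma>) = r \<odot>\<^bsub>sections (ideal_sheaf n I) U\<^esub> \<phi> U \<sigma>"
      unfolding smult_QS smult_I by (auto simp: \<phi>_def restrict_def fun_eq_iff)
  qed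
  have "bij_betw (\<phi> U) (carrier (sections QS U)) (carrier (sections (ideal_sheaf n I) U))" if U: "openin X U" for U
    unfolding bij_betw_def
  proof
    show "inj_on (\<phi> U) (carrier (sections QS U))"
    proof (rule inj_onI)
      fix \<sigma> \<tau> assume \<sigma>: "\<sigma> \<in> carrier (sections QS U)" and \<tau>: "\<tau> \<in> carrier (sections QS U)" and eq: "\<phi> U \<sigma> = \<phi> U \<tau>"
      have "\<sigma> P = \<tau> P" for P
      proof (cases "P \<in> U")
        case True
        note pP = open_points[OF U True]
        obtain q where q: "q \<in> Fst P" "\<sigma> P = germ_class P q" by (rule sections_QS_value[OF U \<sigma> True])
        obtain q' where q': "q' \<in> Fst P" "\<tau> P = germ_class P q'" by (rule sections_QS_value[OF U \<tau> True])
        have "proj q = proj q'"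
          using fun_cong[OF eq, of P] True unfolding \<phi>_def by (simp add: q q' val[OF pP])
        then have "q - q' \<in> Nst P" using ker[OF pP Fst_diff[OF pP q(1) q'(1)]] by (simp add: proj_diff)
        then show ?thesis unfolding q(2) q'(2) by (simp only: germ_class_eq_iff[OF pP q(1) q'(1)])
      next
        case False
        then show ?thesis
          using iffD1[OF carrier_QS[OF U] \<sigma>] iffD1[OF carrier_QS[OF U] \<tau>] by (simp add: extensional_def)
      qed
      then show "\<sigma> = \<tau>" by blast
    qed
    show "\<phi> U ` carrier (sections QS U) = carrier (sections (ideal_sheaf n I) U)"
    proof
      show "\<phi> U ` carrier (sections QS U) \<subseteq> carrier (sections (ideal_sheaf n I) U)"
        unfolding carrier_I target[OF U] using const[OF U] by blast
      show "carrier (sections (ideal_sheaf n I) U) \<subseteq> \<phi> U ` carrier (sections QS U)"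
      proof
        fix s assume "s \<in> carrier (sections (ideal_sheaf n I) U)"
        then obtain r where r: "s = constant_section U r" "\<forall>P\<in>U. r \<in> Ist P"
          unfolding carrier_I target[OF U] by blast
        have "\<forall>P\<in>U. \<exists>q. q \<in> Fst P \<and> proj q = r" using surj open_points[OF U] r(2) by blast
        then obtain q where q: "\<And>P. P \<in> U \<Longrightarrow> q P \<in> Fst P" "\<And>P. P \<in> U \<Longrightarrow> proj (q P) = r" by metis
        define \<sigma> where "\<sigma> = (\<lambda>P\<in>U. germ_class P (q P))"
        have "\<sigma> \<in> carrier (sections QS U)"
        proof (rule iffD2[OF carrier_QS[OF U]], intro conjI ballI)
          show "\<sigma> \<in> extensional U" by (simp add: \<sigma>_def)
          fix P assume P: "P \<in> U"
          obtain V0 where V0: "openin X V0" "P \<in> V0" "\<forall>y\<in>V0. q P \<in> Fst y"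
            using Fst_open[OF open_points[OF U P] q(1)[OF P]] by blast
          have "\<sigma> y = germ_class y (q P)" if y: "y \<in> V0 \<inter> U" for y
          proof -
            have py: "y \<in> proj_points n" using open_points[OF U] y by blast
            have Fy: "q y \<in> Fst y" "q P \<in> Fst y" using q(1) V0(3) y by blast+
            have "proj (q y - q P) = 0" using q(2) P y by (simp add: proj_diff)
            then have "q y - q P \<in> Nst y" using ker[OF py Fst_diff[OF py Fy]] by blast
            then have "germ_class y (q y) = germ_class y (q P)" by (simp only: germ_class_eq_iff[OF py Fy])
            then show ?thesis using y by (simp add: \<sigma>_def)
          qed
          moreover have "openin X (V0 \<inter> U)" using V0(1) U by blast
          moreover have "q P \<in> Fsec (V0 \<inter> U)" using V0(3) by (simp add: Fsec_def)
          ultimately show "\<exists>V q. openin X V \<and> P \<in> V \<and> V \<subseteq> U \<and> q \<in> Fsec V \<and> (\<forall>y\<in>V. \<sigma> y = germ_class y q)"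
            using V0(2) P by (intro exI[of _ "V0 \<inter> U"] exI[of _ "q P"]) blast
        qed
        moreover have "\<phi> U \<sigma> = s"
          using q val[OF open_points[OF U]] unfolding r(1) \<phi>_def \<sigma>_def constant_section_def
          by (auto simp: restrict_def fun_eq_iff)
        ultimately show "s \<in> \<phi> U ` carrier (sections QS U)" by blast
      qed
    qed
  qed
  with hom show ?thesis unfolding sheaf_iso_def by blast
qed

end

section \<open>Finite sums in structures described by an additive map\<close>

lemma
  fixes G :: "('s, 'm) ring_scheme" and f :: "'q::ab_group_add \<Rightarrow> 's"
  assumes D: "\<And>x y. x \<in> D \<Longrightarrow> y \<in> D \<Longrightarrow> x + y \<in> D" "0 \<in> D"
    and car: "carrier G = f ` D" and add: "\<And>x y. x \<in> D \<Longrightarrow> y \<in> D \<Longrightarrow> f x \<oplus>\<^bsub>G\<^esub> f y = f (x + y)"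
    and zero: "\<zero>\<^bsub>G\<^esub> = f 0"
  shows abelian_monoid_image: "abelian_monoid G"
    and finsum_image: "(\<And>j. j < (k::nat) \<Longrightarrow> g j \<in> D) \<Longrightarrow> (\<And>j. j < k \<Longrightarrow> h j = f (g j)) \<Longrightarrow>
      (\<Oplus>\<^bsub>G\<^esub>j\<in>{..<k}. h j) = f (\<Sum>j<k. g j)"
proof -
  show G: "abelian_monoid G"
    by (rule abelian_monoidI) (use D in \<open>auto simp: car zero add add_ac image_iff intro!: bexI\<close>)
  interpret abelian_monoid G by (rule G)
  show "(\<Oplus>\<^bsub>G\<^esub>j\<in>{..<k}. h j) = f (\<Sum>j<k. g j)"
    if "\<And>j. j < (k::nat) \<Longrightarrow> g j \<in> D" "\<And>j. j < k \<Longrightarrow> h j = f (g j)"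
    using that
  proof (induction k)
    case 0
    then show ?case by (simp add: zero)
  next
    case (Suc k)
    have gD: "(\<Sum>j<k. g j) \<in> D"
      using Suc.prems(1) by (induction k) (auto simp: D)
    have "(\<Oplus>\<^bsub>G\<^esub>j\<in>{..<Suc k}. h j) = h k \<oplus>\<^bsub>G\<^esub> (\<Oplus>\<^bsub>G\<^esub>j\<in>{..<k}. h j)"
      unfolding lessThan_Suc using Suc.prems
      by (intro finsum_insert) (auto simp: car)
    also have "\<dots> = f (g k) \<oplus>\<^bsub>G\<^esub> f (\<Sum>j<k. g j)"
      using Suc by simp
    also have "\<dots> = f (\<Sum>j<Suc k. g j)"
      using add[OF Suc.prems(1) gD, of k] by (simp add: add.commute)
    finally show ?case .
  qed
qed

section \<open>The stalks of the ideal sheaf\<close>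

definition ideal_stalk :: "nat \<Rightarrow> (point set \<Rightarrow> func set) \<Rightarrow> point \<Rightarrow> ratfun set" where
  "ideal_stalk n I P = {q. \<exists>U. openin (proj_space n) U \<and> P \<in> U \<and> constant_section U q \<in> I U}"

locale subscheme =
  fixes n :: nat and I :: "point set \<Rightarrow> func set"
  assumes subsheaf_I: "subsheaf (proj_space n) (proj_structure n) (structure_module (proj_structure n)) I"
begin

abbreviation Ist :: "point \<Rightarrow> ratfun set" where "Ist \<equiv> ideal_stalk n I"

lemma carrier_O:
  "openin (proj_space n) U \<Longrightarrow> carrier (sections (structure_module (proj_structure n)) U) =
    constant_section U ` {q. \<forall>P\<in>U. q \<in> local_ring n P}"
  using carrier_ring_sections by (simp add: structure_module_def make_module_def)

lemma O_simps:
  "s \<oplus>\<^bsub>sections (structure_module (proj_structure n)) U\<^esub> t = (\<lambda>P\<in>U. s P + t P)"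
  "\<zero>\<^bsub>sections (structure_module (proj_structure n)) U\<^esub> = constant_section U 0"
  "r \<odot>\<^bsub>sections (structure_module (proj_structure n)) U\<^esub> t = (\<lambda>P\<in>U. r P * t P)"
  "restriction (structure_module (proj_structure n)) U V s = restrict s V"
  by (simp_all add: structure_module_def make_module_def proj_structure_def constant_section_def)

lemma
  assumes U: "openin (proj_space n) U"
  shows I_carrier: "s \<in> I U \<Longrightarrow> s \<in> constant_section U ` {q. \<forall>P\<in>U. q \<in> local_ring n P}"
    and I_zero: "constant_section U 0 \<in> I U"
    and I_plus: "constant_section U p \<in> I U \<Longrightarrow> constant_section U q \<in> I U \<Longrightarrow> constant_section U (p + q) \<in> I U"
    and I_smult: "\<forall>P\<in>U. r \<in> local_ring n P \<Longrightarrow> constant_section U q \<in> I U \<Longrightarrow> constant_section U (r * q) \<in> I U"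
    and I_restrict: "openin (proj_space n) V \<Longrightarrow> V \<subseteq> U \<Longrightarrow> constant_section U q \<in> I U \<Longrightarrow> constant_section V q \<in> I V"
    and I_local: "\<forall>P\<in>U. q \<in> local_ring n P \<Longrightarrow>
      \<forall>P\<in>U. \<exists>V. openin (proj_space n) V \<and> P \<in> V \<and> V \<subseteq> U \<and> constant_section V q \<in> I V \<Longrightarrow> constant_section U q \<in> I U"
proof -
  let ?O = "structure_module (proj_structure n)"
  have sub: "submodule (I U) (ring_sections (proj_structure n) U) (sections ?O U)"
    and res: "\<And>V. openin (proj_space n) V \<Longrightarrow> V \<subseteq> U \<Longrightarrow> restriction ?O U V ` I U \<subseteq> I V"
    and loc: "\<And>s. s \<in> carrier (sections ?O U) \<Longrightarrow>
      \<forall>x\<in>U. \<exists>V. openin (proj_space n) V \<and> x \<in> V \<and> V \<subseteq> U \<and> restriction ?O U V s \<in> I V \<Longrightarrow> s \<in> I U"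
    using subsheaf_I U unfolding subsheaf_def by blast+
  interpret submodule "I U" "ring_sections (proj_structure n) U" "sections ?O U" by (rule sub)
  show "s \<in> I U \<Longrightarrow> s \<in> constant_section U ` {q. \<forall>P\<in>U. q \<in> local_ring n P}"
    using subset carrier_O[OF U] by auto
  show "constant_section U 0 \<in> I U" using one_closed by (simp add: O_simps)
  show "constant_section U (p + q) \<in> I U" if "constant_section U p \<in> I U" "constant_section U q \<in> I U"
    using m_closed[OF that] by (simp add: O_simps constant_section_add)
  show "constant_section U (r * q) \<in> I U" if "\<forall>P\<in>U. r \<in> local_ring n P" "constant_section U q \<in> I U"
  proof -
    have "constant_section U r \<in> carrier (ring_sections (proj_structure n) U)"
      unfolding carrier_ring_sections[OF U] using that(1) by blast
    from smult_closed[OF this that(2)] show ?thesis by (simp add: O_simps constant_section_mult)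
  qed
  show "constant_section V q \<in> I V" if "openin (proj_space n) V" "V \<subseteq> U" "constant_section U q \<in> I U"
    using res[OF that(1,2)] that(3) restrict_constant_section[OF that(2), of q] by (auto simp: O_simps)
  show "constant_section U q \<in> I U" if q: "\<forall>P\<in>U. q \<in> local_ring n P"
    and l: "\<forall>P\<in>U. \<exists>V. openin (proj_space n) V \<and> P \<in> V \<and> V \<subseteq> U \<and> constant_section V q \<in> I V"
  proof (rule loc)
    show "constant_section U q \<in> carrier (sections ?O U)" unfolding carrier_O[OF U] using q by blast
    show "\<forall>x\<in>U. \<exists>V. openin (proj_space n) V \<and> x \<in> V \<and> V \<subseteq> U \<and> restriction ?O U V (constant_section U q) \<in> I V"
      unfolding O_simps using l restrict_constant_section by metis
  qed
qed

lemma Ist_local: assumes "q \<in> Ist P" shows "q \<in> local_ring n P"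
proof -
  obtain U where U: "openin (proj_space n) U" "P \<in> U" "constant_section U q \<in> I U"
    using assms unfolding ideal_stalk_def by blast
  then obtain q' where q': "constant_section U q = constant_section U q'" "\<forall>P\<in>U. q' \<in> local_ring n P"
    using I_carrier[OF U(1,3)] by blast
  have "q = q'" by (rule constant_section_inj[OF _ q'(1)]) (use U(2) in blast)
  then show ?thesis using q'(2) U(2) by blast
qed

text \<open>By the sheaf condition, membership in an ideal sheaf is decided at the stalks.\<close>

lemma I_eq:
  assumes U: "openin (proj_space n) U"
  shows "I U = constant_section U ` {q. \<forall>P\<in>U. q \<in> Ist P}"
proof (intro equalityI subsetI)
  fix s assume s: "s \<in> I U"
  then obtain q where "s = constant_section U q" using I_carrier[OF U s] by blast
  then show "s \<in> constant_section U ` {q. \<forall>P\<in>U. q \<in> Ist P}"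
    using s U unfolding ideal_stalk_def by blast
next
  fix s assume "s \<in> constant_section U ` {q. \<forall>P\<in>U. q \<in> Ist P}"
  then obtain q where q: "s = constant_section U q" "\<forall>P\<in>U. q \<in> Ist P" by blast
  show "s \<in> I U"
    unfolding q(1)
  proof (rule I_local[OF U], intro ballI Ist_local)
    show "\<And>P. P \<in> U \<Longrightarrow> q \<in> Ist P" using q(2) by blast
    show "\<forall>P\<in>U. \<exists>V. openin (proj_space n) V \<and> P \<in> V \<and> V \<subseteq> U \<and> constant_section V q \<in> I V"
    proof
      fix P assume P: "P \<in> U"
      then obtain W where W: "openin (proj_space n) W" "P \<in> W" "constant_section W q \<in> I W"
        using q(2) unfolding ideal_stalk_def by blast
      have o: "openin (proj_space n) (W \<inter> U)" using W(1) U by blast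
      have "constant_section (W \<inter> U) q \<in> I (W \<inter> U)" by (rule I_restrict[OF W(1) o _ W(3)]) blast
      then show "\<exists>V. openin (proj_space n) V \<and> P \<in> V \<and> V \<subseteq> U \<and> constant_section V q \<in> I V"
        using o P W(2) by blast
    qed
  qed
qed

lemma Ist_open:
  "q \<in> Ist P \<Longrightarrow> \<exists>U. openin (proj_space n) U \<and> P \<in> U \<and> (\<forall>Q\<in>U. q \<in> Ist Q)"
  unfolding ideal_stalk_def by blast

lemma Ist_ideal:
  assumes P: "P \<in> proj_points n" shows "ideal_in (local_ring n P) (Ist P)"
  unfolding ideal_in_def
proof (intro conjI ballI subsetI)
  show "q \<in> local_ring n P" if "q \<in> Ist P" for q using that by (rule Ist_local)
  have top: "openin (proj_space n) (proj_points n)" by (metis openin_topspace topspace_proj_space)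
  then show "0 \<in> Ist P" unfolding ideal_stalk_def using I_zero P by blast
next
  fix p q assume "p \<in> Ist P" "q \<in> Ist P"
  then obtain U V where U: "openin (proj_space n) U" "P \<in> U" "constant_section U p \<in> I U"
    and V: "openin (proj_space n) V" "P \<in> V" "constant_section V q \<in> I V" unfolding ideal_stalk_def by blast
  have o: "openin (proj_space n) (U \<inter> V)" using U V by blast
  have "constant_section (U \<inter> V) (p + q) \<in> I (U \<inter> V)"
    by (rule I_plus[OF o I_restrict[OF U(1) o _ U(3)] I_restrict[OF V(1) o _ V(3)]]) auto
  then show "p + q \<in> Ist P" unfolding ideal_stalk_def using o U(2) V(2) by blast
next
  fix r q assume r: "r \<in> local_ring n P" and "q \<in> Ist P"
  then obtain U where U: "openin (proj_space n) U" "P \<in> U" "constant_section U q \<in> I U" unfolding ideal_stalk_def by blast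
  obtain V where V: "openin (proj_space n) V" "P \<in> V" "\<forall>Q\<in>V. r \<in> local_ring n Q"
    using stalk_open[OF P r] by blast
  have o: "openin (proj_space n) (U \<inter> V)" using U V by blast
  have "constant_section (U \<inter> V) (r * q) \<in> I (U \<inter> V)"
    by (rule I_smult[OF o _ I_restrict[OF U(1) o _ U(3)]]) (use V in auto)
  then show "r * q \<in> Ist P" unfolding ideal_stalk_def using o U(2) V(2) by blast
qed

sublocale O_mod_I: constant_quotient n "structure_module (proj_structure n)" I constant_section "local_ring n" Ist "(*)"
proof
  note id = ideal_inD[OF Ist_ideal]
  fix U V :: "point set" and P :: point and q q' r :: ratfun
  { assume U: "openin (proj_space n) U"
    show "carrier (sections (structure_module (proj_structure n)) U) = constant_section U ` {q. \<forall>P\<in>U. q \<in> local_ring n P}"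
      by (rule carrier_O[OF U])
    show "\<zero>\<^bsub>sections (structure_module (proj_structure n)) U\<^esub> = constant_section U 0" by (rule O_simps)
    show "constant_section U q \<oplus>\<^bsub>sections (structure_module (proj_structure n)) U\<^esub> constant_section U q' = constant_section U (q + q')"
      unfolding O_simps by (rule constant_section_add)
    show "constant_section U r \<odot>\<^bsub>sections (structure_module (proj_structure n)) U\<^esub> constant_section U q = constant_section U (r * q)"
      unfolding O_simps by (rule constant_section_mult)
    show "V \<subseteq> U \<Longrightarrow> restriction (structure_module (proj_structure n)) U V (constant_section U q) = constant_section V q"
      unfolding O_simps by (rule restrict_constant_section)
    show "I U = constant_section U ` {q. \<forall>P\<in>U. q \<in> Ist P}" by (rule I_eq[OF U])
    show "U \<noteq> {} \<Longrightarrow> constant_section U q = constant_section U q' \<Longrightarrow> q = q'" by (rule constant_section_inj)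
  }
  { assume P: "P \<in> proj_points n"
    show "q \<in> local_ring n P \<Longrightarrow> \<exists>U. openin (proj_space n) U \<and> P \<in> U \<and> (\<forall>Q\<in>U. q \<in> local_ring n Q)" by (rule stalk_open[OF P])
    show "q \<in> Ist P \<Longrightarrow> \<exists>U. openin (proj_space n) U \<and> P \<in> U \<and> (\<forall>Q\<in>U. q \<in> Ist Q)" by (rule Ist_open)
    show "q \<in> Ist P \<Longrightarrow> q \<in> local_ring n P" by (rule Ist_local)
    show "q \<in> local_ring n P \<Longrightarrow> q' \<in> local_ring n P \<Longrightarrow> q + q' \<in> local_ring n P" by (rule stalk_add[OF P])
    show "q \<in> local_ring n P \<Longrightarrow> - q \<in> local_ring n P" by (rule stalk_uminus[OF P])
    show "r \<in> local_ring n P \<Longrightarrow> q \<in> local_ring n P \<Longrightarrow> r * q \<in> local_ring n P" by (rule stalk_smult[OF P])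
    show "0 \<in> Ist P" by (rule id(2)[OF P])
    show "q \<in> Ist P \<Longrightarrow> q' \<in> Ist P \<Longrightarrow> q + q' \<in> Ist P" by (rule id(3)[OF P])
    show "q \<in> Ist P \<Longrightarrow> - q \<in> Ist P" using id(4)[OF P stalk_const[OF P, of "-1"], of q] by simp
    show "r \<in> local_ring n P \<Longrightarrow> q \<in> Ist P \<Longrightarrow> r * q \<in> Ist P" by (rule id(4)[OF P])
  }
  show "r * (q - q') = r * q - r * q'" by (rule right_diff_distrib)
qed

end

section \<open>Zero-dimensional subschemes\<close>

context subscheme begin

lemma ideal_sheaf_simps:
  "carrier (sections (ideal_sheaf n I) U) = I U"
  "s \<oplus>\<^bsub>sections (ideal_sheaf n I) U\<^esub> t = (\<lambda>P\<in>U. s P + t P)"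
  "\<zero>\<^bsub>sections (ideal_sheaf n I) U\<^esub> = constant_section U 0"
  "r \<odot>\<^bsub>sections (ideal_sheaf n I) U\<^esub> t = (\<lambda>P\<in>U. r P * t P)"
  "restriction (ideal_sheaf n I) U V s = restrict s V"
  by (simp_all add: ideal_sheaf_def restrict_to_def structure_module_def make_module_def proj_structure_def
      constant_section_def)

text \<open>Local generators on \<open>U\<close> are constant families, so the same elements of the field generate
  every stalk over \<open>U\<close>.\<close>

lemma finitely_generated_stalks:
  assumes ft: "finite_type (proj_space n) (proj_structure n) (ideal_sheaf n I)" and P: "P \<in> proj_points n"
  shows "\<exists>U k s. openin (proj_space n) U \<and> P \<in> U \<and> (\<forall>Q\<in>U. (\<forall>j<k. s j \<in> Ist Q) \<and>
        (\<forall>q\<in>Ist Q. \<exists>c. (\<forall>j<k. c j \<in> local_ring n Q) \<and> q = (\<Sum>j<(k::nat). c j * s j)))"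
proof -
  have "\<exists>U k s. openin (proj_space n) U \<and> P \<in> U \<and> s \<in> {..<k} \<rightarrow> I U \<and>
     (\<forall>V t. openin (proj_space n) V \<longrightarrow> V \<subseteq> U \<longrightarrow> t \<in> I V \<longrightarrow>
        (\<forall>y\<in>V. \<exists>W. openin (proj_space n) W \<and> y \<in> W \<and> W \<subseteq> V \<and>
           (\<exists>c\<in>{..<k} \<rightarrow> carrier (ring_sections (proj_structure n) W).
              restriction (ideal_sheaf n I) V W t = linear_combination (ideal_sheaf n I) U k s W c)))"
    using ft P unfolding finite_type_def topspace_proj_space ideal_sheaf_simps(1) by blast
  then obtain U k s where U: "openin (proj_space n) U" "P \<in> U" and s: "s \<in> {..<k} \<rightarrow> I U"
    and gen: "\<And>V t y. openin (proj_space n) V \<Longrightarrow> V \<subseteq> U \<Longrightarrow> t \<in> I V \<Longrightarrow> y \<in> V \<Longrightarrow>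
        \<exists>W. openin (proj_space n) W \<and> y \<in> W \<and> W \<subseteq> V \<and>
           (\<exists>c\<in>{..<k} \<rightarrow> carrier (ring_sections (proj_structure n) W).
              restriction (ideal_sheaf n I) V W t = linear_combination (ideal_sheaf n I) U k s W c)"
    by meson
  have "\<forall>j. \<exists>q. j < k \<longrightarrow> s j = constant_section U q \<and> (\<forall>Q\<in>U. q \<in> Ist Q)"
    using s I_eq[OF U(1)] by blast
  then obtain g where g: "\<And>j. j < k \<Longrightarrow> s j = constant_section U (g j)" "\<And>j Q. j < k \<Longrightarrow> Q \<in> U \<Longrightarrow> g j \<in> Ist Q"
    by metis
  have comb: "\<exists>c. (\<forall>j<k. c j \<in> local_ring n Q) \<and> q = (\<Sum>j<k. c j * g j)" if Q: "Q \<in> U" and q: "q \<in> Ist Q" for Q q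
  proof -
    obtain V0 where V0: "openin (proj_space n) V0" "Q \<in> V0" "\<forall>R\<in>V0. q \<in> Ist R" using Ist_open[OF q] by blast
    define V where "V = V0 \<inter> U"
    have V: "openin (proj_space n) V" "V \<subseteq> U" "Q \<in> V" using V0 U Q by (auto simp: V_def)
    have "constant_section V q \<in> I V" unfolding I_eq[OF V(1)] using V0(3) by (auto simp: V_def)
    from gen[OF V(1,2) this V(3)] obtain W c where W: "openin (proj_space n) W" "Q \<in> W" "W \<subseteq> V"
      and c: "c \<in> {..<k} \<rightarrow> carrier (ring_sections (proj_structure n) W)"
      and eq: "restriction (ideal_sheaf n I) V W (constant_section V q) = linear_combination (ideal_sheaf n I) U k s W c"
      by blast
    have "\<forall>j. \<exists>r. j < k \<longrightarrow> c j = constant_section W r \<and> (\<forall>R\<in>W. r \<in> local_ring n R)"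
      using c carrier_ring_sections[OF W(1)] by blast
    then obtain r where r: "\<And>j. j < k \<Longrightarrow> c j = constant_section W (r j)"
      "\<And>j R. j < k \<Longrightarrow> R \<in> W \<Longrightarrow> r j \<in> local_ring n R" by metis
    have WU: "W \<subseteq> U" using W(3) V(2) by blast
    note id = ideal_inD[OF Ist_ideal[OF open_points[OF W(1)]]]
    have "linear_combination (ideal_sheaf n I) U k s W c = constant_section W (\<Sum>j<k. r j * g j)"
      unfolding linear_combination_def
    proof (rule finsum_image[where D = "{q. \<forall>R\<in>W. q \<in> Ist R}"])
      show "x + y \<in> {q. \<forall>R\<in>W. q \<in> Ist R}" if "x \<in> {q. \<forall>R\<in>W. q \<in> Ist R}" "y \<in> {q. \<forall>R\<in>W. q \<in> Ist R}" for x y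
        using that id(3) by blast
      show "0 \<in> {q. \<forall>R\<in>W. q \<in> Ist R}" using id(2) by blast
      show "carrier (sections (ideal_sheaf n I) W) = constant_section W ` {q. \<forall>R\<in>W. q \<in> Ist R}"
        unfolding ideal_sheaf_simps by (rule I_eq[OF W(1)])
      show "constant_section W x \<oplus>\<^bsub>sections (ideal_sheaf n I) W\<^esub> constant_section W y = constant_section W (x + y)" for x y
        unfolding ideal_sheaf_simps by (rule constant_section_add)
      show "\<zero>\<^bsub>sections (ideal_sheaf n I) W\<^esub> = constant_section W 0" by (rule ideal_sheaf_simps)
      fix j assume j: "j < k"
      show "r j * g j \<in> {q. \<forall>R\<in>W. q \<in> Ist R}" using id(4) r(2)[OF j] g(2)[OF j] WU by blast
      show "c j \<odot>\<^bsub>sections (ideal_sheaf n I) W\<^esub> restriction (ideal_sheaf n I) U W (s j) = constant_section W (r j * g j)"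
        unfolding ideal_sheaf_simps g(1)[OF j] r(1)[OF j] restrict_constant_section[OF WU]
        by (rule constant_section_mult)
    qed
    then have "constant_section W q = constant_section W (\<Sum>j<k. r j * g j)"
      using eq unfolding ideal_sheaf_simps restrict_constant_section[OF W(3)] by simp
    then have "q = (\<Sum>j<k. r j * g j)" using W(2) by (intro constant_section_inj[of W]) auto
    then show ?thesis using r(2) W(2) by blast
  qed
  show ?thesis
    by (intro exI[of _ U] exI[of _ k] exI[of _ g] conjI ballI allI impI U comb g(2))
qed

lemma zero_set_closed:
  assumes "P \<in> proj_points n" shows "closedin (proj_space n) {R \<in> proj_points n. P \<subseteq> R}"
proof -
  let ?E = "{f \<in> P. \<exists>k. homogeneous n k f}"
  have "P \<subseteq> R \<longleftrightarrow> ?E \<subseteq> R" if R: "R \<in> proj_points n" for R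
    using point_subsetI[OF assms R] by blast
  then have eq: "proj_points n - {R \<in> proj_points n. P \<subseteq> R} = proj_points n - {R. ?E \<subseteq> R}" by blast
  have "openin (proj_space n) (proj_points n - {R \<in> proj_points n. P \<subseteq> R})"
    unfolding openin_proj_space zariski_open_def by (intro exI[of _ ?E] conjI eq) simp
  then show ?thesis by (auto simp: closedin_def topspace_proj_space)
qed

lemma open_generization:
  assumes "openin (proj_space n) U" "R \<in> U" "P \<in> proj_points n" "P \<subseteq> R" shows "P \<in> U"
  using assms unfolding openin_iff_basic by blast

abbreviation Z :: "point set" where
  "Z \<equiv> support (proj_space n) (subscheme_structure n I)"

text \<open>The point \<open>P\<close> is dense in this set: an open set that contains a specialisation of \<open>P\<close>
  contains \<open>P\<close>.\<close>

lemma irreducible_in_support: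
  assumes P: "P \<in> proj_points n" "P \<in> Z"
  shows "irreducible_closed (subscheme_space n I) {R \<in> Z. P \<subseteq> R}"
  unfolding irreducible_closed_def
proof (intro conjI allI impI)
  have Zp: "Z \<subseteq> proj_points n" by (auto simp: support_def topspace_proj_space)
  show "closedin (subscheme_space n I) {R \<in> Z. P \<subseteq> R}"
    unfolding subscheme_space_def closedin_subtopology
    using zero_set_closed[OF P(1)] Zp by (intro exI[of _ "{R \<in> proj_points n. P \<subseteq> R}"]) blast
  show "{R \<in> Z. P \<subseteq> R} \<noteq> {}" using P(2) by blast
  have whole: "{R \<in> Z. P \<subseteq> R} \<subseteq> C" if C: "closedin (subscheme_space n I) C" "P \<in> C" for C
  proof
    obtain T where T: "closedin (proj_space n) T" "C = T \<inter> Z"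
      using C(1) unfolding subscheme_space_def closedin_subtopology by blast
    have o: "openin (proj_space n) (proj_points n - T)"
      using T(1) by (simp add: closedin_def topspace_proj_space)
    fix R assume R: "R \<in> {R \<in> Z. P \<subseteq> R}"
    have "R \<in> T"
    proof (rule ccontr)
      assume "R \<notin> T"
      then have "R \<in> proj_points n - T" using R Zp by blast
      then have "P \<in> proj_points n - T" using open_generization[OF o _ P(1)] R by blast
      then show False using C(2) T(2) by blast
    qed
    then show "R \<in> C" using T(2) R by blast
  qed
  fix A B assume "closedin (subscheme_space n I) A" "closedin (subscheme_space n I) B" "{R \<in> Z. P \<subseteq> R} = A \<union> B"
  then show "A = {R \<in> Z. P \<subseteq> R} \<or> B = {R \<in> Z. P \<subseteq> R}"
    using whole[of A] whole[of B] P(2) by blast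
qed

text \<open>If the germ of the section \<open>1\<close> vanishes at \<open>P\<close>, then \<open>1\<close> lies in the stalk of the ideal.\<close>

lemma nonunit_in_support:
  assumes P: "P \<in> proj_points n" and one: "1 \<notin> Ist P"
  shows "P \<in> Z"
proof (rule ccontr)
  let ?F = "subscheme_structure n I"
  let ?pts = "proj_points n"
  have top: "openin (proj_space n) ?pts" by (metis openin_topspace topspace_proj_space)
  assume "P \<notin> Z"
  then have triv: "stalk (proj_space n) ?F P = {germ (proj_space n) ?F P ?pts \<zero>\<^bsub>sections ?F ?pts\<^esub>}"
    using P by (simp add: support_def topspace_proj_space)
  define \<sigma> where "\<sigma> = (\<lambda>P\<in>?pts. O_mod_I.germ_class P 1)"
  have zero: "\<zero>\<^bsub>sections ?F ?pts\<^esub> = (\<lambda>P\<in>?pts. O_mod_I.germ_class P 0)"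
    unfolding subscheme_structure_def by (rule O_mod_I.zero_QS[OF top])
  have car: "\<sigma> \<in> carrier (sections ?F ?pts)"
    unfolding subscheme_structure_def
  proof (rule iffD2[OF O_mod_I.carrier_QS[OF top]], intro conjI ballI)
    show "\<sigma> \<in> extensional ?pts" by (simp add: \<sigma>_def)
    have "1 \<in> O_mod_I.Fsec ?pts" by (simp add: O_mod_I.Fsec_def stalk_1)
    moreover have "\<forall>y\<in>?pts. \<sigma> y = O_mod_I.germ_class y 1" by (simp add: \<sigma>_def)
    ultimately show "\<exists>V q. openin (proj_space n) V \<and> P \<in> V \<and> V \<subseteq> ?pts \<and> q \<in> O_mod_I.Fsec V \<and> (\<forall>y\<in>V. \<sigma> y = O_mod_I.germ_class y q)"
      if "P \<in> ?pts" for P using top that by blast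
  qed
  have res: "restriction ?F U V s = restrict s V" for U V s
    unfolding subscheme_structure_def by (rule O_mod_I.restriction_QS)
  have "germ (proj_space n) ?F P ?pts \<sigma> \<in> stalk (proj_space n) ?F P"
    unfolding stalk_def using top P car by blast
  then have eq: "germ (proj_space n) ?F P ?pts \<sigma> = germ (proj_space n) ?F P ?pts \<zero>\<^bsub>sections ?F ?pts\<^esub>"
    using triv by blast
  have "(?pts, \<sigma>) \<in> germ (proj_space n) ?F P ?pts \<sigma>"
    unfolding germ_def using top P car by blast
  then have "(?pts, \<sigma>) \<in> germ (proj_space n) ?F P ?pts \<zero>\<^bsub>sections ?F ?pts\<^esub>" unfolding eq .
  then obtain W where W: "P \<in> W" "restrict \<zero>\<^bsub>sections ?F ?pts\<^esub> W = restrict \<sigma> W"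
    unfolding germ_def res by blast
  have "O_mod_I.germ_class P 0 = O_mod_I.germ_class P 1"
    using fun_cong[OF W(2), of P] W(1) P unfolding zero \<sigma>_def by simp
  then have "0 - 1 \<in> Ist P"
    using O_mod_I.germ_class_eq_iff[OF P stalk_0[OF P] stalk_1[OF P]] by simp
  then show False
    using O_mod_I.Nst_uminus[OF P, of "0 - 1"] one by simp
qed

text \<open>The closures of two comparable points form a chain of length one.\<close>

lemma krull_dim_pair:
  assumes P: "P \<in> proj_points n" "1 \<notin> Ist P" and Q: "Q \<in> proj_points n" "1 \<notin> Ist Q" and "P \<subset> Q"
  shows "krull_dim (subscheme_space n I) \<noteq> 0"
proof -
  have PZ: "P \<in> Z" and QZ: "Q \<in> Z" using nonunit_in_support P Q by blast+
  define C where "C i = (if i = (0::nat) then {R \<in> Z. Q \<subseteq> R} else {R \<in> Z. P \<subseteq> R})" for i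
  have "\<forall>i\<le>1. irreducible_closed (subscheme_space n I) (C i)"
    using irreducible_in_support[OF P(1) PZ] irreducible_in_support[OF Q(1) QZ] by (simp add: C_def)
  moreover have "\<forall>i<1. C i \<subset> C (Suc i)"
    using \<open>P \<subset> Q\<close> PZ by (auto simp: C_def)
  ultimately have "ereal (real 1) \<le> krull_dim (subscheme_space n I)"
    unfolding krull_dim_def by (intro Sup_upper CollectI exI[of _ 1]) blast
  then show ?thesis by auto
qed

end

lemma ideal_stalks_of_zero_dimensional:
  assumes "zero_dimensional_subscheme n I"
  shows "ideal_stalks n (ideal_stalk n I)"
proof -
  have sub: "subsheaf (proj_space n) (proj_structure n) (structure_module (proj_structure n)) I"
    and coh: "finite_type (proj_space n) (proj_structure n) (ideal_sheaf n I)"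
    and dim: "krull_dim (subscheme_space n I) = 0"
    using assms by (simp_all add: zero_dimensional_subscheme_def closed_subscheme_def coherent_def)
  interpret subscheme n I by unfold_locales (rule sub)
  show ?thesis
  proof
    fix P assume P: "P \<in> proj_points n"
    show "ideal_in (local_ring n P) (Ist P)" by (rule Ist_ideal[OF P])
    show "\<exists>U. openin (proj_space n) U \<and> P \<in> U \<and> (\<forall>Q\<in>U. q \<in> Ist Q)" if "q \<in> Ist P" for q
      by (rule Ist_open[OF that])
    show "\<exists>U k s. openin (proj_space n) U \<and> P \<in> U \<and> (\<forall>Q\<in>U. (\<forall>j<k. s j \<in> Ist Q) \<and>
        (\<forall>q\<in>Ist Q. \<exists>c. (\<forall>j<k. c j \<in> local_ring n Q) \<and> q = (\<Sum>j<(k::nat). c j * s j)))"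
      by (rule finitely_generated_stalks[OF coh P])
    show "1 \<in> Ist Q" if "Q \<in> proj_points n" "P \<subset> Q" "1 \<notin> Ist P" for Q
      using krull_dim_pair[OF P that(3,1) _ that(2)] dim by blast
  qed
qed

section \<open>Global sections of the structure sheaf\<close>

context ideal_on_chart begin

text \<open>Distinct points of the support are separated by some coordinate, and a power of the
  corresponding linear factor lies in the stalk at one point but is a unit at the other.\<close>

lemma separate_points:
  assumes P: "P \<in> supp" "l \<notin> P" and Q: "Q \<in> supp" "l \<notin> Q" and "P \<noteq> Q"
  shows "\<exists>e\<in>A. e \<notin> max_ideal n P \<and> e \<in> I Q"
proof -
  have pP: "P \<in> proj_points n" and pQ: "Q \<in> proj_points n" using P Q by (auto simp: supp_def)
  obtain cs where cs: "\<And>j. j \<le> n \<Longrightarrow> prod_list (map (\<lambda>c. coordinate j - scalar c) (cs j)) \<in> J"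
    using coordinate_roots by blast
  have "\<forall>j. \<exists>z. j \<le> n \<longrightarrow> coordinate j - scalar z \<in> max_ideal n Q"
    using root_at_point[OF pQ Q(2) A_coordinate] cs supp_iff[OF pQ Q(2)] Q(1) by blast
  then obtain x where x: "\<And>j. j \<le> n \<Longrightarrow> coordinate j - scalar (x j) \<in> max_ideal n Q" by metis
  obtain j where j: "j \<le> n" "coordinate j - scalar (x j) \<notin> max_ideal n P"
    using points_eqI[OF pP P(2) pQ Q(2), of x] x \<open>P \<noteq> Q\<close> by blast
  define y where "y = coordinate j - scalar (x j)"
  have yA: "y \<in> A" unfolding y_def by (intro A_diff A_coordinate j A_scalar)
  \<comment> \<open>Linear factors with a root other than the value at \<open>Q\<close> are units at \<open>Q\<close> and can be cancelled.\<close>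
  have claim: "y ^ length zs * t \<in> I Q"
    if "t \<in> local_ring n Q" "prod_list (map (\<lambda>c. coordinate j - scalar c) zs) * t \<in> I Q" for zs t
    using that
  proof (induction zs arbitrary: t)
    case (Cons z zs)
    let ?p = "prod_list (map (\<lambda>c. coordinate j - scalar c) zs)"
    have yt: "y * t \<in> local_ring n Q" by (rule stalk_smult[OF pQ A_local[OF yA pQ Q(2)] Cons.prems(1)])
    show ?case
    proof (cases "z = x j")
      case True
      then have "?p * (y * t) \<in> I Q" using Cons.prems(2) by (simp add: y_def mult_ac)
      from Cons.IH[OF yt this] show ?thesis by (simp add: mult_ac)
    next
      case False
      have zA: "coordinate j - scalar z \<in> A" by (intro A_diff A_coordinate j A_scalar)
      have nz: "coordinate j - scalar z \<notin> max_ideal n Q"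
      proof
        assume "coordinate j - scalar z \<in> max_ideal n Q"
        from max_ideal_diff[OF pQ this x[OF j(1)]] have "scalar (x j - z) \<in> max_ideal n Q" by simp
        then show False using False by (simp only: max_ideal_const_iff[OF pQ]) simp
      qed
      have "(coordinate j - scalar z) * (?p * t) \<in> I Q" using Cons.prems(2) by (simp add: mult.assoc)
      then have "?p * t \<in> I Q" by (rule I_unit_cancel[OF pQ A_local[OF zA pQ Q(2)] nz])
      from I_mult[OF pQ A_local[OF yA pQ Q(2)] Cons.IH[OF Cons.prems(1) this]]
      show ?thesis by (simp add: mult_ac)
    qed
  qed simp
  have "prod_list (map (\<lambda>c. coordinate j - scalar c) (cs j)) * 1 \<in> I Q"
    using J_stalk[OF cs[OF j(1)] pQ Q(2)] by simp
  from claim[OF stalk_1[OF pQ] this] have "y ^ length (cs j) \<in> I Q" by simp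
  moreover have "y ^ length (cs j) \<notin> max_ideal n P"
    using j(2) by (intro power_notin_max_ideal[OF pP P(2) yA]) (simp add: y_def)
  ultimately show ?thesis using A_power[OF yA] by blast
qed

lemma separating_element:
  assumes P: "P \<in> supp" "l \<notin> P" and T: "finite T" "T \<subseteq> supp" "\<And>Q. Q \<in> T \<Longrightarrow> l \<notin> Q" "P \<notin> T"
  shows "\<exists>e\<in>A. e \<notin> max_ideal n P \<and> (\<forall>Q\<in>T. e \<in> I Q)"
  using T
proof (induction T)
  case empty
  have "1 \<notin> max_ideal n P" using P max_ideal_1 by (simp add: supp_def)
  then show ?case using A_1 by blast
next
  case (insert Q T)
  have pP: "P \<in> proj_points n" using P by (simp add: supp_def)
  obtain e where e: "e \<in> A" "e \<notin> max_ideal n P" "\<forall>Q\<in>T. e \<in> I Q" using insert by auto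
  obtain d where d: "d \<in> A" "d \<notin> max_ideal n P" "d \<in> I Q" using separate_points[OF P, of Q] insert by blast
  have "d * e \<in> I R" if "R \<in> insert Q T" for R
  proof -
    have R: "R \<in> proj_points n" "l \<notin> R" using that insert by (auto simp: supp_def)
    show ?thesis
      using that e(3) d(3) I_mult[OF R(1) A_local[OF d(1) R], of e] I_mult[OF R(1) A_local[OF e(1) R], of d]
      by (auto simp: mult.commute)
  qed
  moreover have "d * e \<notin> max_ideal n P"
    using max_ideal_prime[OF pP A_local[OF d(1) pP P(2)] A_local[OF e(1) pP P(2)]] d e by blast
  ultimately show ?case using A_mult[OF d(1) e(1)] by blast
qed

end

locale subscheme_basis = subscheme n I + ideal_basis n "ideal_stalk n I" a c b for n I a c b
begin

abbreviation pts :: "point set" where "pts \<equiv> proj_points n"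

lemma open_pts: "openin (proj_space n) pts"
  by (metis openin_topspace topspace_proj_space)

text \<open>The support lies in the chart, so the ideal is the unit ideal along \<open>l = 0\<close>.\<close>

lemma stalk_off_chart: "P \<in> pts \<Longrightarrow> l \<in> P \<Longrightarrow> q \<in> local_ring n P \<Longrightarrow> q \<in> Ist P"
  using off_supp I_mult[of P q 1] by (force simp: supp_def)

text \<open>The section of \<open>\<O>\<^sub>Z\<close> given by a function on the chart. Outside the chart the function may have
  poles, and the stalks of \<open>\<O>\<^sub>Z\<close> vanish there.\<close>

definition global :: "ratfun \<Rightarrow> point \<Rightarrow> (point set \<times> func set) set" where
  "global f = (\<lambda>P\<in>pts. O_mod_I.germ_class P (if l \<in> P then 0 else f))"

lemma global_outside: "P \<notin> pts \<Longrightarrow> global f P = undefined"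
  by (simp add: global_def)

lemma germ_class_eq: "P \<in> pts \<Longrightarrow> p \<in> local_ring n P \<Longrightarrow> q \<in> local_ring n P \<Longrightarrow> p - q \<in> Ist P \<Longrightarrow> O_mod_I.germ_class P p = O_mod_I.germ_class P q"
  using O_mod_I.germ_class_eq_iff by blast

lemma global_carrier:
  assumes f: "f \<in> A" shows "global f \<in> carrier (sections (subscheme_structure n I) pts)"
  unfolding subscheme_structure_def
proof (rule iffD2[OF O_mod_I.carrier_QS[OF open_pts]], intro conjI ballI)
  show "global f \<in> extensional pts" by (simp add: global_def)
  fix P assume P: "P \<in> pts"
  show "\<exists>V q. openin (proj_space n) V \<and> P \<in> V \<and> V \<subseteq> pts \<and> q \<in> O_mod_I.Fsec V \<and> (\<forall>y\<in>V. global f y = O_mod_I.germ_class y q)"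
  proof (cases "l \<in> P")
    case False
    let ?V = "{Q \<in> pts. l \<notin> Q}"
    have "f \<in> O_mod_I.Fsec ?V" using A_local[OF f] by (simp add: O_mod_I.Fsec_def)
    then show ?thesis using P False openin_basic[OF hom_l]
      by (intro exI[of _ ?V] exI[of _ f]) (auto simp: global_def)
  next
    case True
    then have "1 \<in> Ist P" using stalk_off_chart[OF P] stalk_1[OF P] by blast
    then obtain V where V: "openin (proj_space n) V" "P \<in> V" "\<forall>Q\<in>V. 1 \<in> Ist Q" using Ist_open by blast
    have "global f y = O_mod_I.germ_class y 0" if y: "y \<in> V" for y
    proof (cases "l \<in> y")
      case True
      then show ?thesis using open_points[OF V(1) y] by (simp add: global_def)
    next
      case False
      note py = open_points[OF V(1) y]
      have "f - 0 \<in> Ist y" using I_mult[OF py A_local[OF f py False], of 1] V(3) y by simp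
      then have "O_mod_I.germ_class y f = O_mod_I.germ_class y 0" by (rule germ_class_eq[OF py A_local[OF f py False] stalk_0[OF py]])
      then show ?thesis using py False by (simp add: global_def)
    qed
    moreover have "0 \<in> O_mod_I.Fsec V" using stalk_0[OF open_points[OF V(1)]] by (simp add: O_mod_I.Fsec_def)
    moreover have "V \<subseteq> pts" using open_points[OF V(1)] by blast
    ultimately show ?thesis using V(1,2) by blast
  qed
qed

text \<open>For a global section the denominators \<open>g\<close> with which it becomes regular on the chart form
  an ideal, and this ideal is the unit ideal because the points of the support can be
  separated.\<close>

lemma global_surjective:
  assumes \<sigma>: "\<sigma> \<in> carrier (sections (subscheme_structure n I) pts)"
  shows "\<exists>f\<in>A. \<sigma> = global f"
proof -
  have car: "\<sigma> \<in> carrier (sections O_mod_I.QS pts)" using \<sigma> unfolding subscheme_structure_def .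
  have "\<forall>P\<in>pts. \<exists>q. q \<in> local_ring n P \<and> \<sigma> P = O_mod_I.germ_class P q"
    using O_mod_I.sections_QS_value[OF open_pts car] by metis
  then obtain s where s: "\<And>P. P \<in> pts \<Longrightarrow> s P \<in> local_ring n P" "\<And>P. P \<in> pts \<Longrightarrow> \<sigma> P = O_mod_I.germ_class P (s P)"
    by metis
  define C where "C = {g \<in> A. \<exists>d\<in>A. \<forall>Q\<in>pts. l \<notin> Q \<longrightarrow> g * s Q - d \<in> Ist Q}"
  have "ideal_in A C"
    unfolding ideal_in_def
  proof (intro conjI ballI subsetI)
    show "0 \<in> C" unfolding C_def using I_0 A_0 by (auto intro!: bexI[of _ 0])
  next
    fix g h assume "g \<in> C" "h \<in> C"
    then have gh: "g \<in> A" "h \<in> A"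
      and ex: "\<exists>d\<in>A. \<forall>Q\<in>pts. l \<notin> Q \<longrightarrow> g * s Q - d \<in> Ist Q" "\<exists>d\<in>A. \<forall>Q\<in>pts. l \<notin> Q \<longrightarrow> h * s Q - d \<in> Ist Q"
      unfolding C_def by auto
    obtain d where d: "d \<in> A" "\<forall>Q\<in>pts. l \<notin> Q \<longrightarrow> g * s Q - d \<in> Ist Q" using ex(1) by blast
    obtain d' where d': "d' \<in> A" "\<forall>Q\<in>pts. l \<notin> Q \<longrightarrow> h * s Q - d' \<in> Ist Q" using ex(2) by blast
    have "(g + h) * s Q - (d + d') \<in> Ist Q" if "Q \<in> pts" "l \<notin> Q" for Q
    proof -
      have "(g + h) * s Q - (d + d') = (g * s Q - d) + (h * s Q - d')" by (simp add: algebra_simps)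
      moreover have "g * s Q - d \<in> Ist Q" "h * s Q - d' \<in> Ist Q" using that d(2) d'(2) by blast+
      ultimately show ?thesis using I_add[OF that(1)] by (simp only:)
    qed
    then show "g + h \<in> C"
      unfolding C_def using A_add[OF gh] A_add[OF d(1) d'(1)] by (intro CollectI conjI bexI[of _ "d + d'"]) auto
  next
    fix e g assume e: "e \<in> A" and "g \<in> C"
    then have g: "g \<in> A" and ex: "\<exists>d\<in>A. \<forall>Q\<in>pts. l \<notin> Q \<longrightarrow> g * s Q - d \<in> Ist Q"
      unfolding C_def by auto
    obtain d where d: "d \<in> A" "\<forall>Q\<in>pts. l \<notin> Q \<longrightarrow> g * s Q - d \<in> Ist Q" using ex by blast
    have "e * g * s Q - e * d \<in> Ist Q" if Q: "Q \<in> pts" "l \<notin> Q" for Q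
    proof -
      have "e * g * s Q - e * d = e * (g * s Q - d)" by (simp add: right_diff_distrib mult.assoc)
      moreover have "g * s Q - d \<in> Ist Q" using Q d(2) by blast
      ultimately show ?thesis using I_mult[OF Q(1) A_local[OF e Q]] by (simp only:)
    qed
    then show "e * g \<in> C"
      unfolding C_def using A_mult[OF e g] A_mult[OF e d(1)] by (intro CollectI conjI bexI[of _ "e * d"]) auto
  qed (auto simp: C_def)
  moreover have "\<exists>g\<in>C. g \<notin> max_ideal n P" if P: "P \<in> pts" "l \<notin> P" for P
  proof (cases "P \<in> supp")
    case False
    then obtain g where g: "g \<in> J" "g \<notin> max_ideal n P" using supp_iff[OF P] by blast
    have "g * s Q - 0 \<in> Ist Q" if "Q \<in> pts" "l \<notin> Q" for Q
      using I_mult[OF that(1) s(1)[OF that(1)] J_stalk[OF g(1) that]] by (simp add: mult.commute)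
    then have "g \<in> C"
      unfolding C_def using J_A[OF g(1)] A_0 by (intro CollectI conjI bexI[of _ 0]) auto
    with g(2) show ?thesis by blast
  next
    case True
    obtain x y where xy: "x \<in> A" "y \<in> A" "y \<notin> max_ideal n P" "s P = x / y"
      by (rule A_fraction[OF s(1)[OF P(1)] P])
    have "y \<noteq> 0" using xy(3) max_ideal_0[OF P(1)] by auto
    have "finite (supp - {P})" "supp - {P} \<subseteq> supp" "P \<notin> supp - {P}" using finite_supp by auto
    then obtain e where e: "e \<in> A" "e \<notin> max_ideal n P" "\<forall>Q\<in>supp - {P}. e \<in> Ist Q"
      using separating_element[OF True P(2), of "supp - {P}"] off_supp by blast
    have "e * y * s Q - e * x \<in> Ist Q" if Q: "Q \<in> pts" "l \<notin> Q" for Q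
    proof -
      have loc: "y * s Q - x \<in> local_ring n Q"
        by (rule stalk_diff[OF Q(1) stalk_smult[OF Q(1) A_local[OF xy(2) Q] s(1)[OF Q(1)]] A_local[OF xy(1) Q]])
      have eq: "e * y * s Q - e * x = (y * s Q - x) * e" by (simp add: algebra_simps)
      show ?thesis
      proof (cases "Q = P")
        case True
        then show ?thesis using xy(4) \<open>y \<noteq> 0\<close> I_0[OF Q(1)] by simp
      next
        case False
        show ?thesis
        proof (cases "Q \<in> supp")
          case True
          then show ?thesis unfolding eq using False e(3) by (intro I_mult[OF Q(1) loc]) blast
        next
          case False
          then have "1 \<in> Ist Q" using Q by (simp add: supp_def)
          from I_mult[OF Q(1) stalk_smult[OF Q(1) loc A_local[OF e(1) Q]] this]
          show ?thesis unfolding eq by simp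
        qed
      qed
    qed
    then have "e * y \<in> C"
      unfolding C_def using A_mult[OF e(1) xy(2)] A_mult[OF e(1) xy(1)]
      by (intro CollectI conjI bexI[of _ "e * x"]) auto
    moreover have "e * y \<notin> max_ideal n P"
      using max_ideal_prime[OF P(1) A_local[OF e(1) P] A_local[OF xy(2) P]] e xy by blast
    ultimately show ?thesis by blast
  qed
  ultimately have "1 \<in> C" by (rule one_in_ideal)
  then have "\<exists>d\<in>A. \<forall>Q\<in>pts. l \<notin> Q \<longrightarrow> 1 * s Q - d \<in> Ist Q" by (simp add: C_def)
  then obtain d where d: "d \<in> A" "\<And>Q. Q \<in> pts \<Longrightarrow> l \<notin> Q \<Longrightarrow> 1 * s Q - d \<in> Ist Q" by blast
  have "\<sigma> P = global d P" for P
  proof (cases "P \<in> pts")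
    case True
    show ?thesis
    proof (cases "l \<in> P")
      case lP: True
      have "O_mod_I.germ_class P (s P) = O_mod_I.germ_class P 0"
        by (rule germ_class_eq[OF True s(1)[OF True] stalk_0[OF True]]) (use stalk_off_chart[OF True lP s(1)[OF True]] in simp)
      then show ?thesis using True lP s(2)[OF True] by (simp add: global_def)
    next
      case False
      have "O_mod_I.germ_class P (s P) = O_mod_I.germ_class P d"
        by (rule germ_class_eq[OF True s(1)[OF True] A_local[OF d(1) True False]]) (use d(2)[OF True False] in simp)
      then show ?thesis using True False s(2)[OF True] by (simp add: global_def)
    qed
  next
    case False
    then show ?thesis
      using iffD1[OF O_mod_I.carrier_QS[OF open_pts] car] by (simp add: extensional_def global_def)
  qed
  then show ?thesis using d(1) by blast
qed

lemma global_eq_iff: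
  assumes "f \<in> A" "g \<in> A" shows "global f = global g \<longleftrightarrow> f - g \<in> J"
proof
  assume eq: "global f = global g"
  have "f - g \<in> Ist Q" if Q: "Q \<in> pts" "l \<notin> Q" for Q
  proof -
    have "O_mod_I.germ_class Q f = O_mod_I.germ_class Q g" using fun_cong[OF eq, of Q] Q by (simp add: global_def)
    then show ?thesis using O_mod_I.germ_class_eq_iff[OF Q(1) A_local[OF assms(1) Q] A_local[OF assms(2) Q]] by simp
  qed
  then show "f - g \<in> J" using A_diff[OF assms] by (simp add: J_def)
next
  assume fg: "f - g \<in> J"
  have "O_mod_I.germ_class Q f = O_mod_I.germ_class Q g" if Q: "Q \<in> pts" "l \<notin> Q" for Q
    by (rule germ_class_eq[OF Q(1) A_local[OF assms(1) Q] A_local[OF assms(2) Q] J_stalk[OF fg Q]])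
  then show "global f = global g" by (auto simp: global_def restrict_def fun_eq_iff)
qed

text \<open>The map \<open>global\<close> induces an isomorphism from \<open>A / J\<close> to \<open>H\<^sup>0(\<O>\<^sub>Z)\<close>, so \<open>b\<close> provides a basis.\<close>

lemma dimension_global_sections: "has_dimension (global_sections n (subscheme_structure n I)) c"
proof -
  let ?G = "global_sections n (subscheme_structure n I)"
  let ?S = "sections (subscheme_structure n I) pts"
  have G: "carrier ?G = carrier ?S" "\<zero>\<^bsub>?G\<^esub> = \<zero>\<^bsub>?S\<^esub>" "\<And>s t. s \<oplus>\<^bsub>?G\<^esub> t = s \<oplus>\<^bsub>?S\<^esub> t"
    "\<And>z s. z \<odot>\<^bsub>?G\<^esub> s = (\<lambda>P\<in>pts. Fract (Poly_Mapping.single 0 z) 1) \<odot>\<^bsub>?S\<^esub> s"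
    by (simp_all add: global_sections_def make_module_def Let_def)
  have car: "carrier ?G = global ` A"
    unfolding G using global_carrier global_surjective by blast
  have val: "(if l \<in> P then 0 else f) \<in> local_ring n P" if "P \<in> pts" "f \<in> A" for P f
    using that A_local stalk_0 by auto
  have add: "global f \<oplus>\<^bsub>?G\<^esub> global g = global (f + g)" if fg: "f \<in> A" "g \<in> A" for f g
  proof -
    have eq: "germ_add (proj_space n) O_mod_I.Q P (global f P) (global g P) = global (f + g) P" if P: "P \<in> pts" for P
      using O_mod_I.germ_add_germ_class[OF P val[OF P fg(1)] val[OF P fg(2)]] P by (auto simp: global_def)
    show ?thesis unfolding G unfolding subscheme_structure_def O_mod_I.add_QS
      by (rule ext) (simp add: restrict_def eq global_outside)
  qed
  have zero: "\<zero>\<^bsub>?G\<^esub> = global 0"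
    unfolding G unfolding subscheme_structure_def O_mod_I.zero_QS[OF open_pts] by (simp add: global_def)
  have smult: "z \<odot>\<^bsub>?G\<^esub> global f = global (scalar z * f)" if f: "f \<in> A" for z f
  proof -
    have c: "(\<lambda>P\<in>pts. Fract (Poly_Mapping.single 0 z) 1) = constant_section pts (scalar z)"
      by (simp add: constant_section_def fr_def const_def)
    have r: "\<forall>P\<in>pts. scalar z \<in> local_ring n P" using stalk_const by blast
    have eq: "germ_smult (proj_space n) (proj_structure n) O_mod_I.Q P pts (constant_section pts (scalar z)) (global f P) =
        global (scalar z * f) P" if P: "P \<in> pts" for P
      using O_mod_I.germ_smult_germ_class[OF open_pts P val[OF P f] r] P by (auto simp: global_def)
    show ?thesis unfolding G unfolding subscheme_structure_def O_mod_I.smult_QS c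
      by (rule ext) (simp add: restrict_def eq global_outside)
  qed
  have comb: "(\<Oplus>\<^bsub>?G\<^esub>j\<in>{..<c}. \<gamma> j \<odot>\<^bsub>?G\<^esub> global (b j)) = global (\<Sum>j<c. scalar (\<gamma> j) * b j)" for \<gamma>
    by (rule finsum_image[where D = A])
      (use A_add A_0 car add zero smult b_A A_mult[OF A_scalar] in auto)
  show ?thesis
    unfolding has_dimension_def
  proof (intro bexI[of _ "\<lambda>j. global (b j)"] ballI)
    show "(\<lambda>j. global (b j)) \<in> {..<c} \<rightarrow> carrier ?G" unfolding car using b_A by blast
    fix v assume "v \<in> carrier ?G"
    then obtain f where f: "v = global f" "f \<in> A" unfolding car by blast
    have bA: "(\<Sum>j<c. scalar (\<gamma> j) * b j) \<in> A" for \<gamma>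
      using b_A by (intro A_sum A_mult A_scalar) auto
    have iff: "v = (\<Oplus>\<^bsub>?G\<^esub>j\<in>{..<c}. \<gamma> j \<odot>\<^bsub>?G\<^esub> global (b j)) \<longleftrightarrow> f - (\<Sum>j<c. scalar (\<gamma> j) * b j) \<in> J" for \<gamma>
      unfolding comb f(1) by (rule global_eq_iff[OF f(2) bA])
    show "\<exists>!\<gamma>. \<gamma> \<in> {..<c} \<rightarrow>\<^sub>E UNIV \<and> v = (\<Oplus>\<^bsub>?G\<^esub>j\<in>{..<c}. \<gamma> j \<odot>\<^bsub>?G\<^esub> global (b j))"
      unfolding iff
    proof (rule ex1I[of _ "restrict (coord f) {..<c}"], intro conjI)
      show "restrict (coord f) {..<c} \<in> {..<c} \<rightarrow>\<^sub>E UNIV" by simp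
      show "f - (\<Sum>j<c. scalar (restrict (coord f) {..<c} j) * b j) \<in> J"
        using coord_spec[OF f(2)] by simp
      fix \<gamma> assume \<gamma>: "\<gamma> \<in> {..<c} \<rightarrow>\<^sub>E UNIV \<and> f - (\<Sum>j<c. scalar (\<gamma> j) * b j) \<in> J"
      have "\<gamma> j = restrict (coord f) {..<c} j" for j
      proof (cases "j < c")
        case True
        then show ?thesis using coord_unique[OF f(2) conjunct2[OF \<gamma>] True] by simp
      next
        case False
        then show ?thesis using \<gamma> by (auto simp: PiE_def extensional_def)
      qed
      then show "\<gamma> = restrict (coord f) {..<c}" by blast
    qed
  qed
qed

end

section \<open>The monad\<close>

context subscheme_basis begin

text \<open>The term in degree \<open>i\<close> has a basis indexed by the subsets \<open>S\<close> of \<open>{1..n}\<close> with \<open>1 - i\<close> elements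
  and the basis vectors of \<open>A / J\<close>. The index of the additional summand \<open>\<O>\<close> in degree \<open>0\<close> is
  distinct from these since \<open>0\<close> is not in \<open>{1..n}\<close>.\<close>

definition basis_index :: "int \<Rightarrow> (nat set \<times> nat) set" where
  "basis_index i = (if 1 - int n \<le> i \<and> i \<le> 1 then {S. S \<subseteq> {1..n} \<and> int (card S) = 1 - i} \<times> {..<c} else {}) \<union>
     (if i = 0 then {({0}, 0)} else {})"

definition rank :: "int \<Rightarrow> nat" where
  "rank i = card (basis_index i)"

lemma finite_basis_index: "finite (basis_index i)"
proof -
  have "finite {S. S \<subseteq> {1..n} \<and> int (card S) = 1 - i}"
    by (rule finite_subset[of _ "Pow {1..n}"]) auto
  then show ?thesis by (simp add: basis_index_def)
qed

lemma card_basis_index_koszul: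
  assumes "1 - int n \<le> i" "i \<le> 1"
  shows "card ({S. S \<subseteq> {1..n} \<and> int (card S) = 1 - i} \<times> {..<c}) = (n choose nat (1 - i)) * c"
proof -
  have "{S. S \<subseteq> {1..n} \<and> int (card S) = 1 - i} = {S. S \<subseteq> {1..n} \<and> card S = nat (1 - i)}"
    using assms by auto
  then show ?thesis using n_subsets[of "{1..n}" "nat (1 - i)"] by (simp add: card_cartesian_product)
qed

lemma rank_1: "rank 1 = c"
  unfolding rank_def basis_index_def using card_basis_index_koszul[of 1] by simp

lemma rank_0: "1 \<le> n \<Longrightarrow> rank 0 = n * c + 1"
proof -
  assume n: "1 \<le> n"
  let ?K = "{S. S \<subseteq> {1..n} \<and> int (card S) = 1 - 0} \<times> {..<c}"
  have "finite ?K" using finite_basis_index[of 0] n by (simp add: basis_index_def)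
  moreover have "({0}, 0) \<notin> ?K" by auto
  moreover have "basis_index 0 = insert ({0}, 0) ?K" using n by (auto simp: basis_index_def)
  ultimately have "rank 0 = Suc (card ?K)" by (simp add: rank_def)
  then show ?thesis using card_basis_index_koszul[of 0] n by simp
qed

lemma rank_negative: "1 - int n \<le> i \<Longrightarrow> i < 0 \<Longrightarrow> rank i = (n choose nat (1 - i)) * c"
  unfolding rank_def basis_index_def using card_basis_index_koszul[of i] by simp

definition enum :: "int \<Rightarrow> nat \<Rightarrow> nat set \<times> nat" where
  "enum i = (SOME e. bij_betw e {..<rank i} (basis_index i))"

lemma enum_bij: "bij_betw (enum i) {..<rank i} (basis_index i)"
proof -
  have "\<exists>e. bij_betw e {..<rank i} (basis_index i)"
    using ex_bij_betw_nat_finite[OF finite_basis_index[of i]] by (simp add: rank_def atLeast0LessThan)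
  then show ?thesis unfolding enum_def by (rule someI_ex)
qed

lemma enum_basis_index: "r < rank i \<Longrightarrow> enum i r \<in> basis_index i"
  using enum_bij by (auto simp: bij_betw_def)

definition position :: "int \<Rightarrow> nat set \<times> nat \<Rightarrow> nat" where
  "position i = inv_into {..<rank i} (enum i)"

lemma position: "z \<in> basis_index i \<Longrightarrow> position i z < rank i" "z \<in> basis_index i \<Longrightarrow> enum i (position i z) = z"
  "r < rank i \<Longrightarrow> position i (enum i r) = r"
  using enum_bij[of i] inv_into_into[of z "enum i" "{..<rank i}"] f_inv_into_f[of z "enum i" "{..<rank i}"]
    inv_into_f_f[of "enum i" "{..<rank i}" r]
  by (auto simp: position_def bij_betw_def)

text \<open>Local sections of a term of the monad are written as families indexed by the Koszul basis
  instead of by an initial segment of the natural numbers.\<close>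

definition term_stalk :: "int \<Rightarrow> point \<Rightarrow> (nat set \<times> nat \<Rightarrow> ratfun) set" where
  "term_stalk i P = {q. (\<forall>z. q z \<in> twist_stalk n i P) \<and> (\<forall>z. z \<notin> basis_index i \<longrightarrow> q z = 0)}"

lemma term_stalk_in: "q \<in> term_stalk i P \<Longrightarrow> q z \<in> twist_stalk n i P"
  unfolding term_stalk_def by blast

lemma term_stalk_out: "q \<in> term_stalk i P \<Longrightarrow> z \<notin> basis_index i \<Longrightarrow> q z = 0"
  unfolding term_stalk_def by blast

definition as_section :: "int \<Rightarrow> point set \<Rightarrow> (nat set \<times> nat \<Rightarrow> ratfun) \<Rightarrow> nat \<Rightarrow> func" where
  "as_section i U q = (\<lambda>r\<in>{..<rank i}. constant_section U (q (enum i r)))"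

abbreviation T :: "int \<Rightarrow> (point, func, nat \<Rightarrow> func) module_sheaf" where
  "T i \<equiv> monad_term n rank i"

lemma T_eq: "T i = power_sheaf (twist n i) (rank i)" if "1 \<le> n"
  using that by (auto simp: monad_term_def rank_def basis_index_def)

lemma T_simps:
  assumes "1 \<le> n"
  shows "carrier (sections (T i) U) = {..<rank i} \<rightarrow>\<^sub>E twist_sections n i U"
    "\<zero>\<^bsub>sections (T i) U\<^esub> = (\<lambda>j\<in>{..<rank i}. \<lambda>P\<in>U. 0)"
    "s \<oplus>\<^bsub>sections (T i) U\<^esub> t = (\<lambda>j\<in>{..<rank i}. \<lambda>P\<in>U. s j P + t j P)"
    "r \<odot>\<^bsub>sections (T i) U\<^esub> s = (\<lambda>j\<in>{..<rank i}. \<lambda>P\<in>U. r P * s j P)"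
    "restriction (T i) U V s = (\<lambda>j\<in>{..<rank i}. restrict (s j) V)"
  unfolding T_eq[OF assms] by (simp_all add: power_sheaf_def make_module_def twist_def)

lemma as_section_zero: "(\<lambda>j\<in>{..<rank i}. \<lambda>P\<in>U. 0) = as_section i U 0"
  by (auto simp: as_section_def constant_section_def restrict_def fun_eq_iff)

lemma as_section_add: "(\<lambda>j\<in>{..<rank i}. \<lambda>P\<in>U. as_section i U p j P + as_section i U q j P) = as_section i U (p + q)"
  by (auto simp: as_section_def constant_section_def restrict_def fun_eq_iff)

lemma as_section_smult: "(\<lambda>j\<in>{..<rank i}. \<lambda>P\<in>U. constant_section U r P * as_section i U q j P) = as_section i U (\<lambda>z. r * q z)"
  by (auto simp: as_section_def constant_section_def restrict_def fun_eq_iff)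

lemma as_section_restrict: "V \<subseteq> U \<Longrightarrow> (\<lambda>j\<in>{..<rank i}. restrict (as_section i U q j) V) = as_section i V q"
  by (auto simp: as_section_def constant_section_def restrict_def fun_eq_iff)

lemma as_section_empty: "as_section i {} p = as_section i {} q"
  by (auto simp: as_section_def constant_section_def restrict_def fun_eq_iff)

lemma carrier_T:
  assumes n: "1 \<le> n" and U: "openin (proj_space n) U"
  shows "carrier (sections (T i) U) = as_section i U ` {q. \<forall>P\<in>U. q \<in> term_stalk i P}"
  unfolding T_simps[OF n]
proof (intro equalityI subsetI)
  fix s assume s: "s \<in> {..<rank i} \<rightarrow>\<^sub>E twist_sections n i U"
  then have "\<forall>r\<in>{..<rank i}. \<exists>q. s r = constant_section U q \<and> (\<forall>P\<in>U. q \<in> twist_stalk n i P)"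
    using twist_sections_iff[OF U] by (auto simp: PiE_iff)
  then obtain g where g: "\<And>r. r < rank i \<Longrightarrow> s r = constant_section U (g r)"
    "\<And>r P. r < rank i \<Longrightarrow> P \<in> U \<Longrightarrow> g r \<in> twist_stalk n i P" by (metis lessThan_iff)
  define q where "q z = (if z \<in> basis_index i then g (position i z) else 0)" for z
  have "q \<in> term_stalk i P" if P: "P \<in> U" for P
    using g(2)[OF position(1) P] stalk_0[OF open_points[OF U P]] by (auto simp: term_stalk_def q_def)
  moreover have "s = as_section i U q"
    using s g(1) enum_basis_index position(3) by (auto simp: as_section_def q_def PiE_iff extensional_def fun_eq_iff)
  ultimately show "s \<in> as_section i U ` {q. \<forall>P\<in>U. q \<in> term_stalk i P}" by blast
next
  fix s assume "s \<in> as_section i U ` {q. \<forall>P\<in>U. q \<in> term_stalk i P}"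
  then obtain q where q: "s = as_section i U q" "\<forall>P\<in>U. q \<in> term_stalk i P" by blast
  have "constant_section U (q z) \<in> twist_sections n i U" for z
    using q(2) unfolding twist_sections_iff[OF U] term_stalk_def by blast
  then show "s \<in> {..<rank i} \<rightarrow>\<^sub>E twist_sections n i U"
    unfolding q(1) as_section_def by auto
qed

lemma as_section_inj:
  assumes "U \<noteq> {}" and q: "q \<in> term_stalk i P" "q' \<in> term_stalk i P'" and eq: "as_section i U q = as_section i U q'"
  shows "q = q'"
proof
  fix z
  show "q z = q' z"
  proof (cases "z \<in> basis_index i")
    case True
    have "constant_section U (q z) = constant_section U (q' z)"
      using fun_cong[OF eq, of "position i z"] position(1,2)[OF True] by (simp add: as_section_def)
    then show ?thesis by (rule constant_section_inj[OF assms(1)])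
  qed (simp add: term_stalk_out[OF q(1)] term_stalk_out[OF q(2)])
qed

lemma term_stalk_open:
  assumes P: "P \<in> proj_points n" and q: "q \<in> term_stalk i P"
  shows "\<exists>U. openin (proj_space n) U \<and> P \<in> U \<and> (\<forall>Q\<in>U. q \<in> term_stalk i Q)"
proof -
  have "\<exists>U. openin (proj_space n) U \<and> P \<in> U \<and> (\<forall>Q\<in>U. \<forall>z\<in>K. q z \<in> twist_stalk n i Q)" if "finite K" for K
    using that
  proof (induction K)
    case empty
    then show ?case using open_pts P by blast
  next
    case (insert z K)
    then obtain U where U: "openin (proj_space n) U" "P \<in> U" "\<forall>Q\<in>U. \<forall>z\<in>K. q z \<in> twist_stalk n i Q" by blast
    have "q z \<in> twist_stalk n i P" by (rule term_stalk_in[OF q])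
    then obtain V where V: "openin (proj_space n) V" "P \<in> V" "\<forall>Q\<in>V. q z \<in> twist_stalk n i Q"
      using stalk_open[OF P] by blast
    have "openin (proj_space n) (U \<inter> V)" using U V by blast
    then show ?case using U V by (intro exI[of _ "U \<inter> V"]) auto
  qed
  from this[OF finite_basis_index[of i]]
  obtain U where U: "openin (proj_space n) U" "P \<in> U" "\<forall>Q\<in>U. \<forall>z\<in>basis_index i. q z \<in> twist_stalk n i Q" by blast
  have "q \<in> term_stalk i Q" if Q: "Q \<in> U" for Q
    unfolding term_stalk_def
  proof (intro CollectI conjI allI impI)
    fix z
    show "q z = 0" if "z \<notin> basis_index i" by (rule term_stalk_out[OF q that])
    then show "q z \<in> twist_stalk n i Q" using U(3) Q stalk_0[OF open_points[OF U(1) Q]] by (cases "z \<in> basis_index i") auto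
  qed
  then show ?thesis using U(1,2) by blast
qed

lemma term_stalk_closed:
  assumes P: "P \<in> proj_points n"
  shows "0 \<in> term_stalk i P" "q \<in> term_stalk i P \<Longrightarrow> q' \<in> term_stalk i P \<Longrightarrow> q + q' \<in> term_stalk i P"
    "q \<in> term_stalk i P \<Longrightarrow> - q \<in> term_stalk i P"
    "r \<in> local_ring n P \<Longrightarrow> q \<in> term_stalk i P \<Longrightarrow> (\<lambda>z. r * q z) \<in> term_stalk i P"
  using stalk_0[OF P] stalk_add[OF P] stalk_uminus[OF P] stalk_smult[OF P] by (simp_all add: term_stalk_def)

subsection \<open>The differential\<close>

text \<open>The component outside the summand \<open>\<O>\<close>, extended by zero to all index sets.\<close>

definition koszul_component :: "(nat set \<times> nat \<Rightarrow> ratfun) \<Rightarrow> nat set \<Rightarrow> nat \<Rightarrow> ratfun" where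
  "koszul_component q S = (\<lambda>v. if S \<subseteq> {1..n} then q (S, v) else 0)"

text \<open>The Koszul differential together with the map \<open>f \<mapsto> l f \<cdot> 1\<close> from \<open>\<O>\<close> to the term in degree \<open>1\<close>.\<close>

definition augmented_koszul :: "(nat set \<times> nat \<Rightarrow> ratfun) \<Rightarrow> nat set \<times> nat \<Rightarrow> ratfun" where
  "augmented_koszul q = (\<lambda>(S, v). koszul X n (koszul_component q) S v + (if S = {} then fr l * (q ({0}, 0) * coord_vector 1 v) else 0))"

text \<open>Truncation to the index set of the target makes the formula valid for all \<open>i\<close>, also where a
  term of the monad is zero.\<close>

definition diff :: "int \<Rightarrow> (nat set \<times> nat \<Rightarrow> ratfun) \<Rightarrow> nat set \<times> nat \<Rightarrow> ratfun" where
  "diff i q = (\<lambda>z. if z \<in> basis_index (i + 1) then augmented_koszul q z else 0)"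

lemma scalar_hom: "scalar 0 = 0" "scalar (x + y) = scalar x + scalar y" "scalar (x * y) = scalar x * scalar y"
  by simp_all

sublocale KX: commuting_operators X
  by (rule commuting_pencil) (rule scalar_hom)+

lemma augmented_koszul_add: "augmented_koszul (p + q) z = augmented_koszul p z + augmented_koszul q z"
proof -
  obtain S v where z: "z = (S, v)" by (cases z)
  have "koszul_component (p + q) S = koszul_component p S + koszul_component q S" for S by (simp add: koszul_component_def fun_eq_iff)
  then have "koszul X n (koszul_component (p + q)) S = koszul X n (koszul_component p) S + koszul X n (koszul_component q) S"
    using KX.koszul_add[of n "koszul_component p" "koszul_component q" S] by (simp only: koszul_def)
  then show ?thesis by (simp add: augmented_koszul_def z ring_distribs)
qed

lemma augmented_koszul_scale: "augmented_koszul (\<lambda>z. r * q z) z = r * augmented_koszul q z"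
proof -
  obtain S v where z: "z = (S, v)" by (cases z)
  have "koszul X n (koszul_component (\<lambda>z. r * q z)) S v = koszul X n (\<lambda>S v. r * koszul_component q S v) S v"
    by (simp add: koszul_apply koszul_component_def if_distrib cong: if_cong)
  also have "\<dots> = r * koszul X n (koszul_component q) S v"
    by (rule koszul_pencil_transport[where D = UNIV and h' = "\<lambda>q. r * q", symmetric])
      (auto simp: algebra_simps)
  finally show ?thesis by (simp add: augmented_koszul_def z algebra_simps)
qed

lemma diff_add: "diff i (p + q) = diff i p + diff i q"
  by (simp add: diff_def fun_eq_iff augmented_koszul_add)

lemma diff_scale: "diff i (\<lambda>z. r * q z) = (\<lambda>z. r * diff i q z)"
  by (simp add: diff_def fun_eq_iff augmented_koszul_scale)

lemma diff_zero: "diff i 0 = 0"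
  using diff_scale[of i 0 0] by (simp add: zero_fun_def)

lemma diff_uminus: "diff i (- q) = - diff i q"
  using diff_scale[of i "-1" q] by (simp add: fun_Compl_def)

lemma basis_index_iff: "(S, v) \<in> basis_index i \<longleftrightarrow>
    (1 - int n \<le> i \<and> i \<le> 1 \<and> S \<subseteq> {1..n} \<and> int (card S) = 1 - i \<and> v < c) \<or> (i = 0 \<and> S = {0} \<and> v = 0)"
  by (auto simp: basis_index_def)

lemma koszul_component_vectors: assumes "q \<in> term_stalk i P" shows "koszul_component q S \<in> vectors"
  unfolding vectors_def koszul_component_def
proof (intro CollectI allI impI)
  fix v assume v: "c \<le> v"
  have "(S, v) \<notin> basis_index i" if "S \<subseteq> {1..n}"
    using that v by (auto simp: basis_index_iff)
  then show "(if S \<subseteq> {1..n} then q (S, v) else 0) = 0" using assms by (simp add: term_stalk_def)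
qed

lemma koszul_component_stalk: "P \<in> proj_points n \<Longrightarrow> q \<in> term_stalk i P \<Longrightarrow> koszul_component q S v \<in> twist_stalk n i P"
  using stalk_0 by (simp add: koszul_component_def term_stalk_def)

lemma X_stalk:
  assumes P: "P \<in> proj_points n" and j: "j \<in> {1..n}" and s: "\<And>v. s v \<in> twist_stalk n i P"
  shows "X j s v \<in> twist_stalk n (i + 1) P"
proof -
  have "fr (var j) * s v \<in> twist_stalk n (1 + i) P"
    using stalk_mult[OF P stalk_homogeneous[OF P homogeneous_var] s] j by simp
  moreover have "act (\<lambda>z. fr (const z)) B c j s v \<in> twist_stalk n i P"
    unfolding act_def by (intro stalk_sum[OF P] stalk_smult[OF P] stalk_const[OF P] s)
  then have "fr l * act (\<lambda>z. fr (const z)) B c j s v \<in> twist_stalk n (1 + i) P"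
    using stalk_mult[OF P stalk_homogeneous[OF P hom_l]] by simp
  ultimately show ?thesis using stalk_diff[OF P] by (simp add: pencil_def add.commute)
qed

lemma diff_stalk:
  assumes P: "P \<in> proj_points n" and q: "q \<in> term_stalk i P"
  shows "diff i q \<in> term_stalk (i + 1) P"
proof -
  have "augmented_koszul q (S, v) \<in> twist_stalk n (i + 1) P" for S v
  proof -
    have "koszul X n (koszul_component q) S v \<in> twist_stalk n (i + 1) P"
      unfolding koszul_apply
    proof (intro stalk_sum[OF P])
      fix j assume "j \<in> {1..n} - S"
      then have "X j (koszul_component q (insert j S)) v \<in> twist_stalk n (i + 1) P"
        by (intro X_stalk[OF P] koszul_component_stalk[OF P q]) auto
      then show "ksign j S (X j (koszul_component q (insert j S)) v) \<in> twist_stalk n (i + 1) P"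
        using stalk_uminus[OF P] by (simp add: ksign_def)
    qed
    moreover have "fr l * (q ({0}, 0) * coord_vector 1 v) \<in> twist_stalk n (i + 1) P"
    proof -
      have "coord_vector 1 v * q ({0}, 0) \<in> twist_stalk n i P"
        using term_stalk_in[OF q] stalk_smult[OF P stalk_const[OF P]] by (simp add: coord_vector_def)
      then have "fr l * (coord_vector 1 v * q ({0}, 0)) \<in> twist_stalk n (int 1 + i) P"
        by (rule stalk_mult[OF P stalk_homogeneous[OF P hom_l]])
      then show ?thesis by (simp add: add.commute mult.commute)
    qed
    ultimately show ?thesis
      using stalk_add[OF P, of "koszul X n (koszul_component q) S v" "i + 1" "fr l * (q ({0}, 0) * coord_vector 1 v)"]
      by (auto simp: augmented_koszul_def)
  qed
  then show ?thesis using stalk_0[OF P] by (auto simp: term_stalk_def diff_def)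
qed

lemma diff_extra: "diff i q ({0}, 0) = 0"
proof -
  have "koszul X n (koszul_component q) {0} 0 = 0"
    unfolding koszul_apply
    by (intro sum.neutral ballI) (auto simp: koszul_component_def pencil_zero_apply)
  then show ?thesis by (simp add: diff_def augmented_koszul_def)
qed

lemma koszul_vectors:
  assumes "\<And>S. s S \<in> vectors" and v: "c \<le> v"
  shows "koszul X n s S v = 0"
proof -
  have "X j (s (insert j S)) v = 0" for j
    using pencil_vectors[OF scalar_hom assms(1)[of "insert j S"]] v by (simp add: vectors_def)
  then show ?thesis by (simp add: koszul_apply)
qed

text \<open>The summand \<open>\<O>\<close> maps to the last term, so only the Koszul differential is composed with
  itself.\<close>

lemma diff_diff:
  assumes q: "q \<in> term_stalk i P" and P: "P \<in> proj_points n"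
  shows "diff (i + 1) (diff i q) = 0"
proof
  fix z :: "nat set \<times> nat"
  obtain S v where z: "z = (S, v)" by (cases z)
  show "diff (i + 1) (diff i q) z = 0 z"
  proof (cases "S = {0} \<or> z \<notin> basis_index (i + 1 + 1)")
    case True
    then show ?thesis
    proof
      assume S: "S = {0}"
      have "koszul X n (koszul_component (diff i q)) {0} v = 0"
        unfolding koszul_apply by (intro sum.neutral ballI) (auto simp: koszul_component_def pencil_zero_apply)
      then show ?thesis by (simp add: diff_def[of "i + 1"] augmented_koszul_def z S)
    qed (simp add: diff_def)
  next
    case False
    then have S: "S \<subseteq> {1..n}" "int (card S) = 1 - (i + 1 + 1)" "v < c" "1 - int n \<le> i + 1 + 1" "i + 1 + 1 \<le> 1"
      by (auto simp: basis_index_iff z)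
    have finS: "finite S" using S(1) finite_subset by blast
    have eq: "koszul_component (diff i q) (insert j S) = koszul X n (koszul_component q) (insert j S)" if j: "j \<in> {1..n} - S" for j
    proof
      fix v
      have sub: "insert j S \<subseteq> {1..n}" using j S(1) by auto
      have card: "int (card (insert j S)) = 1 - (i + 1)" using j finS S(2) by simp
      have "card (insert j S) \<le> n" using card_mono[OF _ sub] by simp
      then have rng: "1 - int n \<le> i + 1" using card by linarith
      show "koszul_component (diff i q) (insert j S) v = koszul X n (koszul_component q) (insert j S) v"
      proof (cases "v < c")
        case True
        then show ?thesis using sub card rng S(5) by (simp add: koszul_component_def diff_def basis_index_iff augmented_koszul_def)
      next
        case False
        then have "(insert j S, v) \<notin> basis_index (i + 1)" using sub by (auto simp: basis_index_iff)
        moreover have "koszul X n (koszul_component q) (insert j S) v = 0"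
          by (rule koszul_vectors[OF koszul_component_vectors[OF q]]) (use False in simp)
        ultimately show ?thesis by (simp add: koszul_component_def diff_def)
      qed
    qed
    have "koszul X n (koszul_component (diff i q)) S = koszul X n (koszul X n (koszul_component q)) S"
      by (rule KX.koszul_cong) (rule eq)
    then have "koszul X n (koszul_component (diff i q)) S v = 0"
      unfolding KX.koszul_koszul[OF finS] by simp
    then show ?thesis by (simp add: diff_def[of "i + 1"] augmented_koszul_def z diff_extra)
  qed
qed

subsection \<open>Exactness on stalks of the monad\<close>

text \<open>A cycle with zero component in \<open>\<O>\<close> is a cycle of the Koszul complex that vanishes at the empty
  set.\<close>

lemma exact_koszul_part:
  assumes P: "P \<in> proj_points n" and i: "1 - int n \<le> i" "i \<le> 0"
    and q: "q \<in> term_stalk i P" "q ({0}, 0) = 0" "diff i q = 0"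
  shows "\<exists>p\<in>term_stalk (i - 1) P. diff (i - 1) p = q"
proof -
  have card0: "koszul_component q S v = 0" if "int (card S) \<noteq> 1 - i" for S v
  proof -
    have "(S, v) \<notin> basis_index i" if "S \<subseteq> {1..n}" using that \<open>int (card S) \<noteq> 1 - i\<close> by (auto simp: basis_index_iff)
    then show ?thesis using q(1) by (simp add: koszul_component_def term_stalk_def)
  qed
  have ks: "koszul X n (koszul_component q) S v = 0" if S: "S \<subseteq> {1..n}" for S v
  proof (cases "int (card S) = - i \<and> v < c")
    case True
    then have "(S, v) \<in> basis_index (i + 1)" using S i by (simp add: basis_index_iff)
    then have "augmented_koszul q (S, v) = 0" using fun_cong[OF q(3), of "(S, v)"] by (simp add: diff_def)
    then show ?thesis using q(2) by (simp add: augmented_koszul_def split: if_splits)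
  next
    case False
    show ?thesis
    proof (cases "v < c")
      case True
      with False have "int (card S) \<noteq> - i" by simp
      moreover have "finite S" using S finite_subset by blast
      ultimately have "koszul_component q (insert j S) = (\<lambda>_. 0)" if "j \<in> {1..n} - S" for j
        using card0[of "insert j S"] that by (auto simp: fun_eq_iff)
      then show ?thesis by (simp add: koszul_apply pencil_zero_apply)
    next
      case False
      then show ?thesis using koszul_vectors[OF koszul_component_vectors[OF q(1)]] by simp
    qed
  qed
  obtain t where t: "\<And>S v. t S v \<in> twist_stalk n (i - 1) P" "\<And>S. t S \<in> vectors"
    "\<And>S v. S \<subseteq> {1..n} \<Longrightarrow> koszul X n t S v = koszul_component q S v"
  proof (rule stalk_koszul_exact[OF P, of "koszul_component q" i])
    show "koszul_component q S v \<in> twist_stalk n i P" for S v by (rule koszul_component_stalk[OF P q(1)])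
    show "koszul_component q S \<in> vectors" for S by (rule koszul_component_vectors[OF q(1)])
    show "koszul_component q {} = (\<lambda>_. 0)" using card0[of "{}"] i by auto
  qed (use ks in auto)
  define p where "p z = (if z \<in> basis_index (i - 1) then t (fst z) (snd z) else 0)" for z
  have p: "p \<in> term_stalk (i - 1) P" using t(1) stalk_0[OF P] by (simp add: term_stalk_def p_def)
  have "diff (i - 1) p = q"
  proof
    fix z :: "nat set \<times> nat"
    obtain S v where z: "z = (S, v)" by (cases z)
    show "diff (i - 1) p z = q z"
    proof (cases "z \<in> basis_index i")
      case False
      then show ?thesis using term_stalk_out[OF q(1)] by (simp add: diff_def)
    next
      case True
      show ?thesis
      proof (cases "S = {0}")
        case True
        then have "z = ({0}, 0)" using \<open>z \<in> basis_index i\<close> unfolding z by (auto simp: basis_index_iff)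
        then show ?thesis using q(2) diff_extra by simp
      next
        case False
        then have S: "S \<subseteq> {1..n}" "int (card S) = 1 - i" "v < c" using True by (auto simp: basis_index_iff z)
        have finS: "finite S" using S(1) finite_subset by blast
        have "koszul X n (koszul_component p) S = koszul X n t S"
        proof (rule KX.koszul_cong)
          fix j assume j: "j \<in> {1..n} - S"
          have sub: "insert j S \<subseteq> {1..n}" using j S(1) by auto
          have card: "int (card (insert j S)) = 1 - (i - 1)" using j finS S(2) by simp
          have "card (insert j S) \<le> n" using card_mono[OF _ sub] by simp
          then have rng: "1 - int n \<le> i - 1" using card by linarith
          show "koszul_component p (insert j S) = t (insert j S)"
          proof
            fix v
            have "(insert j S, v) \<in> basis_index (i - 1) \<longleftrightarrow> v < c" using sub card rng i by (auto simp: basis_index_iff)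
            then show "koszul_component p (insert j S) v = t (insert j S) v"
              using sub t(2)[of "insert j S"] by (auto simp: koszul_component_def p_def vectors_def)
          qed
        qed
        then have "koszul X n (koszul_component p) S v = q (S, v)" using t(3)[OF S(1)] S(1) by (simp add: koszul_component_def)
        moreover have "S \<noteq> {}" using S(2) i by auto
        ultimately show ?thesis using True by (simp add: diff_def augmented_koszul_def z)
      qed
    qed
  qed
  with p show ?thesis by blast
qed

text \<open>The family in degree \<open>0\<close> with components \<open>r j\<close> in the Koszul part and \<open>x\<close> in the
  summand \<open>\<O>\<close>.\<close>

definition degree_zero :: "(nat \<Rightarrow> nat \<Rightarrow> ratfun) \<Rightarrow> ratfun \<Rightarrow> nat set \<times> nat \<Rightarrow> ratfun" where
  "degree_zero r x = (\<lambda>(S, v). if S = {0} then (if v = 0 then x else 0)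
     else if \<exists>j\<in>{1..n}. S = {j} then r (the_elem S) v else 0)"

lemma degree_zero_stalk:
  assumes P: "P \<in> proj_points n" and n: "1 \<le> n" and r: "\<And>j. r j \<in> vectors" "\<And>j v. r j v \<in> local_ring n P"
    and x: "x \<in> local_ring n P"
  shows "degree_zero r x \<in> term_stalk 0 P"
proof -
  have "degree_zero r x (S, v) \<in> local_ring n P" for S v
    using r(2) x stalk_0[OF P] by (simp add: degree_zero_def)
  moreover have "degree_zero r x (S, v) = 0" if z: "(S, v) \<notin> basis_index 0" for S v
  proof (cases "\<exists>j\<in>{1..n}. S = {j}")
    case True
    then obtain j where j: "j \<in> {1..n}" "S = {j}" by blast
    then have "c \<le> v" using z n by (auto simp: basis_index_iff not_less[symmetric])
    then show ?thesis using j r(1)[of j] by (auto simp: degree_zero_def vectors_def)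
  next
    case False
    then show ?thesis using z by (auto simp: degree_zero_def basis_index_iff)
  qed
  ultimately show ?thesis by (simp add: term_stalk_def split_paired_all)
qed

lemma augmented_koszul_degree_zero:
  "augmented_koszul (degree_zero r x) ({}, v) = (\<Sum>j\<in>{1..n}. X j (r j) v) + fr l * (x * coord_vector 1 v)"
proof -
  have "koszul_component (degree_zero r x) {j} = r j" if "j \<in> {1..n}" for j
    using that by (auto simp: koszul_component_def degree_zero_def)
  then have "koszul X n (koszul_component (degree_zero r x)) {} v = (\<Sum>j\<in>{1..n}. X j (r j) v)"
    unfolding koszul_apply by (intro sum.cong) (auto simp: ksign_def)
  then show ?thesis by (simp add: augmented_koszul_def degree_zero_def)
qed

lemma basis_index_1: "(S, v) \<in> basis_index 1 \<longleftrightarrow> S = {} \<and> v < c"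
  by (auto simp: basis_index_iff finite_subset)

lemma exact_last:
  assumes P: "P \<in> proj_points n" and n: "1 \<le> n" and q: "q \<in> term_stalk 1 P"
  shows "\<exists>p\<in>term_stalk 0 P. diff 0 p = q"
proof -
  obtain x where x: "x \<in> local_ring n P" "(\<lambda>v. koszul_component q {} v - fr l * (x * coord_vector 1 v)) \<in> pencil_image X (local_ring n P)"
    using augmented_pencil_surjective[OF P koszul_component_vectors[OF q] koszul_component_stalk[OF P q]] by blast
  obtain r where r: "\<And>j. r j \<in> vectors" "\<And>j v. r j v \<in> local_ring n P"
    "\<And>v. koszul_component q {} v - fr l * (x * coord_vector 1 v) = (\<Sum>j\<in>{1..n}. X j (r j) v)"
    using x(2) by (rule pencil_imageE) blast
  have "diff 0 (degree_zero r x) = q"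
  proof
    fix z :: "nat set \<times> nat"
    obtain S v where z: "z = (S, v)" by (cases z)
    show "diff 0 (degree_zero r x) z = q z"
    proof (cases "z \<in> basis_index 1")
      case True
      then have S: "S = {}" unfolding z basis_index_1 by blast
      have "augmented_koszul (degree_zero r x) ({}, v) = q ({}, v)"
        unfolding augmented_koszul_degree_zero r(3)[symmetric] by (simp add: koszul_component_def)
      then show ?thesis using True by (simp add: diff_def z S)
    next
      case False
      then show ?thesis using term_stalk_out[OF q] by (simp add: diff_def)
    qed
  qed
  moreover have "degree_zero r x \<in> term_stalk 0 P" by (rule degree_zero_stalk[OF P n r(1,2) x(1)])
  ultimately show ?thesis by blast
qed

lemma exact_stalk:
  assumes P: "P \<in> proj_points n" and n: "1 \<le> n" and "i \<noteq> 0" and q: "q \<in> term_stalk i P" "diff i q = 0"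
  shows "\<exists>p\<in>term_stalk (i - 1) P. diff (i - 1) p = q"
proof -
  consider "i = 1" | "1 - int n \<le> i" "i \<le> 0" | "i < 1 - int n \<or> 1 < i" using \<open>i \<noteq> 0\<close> by linarith
  then show ?thesis
  proof cases
    case 1
    then show ?thesis using exact_last[OF P n] q(1) by simp
  next
    case 2
    have "({0}, 0) \<notin> basis_index i" using \<open>i \<noteq> 0\<close> by (auto simp: basis_index_iff)
    then have "q ({0}, 0) = 0" using q(1) by (simp add: term_stalk_def)
    then show ?thesis by (rule exact_koszul_part[OF P 2 q(1) _ q(2)])
  next
    case 3
    then have "basis_index i = {}" using n by (auto simp: basis_index_def)
    then have "q = 0" using q(1) by (simp add: term_stalk_def fun_eq_iff)
    then show ?thesis using diff_zero term_stalk_closed(1)[OF P] by blast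
  qed
qed

text \<open>A cycle with component \<open>f\<close> in \<open>\<O>\<close> exhibits \<open>l f \<cdot> 1\<close> as an element of the image of the pencil; by
  the next lemma every such \<open>f\<close> occurs.\<close>

lemma kernel_value_in_ideal:
  assumes P: "P \<in> proj_points n" and n: "1 \<le> n" and q: "q \<in> term_stalk 0 P" "diff 0 q = 0"
  shows "q ({0}, 0) \<in> Ist P"
proof -
  have x: "q ({0}, 0) \<in> local_ring n P" using q(1) by (simp add: term_stalk_def)
  have "(\<lambda>v. fr l * (q ({0}, 0) * coord_vector 1 v)) \<in> pencil_image X (local_ring n P)"
  proof (rule pencil_imageI[of "\<lambda>j v. - koszul_component q {j} v"])
    show "(\<lambda>v. - koszul_component q {j} v) \<in> vectors" for j using koszul_component_vectors[OF q(1), of "{j}"] by (simp add: vectors_def)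
    show "- koszul_component q {j} v \<in> local_ring n P" for j v by (rule stalk_uminus[OF P koszul_component_stalk[OF P q(1)]])
    fix v
    have neg: "X j (\<lambda>v. - koszul_component q {j} v) v = - X j (koszul_component q {j}) v" for j
      using pencil_scale_apply[of _ _ _ j "-1" "koszul_component q {j}" v] by simp
    show "fr l * (q ({0}, 0) * coord_vector 1 v) = (\<Sum>j\<in>{1..n}. X j (\<lambda>v. - koszul_component q {j} v) v)"
    proof (cases "v < c")
      case True
      then have "augmented_koszul q ({}, v) = 0" using fun_cong[OF q(2), of "({}, v)"] by (simp add: diff_def basis_index_1)
      then have "(\<Sum>j\<in>{1..n}. X j (koszul_component q {j}) v) + fr l * (q ({0}, 0) * coord_vector 1 v) = 0"
        by (simp add: augmented_koszul_def koszul_apply ksign_def)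
      then show ?thesis unfolding neg sum_negf by (simp add: add_eq_0_iff)
    next
      case False
      then have "X j (koszul_component q {j}) v = 0" for j
        using pencil_vectors[OF scalar_hom koszul_component_vectors[OF q(1)]] by (simp add: vectors_def)
      moreover have "coord_vector 1 v = 0" using False by (simp add: coord_vector_def coord_outside)
      ultimately show ?thesis unfolding neg by simp
    qed
  qed
  then show ?thesis using augmented_kernel_iff[OF P x] by blast
qed

lemma ideal_value_lifts:
  assumes P: "P \<in> proj_points n" and n: "1 \<le> n" and x: "x \<in> Ist P"
  shows "\<exists>q\<in>term_stalk 0 P. diff 0 q = 0 \<and> q ({0}, 0) = x"
proof -
  have xl: "x \<in> local_ring n P" by (rule Ist_local[OF x])
  have "(\<lambda>v. fr l * (x * coord_vector 1 v)) \<in> pencil_image X (local_ring n P)"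
    using augmented_kernel_iff[OF P xl] x by blast
  then obtain r where r: "\<And>j. r j \<in> vectors" "\<And>j v. r j v \<in> local_ring n P"
    "\<And>v. fr l * (x * coord_vector 1 v) = (\<Sum>j\<in>{1..n}. X j (r j) v)"
    by (rule pencil_imageE) blast
  define r' where "r' j v = - 1 * r j v" for j v
  have r': "r' j \<in> vectors" "r' j v \<in> local_ring n P" for j v
    using r(1)[of j] stalk_uminus[OF P r(2)[of j v]] by (simp_all add: r'_def vectors_def)
  have "X j (r' j) v = - X j (r j) v" for j v
    unfolding r'_def pencil_scale_apply by simp
  then have "augmented_koszul (degree_zero r' x) ({}, v) = 0" for v
    unfolding augmented_koszul_degree_zero r(3) by (simp add: sum_negf)
  then have "diff 0 (degree_zero r' x) = 0"
    by (auto simp: diff_def fun_eq_iff basis_index_1 split_paired_all)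
  moreover have "degree_zero r' x ({0}, 0) = x" by (simp add: degree_zero_def)
  moreover have "degree_zero r' x \<in> term_stalk 0 P" by (rule degree_zero_stalk[OF P n r' xl])
  ultimately show ?thesis by blast
qed

subsection \<open>Sheaf maps\<close>

text \<open>A section over a nonempty open set is recovered from its values at the generic point \<open>{0}\<close>.\<close>

definition as_family :: "int \<Rightarrow> (nat \<Rightarrow> func) \<Rightarrow> nat set \<times> nat \<Rightarrow> ratfun" where
  "as_family i s = (\<lambda>z. if z \<in> basis_index i then s (position i z) {0} else 0)"

definition \<alpha> :: "int \<Rightarrow> point set \<Rightarrow> (nat \<Rightarrow> func) \<Rightarrow> nat \<Rightarrow> func" where
  "\<alpha> i U s = as_section (i + 1) U (diff i (as_family i s))"

lemma \<alpha>_as_section: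
  assumes U: "openin (proj_space n) U" and q: "\<forall>P\<in>U. q \<in> term_stalk i P"
  shows "\<alpha> i U (as_section i U q) = as_section (i + 1) U (diff i q)"
proof (cases "U = {}")
  case True
  then show ?thesis using as_section_empty by (simp add: \<alpha>_def)
next
  case False
  then obtain P where P: "P \<in> U" by blast
  then have g: "{0} \<in> U" using generic_in_open[OF U] by blast
  have "as_family i (as_section i U q) = q"
  proof
    fix z show "as_family i (as_section i U q) z = q z"
      using term_stalk_out[OF bspec[OF q P], of z] g position(1,2)[of z i]
      by (simp add: as_family_def as_section_def constant_section_def)
  qed
  then show ?thesis by (simp add: \<alpha>_def)
qed

abbreviation sm :: "ratfun \<Rightarrow> (nat set \<times> nat \<Rightarrow> ratfun) \<Rightarrow> nat set \<times> nat \<Rightarrow> ratfun" where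
  "sm r q \<equiv> \<lambda>z. r * q z"

context
  assumes n1: "1 \<le> n"
begin

lemmas T_carrier = carrier_T[OF n1] and T_rules = T_simps[OF n1]

lemma \<alpha>_hom: "sheaf_hom (proj_space n) (proj_structure n) (T i) (T (i + 1)) (\<alpha> i)"
  unfolding sheaf_hom_def
proof (intro allI impI conjI ballI)
  fix U assume U: "openin (proj_space n) U"
  show "\<alpha> i U \<in> carrier (sections (T i) U) \<rightarrow> carrier (sections (T (i + 1)) U)"
  proof
    fix s assume "s \<in> carrier (sections (T i) U)"
    then obtain q where q: "s = as_section i U q" "\<forall>P\<in>U. q \<in> term_stalk i P" unfolding T_carrier[OF U] by blast
    show "\<alpha> i U s \<in> carrier (sections (T (i + 1)) U)"
      unfolding q(1) \<alpha>_as_section[OF U q(2)] T_carrier[OF U] using q(2) diff_stalk[OF open_points[OF U]] by blast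
  qed
next
  fix U s t assume U: "openin (proj_space n) U" and "s \<in> carrier (sections (T i) U)" "t \<in> carrier (sections (T i) U)"
  then obtain p q where p: "s = as_section i U p" "\<forall>P\<in>U. p \<in> term_stalk i P" and q: "t = as_section i U q" "\<forall>P\<in>U. q \<in> term_stalk i P"
    unfolding T_carrier[OF U] by blast
  have pq: "\<forall>P\<in>U. p + q \<in> term_stalk i P" using p(2) q(2) term_stalk_closed(2)[OF open_points[OF U]] by blast
  show "\<alpha> i U (s \<oplus>\<^bsub>sections (T i) U\<^esub> t) = \<alpha> i U s \<oplus>\<^bsub>sections (T (i + 1)) U\<^esub> \<alpha> i U t"
    unfolding T_rules p(1) q(1) as_section_add \<alpha>_as_section[OF U p(2)] \<alpha>_as_section[OF U q(2)] \<alpha>_as_section[OF U pq] diff_add ..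
next
  fix U r s assume U: "openin (proj_space n) U" and r: "r \<in> carrier (ring_sections (proj_structure n) U)"
    and "s \<in> carrier (sections (T i) U)"
  then obtain q x where q: "s = as_section i U q" "\<forall>P\<in>U. q \<in> term_stalk i P" and x: "r = constant_section U x" "\<forall>P\<in>U. x \<in> local_ring n P"
    unfolding T_carrier[OF U] carrier_ring_sections[OF U] by blast
  have xq: "\<forall>P\<in>U. sm x q \<in> term_stalk i P" using q(2) x(2) term_stalk_closed(4)[OF open_points[OF U]] by blast
  show "\<alpha> i U (r \<odot>\<^bsub>sections (T i) U\<^esub> s) = r \<odot>\<^bsub>sections (T (i + 1)) U\<^esub> \<alpha> i U s"
    unfolding T_rules q(1) x(1) as_section_smult \<alpha>_as_section[OF U q(2)] \<alpha>_as_section[OF U xq] diff_scale ..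
next
  fix U V s assume U: "openin (proj_space n) U" and V: "openin (proj_space n) V" "V \<subseteq> U"
    and "s \<in> carrier (sections (T i) U)"
  then obtain q where q: "s = as_section i U q" "\<forall>P\<in>U. q \<in> term_stalk i P" unfolding T_carrier[OF U] by blast
  have qV: "\<forall>P\<in>V. q \<in> term_stalk i P" using q(2) V(2) by blast
  show "\<alpha> i V (restriction (T i) U V s) = restriction (T (i + 1)) U V (\<alpha> i U s)"
    unfolding T_rules q(1) \<alpha>_as_section[OF U q(2)] as_section_restrict[OF V(2)] \<alpha>_as_section[OF V(1) qV] ..
qed

lemma \<alpha>_\<alpha>:
  assumes U: "openin (proj_space n) U" and "s \<in> carrier (sections (T i) U)"
  shows "\<alpha> (i + 1) U (\<alpha> i U s) = \<zero>\<^bsub>sections (T (i + 2)) U\<^esub>"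
proof -
  obtain q where q: "s = as_section i U q" "\<forall>P\<in>U. q \<in> term_stalk i P" using assms(2) unfolding T_carrier[OF U] by blast
  have dq: "\<forall>P\<in>U. diff i q \<in> term_stalk (i + 1) P" using q(2) diff_stalk[OF open_points[OF U]] by blast
  have "\<alpha> (i + 1) U (\<alpha> i U s) = as_section (i + 1 + 1) U (diff (i + 1) (diff i q))"
    unfolding q(1) \<alpha>_as_section[OF U q(2)] \<alpha>_as_section[OF U dq] ..
  also have "\<dots> = as_section (i + 1 + 1) U 0"
  proof (cases "U = {}")
    case True
    then show ?thesis using as_section_empty by simp
  next
    case False
    then obtain P where P: "P \<in> U" by blast
    then show ?thesis using diff_diff[OF _ open_points[OF U P], of q i] q(2) by simp
  qed
  also have "\<dots> = \<zero>\<^bsub>sections (T (i + 2)) U\<^esub>" unfolding T_rules as_section_zero by (simp add: add.assoc)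
  finally show ?thesis .
qed

definition kernel_stalk :: "int \<Rightarrow> point \<Rightarrow> (nat set \<times> nat \<Rightarrow> ratfun) set" where
  "kernel_stalk i P = {q \<in> term_stalk i P. diff i q = 0}"

definition image_stalk :: "int \<Rightarrow> point \<Rightarrow> (nat set \<times> nat \<Rightarrow> ratfun) set" where
  "image_stalk i P = diff (i - 1) ` term_stalk (i - 1) P"

lemma image_stalk_stalk: "P \<in> proj_points n \<Longrightarrow> q \<in> image_stalk i P \<Longrightarrow> q \<in> term_stalk i P"
  using diff_stalk[of P _ "i - 1"] by (auto simp: image_stalk_def)

lemma kernel_sections_eq:
  assumes U: "openin (proj_space n) U"
  shows "kernel_sections (T i) (T (i + 1)) (\<alpha> i) U = as_section i U ` {q. \<forall>P\<in>U. q \<in> kernel_stalk i P}"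
proof (cases "U = {}")
  case True
  have "as_section (i + 1) U p = as_section (i + 1) U 0" for p using as_section_empty True by simp
  then have "\<alpha> i U s = \<zero>\<^bsub>sections (T (i + 1)) U\<^esub>" for s unfolding T_rules as_section_zero \<alpha>_def .
  then show ?thesis unfolding kernel_sections_def T_carrier[OF U] using True by simp
next
  case False
  then obtain P where P: "P \<in> U" by blast
  have "\<alpha> i U (as_section i U q) = \<zero>\<^bsub>sections (T (i + 1)) U\<^esub> \<longleftrightarrow> diff i q = 0" if q: "\<forall>P\<in>U. q \<in> term_stalk i P" for q
  proof -
    note pP = open_points[OF U P]
    have "diff i q \<in> term_stalk (i + 1) P" using q P diff_stalk[OF pP] by blast
    then have "diff i q = 0" if "as_section (i + 1) U (diff i q) = as_section (i + 1) U 0"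
      by (rule as_section_inj[OF False _ term_stalk_closed(1)[OF pP] that])
    then show ?thesis unfolding \<alpha>_as_section[OF U q] T_rules as_section_zero by auto
  qed
  then show ?thesis
    unfolding kernel_sections_def T_carrier[OF U] kernel_stalk_def using P by blast
qed

lemma image_sections_eq:
  assumes U: "openin (proj_space n) U"
  shows "image_sections (proj_space n) (T (i - 1)) (T i) (\<alpha> (i - 1)) U = as_section i U ` {q. \<forall>P\<in>U. q \<in> image_stalk i P}"
proof (intro equalityI subsetI)
  fix t assume t: "t \<in> image_sections (proj_space n) (T (i - 1)) (T i) (\<alpha> (i - 1)) U"
  then obtain q where q: "t = as_section i U q" "\<forall>P\<in>U. q \<in> term_stalk i P"
    unfolding image_sections_def T_carrier[OF U] by blast
  have "q \<in> image_stalk i P" if P: "P \<in> U" for P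
  proof -
    obtain V s where V: "openin (proj_space n) V" "P \<in> V" "V \<subseteq> U" and s: "s \<in> carrier (sections (T (i - 1)) V)"
      "\<alpha> (i - 1) V s = restriction (T i) U V t"
      using t P unfolding image_sections_def by blast
    obtain p where p: "s = as_section (i - 1) V p" "\<forall>P\<in>V. p \<in> term_stalk (i - 1) P" using s(1) unfolding T_carrier[OF V(1)] by blast
    have eq: "as_section i V (diff (i - 1) p) = as_section i V q"
      using s(2) unfolding p(1) \<alpha>_as_section[OF V(1) p(2)] q(1) T_rules as_section_restrict[OF V(3)] by simp
    have dp: "diff (i - 1) p \<in> term_stalk i P" using p(2) V(2) diff_stalk[OF open_points[OF U P], of p "i - 1"] by simp
    have "V \<noteq> {}" using V(2) by blast
    then have "diff (i - 1) p = q" using dp bspec[OF q(2) P] eq by (rule as_section_inj)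
    then show ?thesis using p(2) V(2) unfolding image_stalk_def by blast
  qed
  then show "t \<in> as_section i U ` {q. \<forall>P\<in>U. q \<in> image_stalk i P}" using q(1) by blast
next
  fix t assume "t \<in> as_section i U ` {q. \<forall>P\<in>U. q \<in> image_stalk i P}"
  then obtain q where q: "t = as_section i U q" "\<forall>P\<in>U. q \<in> image_stalk i P" by blast
  show "t \<in> image_sections (proj_space n) (T (i - 1)) (T i) (\<alpha> (i - 1)) U"
    unfolding image_sections_def
  proof (intro CollectI conjI ballI)
    show "t \<in> carrier (sections (T i) U)"
      unfolding T_carrier[OF U] q(1) using q(2) image_stalk_stalk[OF open_points[OF U]] by blast
    fix P assume P: "P \<in> U"
    obtain p where p: "p \<in> term_stalk (i - 1) P" "q = diff (i - 1) p" using q(2) P unfolding image_stalk_def by blast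
    obtain W where W: "openin (proj_space n) W" "P \<in> W" "\<forall>Q\<in>W. p \<in> term_stalk (i - 1) Q"
      using term_stalk_open[OF open_points[OF U P] p(1)] by blast
    define V where "V = W \<inter> U"
    have V: "openin (proj_space n) V" "P \<in> V" "V \<subseteq> U" using W U P by (auto simp: V_def)
    have pV: "\<forall>Q\<in>V. p \<in> term_stalk (i - 1) Q" using W(3) by (simp add: V_def)
    have "\<alpha> (i - 1) V (as_section (i - 1) V p) = restriction (T i) U V t"
      unfolding \<alpha>_as_section[OF V(1) pV] q(1) p(2) T_rules as_section_restrict[OF V(3)] by simp
    moreover have "as_section (i - 1) V p \<in> carrier (sections (T (i - 1)) V)" unfolding T_carrier[OF V(1)] using pV by blast
    ultimately show "\<exists>V. openin (proj_space n) V \<and> P \<in> V \<and> V \<subseteq> U \<and>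
       (\<exists>s\<in>carrier (sections (T (i - 1)) V). \<alpha> (i - 1) V s = restriction (T i) U V t)"
      using V by blast
  qed
qed

lemma image_stalk_kernel_stalk:
  assumes P: "P \<in> proj_points n" and q: "q \<in> image_stalk i P"
  shows "q \<in> kernel_stalk i P"
proof -
  obtain p where p: "p \<in> term_stalk (i - 1) P" "q = diff (i - 1) p" using q unfolding image_stalk_def by blast
  have "diff (i - 1 + 1) (diff (i - 1) p) = 0" by (rule diff_diff[OF p(1) P])
  then show ?thesis using image_stalk_stalk[OF P q] by (simp add: kernel_stalk_def p(2) del: zero_fun_def)
qed

lemma kernel_stalk_image_stalk:
  assumes "P \<in> proj_points n" "i \<noteq> 0" "q \<in> kernel_stalk i P"
  shows "q \<in> image_stalk i P"
  using exact_stalk[OF assms(1) n1 assms(2), of q] assms(3) unfolding kernel_stalk_def image_stalk_def by blast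

lemma monad: "perfect_extended_monad n rank \<alpha>"
  unfolding perfect_extended_monad_def
proof (intro conjI allI impI)
  fix i U s assume "openin (proj_space n) U" "s \<in> carrier (sections (T i) U)"
  then show "\<alpha> (i + 1) U (\<alpha> i U s) = \<zero>\<^bsub>sections (T (i + 2)) U\<^esub>" by (rule \<alpha>_\<alpha>)
next
  fix i :: int and U assume i: "i \<noteq> 0" and U: "openin (proj_space n) U"
  have "{q. \<forall>P\<in>U. q \<in> kernel_stalk i P} = {q. \<forall>P\<in>U. q \<in> image_stalk i P}"
    using image_stalk_kernel_stalk kernel_stalk_image_stalk[OF _ i] open_points[OF U] by blast
  then show "kernel_sections (T i) (T (i + 1)) (\<alpha> i) U =
        image_sections (proj_space n) (T (i - 1)) (T i) (\<alpha> (i - 1)) U"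
    unfolding kernel_sections_eq[OF U] image_sections_eq[OF U] by simp
qed (rule \<alpha>_hom)

text \<open>The projection to the summand \<open>\<O>\<close> maps the cycles onto the ideal, and its kernel consists of
  the boundaries.\<close>

lemma cohomology: "sheaf_iso (proj_space n) (proj_structure n) (monad_cohomology n rank \<alpha>) (ideal_sheaf n I)"
proof -
  let ?F = "restrict_to (T 0) (kernel_sections (T 0) (T 1) (\<alpha> 0))"
  let ?N = "image_sections (proj_space n) (T (- 1)) (T 0) (\<alpha> (- 1))"
  have ker: "kernel_sections (T 0) (T 1) (\<alpha> 0) U = as_section 0 U ` {q. \<forall>P\<in>U. q \<in> kernel_stalk 0 P}" if "openin (proj_space n) U" for U
    using kernel_sections_eq[OF that, of 0] by simp
  have im: "?N U = as_section 0 U ` {q. \<forall>P\<in>U. q \<in> image_stalk 0 P}" if "openin (proj_space n) U" for U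
    using image_sections_eq[OF that, of 0] by simp
  have F: "carrier (sections ?F U) = kernel_sections (T 0) (T 1) (\<alpha> 0) U" "\<zero>\<^bsub>sections ?F U\<^esub> = \<zero>\<^bsub>sections (T 0) U\<^esub>"
    "s \<oplus>\<^bsub>sections ?F U\<^esub> t = s \<oplus>\<^bsub>sections (T 0) U\<^esub> t" "r \<odot>\<^bsub>sections ?F U\<^esub> s = r \<odot>\<^bsub>sections (T 0) U\<^esub> s"
    "restriction ?F = restriction (T 0)" for U s t r
    by (simp_all add: restrict_to_def)
  interpret H: constant_quotient n ?F ?N "as_section 0" "kernel_stalk 0" "image_stalk 0" sm
  proof
    fix U V :: "point set" and P :: point and q q' :: "nat set \<times> nat \<Rightarrow> ratfun" and r :: ratfun
    { assume U: "openin (proj_space n) U"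
      show "carrier (sections ?F U) = as_section 0 U ` {q. \<forall>P\<in>U. q \<in> kernel_stalk 0 P}" unfolding F by (rule ker[OF U])
      show "\<zero>\<^bsub>sections ?F U\<^esub> = as_section 0 U 0" unfolding F T_rules by (rule as_section_zero)
      show "as_section 0 U q \<oplus>\<^bsub>sections ?F U\<^esub> as_section 0 U q' = as_section 0 U (q + q')" unfolding F T_rules by (rule as_section_add)
      show "constant_section U r \<odot>\<^bsub>sections ?F U\<^esub> as_section 0 U q = as_section 0 U (sm r q)" unfolding F T_rules by (rule as_section_smult)
      show "V \<subseteq> U \<Longrightarrow> restriction ?F U V (as_section 0 U q) = as_section 0 V q" unfolding F T_rules by (rule as_section_restrict)
      show "?N U = as_section 0 U ` {q. \<forall>P\<in>U. q \<in> image_stalk 0 P}" by (rule im[OF U])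
      show "q = q'" if "U \<noteq> {}" "\<forall>P\<in>U. q \<in> kernel_stalk 0 P" "\<forall>P\<in>U. q' \<in> kernel_stalk 0 P" "as_section 0 U q = as_section 0 U q'"
        using that as_section_inj[OF that(1), of q 0 _ q'] unfolding kernel_stalk_def by blast
    }
    { assume P: "P \<in> proj_points n"
      note cl = term_stalk_closed[OF P]
      show "\<exists>U. openin (proj_space n) U \<and> P \<in> U \<and> (\<forall>Q\<in>U. q \<in> kernel_stalk 0 Q)" if "q \<in> kernel_stalk 0 P"
        using term_stalk_open[OF P, of q 0] that unfolding kernel_stalk_def by blast
      show "\<exists>U. openin (proj_space n) U \<and> P \<in> U \<and> (\<forall>Q\<in>U. q \<in> image_stalk 0 Q)" if q: "q \<in> image_stalk 0 P"
      proof -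
        obtain p where "p \<in> term_stalk (0 - 1) P" "q = diff (0 - 1) p" using q unfolding image_stalk_def by blast
        then show ?thesis using term_stalk_open[OF P, of p "0 - 1"] unfolding image_stalk_def by blast
      qed
      show "q \<in> image_stalk 0 P \<Longrightarrow> q \<in> kernel_stalk 0 P" by (rule image_stalk_kernel_stalk[OF P])
      show "q \<in> kernel_stalk 0 P \<Longrightarrow> q' \<in> kernel_stalk 0 P \<Longrightarrow> q + q' \<in> kernel_stalk 0 P" using cl(2) by (simp add: kernel_stalk_def diff_add)
      show "q \<in> kernel_stalk 0 P \<Longrightarrow> - q \<in> kernel_stalk 0 P" using cl(3) by (simp add: kernel_stalk_def diff_uminus)
      show "r \<in> local_ring n P \<Longrightarrow> q \<in> kernel_stalk 0 P \<Longrightarrow> sm r q \<in> kernel_stalk 0 P"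
        using cl(4) by (auto simp: kernel_stalk_def diff_scale fun_eq_iff)
      have "0 = diff (0 - 1) 0" by (rule diff_zero[symmetric])
      then show "0 \<in> image_stalk 0 P" unfolding image_stalk_def by (rule image_eqI[of _ "diff (0 - 1)"]) (rule cl(1))
      show "q + q' \<in> image_stalk 0 P" if q: "q \<in> image_stalk 0 P" "q' \<in> image_stalk 0 P"
      proof -
        obtain p where p: "p \<in> term_stalk (0 - 1) P" "q = diff (0 - 1) p" using q(1) unfolding image_stalk_def by blast
        obtain p' where p': "p' \<in> term_stalk (0 - 1) P" "q' = diff (0 - 1) p'" using q(2) unfolding image_stalk_def by blast
        have "diff (0 - 1) p + diff (0 - 1) p' = diff (0 - 1) (p + p')" by (rule diff_add[symmetric])
        then show ?thesis unfolding image_stalk_def p(2) p'(2) by (rule image_eqI[of _ "diff (0 - 1)"]) (rule cl(2)[OF p(1) p'(1)])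
      qed
      show "- q \<in> image_stalk 0 P" if q: "q \<in> image_stalk 0 P"
      proof -
        obtain p where p: "p \<in> term_stalk (0 - 1) P" "q = diff (0 - 1) p" using q unfolding image_stalk_def by blast
        have "- diff (0 - 1) p = diff (0 - 1) (- p)" by (rule diff_uminus[symmetric])
        then show ?thesis unfolding image_stalk_def p(2) by (rule image_eqI[of _ "diff (0 - 1)"]) (rule cl(3)[OF p(1)])
      qed
      show "sm r q \<in> image_stalk 0 P" if r: "r \<in> local_ring n P" and q: "q \<in> image_stalk 0 P"
      proof -
        obtain p where p: "p \<in> term_stalk (0 - 1) P" "q = diff (0 - 1) p" using q unfolding image_stalk_def by blast
        have "sm r (diff (0 - 1) p) = diff (0 - 1) (sm r p)" by (rule diff_scale[symmetric])
        then show ?thesis unfolding image_stalk_def p(2) by (rule image_eqI[of _ "diff (0 - 1)"]) (rule cl(4)[OF r p(1)])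
      qed
    }
    show "sm r (q - q') = sm r q - sm r q'" by (simp add: fun_eq_iff right_diff_distrib)
  qed
  show ?thesis
    unfolding monad_cohomology_def
  proof (rule H.quotient_iso_ideal_sheaf[of "\<lambda>q. q ({0}, 0)" I Ist])
    show "I U = constant_section U ` {q. \<forall>P\<in>U. q \<in> Ist P}" if "openin (proj_space n) U" for U
      by (rule I_eq[OF that])
    fix P assume P: "P \<in> proj_points n"
    show "q ({0}, 0) \<in> Ist P" if "q \<in> kernel_stalk 0 P" for q
      using kernel_value_in_ideal[OF P n1] that unfolding kernel_stalk_def by blast
    show "\<exists>q\<in>kernel_stalk 0 P. q ({0}, 0) = x" if "x \<in> Ist P" for x
      using ideal_value_lifts[OF P n1 that] unfolding kernel_stalk_def by blast
    show "q ({0}, 0) = 0 \<longleftrightarrow> q \<in> image_stalk 0 P" if q: "q \<in> kernel_stalk 0 P" for q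
    proof
      assume "q ({0}, 0) = 0"
      then show "q \<in> image_stalk 0 P"
        using exact_koszul_part[OF P, of 0 q] q n1 unfolding kernel_stalk_def image_stalk_def by auto
    next
      assume "q \<in> image_stalk 0 P"
      then show "q ({0}, 0) = 0" unfolding image_stalk_def using diff_extra by blast
    qed
  qed simp_all
qed

end

end

theorem corollary4p2:
  fixes n :: nat
    and I :: "point set \<Rightarrow> func set"
  assumes "2 \<le> n"
    and "zero_dimensional_subscheme n I"
  shows "\<exists>a \<alpha>.
    has_dimension (global_sections n (subscheme_structure n I)) (a 1) \<and>
    a 0 = n * a 1 + 1 \<and>
    (\<forall>i. 1 - int n \<le> i \<and> i < 0 \<longrightarrow> a i = (n choose nat (1 - i)) * a 1) \<and>
    perfect_extended_monad n a \<alpha> \<and>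
    sheaf_iso (proj_space n) (proj_structure n) (monad_cohomology n a \<alpha>) (ideal_sheaf n I)"
proof -
  have st: "ideal_stalks n (ideal_stalk n I)" by (rule ideal_stalks_of_zero_dimensional[OF assms(2)])
  obtain a c b where basis: "ideal_basis n (ideal_stalk n I) a c b"
    using ideal_stalks.exists_ideal_basis[OF st] by blast
  have sub: "subscheme n I"
    using assms(2) by unfold_locales (simp add: zero_dimensional_subscheme_def closed_subscheme_def)
  interpret subscheme_basis n I a c b
    by (rule subscheme_basis.intro[OF sub basis])
  have n: "1 \<le> n" using assms(1) by simp
  show ?thesis
    using dimension_global_sections rank_1 rank_0[OF n] rank_negative monad[OF n] cohomology[OF n]
    by (intro exI[of _ rank] exI[of _ \<alpha>]) auto
qed

end
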